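(* Let $\sigma_c^2=\sum_{u=1}^{2U}\sigma_{c,u}^2$, where for $1\le m\le M$ and $(m-1)T<t\le mT$, $$\sigma_{c,2t-1}^2=E_q\big(\{[f_{m,t}^c(\mathbf X_{m,t})]^2-[f_{m,t-1}^c(\mathbf X_{m,t-1})]^2\}\,h_{m,t-1}(\mathbf X_{m,t-1})\big),$$ $$\sigma_{c,2t}^2=E_q\{[f_{m,t}^c(\mathbf X_{m,t})]^2h_{m,t}(\mathbf X_{m,t})\}.$$ Assume that $E_q\{f_t^2(\mathbf X_t)[h_t(\mathbf X_t)+h_{t-1}(\mathbf X_{t-1})]\}<\infty$ for $1\le t\le U$, where $f_t(\mathbf x_t)=E_q[\psi(\mathbf X_U)L(\mathbf X_U)|\mathbf X_t=\mathbf x_t]$ (with the uncentered function $\psi$). Then $$\sqrt K(\widetilde\psi_U-\psi_U)\Rightarrow N(0,\sigma_c^2)\quad\text{as }K\to\infty$$ (convergence in distribution, with $M$, $T$, $\theta$ and the observations fixed).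
   Context: Model. Let $M,T\ge1$ be integers and $U=MT>1$. A hidden Markov model has latent states $X_t$ in a space $\mathsf X$ with dominating measure (written $dx$), initial density $p_\theta(x_1)$ (also written $p_\theta(x_t|x_{t-1})$ for $t=1$), transition density $p_\theta(x_t|x_{t-1})$, and observation density $g_\theta(Y_t|x_t)$. The parameter $\theta$ and the observations $\mathbf Y_U=(Y_1,\dots,Y_U)$ are fixed. Write $\mathbf x_t=(x_1,\dots,x_t)$ and, for $(m-1)T<t\le mT$, $\mathbf x_{m,t}=(x_{(m-1)T+1},\dots,x_t)$ (and $\mathbf x_{m,(m-1)T}$ is empty); similarly for capital letters. Let $$p_\theta(\mathbf x_U|\mathbf Y_U)=\prod_{t=1}^U[p_\theta(x_t|x_{t-1})g_\theta(Y_t|x_t)]\big/\lambda(\theta),$$ where $\lambda(\theta)\in(0,\infty)$ is the normalizing constant (likelihood). Let $\psi:\mathsf X^U\to\mathbb R$ be measurable with $\psi_U:=E_p[\psi(\mathbf X_U)|\mathbf Y_U]=\int\psi(\mathbf x_U)p_\theta(\mathbf x_U|\mathbf Y_U)\,d\mathbf x_U$ existing and finite. Importance densities and weights. For each $t$, $q_t(\cdot|\mathbf x_{t-1})$ is a probability density on $\mathsf X$ with $q_t(x_t|\mathbf x_{t-1})>0$ whenever $p_\theta(x_t|x_{t-1})>0$, and $w_t(\mathbf x_t)>0$ is a resampling weight. For $(m-1)T<t\le mT$, neither depends on $\mathbf x_{(m-1)T}$, so we write $q_t(\cdot|\mathbf x_{m,t-1})$ and $w_t(\mathbf x_{m,t})$.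 $E_q$ denotes expectation when $\mathbf X_U$ has density $\prod_{t=1}^Uq_t(x_t|\mathbf x_{t-1})$ (no resampling). Let $\eta_0=1$ and assume $\eta_t:=E_q[\prod_{u=1}^tw_u(\mathbf X_u)]<\infty$ for $1\le t\le U$. Let $\eta_{m,t}=\eta_t/\eta_{(m-1)T}$ and $$h_t(\mathbf x_t)=\eta_t\Big/\prod_{u=1}^tw_u(\mathbf x_u),\qquad h_{m,t}(\mathbf x_{m,t})=\eta_{m,t}\Big/\prod_{u=(m-1)T+1}^tw_u(\mathbf x_{m,u}),$$ with $h_0=1$ and $h_{m,(m-1)T}=1$. Algorithm. Let $K\ge 1$. The $M$ particle filters are run independently. Filter $m$, at stages $t=(m-1)T+1,\dots,mT$: (1) for $1\le k\le K$ sample (independently given the past) $\widetilde X_t^k\sim q_t(\cdot|\mathbf X_{m,t-1}^k)$ and put $\widetilde{\mathbf X}_{m,t}^k=(\mathbf X_{m,t-1}^k,\widetilde X_t^k)$ (just $\widetilde X_t^k$ if $t=(m-1)T+1$); (2) let $\bar w_t=K^{-1}\sum_kw_t(\widetilde{\mathbf X}_{m,t}^k)$, $W_t^j=w_t(\widetilde{\mathbf X}_{m,t}^j)/(K\bar w_t)$, and generate conditionally i.i.d. $B_t^1,\dots,B_t^K$ with $P\{B_t^1=j\}=W_t^j$; (3) with $B(k)=B_t^k$ set $\mathbf X_{m,t}^k=\widetilde{\mathbf X}_{m,t}^{B(k)}$, $\widetilde H_{m,t}^j=H_{m,t-1}^j/(KW_t^j)$, $H_{m,t}^k=\widetilde H_{m,t}^{B(k)}$,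 with initial convention $H_{m,(m-1)T}^k=1$. Joined paths and estimator. $\mathsf Z^M=\{1,\dots,K\}^M$; for $\mathbf k=(k(1),\dots,k(M))\in\mathsf Z^M$, $\mathbf X_U^{\mathbf k}=(\mathbf X_{1,T}^{k(1)},\dots,\mathbf X_{M,MT}^{k(M)})$ and $H_U^{\mathbf k}=\prod_{n=1}^MH_{n,nT}^{k(n)}$. Let $L(\mathbf x_U)=p_\theta(\mathbf x_U|\mathbf Y_U)/\prod_{t=1}^Uq_t(x_t|\mathbf x_{t-1})$ and $$\widetilde\psi_U=\sum_{\mathbf k\in\mathsf Z^M}L(\mathbf X_U^{\mathbf k})\psi(\mathbf X_U^{\mathbf k})H_U^{\mathbf k}\Big/\sum_{\mathbf k\in\mathsf Z^M}L(\mathbf X_U^{\mathbf k})H_U^{\mathbf k}$$ (with an arbitrary fixed value, e.g. $0$, if the denominator vanishes). Centered functions. $\psi^c(\mathbf x_U)=\psi(\mathbf x_U)-\psi_U$; for $(m-1)T<t\le mT$, $f_{m,t}^c(\mathbf x_{m,t})=E_q[\psi^c(\mathbf X_U)L(\mathbf X_U)|\mathbf X_{m,t}=\mathbf x_{m,t}]$, and $f_{m,(m-1)T}^c=0$. $N(0,\sigma_c^2)$ is the normal distribution with mean $0$ and variance $\sigma_c^2$ (degenerate at $0$ if $\sigma_c^2=0$).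
   Formalization: The moment condition is also assumed for the centered function ψ−ψ_U, i.e. E_q{(f_t^c)²(h_t+h_{t−1})}<∞ with f_t^c=E_q[ψ^c L|X_t]; with only the uncentered condition σ_c² can be infinite (M=1, w_t=1, ψL bounded, ψ_U≠0, E_q L²=∞). *)

theory Defs
  imports "HOL-Probability.Probability"
begin

section \<open>Hidden Markov model and importance densities\<close>

text \<open>The parameter of the model is fixed throughout and is therefore not mentioned.  Times are
  \<open>1, \<dots>, U\<close> and filters are \<open>1, \<dots>, M\<close>.  A path over a set \<open>I\<close> of times is an element of the
  product space over \<open>I\<close>, hence an extensional function on \<open>I\<close>; in particular \<open>\<lambda>_. undefined\<close>
  is the empty path.  For \<open>t\<close> in segment \<open>m\<close>, the first argument of \<open>prop_dens S t\<close> is a path over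
  \<open>{(m - 1) T<..<t}\<close> and the argument of \<open>res_weight S t\<close> is a path over \<open>{(m - 1) T<..t}\<close>,
  so that neither depends on earlier segments.\<close>

record ('x, 'y) pf_model =
  state_meas :: "'x measure"
  obs_meas :: "'y measure"
  init_dens :: "'x \<Rightarrow> real"
  trans_dens :: "'x \<Rightarrow> 'x \<Rightarrow> real" \<comment> \<open>\<open>trans_dens S x x'\<close> is the density at \<open>x'\<close> given \<open>x\<close>\<close>
  obs_dens :: "'x \<Rightarrow> 'y \<Rightarrow> real"
  obs :: "nat \<Rightarrow> 'y"
  n_filters :: nat
  seg_len :: nat
  prop_dens :: "nat \<Rightarrow> (nat \<Rightarrow> 'x) \<Rightarrow> 'x \<Rightarrow> real"
  res_weight :: "nat \<Rightarrow> (nat \<Rightarrow> 'x) \<Rightarrow> real"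

definition horizon :: "('x, 'y) pf_model \<Rightarrow> nat" where
  "horizon S = n_filters S * seg_len S"

definition filter_of :: "('x, 'y) pf_model \<Rightarrow> nat \<Rightarrow> nat" where
  "filter_of S t = (t - 1) div seg_len S + 1"

definition seg_start :: "('x, 'y) pf_model \<Rightarrow> nat \<Rightarrow> nat" where
  "seg_start S m = (m - 1) * seg_len S"

definition seg_end :: "('x, 'y) pf_model \<Rightarrow> nat \<Rightarrow> nat" where
  "seg_end S m = m * seg_len S"

definition path_space :: "('x, 'y) pf_model \<Rightarrow> nat set \<Rightarrow> (nat \<Rightarrow> 'x) measure" where
  "path_space S I = PiM I (\<lambda>_. state_meas S)"

text \<open>In the following definitions \<open>x\<close> is a path over a set that contains \<open>{1..t}\<close>, respectively
  \<open>{1..U}\<close>.\<close>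

definition step_dens :: "('x, 'y) pf_model \<Rightarrow> nat \<Rightarrow> (nat \<Rightarrow> 'x) \<Rightarrow> real" where
  "step_dens S t x = (if t = 1 then init_dens S (x 1) else trans_dens S (x (t - 1)) (x t))"

definition unnorm_dens :: "('x, 'y) pf_model \<Rightarrow> (nat \<Rightarrow> 'x) \<Rightarrow> real" where
  "unnorm_dens S x = (\<Prod>t\<in>{1..horizon S}. step_dens S t x * obs_dens S (x t) (obs S t))"

definition likelihood :: "('x, 'y) pf_model \<Rightarrow> real" where
  "likelihood S = (\<integral>x. unnorm_dens S x \<partial>path_space S {1..horizon S})"

definition post_dens :: "('x, 'y) pf_model \<Rightarrow> (nat \<Rightarrow> 'x) \<Rightarrow> real" where
  "post_dens S x = unnorm_dens S x / likelihood S"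

definition post_mean :: "('x, 'y) pf_model \<Rightarrow> ((nat \<Rightarrow> 'x) \<Rightarrow> real) \<Rightarrow> real" where
  "post_mean S \<psi> = (\<integral>x. \<psi> x * post_dens S x \<partial>path_space S {1..horizon S})"

definition prop_at :: "('x, 'y) pf_model \<Rightarrow> nat \<Rightarrow> (nat \<Rightarrow> 'x) \<Rightarrow> real" where
  "prop_at S t x = prop_dens S t (restrict x {seg_start S (filter_of S t)<..<t}) (x t)"

definition weight_at :: "('x, 'y) pf_model \<Rightarrow> nat \<Rightarrow> (nat \<Rightarrow> 'x) \<Rightarrow> real" where
  "weight_at S t x = res_weight S t (restrict x {seg_start S (filter_of S t)<..t})"

definition prop_path_dens :: "('x, 'y) pf_model \<Rightarrow> (nat \<Rightarrow> 'x) \<Rightarrow> real" where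
  "prop_path_dens S x = (\<Prod>t\<in>{1..horizon S}. prop_at S t x)"

text \<open>The law of the whole path under the importance densities, without resampling.\<close>

definition prop_law :: "('x, 'y) pf_model \<Rightarrow> (nat \<Rightarrow> 'x) measure" where
  "prop_law S = density (path_space S {1..horizon S}) (\<lambda>x. ennreal (prop_path_dens S x))"

definition lik_ratio :: "('x, 'y) pf_model \<Rightarrow> (nat \<Rightarrow> 'x) \<Rightarrow> real" where
  "lik_ratio S x = post_dens S x / prop_path_dens S x"

definition eta :: "('x, 'y) pf_model \<Rightarrow> nat \<Rightarrow> real" where
  "eta S t = (\<integral>x. (\<Prod>u\<in>{1..t}. weight_at S u x) \<partial>prop_law S)"

definition hfun :: "('x, 'y) pf_model \<Rightarrow> nat \<Rightarrow> (nat \<Rightarrow> 'x) \<Rightarrow> real" where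
  "hfun S t x = eta S t / (\<Prod>u\<in>{1..t}. weight_at S u x)"

definition hfun_seg :: "('x, 'y) pf_model \<Rightarrow> nat \<Rightarrow> nat \<Rightarrow> (nat \<Rightarrow> 'x) \<Rightarrow> real" where
  "hfun_seg S m t x =
     (eta S t / eta S (seg_start S m)) / (\<Prod>u\<in>{seg_start S m<..t}. weight_at S u x)"

locale pf_setting =
  fixes S :: "('x, 'y) pf_model"
  assumes sigma_finite: "sigma_finite_measure (state_meas S)"
    and n_filters_pos: "n_filters S \<ge> 1"
    and seg_len_pos: "seg_len S \<ge> 1"
    and horizon_gt_1: "horizon S > 1"
    and init_measurable: "init_dens S \<in> borel_measurable (state_meas S)"
    and init_nonneg: "\<And>x. x \<in> space (state_meas S) \<Longrightarrow> init_dens S x \<ge> 0"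
    and init_density: "(\<integral>\<^sup>+x. ennreal (init_dens S x) \<partial>state_meas S) = 1"
    and trans_measurable:
      "(\<lambda>(x, x'). trans_dens S x x') \<in> borel_measurable (state_meas S \<Otimes>\<^sub>M state_meas S)"
    and trans_nonneg: "\<And>x x'. x \<in> space (state_meas S) \<Longrightarrow> x' \<in> space (state_meas S) \<Longrightarrow>
      trans_dens S x x' \<ge> 0"
    and trans_density: "\<And>x. x \<in> space (state_meas S) \<Longrightarrow>
      (\<integral>\<^sup>+x'. ennreal (trans_dens S x x') \<partial>state_meas S) = 1"
    and obs_measurable:
      "(\<lambda>(x, y). obs_dens S x y) \<in> borel_measurable (state_meas S \<Otimes>\<^sub>M obs_meas S)"
    and obs_nonneg: "\<And>x y. x \<in> space (state_meas S) \<Longrightarrow> y \<in> space (obs_meas S) \<Longrightarrow>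
      obs_dens S x y \<ge> 0"
    and obs_density: "\<And>x. x \<in> space (state_meas S) \<Longrightarrow>
      (\<integral>\<^sup>+y. ennreal (obs_dens S x y) \<partial>obs_meas S) = 1"
    and obs_in_space: "\<And>t. t \<in> {1..horizon S} \<Longrightarrow> obs S t \<in> space (obs_meas S)"
    and likelihood_finite: "integrable (path_space S {1..horizon S}) (unnorm_dens S)"
    and likelihood_pos: "likelihood S > 0"
    and prop_measurable: "\<And>t. t \<in> {1..horizon S} \<Longrightarrow>
      (\<lambda>(z, x). prop_dens S t z x) \<in> borel_measurable
        (path_space S {seg_start S (filter_of S t)<..<t} \<Otimes>\<^sub>M state_meas S)"
    and prop_nonneg: "\<And>t z x. t \<in> {1..horizon S} \<Longrightarrow>
      z \<in> space (path_space S {seg_start S (filter_of S t)<..<t}) \<Longrightarrow>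
      x \<in> space (state_meas S) \<Longrightarrow> prop_dens S t z x \<ge> 0"
    and prop_density: "\<And>t z. t \<in> {1..horizon S} \<Longrightarrow>
      z \<in> space (path_space S {seg_start S (filter_of S t)<..<t}) \<Longrightarrow>
      (\<integral>\<^sup>+x. ennreal (prop_dens S t z x) \<partial>state_meas S) = 1"
    and prop_pos: "\<And>t x. t \<in> {1..horizon S} \<Longrightarrow> x \<in> space (path_space S {1..t}) \<Longrightarrow>
      step_dens S t x > 0 \<Longrightarrow> prop_at S t x > 0"
    and weight_measurable: "\<And>t. t \<in> {1..horizon S} \<Longrightarrow>
      res_weight S t \<in> borel_measurable (path_space S {seg_start S (filter_of S t)<..t})"
    and weight_pos: "\<And>t z. t \<in> {1..horizon S} \<Longrightarrow>
      z \<in> space (path_space S {seg_start S (filter_of S t)<..t}) \<Longrightarrow> res_weight S t z > 0"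
    and eta_finite: "\<And>t. t \<in> {1..horizon S} \<Longrightarrow>
      integrable (prop_law S) (\<lambda>x. \<Prod>u\<in>{1..t}. weight_at S u x)"


section \<open>Conditional expectations and asymptotic variance\<close>

text \<open>\<open>cond_mean S I \<phi>\<close> is the conditional expectation of \<open>\<phi>(X)\<close> given \<open>(X t)\<^sub>t\<^sub>\<in>\<^sub>I\<close>, viewed as
  a random variable on the space of whole paths; thus \<open>ffun S \<psi> t\<close> below is \<open>f\<^sub>t\<close> evaluated at
  the path up to time \<open>t\<close>, and similarly for \<open>ffun_cseg\<close>.\<close>

definition cond_mean ::
    "('x, 'y) pf_model \<Rightarrow> nat set \<Rightarrow> ((nat \<Rightarrow> 'x) \<Rightarrow> real) \<Rightarrow> (nat \<Rightarrow> 'x) \<Rightarrow> real" where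
  "cond_mean S I \<phi> = real_cond_exp (prop_law S)
     (vimage_algebra (space (prop_law S)) (\<lambda>x. restrict x I) (path_space S I)) \<phi>"

definition ffun ::
    "('x, 'y) pf_model \<Rightarrow> ((nat \<Rightarrow> 'x) \<Rightarrow> real) \<Rightarrow> nat \<Rightarrow> (nat \<Rightarrow> 'x) \<Rightarrow> real" where
  "ffun S \<psi> t = cond_mean S {1..t} (\<lambda>x. \<psi> x * lik_ratio S x)"

definition centred ::
    "('x, 'y) pf_model \<Rightarrow> ((nat \<Rightarrow> 'x) \<Rightarrow> real) \<Rightarrow> (nat \<Rightarrow> 'x) \<Rightarrow> real" where
  "centred S \<psi> x = \<psi> x - post_mean S \<psi>"

definition ffun_cseg ::
    "('x, 'y) pf_model \<Rightarrow> ((nat \<Rightarrow> 'x) \<Rightarrow> real) \<Rightarrow> nat \<Rightarrow> nat \<Rightarrow> (nat \<Rightarrow> 'x) \<Rightarrow> real" where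
  "ffun_cseg S \<psi> m t =
     (if t = seg_start S m then (\<lambda>_. 0)
      else cond_mean S {seg_start S m<..t} (\<lambda>x. centred S \<psi> x * lik_ratio S x))"

definition sigma2_c :: "('x, 'y) pf_model \<Rightarrow> ((nat \<Rightarrow> 'x) \<Rightarrow> real) \<Rightarrow> nat \<Rightarrow> real" where
  "sigma2_c S \<psi> u =
     (let t = (u + 1) div 2; m = filter_of S t in
      if odd u
      then (\<integral>x. ((ffun_cseg S \<psi> m t x)\<^sup>2 - (ffun_cseg S \<psi> m (t - 1) x)\<^sup>2)
                 * hfun_seg S m (t - 1) x \<partial>prop_law S)
      else (\<integral>x. (ffun_cseg S \<psi> m t x)\<^sup>2 * hfun_seg S m t x \<partial>prop_law S))"

definition asym_var :: "('x, 'y) pf_model \<Rightarrow> ((nat \<Rightarrow> 'x) \<Rightarrow> real) \<Rightarrow> real" where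
  "asym_var S \<psi> = (\<Sum>u\<in>{1..2 * horizon S}. sigma2_c S \<psi> u)"

definition normal_law :: "real \<Rightarrow> real \<Rightarrow> real measure" where
  "normal_law \<mu> v =
     (if v = 0 then return borel \<mu> else density lborel (\<lambda>x. ennreal (normal_density \<mu> (sqrt v) x)))"


section \<open>The parallel particle filters and the estimator\<close>

text \<open>Here \<open>xt t k\<close> is the value sampled at time \<open>t\<close> for particle \<open>k\<close> and \<open>b t k\<close> is the
  resampling index.  \<open>res_path S xt b m t k\<close> is the path, over \<open>{(m - 1) T<..t}\<close>, of particle \<open>k\<close>
  of filter \<open>m\<close> after resampling at time \<open>t\<close>; \<open>new_path S xt b m t k\<close> is its path before
  resampling.  Both are meant for \<open>t \<le> m T\<close>.\<close>

primrec res_path ::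
    "('x, 'y) pf_model \<Rightarrow> (nat \<Rightarrow> nat \<Rightarrow> 'x) \<Rightarrow> (nat \<Rightarrow> nat \<Rightarrow> nat) \<Rightarrow> nat \<Rightarrow> nat \<Rightarrow> nat \<Rightarrow> nat \<Rightarrow> 'x"
where
  "res_path S xt b m 0 = (\<lambda>k _. undefined)"
| "res_path S xt b m (Suc t) = (\<lambda>k.
     if Suc t \<le> seg_start S m then (\<lambda>_. undefined)
     else (res_path S xt b m t (b (Suc t) k))(Suc t := xt (Suc t) (b (Suc t) k)))"

definition new_path ::
    "('x, 'y) pf_model \<Rightarrow> (nat \<Rightarrow> nat \<Rightarrow> 'x) \<Rightarrow> (nat \<Rightarrow> nat \<Rightarrow> nat) \<Rightarrow> nat \<Rightarrow> nat \<Rightarrow> nat \<Rightarrow> nat \<Rightarrow> 'x"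
where
  "new_path S xt b m t k = (res_path S xt b m (t - 1) k)(t := xt t k)"

lemma res_path_eq_new_path:
  assumes "t > seg_start S m"
  shows "res_path S xt b m t k = new_path S xt b m t (b t k)"
  using assms by (cases t) (auto simp: new_path_def)

definition norm_weight ::
    "('x, 'y) pf_model \<Rightarrow> nat \<Rightarrow> (nat \<Rightarrow> nat \<Rightarrow> 'x) \<Rightarrow> (nat \<Rightarrow> nat \<Rightarrow> nat) \<Rightarrow> nat \<Rightarrow> nat \<Rightarrow> nat \<Rightarrow> real"
where
  "norm_weight S K xt b m t j =
     (let wbar = (\<Sum>i\<in>{1..K}. res_weight S t (new_path S xt b m t i)) / real K
      in res_weight S t (new_path S xt b m t j) / (real K * wbar))"

primrec hist_weight ::
    "('x, 'y) pf_model \<Rightarrow> nat \<Rightarrow> (nat \<Rightarrow> nat \<Rightarrow> 'x) \<Rightarrow> (nat \<Rightarrow> nat \<Rightarrow> nat) \<Rightarrow> nat \<Rightarrow> nat \<Rightarrow> nat \<Rightarrow> real"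
where
  "hist_weight S K xt b m 0 = (\<lambda>k. 1)"
| "hist_weight S K xt b m (Suc t) = (\<lambda>k.
     if Suc t \<le> seg_start S m then 1
     else (let j = b (Suc t) k
           in hist_weight S K xt b m t j / (real K * norm_weight S K xt b m (Suc t) j)))"

definition joined_path ::
    "('x, 'y) pf_model \<Rightarrow> (nat \<Rightarrow> nat \<Rightarrow> 'x) \<Rightarrow> (nat \<Rightarrow> nat \<Rightarrow> nat) \<Rightarrow> (nat \<Rightarrow> nat) \<Rightarrow> nat \<Rightarrow> 'x"
where
  "joined_path S xt b \<kappa> = (\<lambda>t\<in>{1..horizon S}.
     let m = filter_of S t in res_path S xt b m (seg_end S m) (\<kappa> m) t)"

definition joined_weight ::
    "('x, 'y) pf_model \<Rightarrow> nat \<Rightarrow> (nat \<Rightarrow> nat \<Rightarrow> 'x) \<Rightarrow> (nat \<Rightarrow> nat \<Rightarrow> nat) \<Rightarrow> (nat \<Rightarrow> nat) \<Rightarrow> real"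
where
  "joined_weight S K xt b \<kappa> =
     (\<Prod>n\<in>{1..n_filters S}. hist_weight S K xt b n (seg_end S n) (\<kappa> n))"

definition pf_estimator ::
    "('x, 'y) pf_model \<Rightarrow> ((nat \<Rightarrow> 'x) \<Rightarrow> real) \<Rightarrow> real \<Rightarrow> nat \<Rightarrow>
     (nat \<Rightarrow> nat \<Rightarrow> 'x) \<Rightarrow> (nat \<Rightarrow> nat \<Rightarrow> nat) \<Rightarrow> real"
where
  "pf_estimator S \<psi> c K xt b =
     (let Z = {1..n_filters S} \<rightarrow>\<^sub>E {1..K};
          den = (\<Sum>\<kappa>\<in>Z. lik_ratio S (joined_path S xt b \<kappa>) * joined_weight S K xt b \<kappa>)
      in if den = 0 then c
         else (\<Sum>\<kappa>\<in>Z. lik_ratio S (joined_path S xt b \<kappa>) * \<psi> (joined_path S xt b \<kappa>)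
                          * joined_weight S K xt b \<kappa>) / den)"

text \<open>The sigma-algebra generated by the samples \<open>X t k\<close> for \<open>(t, k) \<in> I\<close> and the resampling
  indices \<open>B t k\<close> for \<open>(t, k) \<in> J\<close>.\<close>

definition past_algebra ::
    "('x, 'y) pf_model \<Rightarrow> nat \<Rightarrow> 'w measure \<Rightarrow> (nat \<Rightarrow> nat \<Rightarrow> 'w \<Rightarrow> 'x) \<Rightarrow> (nat \<Rightarrow> nat \<Rightarrow> 'w \<Rightarrow> nat) \<Rightarrow>
     (nat \<times> nat) set \<Rightarrow> (nat \<times> nat) set \<Rightarrow> 'w measure"
where
  "past_algebra S K P X B I J =
     vimage_algebra (space P)
       (\<lambda>\<omega>. (\<lambda>(t, k)\<in>I. X t k \<omega>, \<lambda>(t, k)\<in>J. B t k \<omega>))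
       (PiM I (\<lambda>_. state_meas S) \<Otimes>\<^sub>M PiM J (\<lambda>_. count_space {1..K}))"

text \<open>The random variables of a run of the \<open>M\<close> filters with \<open>K\<close> particles each: \<open>X t k\<close> is the value
  sampled at time \<open>t\<close> for particle \<open>k\<close> and \<open>B t k\<close> is the resampling index.  Conditional laws of
  filter \<open>m\<close> are given the past of that filter; conditional independence over \<open>k\<close> is the product
  form on the right-hand sides.\<close>

locale parallel_filters = prob_space P
  for S :: "('x, 'y) pf_model" and K :: nat and P :: "'w measure"
    and X :: "nat \<Rightarrow> nat \<Rightarrow> 'w \<Rightarrow> 'x" and B :: "nat \<Rightarrow> nat \<Rightarrow> 'w \<Rightarrow> nat" +
  assumes sample_measurable: "\<And>t k. t \<in> {1..horizon S} \<Longrightarrow> k \<in> {1..K} \<Longrightarrow>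
      X t k \<in> measurable P (state_meas S)"
    and index_measurable: "\<And>t k. t \<in> {1..horizon S} \<Longrightarrow> k \<in> {1..K} \<Longrightarrow>
      B t k \<in> measurable P (count_space {1..K})"
    and filters_indep: "indep_vars
      (\<lambda>m. PiM ({seg_start S m<..seg_end S m} \<times> {1..K}) (\<lambda>_. state_meas S \<Otimes>\<^sub>M count_space {1..K}))
      (\<lambda>m \<omega>. \<lambda>(t, k)\<in>{seg_start S m<..seg_end S m} \<times> {1..K}. (X t k \<omega>, B t k \<omega>))
      {1..n_filters S}"
    and sampling: "\<And>m t A. m \<in> {1..n_filters S} \<Longrightarrow> t \<in> {seg_start S m<..seg_end S m} \<Longrightarrow>
      (\<And>k. k \<in> {1..K} \<Longrightarrow> A k \<in> sets (state_meas S)) \<Longrightarrow>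
      AE \<omega> in P.
        real_cond_exp P
          (past_algebra S K P X B ({seg_start S m<..<t} \<times> {1..K}) ({seg_start S m<..<t} \<times> {1..K}))
          (indicator {\<omega> \<in> space P. \<forall>k\<in>{1..K}. X t k \<omega> \<in> A k}) \<omega> =
        (\<Prod>k\<in>{1..K}. measure
           (density (state_meas S) (\<lambda>x. ennreal (prop_dens S t
              (res_path S (\<lambda>t k. X t k \<omega>) (\<lambda>t k. B t k \<omega>) m (t - 1) k) x)))
           (A k))"
    and resampling: "\<And>m t \<beta>. m \<in> {1..n_filters S} \<Longrightarrow> t \<in> {seg_start S m<..seg_end S m} \<Longrightarrow>
      (\<And>k. k \<in> {1..K} \<Longrightarrow> \<beta> k \<in> {1..K}) \<Longrightarrow>
      AE \<omega> in P.
        real_cond_exp P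
          (past_algebra S K P X B ({seg_start S m<..t} \<times> {1..K}) ({seg_start S m<..<t} \<times> {1..K}))
          (indicator {\<omega> \<in> space P. \<forall>k\<in>{1..K}. B t k \<omega> = \<beta> k}) \<omega> =
        (\<Prod>k\<in>{1..K}. norm_weight S K (\<lambda>t k. X t k \<omega>) (\<lambda>t k. B t k \<omega>) m t (\<beta> k))"

end

theory Submission
 imports Defs
begin

text \<open>A single filter moves by martingale increments, two per stage (sampling and
 resampling).  Its history weights are a function of the particle's path times one scalar, common to
 all particles and tending to 1; hence the conditional variances of the increments are empirical
 means, which converge by a law of large numbers, and the characteristic function picks up one
 Gaussian factor per increment.  For joined paths, the sum over all combinations of the numerator
 with the centred \<open>\<psi>\<close> telescopes over the filters.  Given the earlier filters, the \<open>m\<close>-th difference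
 is the error of filter \<open>m\<close> on a martingale that depends on their particles; replacing it by its mean
 over the earlier segments costs \<open>o(K^(-1/2))\<close>, since the second moments of the difference vanish.
 What remains is a sum of independent single-filter errors, while the denominator tends to 1.\<close>

text \<open>Only the weighted second moments E[f_t^2 (h_t + h_(t-1))] are available: neither the
  weights nor \<psi> are bounded. This fixes two choices. Laws of large numbers are proved in mean,
  since unbiasedness of the weighted empirical measures controls L1 norms, whereas an integrable
  function need not have the second moment that a variance bound asks for. The Gaussian factor of an
  increment comes from an estimate by E[X^2 min(1, |s X|)], which needs no third moment. The common
  scalar \<open>R\<close> is random and known to tend to 1 only in probability, so the one-step
  bounds keep it as a separate factor, and errors are capped at a constant wherever expectations of
  them are taken. The run itself is specified by conditional probabilities of boxes; these are
  upgraded to the joint law of the past and the new variables, so that each stage becomes an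
  integral against a product of kernels. Across filters the obstacle is that the martingale seen by
  a filter depends on the earlier particles; evaluating the earlier filters at one sample point and
  the current filter at another separates the two sources of randomness. Each \<open>K\<close> has
  its own probability space.\<close>

abbreviation (input) bmf :: "'a measure => ('a => 'b::topological_space) set" where
 "bmf M == borel_measurable M"

abbreviation (input) nint :: "'a measure => ('a => ennreal) => ennreal" where
 "nint M f == integral\<^sup>N M f"

abbreviation (input) lint :: "'a measure => ('a => 'b::{banach, second_countable_topology}) => 'b" where
 "lint M f == integral\<^sup>L M f"

abbreviation (input) prod_meas (infixr "><" 80) where
 "M >< N == M \<Otimes>\<^sub>M N"

abbreviation (input) tends (infix "--->" 60) where
 "u ---> l == u \<longlonglongrightarrow> l"

lemmas mcomp = measurable_compose

lemmas int_bound = Bochner_Integration.integrable_bound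

section \<open>Centred sums under product measures\<close>

lemma ennreal_power2_le_imp_le:
 fixes x y :: ennreal
 assumes "x\<^sup>2 <= y\<^sup>2" shows "x <= y"
proof (cases "y = top")
 case False
 then obtain b where b: "y = ennreal b" "0 <= b" by (cases y) auto
 have "x * x <= ennreal (b * b)" using assms b by (simp add: power2_eq_square ennreal_mult)
 then have "x * x ~= top" using ennreal_less_top leD top.not_eq_extremum by metis
 then have "x ~= top" by auto
 then obtain a where a: "x = ennreal a" "0 <= a" by (cases x) auto
 have "a\<^sup>2 <= b\<^sup>2" using assms a b by (simp add: ennreal_power)
 then have "a <= b" using b(2) by (rule power2_le_imp_le)
 then show ?thesis using a b by simp
qed simp

text \<open>The joint law of the coordinate maps is the product measure itself, and each marginal is
  the corresponding factor. The criterion through joint laws concerns nonempty index sets, hence the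
  separate empty case.\<close>

lemma indep_vars_PiM_coordinate':
 assumes "finite I" "!!i. i \<in> I ==> prob_space (M i)"
 shows "prob_space.indep_vars (PiM I M) M (%i v. v i) I"
proof (cases "I = {}")
 case True
 interpret prob_space "PiM I M" by (intro prob_space_PiM assms)
 show ?thesis unfolding indep_vars_def indep_sets_def using True by auto
next
 case False
 interpret prob_space "PiM I M" by (intro prob_space_PiM assms)
 have "distr (PiM I M) (PiM I M) (%v. \<lambda>i\<in>I. v i) = distr (PiM I M) (PiM I M) (%v. v)"
  by (rule distr_cong) (auto simp: space_PiM PiE_def extensional_restrict)
 also have "... = PiM I M" by (simp add: distr_id2)
 also have "... = PiM I (%i. distr (PiM I M) (M i) (%v. v i))"
  using assms by (intro PiM_cong) (auto simp: distr_PiM_component)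
 finally show ?thesis using assms False
  by (subst indep_vars_iff_distr_eq_PiM') auto
qed

text \<open>Cauchy-Schwarz passes from the first to the second moment, where independence and the
  zero means remove all off-diagonal terms.\<close>

lemma PiM_centred_sum:
 fixes xi :: "'i => 'a => real"
 assumes I: "finite I" and M: "!!i. i \<in> I ==> prob_space (M i)"
  and meas: "!!i. i \<in> I ==> xi i \<in> bmf (M i)"
  and sq: "!!i. i \<in> I ==> integrable (M i) (%x. (xi i x)\<^sup>2)"
  and mean: "!!i. i \<in> I ==> (lint (M i) (%x. xi i x)) = 0"
 shows "nint (PiM I M) (%v. ennreal \<bar>\<Sum>i\<in>I. xi i (v i)\<bar>) <= ennreal (sqrt (\<Sum>i\<in>I. lint (M i) (%x. (xi i x)\<^sup>2)))"
proof -
 interpret prob_space "PiM I M" by (intro prob_space_PiM M)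
 have comp[measurable]: "(%v. xi i (v i)) \<in> bmf (PiM I M)" if "i \<in> I" for i
  using mcomp[of "%v. v i" "PiM I M" "M i" "xi i" borel] measurable_component_singleton[OF that] meas[OF that] by blast
 have ind: "indep_vars (%_. borel) (%i v. xi i (v i)) I"
  using indep_vars_compose2[OF indep_vars_PiM_coordinate'[OF I M], of xi "%_. borel"] meas by auto
 have distr: "distr (PiM I M) (M i) (%v. v i) = M i" if "i \<in> I" for i
  using M that by (rule distr_PiM_component)
 have int: "integrable (PiM I M) (%v. f (v i)) \<and> (lint (PiM I M) (%v. f (v i))) = lint (M i) (%x. f x)"
  if "i \<in> I" "integrable (M i) f" for i and f :: "'a => real"
 proof -
  have f: "f \<in> bmf (M i)" using that by auto
  show ?thesis
   using that integrable_distr_eq[of "%v. v i" "PiM I M" "M i" f]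
    integral_distr[of "%v. v i" "PiM I M" "M i" f] measurable_component_singleton[OF that(1), of M] f distr[OF that(1)]
   by simp
 qed
 have i1: "integrable (M i) (xi i)" if "i \<in> I" for i
 proof -
  interpret Mi: prob_space "M i" by (rule M[OF that])
  show ?thesis using meas[OF that] sq[OF that] by (rule Mi.square_integrable_imp_integrable)
 qed
 have cross: "integrable (PiM I M) (%v. xi i (v i) * xi j (v j)) \<and>
   (lint (PiM I M) (%v. xi i (v i) * xi j (v j))) = (if i = j then lint (M i) (%x. (xi i x)\<^sup>2) else 0)"
  if ij: "i \<in> I" "j \<in> I" for i j
 proof (cases "i = j")
  case True
  then show ?thesis using int[OF ij(1) sq[OF ij(1)]] by (simp add: power2_eq_square)
 next
  case False
  have iv: "indep_var borel (%v. xi i (v i)) borel (%v. xi j (v j))"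
  proof -
   have "indep_var (PiM {i} (%_. borel)) (%v. \<lambda>k\<in>{i}. xi k (v k)) (PiM {j} (%_. borel)) (%v. \<lambda>k\<in>{j}. xi k (v k))"
    using ind ij False by (intro indep_var_restrict[of _ _ I]) auto
   from indep_var_compose[OF this, of "%f. f i" borel "%f. f j" borel] show ?thesis
    by (simp add: comp_def)
  qed
  show ?thesis using indep_var_integrable[OF iv] indep_var_lebesgue_integral[OF iv]
   int[OF ij(1) i1[OF ij(1)]] int[OF ij(2) i1[OF ij(2)]] mean ij False by auto
 qed
 have sqe: "(\<Sum>i\<in>I. xi i (v i))\<^sup>2 = (\<Sum>i\<in>I. \<Sum>j\<in>I. xi i (v i) * xi j (v j))" for v
  by (simp add: power2_eq_square sum_product)
 have sqint: "integrable (PiM I M) (%v. (\<Sum>i\<in>I. xi i (v i))\<^sup>2)"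
  unfolding sqe using cross by (intro Bochner_Integration.integrable_sum) auto
 have sqval: "lint (PiM I M) (%v. (\<Sum>i\<in>I. xi i (v i))\<^sup>2) = (\<Sum>i\<in>I. lint (M i) (%x. (xi i x)\<^sup>2))"
 proof -
  have "lint (PiM I M) (%v. (\<Sum>i\<in>I. xi i (v i))\<^sup>2) = (\<Sum>i\<in>I. \<Sum>j\<in>I. lint (PiM I M) (%v. xi i (v i) * xi j (v j)))"
   unfolding sqe using cross
   by (subst Bochner_Integration.integral_sum) (auto intro!: sum.cong Bochner_Integration.integral_sum Bochner_Integration.integrable_sum)
  also have "... = (\<Sum>i\<in>I. \<Sum>j\<in>I. if i = j then lint (M i) (%x. (xi i x)\<^sup>2) else 0)"
   using cross by (intro sum.cong) auto
  finally show ?thesis using I by simp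
 qed
 have "(nint (PiM I M) (%v. ennreal \<bar>\<Sum>i\<in>I. xi i (v i)\<bar>))\<^sup>2 = (nint (PiM I M) (%v. ennreal \<bar>\<Sum>i\<in>I. xi i (v i)\<bar> * 1))\<^sup>2" by simp
 also have "... <= nint (PiM I M) (%v. (ennreal \<bar>\<Sum>i\<in>I. xi i (v i)\<bar>)\<^sup>2) * nint (PiM I M) (%v. 1\<^sup>2)"
  by (rule Cauchy_Schwarz_nn_integral) auto
 also have "... = ennreal (\<Sum>i\<in>I. lint (M i) (%x. (xi i x)\<^sup>2))"
  using sqint sqval by (simp add: ennreal_power nn_integral_eq_integral emeasure_space_1)
 also have "... = (ennreal (sqrt (\<Sum>i\<in>I. lint (M i) (%x. (xi i x)\<^sup>2))))\<^sup>2"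
  by (simp add: ennreal_power sum_nonneg)
 finally show ?thesis by (rule ennreal_power2_le_imp_le)
qed

text \<open>Both the characteristic function and the Gaussian are compared with the same quadratic 1
  - s^2 v / 2, and each comparison costs s^2 E[X^2 min(1, |s X|)]. This is the Lindeberg quantity:
  it is finite under second moments alone and small when the scaled variable is small.\<close>

lemma (in prob_space) iexp_gauss_bound:
 fixes X :: "'a => real"
 assumes X[measurable]: "random_variable borel X" and sq: "integrable M (%x. (X x)\<^sup>2)"
  and mean: "expectation X = 0"
 shows "cmod ((CLINT x|M. iexp (s * X x)) - of_real (exp (- (s\<^sup>2 * expectation (%x. (X x)\<^sup>2) / 2))))
  <= 2 * s\<^sup>2 * expectation (%x. (X x)\<^sup>2 * min 1 \<bar>s * X x\<bar>)"
proof -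
 define v where "v = expectation (%x. (X x)\<^sup>2)"
 define L where "L = expectation (%x. (X x)\<^sup>2 * min 1 \<bar>s * X x\<bar>)"
 have i1: "integrable M X" using sq by (rule square_integrable_imp_integrable[rotated]) simp
 have Lint: "integrable M (%x. (X x)\<^sup>2 * min 1 \<bar>s * X x\<bar>)"
  by (rule int_bound[OF sq]) (auto simp: abs_mult mult_left_le)
 have var: "variance X = v" unfolding v_def using mean by simp
 have A: "cmod (char (distr M borel X) s - (1 - s\<^sup>2 * v / 2)) <= s\<^sup>2 * L"
 proof -
  have mint: "integrable M (%x. min (6 * (X x)\<^sup>2) (\<bar>s\<bar> * \<bar>X x\<bar> ^ 3))"
   by (rule int_bound[of M "%x. 6 * (X x)\<^sup>2"]) (use sq in auto)
  \<comment> \<open>The available Taylor bound has the factor s^2 / 6 and the minimum of 6 x^2 and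
    |s| |x|^3; the constant 6 cancels against 1/6 at the end.\<close>
  have pt: "min (6 * (X x)\<^sup>2) (\<bar>s\<bar> * \<bar>X x\<bar> ^ 3) <= 6 * ((X x)\<^sup>2 * min 1 \<bar>s * X x\<bar>)" for x
  proof (cases "\<bar>s * X x\<bar> <= 1")
   case True
   have "\<bar>s\<bar> * \<bar>X x\<bar> ^ 3 = (X x)\<^sup>2 * \<bar>s * X x\<bar>"
    by (simp add: power3_eq_cube power2_eq_square abs_mult flip: power2_abs)
   moreover have "0 <= (X x)\<^sup>2 * \<bar>s * X x\<bar>" by simp
   ultimately have "\<bar>s\<bar> * \<bar>X x\<bar> ^ 3 <= 6 * ((X x)\<^sup>2 * \<bar>s * X x\<bar>)" by linarith
   then show ?thesis using True by (simp add: min_absorb2 min.coboundedI2)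
  qed (auto simp: min_def)
  have "cmod (char (distr M borel X) s - (1 - s\<^sup>2 * v / 2)) \<le>
   (s\<^sup>2 / 6) * expectation (%x. min (6 * (X x)\<^sup>2) (\<bar>s\<bar> * \<bar>X x\<bar> ^ 3))"
   using char_approx3'[OF X i1 sq mean var refl, of s] by simp
  also have "... <= (s\<^sup>2 / 6) * expectation (%x. 6 * ((X x)\<^sup>2 * min 1 \<bar>s * X x\<bar>))"
   by (intro mult_left_mono integral_mono mint pt) (use Lint in auto)
  also have "... = s\<^sup>2 * L" by (simp add: L_def)
  finally show ?thesis .
 qed
 have B: "\<bar>exp (- (s\<^sup>2 * v / 2)) - (1 - s\<^sup>2 * v / 2)\<bar> <= s\<^sup>2 * L"
 proof -
  define y where "y x = s\<^sup>2 * (X x)\<^sup>2 / 2" for x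
  have yint: "integrable M y" unfolding y_def using sq by simp
  have ym[measurable]: "y \<in> bmf M" unfolding y_def by simp
  have y0: "y x >= 0" for x by (simp add: y_def)
  have yE: "expectation y = s\<^sup>2 * v / 2" unfolding y_def v_def by simp
  have eint: "integrable M (%x. exp (- y x))"
   by (rule integrable_const_bound[where B=1]) (auto simp: y0)
  have lin: "integrable M (%x. exp (- (s\<^sup>2 * v / 2)) * (1 - (y x - s\<^sup>2 * v / 2)))"
   using yint by simp
  \<comment> \<open>Jensen's inequality by hand: the tangent of exp(-y) at the mean of
    \<open>y\<close> integrates to exp(-E y) and lies below exp(-y).\<close>
  have "exp (- (s\<^sup>2 * v / 2)) = expectation (%x. exp (- (s\<^sup>2 * v / 2)) * (1 - (y x - s\<^sup>2 * v / 2)))"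
   using yint yE by (simp add: prob_space)
  also have "... <= expectation (%x. exp (- y x))"
  proof (rule integral_mono[OF lin eint])
   fix x
   have "1 - (y x - s\<^sup>2 * v / 2) <= exp (- (y x - s\<^sup>2 * v / 2))"
    using exp_ge_add_one_self[of "- (y x - s\<^sup>2 * v / 2)"] by linarith
   then have "exp (- (s\<^sup>2 * v / 2)) * (1 - (y x - s\<^sup>2 * v / 2)) <= exp (- (s\<^sup>2 * v / 2)) * exp (- (y x - s\<^sup>2 * v / 2))"
    by (intro mult_left_mono) auto
   also have "... = exp (- y x)" by (simp flip: exp_add)
   finally show "exp (- (s\<^sup>2 * v / 2)) * (1 - (y x - s\<^sup>2 * v / 2)) <= exp (- y x)" .
  qed
  also have "... <= expectation (%x. 1 - y x + s\<^sup>2 * ((X x)\<^sup>2 * min 1 \<bar>s * X x\<bar>))"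
  proof (rule integral_mono[OF eint])
   show "integrable M (%x. 1 - y x + s\<^sup>2 * ((X x)\<^sup>2 * min 1 \<bar>s * X x\<bar>))" using yint Lint by simp
   fix x
   define u where "u = \<bar>s * X x\<bar>"
   have u0: "u >= 0" by (simp add: u_def)
   have u2: "u\<^sup>2 = s\<^sup>2 * (X x)\<^sup>2" by (simp add: u_def power_mult_distrib)
   have yu: "y x = u\<^sup>2 / 2" by (simp add: y_def u2)
   \<comment> \<open>With y = u^2 / 2: for u at most 1 the chain exp(-y) <= 1 / (1 + y) <= 1 - y +
     y^2 gives a remainder below u^3; for larger u the bound exp(-y) <= 1 suffices, as u^2 exceeds
     y.\<close>
   have "exp (- y x) <= 1 - y x + u\<^sup>2 * min 1 u"
   proof (cases "u <= 1")
    case True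
    have "1 + y x <= exp (y x)" by (rule exp_ge_add_one_self)
    then have "exp (- y x) <= 1 / (1 + y x)"
     using y0[of x] by (simp add: exp_minus field_simps)
    also have "... <= 1 - y x + y x * y x"
     using y0[of x] by (simp add: divide_simps) (simp add: algebra_simps)
    also have "y x * y x <= u\<^sup>2 * u"
    proof -
     have "y x * y x = (u\<^sup>2 * u) * (u / 4)" by (simp add: yu power2_eq_square)
     also have "... <= (u\<^sup>2 * u) * 1" using True u0 by (intro mult_left_mono) auto
     finally show ?thesis by simp
    qed
    finally show ?thesis using True by (simp add: min_absorb2)
   next
    case False
    have "exp (- y x) <= 1" using y0[of x] by simp
    also have "1 <= 1 - y x + u\<^sup>2" using yu zero_le_power2[of u] by linarith
    finally show ?thesis using False by (simp add: min_absorb1)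
   qed
   then show "exp (- y x) <= 1 - y x + s\<^sup>2 * ((X x)\<^sup>2 * min 1 \<bar>s * X x\<bar>)"
    unfolding u2 by (simp add: u_def mult.assoc)
  qed
  also have "... = 1 - s\<^sup>2 * v / 2 + s\<^sup>2 * L"
   using yint Lint yE by (simp add: L_def prob_space)
  finally have up: "exp (- (s\<^sup>2 * v / 2)) <= 1 - s\<^sup>2 * v / 2 + s\<^sup>2 * L" .
  have lo: "1 - s\<^sup>2 * v / 2 <= exp (- (s\<^sup>2 * v / 2))"
   using exp_ge_add_one_self[of "- (s\<^sup>2 * v / 2)"] by simp
  show ?thesis using up lo by simp
 qed
 have C: "char (distr M borel X) s = (CLINT x|M. iexp (s * X x))"
  unfolding char_def by (subst integral_distr) auto
 have "cmod ((CLINT x|M. iexp (s * X x)) - of_real (exp (- (s\<^sup>2 * v / 2))))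
  <= cmod (char (distr M borel X) s - (1 - s\<^sup>2 * v / 2)) + cmod (of_real (exp (- (s\<^sup>2 * v / 2)) - (1 - s\<^sup>2 * v / 2)))"
  unfolding C by (rule order_trans[OF _ norm_triangle_ineq4]) (simp add: algebra_simps)
 also have "... <= s\<^sup>2 * L + s\<^sup>2 * L" using A B unfolding norm_of_real by (intro add_mono)
 finally show ?thesis by (simp add: v_def L_def)
qed

section \<open>Independent draws given a sigma-algebra\<close>

text \<open>Common abstraction of sampling and resampling: given \<open>F\<close>, the variables
  \<open>V k\<close> are independent with \<open>F\<close>-dependent densities \<open>d k\<close>.
  The defining property \<open>box\<close> is a family of almost sure identities, one for each box,
  with an exceptional set that may depend on the box; what follows turns it into a statement about a
  joint law.\<close>

locale cond_step = prob_space P for P :: "'w measure" +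
 fixes F :: "'w measure" and nu :: "'v measure" and I :: "'k set"
  and V :: "'k => 'w => 'v" and d :: "'k => 'w => 'v => real"
 assumes subalg: "subalgebra P F"
  and sigma_finite_base: "sigma_finite_measure nu"
  and finite_I: "finite I"
  and V_meas: "!!k. k \<in> I ==> V k \<in> measurable P nu"
  and d_meas: "!!k. k \<in> I ==> (%(q, v). d k q v) \<in> bmf (F >< nu)"
  and d_nonneg: "!!k q v. k \<in> I ==> q \<in> space P ==> v \<in> space nu ==> d k q v >= 0"
  and d_prob: "!!k q. k \<in> I ==> q \<in> space P ==> (nint nu (%v. ennreal (d k q v))) = 1"
  and box: "!!A. (!!k. k \<in> I ==> A k \<in> sets nu) ==>
   AE q in P. real_cond_exp P F (indicator {q \<in> space P. \<forall>k\<in>I. V k q \<in> A k}) q =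
    (\<Prod>k\<in>I. measure (density nu (%v. ennreal (d k q v))) (A k))"
begin

definition kp :: "'k => 'w => 'v measure" where
 "kp k q = density nu (%v. ennreal (d k q v))"

abbreviation "Vnu == PiM I (%_. nu)"

definition bvec :: "'w => 'k => 'v" where "bvec q = (\<lambda>k\<in>I. V k q)"

definition joint_dens :: "'w \<times> ('k => 'v) => real" where
 "joint_dens = (%(q, v). \<Prod>k\<in>I. d k q (v k))"

lemma space_F[simp]: "space F = space P"
 using subalg by (simp add: subalgebra_def)

lemma sets_F: "A \<in> sets F ==> A \<in> sets P"
 using subalg by (auto simp: subalgebra_def)

lemma F_into_P: "f \<in> measurable F N ==> f \<in> measurable P N"
 by (rule measurable_from_subalg[OF subalg])

lemma d_meas1: "k \<in> I ==> q \<in> space P ==> d k q \<in> bmf nu"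
 using mcomp[OF measurable_Pair1' d_meas, of q k] by simp

lemma sets_kp[simp, measurable_cong]: "sets (kp k q) = sets nu"
 by (simp add: kp_def)

lemma space_kp[simp]: "space (kp k q) = space nu"
 by (simp add: kp_def)

lemma prob_kp: "k \<in> I ==> q \<in> space P ==> prob_space (kp k q)"
proof (rule prob_spaceI)
 assume k: "k \<in> I" and q: "q \<in> space P"
 note [measurable] = d_meas1[OF k q]
 have "emeasure (kp k q) (space nu) = nint nu (%v. ennreal (d k q v))"
  unfolding kp_def by (subst emeasure_density) (auto intro!: nn_integral_cong)
 then show "emeasure (kp k q) (space (kp k q)) = 1" using d_prob[OF k q] by simp
qed

lemma sets_PiM_kp[measurable_cong]: "sets (PiM I (%k. kp k q)) = sets Vnu"
 by (rule sets_PiM_cong) auto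

lemma prob_PiM_kp: "q \<in> space P ==> prob_space (PiM I (%k. kp k q))"
 by (intro prob_space_PiM prob_kp)

lemma sigma_finite_Vnu: "sigma_finite_measure Vnu"
proof -
 interpret product_sigma_finite "%_. nu" unfolding product_sigma_finite_def using sigma_finite_base by simp
 show ?thesis by (rule sigma_finite[OF finite_I])
qed

lemma joint_dens_meas[measurable]: "joint_dens \<in> bmf (F >< Vnu)"
proof -
 have "(%x. d k (fst x) (snd x k)) \<in> bmf (F >< Vnu)" if "k \<in> I" for k
 proof -
  have [measurable]: "(%x. snd x k) \<in> measurable (F >< Vnu) nu"
   using that by measurable
  have "(%x. (fst x, snd x k)) \<in> measurable (F >< Vnu) (F >< nu)" by measurable
  from mcomp[OF this d_meas[OF that]] show ?thesis by simp
 qed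
 then show ?thesis unfolding joint_dens_def split_beta' by (intro borel_measurable_prod) auto
qed

lemma joint_dens_meas1: "q \<in> space P ==> (%v. joint_dens (q, v)) \<in> bmf Vnu"
 using mcomp[OF measurable_Pair1' joint_dens_meas, of q] by simp

lemma joint_dens_nonneg: "q \<in> space P ==> v \<in> space Vnu ==> joint_dens (q, v) >= 0"
 unfolding joint_dens_def by (auto intro!: prod_nonneg d_nonneg simp: space_PiM)

text \<open>Both sides agree on boxes by Tonelli for products, and a product measure is determined
  there.\<close>

lemma PiM_kp:
 assumes q: "q \<in> space P"
 shows "PiM I (%k. kp k q) = density Vnu (%v. ennreal (joint_dens (q, v)))"
proof -
 \<comment> \<open>The kernels are probability measures only for indices in \<open>I\<close>;
   outside they are replaced by \<open>nu\<close> so that every member of the family is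
   sigma-finite.\<close>
 define kp' where "kp' k = (if k \<in> I then kp k q else nu)" for k
 interpret N: product_sigma_finite "%_. nu" unfolding product_sigma_finite_def using sigma_finite_base by simp
 have sf: "sigma_finite_measure (kp' k)" for k
  using prob_kp[OF _ q, of k] sigma_finite_base
  by (auto simp: kp'_def prob_space_def finite_measure_def)
 interpret K: product_sigma_finite kp' unfolding product_sigma_finite_def using sf by simp
 have "density Vnu (%v. ennreal (joint_dens (q, v))) = PiM I kp'"
 proof (rule K.PiM_eqI[OF finite_I])
  show "sets (density Vnu (%v. ennreal (joint_dens (q, v)))) = sets (PiM I kp')"
   by (simp, rule sets_PiM_cong) (auto simp: kp'_def)
  fix A assume A: "!!i. i \<in> I ==> A i \<in> sets (kp' i)"
  then have A': "!!i. i \<in> I ==> A i \<in> sets nu" by (simp add: kp'_def)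
  have "emeasure (density Vnu (%v. ennreal (joint_dens (q, v)))) (Pi\<^sub>E I A)
   = nint Vnu (%v. ennreal (joint_dens (q, v)) * indicator (Pi\<^sub>E I A) v)"
   using A' finite_I by (intro emeasure_density sets_PiM_I_finite mcomp[OF joint_dens_meas1[OF q] measurable_ennreal]) auto
  also have "... = nint Vnu (%v. (\<Prod>k\<in>I. ennreal (d k q (v k)) * indicator (A k) (v k)))"
  proof (rule nn_integral_cong)
   fix v assume v: "v \<in> space Vnu"
   have 1: "ennreal (joint_dens (q, v)) = (\<Prod>k\<in>I. ennreal (d k q (v k)))"
    unfolding joint_dens_def prod.case using v q by (intro prod_ennreal[symmetric] d_nonneg) (auto simp: space_PiM PiE_mem)
   have 2: "indicator (Pi\<^sub>E I A) v = (\<Prod>k\<in>I. indicator (A k) (v k) :: ennreal)"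
    using v finite_I by (auto simp: indicator_def space_PiM PiE_def Pi_def prod_zero_iff)
   show "ennreal (joint_dens (q, v)) * indicator (Pi\<^sub>E I A) v = (\<Prod>k\<in>I. ennreal (d k q (v k)) * indicator (A k) (v k))"
    unfolding 1 2 by (simp add: prod.distrib)
  qed
  also have "... = (\<Prod>k\<in>I. nint nu (%x. ennreal (d k q x) * indicator (A k) x))"
   using A' d_meas1[OF _ q] by (intro N.product_nn_integral_prod finite_I) auto
  also have "... = (\<Prod>k\<in>I. emeasure (kp' k) (A k))"
   using A' d_meas1[OF _ q] by (intro prod.cong) (auto simp: kp'_def kp_def emeasure_density)
  finally show "emeasure (density Vnu (%v. ennreal (joint_dens (q, v)))) (Pi\<^sub>E I A) = (\<Prod>i\<in>I. emeasure (kp' i) (A i))" .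
 qed
 moreover have "PiM I kp' = PiM I (%k. kp k q)" by (rule PiM_cong) (auto simp: kp'_def)
 ultimately show ?thesis by simp
qed

lemma bvec_meas[measurable]: "bvec \<in> measurable P Vnu"
 unfolding bvec_def using V_meas by (intro measurable_restrict) auto

lemma pair_bvec_meas: "(%q. (q, bvec q)) \<in> measurable P (F >< Vnu)"
proof (rule measurable_Pair)
 show "(%q. q) \<in> measurable P F" by (rule F_into_P) simp
qed simp

abbreviation "PF == restr_to_subalg P F"

lemma sets_PF[simp, measurable_cong]: "sets PF = sets F"
 by (rule sets_restr_to_subalg[OF subalg])

lemma nn_PF: "f \<in> bmf F ==> (nint PF (%q. f q)) = nint P (%q. f q)"
 by (rule nn_integral_subalgebra2[OF subalg])

text \<open>Candidate for the law of the past together with the new variables: \<open>P\<close>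
  restricted to \<open>F\<close>, followed by the product kernel, written as a density with respect
  to a product measure so that Fubini applies.\<close>

abbreviation "joint_law == density (PF >< Vnu) (%x. ennreal (joint_dens x))"

lemma sets_PFV: "sets (PF >< Vnu) = sets (F >< Vnu)"
 by (rule sets_pair_measure_cong) auto

lemma nn_joint_law_meas:
 assumes f[measurable]: "f \<in> bmf (F >< Vnu)"
 shows "(%q. nint (PiM I (%k. kp k q)) (%v. f (q, v))) \<in> bmf F"
  and "nint joint_law (%x. f x) = nint P (%q. nint (PiM I (%k. kp k q)) (%v. f (q, v)))"
proof -
 interpret V: sigma_finite_measure Vnu by (rule sigma_finite_Vnu)
 have f': "f \<in> bmf (PF >< Vnu)" using f measurable_cong_sets[OF sets_PFV] by blast
 have j': "joint_dens \<in> bmf (PF >< Vnu)" using joint_dens_meas measurable_cong_sets[OF sets_PFV] by blast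
 have fm: "(%v. f (q, v)) \<in> bmf Vnu" if "q \<in> space P" for q
  using mcomp[OF measurable_Pair1' f, of q] that by simp
 have eq: "nint (PiM I (%k. kp k q)) (%v. f (q, v)) = nint Vnu (%v. ennreal (joint_dens (q, v)) * f (q, v))" if "q \<in> space P" for q
  unfolding PiM_kp[OF that] using that fm joint_dens_meas1
  by (subst nn_integral_density) auto
 have m: "(%q. nint Vnu (%v. ennreal (joint_dens (q, v)) * f (q, v))) \<in> bmf F"
  by (intro V.borel_measurable_nn_integral) (simp add: split_beta')
 show meas: "(%q. nint (PiM I (%k. kp k q)) (%v. f (q, v))) \<in> bmf F"
  using m by (rule measurable_cong[THEN iffD2, rotated]) (simp add: eq)
 have "nint joint_law (%x. f x) = nint (PF >< Vnu) (%x. ennreal (joint_dens x) * f x)"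
  using f' j' by (subst nn_integral_density) auto
 also have "... = nint PF (%q. nint Vnu (%v. ennreal (joint_dens (q, v)) * f (q, v)))"
  using f' j' by (subst V.nn_integral_fst[symmetric]) auto
 also have "... = nint P (%q. nint Vnu (%v. ennreal (joint_dens (q, v)) * f (q, v)))"
  by (rule nn_PF[OF m])
 also have "... = nint P (%q. nint (PiM I (%k. kp k q)) (%v. f (q, v)))"
  by (intro nn_integral_cong) (simp add: eq)
 finally show "nint joint_law (%x. f x) = nint P (%q. nint (PiM I (%k. kp k q)) (%v. f (q, v)))" .
qed

text \<open>For C in \<open>F\<close> and a box, integrating \<open>box\<close> over C shows that
  both measures give C times the box the same mass. Rectangles with a box as second side are not
  closed under replacing the box by an arbitrary set, so the extension takes two rounds: from boxes
  to all sets D for fixed C, and from products C times D to the whole pair sigma-algebra.\<close>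

lemma joint_distr: "distr P (F >< Vnu) (%q. (q, bvec q)) = joint_law"
proof -
 let ?m = "%A q. (\<Prod>k\<in>I. measure (kp k q) (A k))"
 let ?\<mu> = "distr P (F >< Vnu) (%q. (q, bvec q))"
 interpret SF: finite_measure_subalgebra P F by unfold_locales (rule subalg)
 have rect: "emeasure ?\<mu> (C \<times> Pi\<^sub>E I A) = emeasure joint_law (C \<times> Pi\<^sub>E I A)"
  if C: "C \<in> sets F" and A: "!!k. k \<in> I ==> A k \<in> sets nu" for C A
 proof -
  note [measurable] = sets_F[OF C] C
  define E where "E = {q \<in> space P. \<forall>k\<in>I. V k q \<in> A k}"
  have E[measurable]: "E \<in> sets P"
  proof -
   have "E = bvec -` Pi\<^sub>E I A \<inter> space P" by (auto simp: E_def bvec_def)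
   then show ?thesis using A finite_I by (auto intro!: measurable_sets[OF bvec_meas] sets_PiM_I_finite)
  qed
  have PA: "Pi\<^sub>E I A \<in> sets Vnu" using A finite_I by (intro sets_PiM_I_finite) auto
  have prodP: "emeasure (PiM I (%k. kp k q)) (Pi\<^sub>E I A) = ennreal (?m A q)" if "q \<in> space P" for q
  proof -
   define kp' where "kp' k = (if k \<in> I then kp k q else nu)" for k
   have sf: "sigma_finite_measure (kp' k)" for k
    using prob_kp[OF _ that, of k] sigma_finite_base
    by (auto simp: kp'_def prob_space_def finite_measure_def)
   interpret K: product_sigma_finite kp' unfolding product_sigma_finite_def using sf by simp
   have "emeasure (PiM I kp') (Pi\<^sub>E I A) = (\<Prod>k\<in>I. emeasure (kp' k) (A k))"
    using A by (intro K.emeasure_PiM finite_I) (auto simp: kp'_def)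
   also have "... = (\<Prod>k\<in>I. ennreal (measure (kp k q) (A k)))"
    using prob_kp[OF _ that] by (intro prod.cong) (auto simp: kp'_def finite_measure.emeasure_eq_measure prob_space_def)
   also have "PiM I kp' = PiM I (%k. kp k q)" by (rule PiM_cong) (auto simp: kp'_def)
   finally show ?thesis by (simp add: prod_ennreal)
  qed
  have pm: "(%q. \<Prod>k\<in>I. measure (kp k q) (A k)) \<in> bmf P"
  proof -
   have "(%q. nint (PiM I (%k. kp k q)) (%v. indicator (space F \<times> Pi\<^sub>E I A) (q, v))) \<in> bmf F"
    using PA sets.top[of F] by (intro nn_joint_law_meas borel_measurable_indicator pair_measureI) simp_all
   then have "(%q. enn2real (nint (PiM I (%k. kp k q)) (%v. indicator (space F \<times> Pi\<^sub>E I A) (q, v)))) \<in> bmf P"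
    by (auto intro: F_into_P)
   moreover have "enn2real (nint (PiM I (%k. kp k q)) (%v. indicator (space F \<times> Pi\<^sub>E I A) (q, v))) = (?m A q)"
    if "q \<in> space P" for q
   proof -
    have "nint (PiM I (%k. kp k q)) (%v. indicator (space F \<times> Pi\<^sub>E I A) (q, v)) = nint (PiM I (%k. kp k q)) (%v. indicator (Pi\<^sub>E I A) v)"
     using that by (intro nn_integral_cong) (auto simp: indicator_def)
    also have "... = ennreal (?m A q)"
     using PA prodP[OF that] by (subst nn_integral_indicator) (auto simp: sets_PiM_kp)
    finally show ?thesis by (simp add: prod_nonneg)
   qed
   ultimately show ?thesis by (rule measurable_cong[THEN iffD1, rotated]) auto
  qed
  have pint: "integrable P (%q. \<Prod>k\<in>I. measure (kp k q) (A k))"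
   using pm prob_kp by (intro integrable_const_bound[where B=1])
    (auto simp: abs_prod intro!: prod_le_1 prob_space.prob_le_1)
  have "emeasure ?\<mu> (C \<times> Pi\<^sub>E I A) = emeasure P (C \<inter> E)"
  proof -
   have "(%q. (q, bvec q)) -` (C \<times> Pi\<^sub>E I A) \<inter> space P = C \<inter> E"
    using sets.sets_into_space[OF C] by (auto simp: E_def bvec_def)
   then show ?thesis using C PA by (subst emeasure_distr[OF pair_bvec_meas]) auto
  qed
  also have "... = ennreal (\<integral>q\<in>C. indicator E q \<partial>P)"
   by (simp add: emeasure_eq_measure set_lebesgue_integral_def indicator_inter_arith[symmetric])
  \<comment> \<open>The defining property of the conditional expectation on the set C of
    \<open>F\<close>; it is the only place where the hypothesis of conditional laws enters.\<close>
  also have "(\<integral>q\<in>C. indicator E q \<partial>P) = (\<integral>q\<in>C. real_cond_exp P F (indicator E) q \<partial>P)"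
   using C by (intro SF.real_cond_exp_intA) (auto simp: emeasure_eq_measure)
  also have "... = (\<integral>q\<in>C. (?m A q) \<partial>P)"
   unfolding set_lebesgue_integral_def
  proof (rule integral_cong_AE)
   have "AE q in P. real_cond_exp P F (indicator E) q = (?m A q)"
    unfolding E_def kp_def by (rule box) (rule A)
   then show "AE q in P. indicator C q *\<^sub>R real_cond_exp P F (indicator E) q = indicator C q *\<^sub>R (?m A q)"
    by eventually_elim simp
  qed (use pm in auto)
  also have "ennreal \<dots> = nint P (%q. ennreal (indicator C q * (?m A q)))"
   unfolding set_lebesgue_integral_def real_scaleR_def
   using integrable_mult_indicator[OF sets_F[OF C] pint]
   by (intro nn_integral_eq_integral[symmetric] AE_I2) (auto intro!: mult_nonneg_nonneg prod_nonneg)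
  also have "... = nint P (%q. nint (PiM I (%k. kp k q)) (%v. indicator (C \<times> Pi\<^sub>E I A) (q, v)))"
  proof (rule nn_integral_cong)
   fix q assume q: "q \<in> space P"
   have "nint (PiM I (%k. kp k q)) (%v. indicator (C \<times> Pi\<^sub>E I A) (q, v)) = nint (PiM I (%k. kp k q)) (%v. indicator C q * indicator (Pi\<^sub>E I A) v)"
    by (intro nn_integral_cong) (auto simp: indicator_def)
   also have "... = indicator C q * ennreal (?m A q)"
    using PA prodP[OF q] by (subst nn_integral_cmult_indicator) (auto simp: sets_PiM_kp)
   finally show "ennreal (indicator C q * (?m A q)) = nint (PiM I (%k. kp k q)) (%v. indicator (C \<times> Pi\<^sub>E I A) (q, v))"
    by (auto simp: indicator_def)
  qed
  also have "... = nint joint_law (%x. indicator (C \<times> Pi\<^sub>E I A) x)"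
   using C PA by (subst nn_joint_law_meas(2)) auto
  also have "... = emeasure joint_law (C \<times> Pi\<^sub>E I A)"
   using C PA by (subst nn_integral_indicator) (auto simp: sets_PFV)
  finally show ?thesis .
 qed
 have mu1: "emeasure ?\<mu> (space (F >< Vnu)) = 1"
 proof -
  have "(%q. (q, bvec q)) -` space (F >< Vnu) \<inter> space P = space P"
   using measurable_space[OF pair_bvec_meas] by auto
  then show ?thesis by (subst emeasure_distr[OF pair_bvec_meas]) (auto simp: emeasure_space_1)
 qed
 have rect2: "emeasure ?\<mu> (C \<times> D) = emeasure joint_law (C \<times> D)"
  if C: "C \<in> sets F" and D: "D \<in> sets Vnu" for C D
 proof -
  \<comment> \<open>Cutting to C and projecting onto the second component leaves two finite measures
    on the product space of the new variables that agree on boxes, hence everywhere.\<close>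
  define N1 where "N1 = distr (density ?\<mu> (indicator (C \<times> space Vnu))) Vnu snd"
  define N2 where "N2 = distr (density joint_law (indicator (C \<times> space Vnu))) Vnu snd"
  have N: "emeasure (distr (density \<mu> (indicator (C \<times> space Vnu))) Vnu snd) D = emeasure \<mu> (C \<times> D)"
   if s: "sets \<mu> = sets (F >< Vnu)" and D: "D \<in> sets Vnu" for \<mu> D
  proof -
   have CS: "C \<times> space Vnu \<in> sets \<mu>" unfolding s using C by (intro pair_measureI sets.top)
   have sn: "snd -` D \<inter> space \<mu> = space F \<times> D"
    using sets.sets_into_space[OF D] sets_eq_imp_space_eq[OF s] by (auto simp: space_pair_measure)
   have sD: "space F \<times> D \<in> sets \<mu>" unfolding s using D by (intro pair_measureI sets.top)
   have ms: "snd \<in> measurable (density \<mu> (indicator (C \<times> space Vnu))) Vnu"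
    by (subst measurable_cong_sets[of _ "F >< Vnu" _ Vnu]) (simp_all add: s)
   have "emeasure (distr (density \<mu> (indicator (C \<times> space Vnu))) Vnu snd) D
    = nint \<mu> (%x. indicator (C \<times> space Vnu) x * indicator (space F \<times> D) x)"
    using CS sD by (subst emeasure_distr[OF ms D]) (simp add: sn emeasure_density)
   also have "... = nint \<mu> (%x. indicator (C \<times> D) x)"
    using sets.sets_into_space[OF C] sets.sets_into_space[OF D]
    by (intro nn_integral_cong) (auto simp: indicator_def)
   also have "... = emeasure \<mu> (C \<times> D)" by (subst nn_integral_indicator) (simp_all add: s C D)
   finally show ?thesis .
  qed
  have "N1 = N2"
  proof (rule measure_eqI_PiM_finite[OF finite_I])
   show "sets N1 = sets Vnu" "sets N2 = sets Vnu" by (simp_all add: N1_def N2_def)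
   fix A :: "'k => 'v set" assume A: "!!i. i \<in> I ==> A i \<in> sets nu"
   have PA: "Pi\<^sub>E I A \<in> sets Vnu" using A finite_I by (intro sets_PiM_I_finite) auto
   show "emeasure N1 (Pi\<^sub>E I A) = emeasure N2 (Pi\<^sub>E I A)"
    unfolding N1_def N2_def using rect[OF C A] by (subst (1 2) N[OF _ PA]) (auto simp: sets_PFV)
  next
   show "range (%_::nat. space Vnu) \<subseteq> prod_algebra I (%_. nu)"
    using finite_I by (auto simp: space_PiM intro!: prod_algebraI_finite)
   show "(\<Union>i::nat. space Vnu) = space Vnu" by simp
   have "emeasure N1 (space Vnu) <= emeasure ?\<mu> (space (F >< Vnu))"
    unfolding N1_def using sets.sets_into_space[OF C] sets.top[of "F >< Vnu"]
    by (subst N) (auto intro!: emeasure_mono simp: space_pair_measure)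
   also have "... < \<infinity>" by (subst mu1) simp
   finally show "emeasure N1 (space Vnu) ~= \<infinity>" by simp
  qed
  then show ?thesis using N[of ?\<mu> D] N[of joint_law D] D unfolding N1_def N2_def by (simp add: sets_PFV)
 qed
 let ?E = "{a \<times> b | a b. a \<in> sets F \<and> b \<in> sets Vnu}"
 show ?thesis
 proof (rule measure_eqI_generator_eq[of ?E "space F \<times> space Vnu" _ _ "%_::nat. space F \<times> space Vnu"])
  show "Int_stable ?E" by (rule Int_stable_pair_measure_generator)
  show "?E \<subseteq> Pow (space F \<times> space Vnu)" using sets.space_closed[of F] sets.space_closed[of Vnu] by blast
  show "emeasure ?\<mu> X = emeasure joint_law X" if "X \<in> ?E" for X
   using that rect2 by auto
  show "sets ?\<mu> = sigma_sets (space F \<times> space Vnu) ?E"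
   by (simp add: sets_pair_measure)
  show "sets joint_law = sigma_sets (space F \<times> space Vnu) ?E"
   unfolding sets_density sets_PFV by (rule sets_pair_measure)
  show "range (%_::nat. space F \<times> space Vnu) \<subseteq> ?E" using sets.top[of F] sets.top[of Vnu] by blast
  show "emeasure ?\<mu> (space F \<times> space Vnu) ~= \<infinity>" using mu1 by (simp add: space_pair_measure)
 qed auto
qed

text \<open>The usable form of the disintegration: under an expectation the new variables may be
  integrated out against the product kernel while the past stays fixed.\<close>

lemma nn_joint:
 assumes f: "f \<in> bmf (F >< Vnu)"
 shows "nint P (%q. f (q, bvec q)) = nint P (%q. nint (PiM I (%k. kp k q)) (%v. f (q, v)))"
 using nn_integral_distr[OF pair_bvec_meas, of f] f nn_joint_law_meas(2)[OF f] unfolding joint_distr by simp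

lemma nn_kp:
 assumes f: "f \<in> bmf (F >< nu)" and k: "k \<in> I" and q: "q \<in> space P"
 shows "nint (kp k q) (%v. f (q, v)) = nint nu (%v. ennreal (d k q v) * f (q, v))"
proof -
 have "(%v. f (q, v)) \<in> bmf nu"
  using mcomp[OF measurable_Pair1' f, of q] q by simp
 then show ?thesis unfolding kp_def using d_meas1[OF k q] by (subst nn_integral_density) auto
qed

lemma int_kp:
 fixes f :: "'w \<times> 'v => real"
 assumes f: "f \<in> bmf (F >< nu)" and k: "k \<in> I" and q: "q \<in> space P"
 shows "lint (kp k q) (%v. f (q, v)) = lint nu (%v. d k q v * f (q, v))"
  and "integrable (kp k q) (%v. f (q, v)) \<longleftrightarrow> integrable nu (%v. d k q v * f (q, v))"
proof -
 have 1: "(%v. f (q, v)) \<in> bmf nu"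
  using mcomp[OF measurable_Pair1' f, of q] q by simp
 have 2: "AE v in nu. 0 <= d k q v" using d_nonneg[OF k q] by (intro AE_I2) auto
 show "lint (kp k q) (%v. f (q, v)) = lint nu (%v. d k q v * f (q, v))"
  unfolding kp_def using integral_density[OF 1 d_meas1[OF k q] 2] by simp
 show "integrable (kp k q) (%v. f (q, v)) \<longleftrightarrow> integrable nu (%v. d k q v * f (q, v))"
  unfolding kp_def using integrable_density[OF 1 d_meas1[OF k q] 2] by simp
qed

lemma int_kp_meas:
 fixes f :: "'w \<times> 'v => real"
 assumes f[measurable]: "f \<in> bmf (F >< nu)" and k: "k \<in> I"
 shows "(%q. lint (kp k q) (%v. f (q, v))) \<in> bmf F"
proof -
 interpret nu: sigma_finite_measure nu by (rule sigma_finite_base)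
 note [measurable] = d_meas[OF k]
 have "(%q. lint nu (%v. d k q v * f (q, v))) \<in> bmf F"
  by (intro nu.borel_measurable_lebesgue_integral) (simp add: split_beta')
 then show ?thesis by (rule measurable_cong[THEN iffD2, rotated]) (simp add: int_kp f k)
qed

lemma nn_joint1:
 assumes f[measurable]: "f \<in> bmf (F >< nu)" and k[measurable]: "k \<in> I"
 shows "nint P (%q. f (q, V k q)) = nint P (%q. nint (kp k q) (%v. f (q, v)))"
proof -
 have "nint P (%q. f (q, V k q)) = nint P (%q. f (fst (q, bvec q), snd (q, bvec q) k))"
  using k by (simp add: bvec_def)
 also have "... = nint P (%q. nint (PiM I (%k. kp k q)) (%v. f (q, v k)))"
  by (subst nn_joint) auto
 also have "... = nint P (%q. nint (kp k q) (%v. f (q, v)))"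
 proof (rule nn_integral_cong)
  fix q assume q: "q \<in> space P"
  have fm: "(%v. f (q, v)) \<in> bmf (kp k q)"
   using mcomp[OF measurable_Pair1' f, of q] q by simp
  have "nint (kp k q) (%v. f (q, v)) = nint (distr (PiM I (%k. kp k q)) (kp k q) (%v. v k)) (%v. f (q, v))"
   using prob_kp q k by (subst distr_PiM_component) auto
  also have "... = nint (PiM I (%k. kp k q)) (%v. f (q, v k))"
   using fm k by (subst nn_integral_distr) auto
  finally show "nint (PiM I (%k. kp k q)) (%v. f (q, v k)) = nint (kp k q) (%v. f (q, v))" by simp
 qed
 finally show ?thesis .
qed

text \<open>The conditional variance is bounded by a product of two random factors, each with
  controlled mean, because in the applications one factor is the scalar \<open>R\<close> and the
  other an empirical mean divided by K; the product itself need not be integrable. Conditionally the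
  sum has mean modulus at most sqrt(X) sqrt(Y), and a second Cauchy-Schwarz over \<open>P\<close>
  separates the factors.\<close>

lemma centred_sum_L1:
 fixes xi :: "'k => 'w => 'v => real"
 assumes xi[measurable]: "!!k. k \<in> I ==> (%(q, v). xi k q v) \<in> bmf (F >< nu)"
  and ae: "AE q in P. (\<forall>k\<in>I. integrable (kp k q) (%v. (xi k q v)\<^sup>2) \<and> (lint (kp k q) (%v. xi k q v)) = 0) \<and>
    (\<Sum>k\<in>I. lint (kp k q) (%v. (xi k q v)\<^sup>2)) <= X q * Y q \<and> 0 <= X q \<and> 0 <= Y q"
  and X[measurable]: "X \<in> bmf P" and Y[measurable]: "Y \<in> bmf P"
  and x: "nint P (%q. ennreal (X q)) <= ennreal x" "x >= 0" and y: "nint P (%q. ennreal (Y q)) <= ennreal y" "y >= 0"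
 shows "nint P (%q. ennreal \<bar>\<Sum>k\<in>I. xi k q (V k q)\<bar>) <= ennreal (sqrt (x * y))"
proof -
 have m: "(%p. ennreal \<bar>\<Sum>k\<in>I. xi k (fst p) (snd p k)\<bar>) \<in> bmf (F >< Vnu)"
 proof -
  have "(%p. xi k (fst p) (snd p k)) \<in> bmf (F >< Vnu)" if "k \<in> I" for k
  proof -
   have "(%x. (fst x, snd x k)) \<in> measurable (F >< Vnu) (F >< nu)" using that by measurable
   from mcomp[OF this xi[OF that]] show ?thesis by simp
  qed
  then show ?thesis by measurable
 qed
 have "nint P (%q. ennreal \<bar>\<Sum>k\<in>I. xi k q (V k q)\<bar>) =
   (nint P (%q. ennreal \<bar>\<Sum>k\<in>I. xi k (fst (q, bvec q)) (snd (q, bvec q) k)\<bar>))"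
  by (intro nn_integral_cong arg_cong[where f=ennreal] arg_cong[where f=abs] sum.cong) (auto simp: bvec_def)
 also have "... = nint P (%q. nint (PiM I (%k. kp k q)) (%v. ennreal \<bar>\<Sum>k\<in>I. xi k q (v k)\<bar>))"
  by (subst nn_joint[OF m]) simp
 also have "... <= nint P (%q. ennreal (sqrt (X q)) * ennreal (sqrt (Y q)))"
 proof (rule nn_integral_mono_AE, use ae AE_space in eventually_elim)
  case (elim q)
  then have q: "q \<in> space P" by simp
  have xim: "xi k q \<in> bmf (kp k q)" if "k \<in> I" for k
   using mcomp[OF measurable_Pair1' xi[OF that], of q] q by simp
  have "nint (PiM I (%k. kp k q)) (%v. ennreal \<bar>\<Sum>k\<in>I. xi k q (v k)\<bar>) <= ennreal (sqrt (\<Sum>k\<in>I. lint (kp k q) (%v. (xi k q v)\<^sup>2)))"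
   using elim xim prob_kp[OF _ q] by (intro PiM_centred_sum finite_I) auto
  also have "... <= ennreal (sqrt (X q * Y q))" using elim by (intro ennreal_leI real_sqrt_le_mono) simp
  also have "... = ennreal (sqrt (X q)) * ennreal (sqrt (Y q))" using elim by (simp add: real_sqrt_mult ennreal_mult)
  finally show ?case .
 qed
 finally have "(nint P (%q. ennreal \<bar>\<Sum>k\<in>I. xi k q (V k q)\<bar>))\<^sup>2 <= (nint P (%q. ennreal (sqrt (X q)) * ennreal (sqrt (Y q))))\<^sup>2"
  by (rule power_mono) simp
 also have "... <= nint P (%q. (ennreal (sqrt (X q)))\<^sup>2) * nint P (%q. (ennreal (sqrt (Y q)))\<^sup>2)"
  by (rule Cauchy_Schwarz_nn_integral) auto
 also have "nint P (%q. (ennreal (sqrt (X q)))\<^sup>2) = nint P (%q. ennreal (X q))"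
  by (rule nn_integral_cong_AE, use ae in eventually_elim) (auto simp: ennreal_power)
 also have "nint P (%q. (ennreal (sqrt (Y q)))\<^sup>2) = nint P (%q. ennreal (Y q))"
  by (rule nn_integral_cong_AE, use ae in eventually_elim) (auto simp: ennreal_power)
 also have "nint P (%q. ennreal (X q)) * nint P (%q. ennreal (Y q)) <= ennreal x * ennreal y"
  by (intro mult_mono x y) auto
 also have "... = (ennreal (sqrt (x * y)))\<^sup>2" using x y by (simp add: ennreal_power ennreal_mult)
 finally show ?thesis by (rule ennreal_power2_le_imp_le)
qed

text \<open>Complex counterpart of \<open>nn_joint\<close> for characteristic functions; boundedness
  supplies the integrability that Fubini asks for.\<close>

lemma bounded_joint:
 fixes g :: "'w \<times> ('k => 'v) => complex"
 assumes g[measurable]: "g \<in> bmf (F >< Vnu)" and bd: "!!x. cmod (g x) <= 1"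
 shows "(CLINT q|P. g (q, bvec q)) = (CLINT q|P. CLINT v|PiM I (%k. kp k q). g (q, v))"
  and "(%q. CLINT v|PiM I (%k. kp k q). g (q, v)) \<in> bmf F"
proof -
 interpret V: sigma_finite_measure Vnu by (rule sigma_finite_Vnu)
 interpret PFs: prob_space PF by (rule prob_space_restr_to_subalg[OF subalg]) (rule prob_space_axioms)
 interpret pair_sigma_finite PF Vnu ..
 have g'[measurable]: "g \<in> bmf (PF >< Vnu)" using g measurable_cong_sets[OF sets_PFV] by blast
 have j'[measurable]: "joint_dens \<in> bmf (PF >< Vnu)" using joint_dens_meas measurable_cong_sets[OF sets_PFV] by blast
 have spPF: "space PF = space P" by (rule space_restr_to_subalg)
 have j0: "AE x in PF >< Vnu. 0 <= joint_dens x"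
  using joint_dens_nonneg by (intro AE_I2) (auto simp: space_pair_measure spPF)
 interpret J: prob_space joint_law
  unfolding joint_distr[symmetric] by (rule prob_space_distr[OF pair_bvec_meas])
 have gint: "integrable joint_law g" using bd by (intro J.integrable_const_bound[where B=1]) auto
 then have gint': "integrable (PF >< Vnu) (%x. joint_dens x *\<^sub>R g x)"
  using integrable_density[OF g' j' j0] by simp
 have eq: "(CLINT v|PiM I (%k. kp k q). g (q, v)) = (CLINT v|Vnu. joint_dens (q, v) *\<^sub>R g (q, v))" if "q \<in> space P" for q
 proof -
  have 1: "(%v. g (q, v)) \<in> bmf Vnu"
   using mcomp[OF measurable_Pair1' g, of q] that by simp
  show ?thesis unfolding PiM_kp[OF that]
   using joint_dens_nonneg[OF that] by (intro integral_density 1 joint_dens_meas1 that AE_I2) auto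
 qed
 have m: "(%q. CLINT v|Vnu. joint_dens (q, v) *\<^sub>R g (q, v)) \<in> bmf F"
  by (intro V.borel_measurable_lebesgue_integral) (simp add: split_beta')
 show "(%q. CLINT v|PiM I (%k. kp k q). g (q, v)) \<in> bmf F"
  using m by (rule measurable_cong[THEN iffD2, rotated]) (simp add: eq)
 have "(CLINT q|P. g (q, bvec q)) = (CLINT x|joint_law. g x)"
  unfolding joint_distr[symmetric] by (rule integral_distr[OF pair_bvec_meas, symmetric]) (rule g)
 also have "... = (CLINT x|(PF >< Vnu). joint_dens x *\<^sub>R g x)" by (rule integral_density[OF g' j' j0])
 also have "... = (CLINT q|PF. CLINT v|Vnu. joint_dens (q, v) *\<^sub>R g (q, v))"
  using integral_fst'[OF gint'] by simp
 also have "... = (CLINT q|P. CLINT v|Vnu. joint_dens (q, v) *\<^sub>R g (q, v))"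
  by (rule integral_subalgebra2[OF subalg m])
 also have "... = (CLINT q|P. CLINT v|PiM I (%k. kp k q). g (q, v))"
  by (intro Bochner_Integration.integral_cong refl eq[symmetric])
 finally show "(CLINT q|P. g (q, bvec q)) = (CLINT q|P. CLINT v|PiM I (%k. kp k q). g (q, v))" .
qed

lemma exp_neg_diff_le: "a >= 0 ==> b >= 0 ==> \<bar>exp (- a) - exp (- b :: real)\<bar> <= \<bar>a - b\<bar>"
proof -
 have *: "exp (- b) - exp (- a) <= a - b" if "0 <= b" "b <= a" for a b :: real
 proof -
  have "1 - exp (- (a - b)) <= a - b" using exp_ge_add_one_self[of "- (a - b)"] by linarith
  then have "exp (- b) * (1 - exp (- (a - b))) <= 1 * (a - b)"
   using that by (intro mult_mono) auto
  moreover have "exp (- b) * exp (- (a - b)) = exp (- a)" by (simp flip: exp_add)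
  ultimately show ?thesis unfolding right_diff_distrib by simp
 qed
 assume "a >= 0" "b >= 0"
 then show ?thesis using *[of a b] *[of b a] by (cases "a <= b") auto
qed

text \<open>Given \<open>F\<close>, the characteristic function of the sum is a product of factors,
  each close to a Gaussian one by \<open>iexp_gauss_bound\<close>, and the Gaussian factors multiply
  to exp(-s^2 v / 2) with the conditional variance v. Replacing v by a constant costs a Lipschitz
  term. The factor \<open>ze\<close> carries the contribution of the past, which allows iteration
  over the stages; the cap 2 makes the bound tend to zero even if its ingredients converge only in
  probability.\<close>

lemma centred_sum_char:
 fixes xi :: "'k => 'w => 'v => real" and ze :: "'w => complex" and s \<sigma>2 :: real
 defines "v == %q. \<Sum>k\<in>I. lint (kp k q) (%v. (xi k q v)\<^sup>2)"
  and "La == %q. \<Sum>k\<in>I. lint (kp k q) (%v. (xi k q v)\<^sup>2 * min 1 \<bar>s * xi k q v\<bar>)"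
 assumes xi[measurable]: "!!k. k \<in> I ==> (%(q, v). xi k q v) \<in> bmf (F >< nu)"
  and ae: "AE q in P. \<forall>k\<in>I. integrable (kp k q) (%v. (xi k q v)\<^sup>2) \<and> (lint (kp k q) (%v. xi k q v)) = 0"
  and ze[measurable]: "ze \<in> bmf F" and ze1: "!!q. cmod (ze q) <= 1" and \<sigma>2: "\<sigma>2 >= 0"
 shows "cmod ((CLINT q|P. ze q * iexp (s * (\<Sum>k\<in>I. xi k q (V k q)))) - of_real (exp (- (s\<^sup>2 * \<sigma>2 / 2))) * (CLINT q|P. ze q))
  <= lint P (%q. min 2 (2 * s\<^sup>2 * La q + s\<^sup>2 / 2 * \<bar>v q - \<sigma>2\<bar>))"
  and "v \<in> bmf F" and "La \<in> bmf F"
proof -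
 have xi2: "(%x. xi k (fst x) (snd x)) \<in> bmf (F >< nu)" if "k \<in> I" for k
  using xi[OF that] by (simp add: split_beta')
 show vm: "v \<in> bmf F"
 proof -
  have "(%q. lint (kp k q) (%v. (%x. (xi k (fst x) (snd x))\<^sup>2) (q, v))) \<in> bmf F" if "k \<in> I" for k
   using xi2[OF that] that by (intro int_kp_meas) auto
  then show ?thesis unfolding v_def by auto
 qed
 show Lam: "La \<in> bmf F"
 proof -
  have "(%q. lint (kp k q) (%v. (%x. (xi k (fst x) (snd x))\<^sup>2 * min 1 \<bar>s * xi k (fst x) (snd x)\<bar>) (q, v))) \<in> bmf F" if "k \<in> I" for k
   using xi2[OF that] that by (intro int_kp_meas) auto
  then show ?thesis unfolding La_def by auto
 qed
 have [measurable]: "v \<in> bmf P" "La \<in> bmf P" "ze \<in> bmf P"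
  using F_into_P[OF vm] F_into_P[OF Lam] F_into_P[OF ze] by auto
 define g where "g x = ze (fst x) * iexp (s * (\<Sum>k\<in>I. xi k (fst x) (snd x k)))" for x
 have gm: "g \<in> bmf (F >< Vnu)"
 proof -
  have "(%p. xi k (fst p) (snd p k)) \<in> bmf (F >< Vnu)" if "k \<in> I" for k
  proof -
   have "(%x. (fst x, snd x k)) \<in> measurable (F >< Vnu) (F >< nu)" using that by measurable
   from mcomp[OF this xi[OF that]] show ?thesis by simp
  qed
  then show ?thesis unfolding g_def by measurable
 qed
 have g1: "cmod (g x) <= 1" for x unfolding g_def by (simp add: norm_mult ze1)
 define Ph where "Ph q = (CLINT v|PiM I (%k. kp k q). g (q, v))" for q
 have Phm: "Ph \<in> bmf P" unfolding Ph_def using bounded_joint(2)[OF gm g1] by (rule F_into_P)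
 define e where "e = exp (- (s\<^sup>2 * \<sigma>2 / 2))"
 have e01: "0 <= e" "e <= 1" unfolding e_def using \<sigma>2 by auto
 have "(CLINT q|P. ze q * iexp (s * (\<Sum>k\<in>I. xi k q (V k q)))) = (CLINT q|P. g (q, bvec q))"
  unfolding g_def by (intro Bochner_Integration.integral_cong) (auto simp: bvec_def)
 also have "... = (CLINT q|P. Ph q)" unfolding Ph_def by (rule bounded_joint(1)[OF gm g1])
 finally have E: "(CLINT q|P. ze q * iexp (s * (\<Sum>k\<in>I. xi k q (V k q)))) = (CLINT q|P. Ph q)" .
 have pt: "AE q in P. cmod (Ph q - of_real e * ze q) <= min 2 (2 * s\<^sup>2 * La q + s\<^sup>2 / 2 * \<bar>v q - \<sigma>2\<bar>)"
  using ae AE_space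
 proof eventually_elim
  case (elim q)
  then have q: "q \<in> space P" by simp
  interpret PK: prob_space "PiM I (%k. kp k q)" by (rule prob_PiM_kp[OF q])
  have xim[measurable]: "xi k q \<in> bmf (kp k q)" if "k \<in> I" for k
   using mcomp[OF measurable_Pair1' xi[OF that], of q] q by simp
  define ph where "ph k = (CLINT v|kp k q. iexp (s * xi k q v))" for k
  define vk where "vk k = lint (kp k q) (%v. (xi k q v)\<^sup>2)" for k
  define Lk where "Lk k = lint (kp k q) (%v. (xi k q v)\<^sup>2 * min 1 \<bar>s * xi k q v\<bar>)" for k
  have vk0: "vk k >= 0" for k unfolding vk_def by simp
  have phb: "cmod (ph k - of_real (exp (- (s\<^sup>2 * vk k / 2)))) <= 2 * s\<^sup>2 * Lk k" if "k \<in> I" for k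
  proof -
   interpret K: prob_space "kp k q" by (rule prob_kp[OF that q])
   show ?thesis unfolding ph_def vk_def Lk_def
    using elim that xim[OF that] by (intro K.iexp_gauss_bound) auto
  qed
  have ph1: "cmod (ph k) <= 1" if "k \<in> I" for k
  proof -
   interpret K: prob_space "kp k q" by (rule prob_kp[OF that q])
   have "cmod (ph k) <= lint (kp k q) (%v. cmod (iexp (s * xi k q v)))" unfolding ph_def by (rule integral_norm_bound)
   then show ?thesis using K.prob_space by simp
  qed
  have ind: "PK.indep_vars (%_. borel) (%k v. iexp (s * xi k q (v k))) I"
   using xim by (intro PK.indep_vars_compose2[OF indep_vars_PiM_coordinate'[OF finite_I prob_kp[OF _ q]], of "%k x. iexp (s * xi k q x)" "%_. borel"]) auto
  have pheq: "(CLINT v|PiM I (%k. kp k q). iexp (s * xi k q (v k))) = ph k" if "k \<in> I" for k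
  proof -
   have "ph k = (CLINT x|distr (PiM I (%k. kp k q)) (kp k q) (%v. v k). iexp (s * xi k q x))"
    unfolding ph_def using prob_kp q that by (subst distr_PiM_component) auto
   also have "... = (CLINT v|PiM I (%k. kp k q). iexp (s * xi k q (v k)))"
    using that xim[OF that] by (intro integral_distr) auto
   finally show ?thesis by simp
  qed
  have "Ph q = ze q * (CLINT v|PiM I (%k. kp k q). (\<Prod>k\<in>I. iexp (s * xi k q (v k))))"
   unfolding Ph_def g_def using finite_I by (simp add: sum_distrib_left exp_sum)
  also have "(CLINT v|PiM I (%k. kp k q). (\<Prod>k\<in>I. iexp (s * xi k q (v k)))) = (\<Prod>k\<in>I. ph k)"
  proof (subst PK.indep_vars_lebesgue_integral[OF finite_I ind])
   fix k assume k: "k \<in> I"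
   have "(%v. xi k q (v k)) \<in> bmf (PiM I (%k. kp k q))"
    using k xim[OF k] by measurable
   then show "integrable (PiM I (%k. kp k q)) (%v. iexp (s * xi k q (v k)))"
    by (intro PK.integrable_const_bound[where B=1]) auto
  qed (rule prod.cong[OF refl pheq])
  finally have Ph: "Ph q = ze q * (\<Prod>k\<in>I. ph k)" .
  have "cmod ((\<Prod>k\<in>I. ph k) - of_real e) <= cmod ((\<Prod>k\<in>I. ph k) - (\<Prod>k\<in>I. of_real (exp (- (s\<^sup>2 * vk k / 2))))) + cmod ((\<Prod>k\<in>I. of_real (exp (- (s\<^sup>2 * vk k / 2)))) - of_real e)"
   by (rule order_trans[OF _ norm_triangle_ineq]) simp
  \<comment> \<open>A difference of products of numbers of modulus at most 1 is at most the sum of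
    the differences of the factors; the Gaussian factors qualify because the variances are
    nonnegative.\<close>
  also have "cmod ((\<Prod>k\<in>I. ph k) - (\<Prod>k\<in>I. of_real (exp (- (s\<^sup>2 * vk k / 2))))) <= (\<Sum>k\<in>I. cmod (ph k - of_real (exp (- (s\<^sup>2 * vk k / 2)))))"
   using ph1 vk0 by (intro norm_prod_diff) auto
  also have "... <= (\<Sum>k\<in>I. 2 * s\<^sup>2 * Lk k)" by (intro sum_mono phb)
  also have "... = 2 * s\<^sup>2 * La q" by (simp add: La_def Lk_def sum_distrib_left)
  also have "(\<Prod>k\<in>I. complex_of_real (exp (- (s\<^sup>2 * vk k / 2)))) = of_real (exp (- (s\<^sup>2 * v q / 2)))"
   using finite_I by (simp add: v_def vk_def sum_distrib_left sum_divide_distrib exp_sum flip: sum_negf)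
  also have "cmod (of_real (exp (- (s\<^sup>2 * v q / 2))) - of_real e) = \<bar>exp (- (s\<^sup>2 * v q / 2)) - e\<bar>"
   by (metis norm_of_real of_real_diff)
  also have "... <= \<bar>s\<^sup>2 * v q / 2 - s\<^sup>2 * \<sigma>2 / 2\<bar>"
   unfolding e_def using \<sigma>2 by (intro exp_neg_diff_le) (auto simp: v_def intro!: sum_nonneg mult_nonneg_nonneg)
  also have "... = s\<^sup>2 / 2 * \<bar>v q - \<sigma>2\<bar>" by (simp add: abs_mult flip: right_diff_distrib diff_divide_distrib)
  finally have b1: "cmod ((\<Prod>k\<in>I. ph k) - of_real e) <= 2 * s\<^sup>2 * La q + s\<^sup>2 / 2 * \<bar>v q - \<sigma>2\<bar>" by simp
  have "cmod (\<Prod>k\<in>I. ph k) <= 1" unfolding prod_norm[symmetric] using ph1 by (intro prod_le_1) auto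
  then have b2: "cmod ((\<Prod>k\<in>I. ph k) - of_real e) <= 2"
   using norm_triangle_ineq4[of "\<Prod>k\<in>I. ph k" "of_real e"] e01 by simp
  have "cmod (Ph q - of_real e * ze q) = cmod (ze q) * cmod ((\<Prod>k\<in>I. ph k) - of_real e)"
   unfolding Ph by (simp add: algebra_simps flip: norm_mult)
  also have "... <= 1 * cmod ((\<Prod>k\<in>I. ph k) - of_real e)" by (intro mult_right_mono ze1) auto
  finally show ?case using b1 b2 by simp
 qed
 have La0: "La q >= 0" for q unfolding La_def by (intro sum_nonneg integral_nonneg_AE AE_I2) auto
 have zei: "integrable P ze" using ze1 by (intro integrable_const_bound[where B=1]) auto
 have Phi: "integrable P Ph"
 proof (rule integrable_const_bound[where B=1, OF _ Phm], rule AE_I2)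
  fix q assume q: "q \<in> space P"
  interpret PK: prob_space "PiM I (%k. kp k q)" by (rule prob_PiM_kp[OF q])
  have gm1: "(%v. g (q, v)) \<in> bmf (PiM I (%k. kp k q))"
   using mcomp[OF measurable_Pair1' gm, of q] q by simp
  have "cmod (Ph q) <= lint (PiM I (%k. kp k q)) (%v. cmod (g (q, v)))" unfolding Ph_def by (rule integral_norm_bound)
  also have "... <= lint (PiM I (%k. kp k q)) (%v. 1)"
   using g1 gm1 by (intro integral_mono PK.integrable_const_bound[where B=1]) auto
  finally show "cmod (Ph q) <= 1" by (simp add: PK.prob_space)
 qed
 have "cmod ((CLINT q|P. Ph q) - of_real e * (CLINT q|P. ze q)) = cmod (CLINT q|P. Ph q - of_real e * ze q)"
  using Phi zei by (simp add: Bochner_Integration.integral_diff)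
 also have "... <= lint P (%q. cmod (Ph q - of_real e * ze q))" by (rule integral_norm_bound)
 also have "... <= lint P (%q. min 2 (2 * s\<^sup>2 * La q + s\<^sup>2 / 2 * \<bar>v q - \<sigma>2\<bar>))"
  using Phi zei La0 pt by (intro integral_mono_AE integrable_norm Bochner_Integration.integrable_diff integrable_mult_right
   integrable_const_bound[where B=2 and f="%q. min 2 (2 * s\<^sup>2 * La q + s\<^sup>2 / 2 * \<bar>v q - \<sigma>2\<bar>)"]) auto
 finally show "cmod ((CLINT q|P. ze q * iexp (s * (\<Sum>k\<in>I. xi k q (V k q)))) - of_real (exp (- (s\<^sup>2 * \<sigma>2 / 2))) * (CLINT q|P. ze q))
  <= lint P (%q. min 2 (2 * s\<^sup>2 * La q + s\<^sup>2 / 2 * \<bar>v q - \<sigma>2\<bar>))"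
  unfolding E e_def .
qed

end

lemma tendsto_0_le_ennreal:
 fixes f g :: "nat => ennreal"
 assumes "!!n. f n <= g n" "g ---> 0"
 shows "f ---> 0"
 by (rule tendsto_sandwich[OF _ _ tendsto_const assms(2)]) (simp_all add: assms(1))

lemma tendsto_0_le_real:
 fixes f g :: "nat => real"
 assumes "!!n. 0 <= f n" "!!n. f n <= g n" "g ---> 0"
 shows "f ---> 0"
 by (rule tendsto_sandwich[OF _ _ tendsto_const assms(3)]) (simp_all add: assms(1,2))

subsection \<open>Convergence in probability\<close>

text \<open>The probability space varies with the index, so only convergence to a constant makes
  sense here.\<close>

definition conv_prob :: "(nat => 'w measure) => (nat => 'w => real) => real => bool" where
 "conv_prob P Z a \<longleftrightarrow> (\<forall>ep>0. (%n. measure (P n) {q \<in> space (P n). ep <= \<bar>Z n q - a\<bar>}) ---> 0)"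

locale prob_seq =
 fixes P :: "nat => 'w measure"
 assumes prob: "!!n. prob_space (P n)"
begin

lemma conv_probI:
 assumes "!!ep. ep > 0 ==> (%n. measure (P n) {q \<in> space (P n). ep <= \<bar>Z n q - a\<bar>}) ---> 0"
 shows "conv_prob P Z a"
 using assms by (auto simp: conv_prob_def)

lemma conv_probD:
 "conv_prob P Z a ==> ep > 0 ==> (%n. measure (P n) {q \<in> space (P n). ep <= \<bar>Z n q - a\<bar>}) ---> 0"
 by (auto simp: conv_prob_def)

lemma conv_prob_L1:
 assumes Z[measurable]: "!!n. Z n \<in> bmf (P n)"
  and L1: "(%n. nint (P n) (%q. ennreal \<bar>Z n q - a\<bar>)) ---> 0"
 shows "conv_prob P Z a"
proof (rule conv_probI)
 fix ep :: real assume ep: "ep > 0"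
 have "emeasure (P n) {q \<in> space (P n). ep <= \<bar>Z n q - a\<bar>} <= ennreal (1 / ep) * nint (P n) (%q. ennreal \<bar>Z n q - a\<bar>)" for n
 proof -
  have "{q \<in> space (P n). ep <= \<bar>Z n q - a\<bar>} = {q \<in> space (P n). 1 <= ennreal (1 / ep) * ennreal \<bar>Z n q - a\<bar>}"
   using ep by (auto simp: field_simps simp flip: ennreal_mult)
  then show ?thesis
   using nn_integral_Markov_inequality[where u="%q. ennreal \<bar>Z n q - a\<bar>" and M="P n" and A="space (P n)" and c="ennreal (1 / ep)"]
   by simp
 qed
 moreover have "(%n. ennreal (1 / ep) * nint (P n) (%q. ennreal \<bar>Z n q - a\<bar>)) ---> ennreal (1 / ep) * 0"
  by (intro ennreal_tendsto_cmult L1) simp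
 then have "(%n. ennreal (1 / ep) * nint (P n) (%q. ennreal \<bar>Z n q - a\<bar>)) ---> 0" by simp
 ultimately have "(%n. emeasure (P n) {q \<in> space (P n). ep <= \<bar>Z n q - a\<bar>}) ---> 0"
  by (rule tendsto_0_le_ennreal)
 then show "(%n. measure (P n) {q \<in> space (P n). ep <= \<bar>Z n q - a\<bar>}) ---> 0"
  unfolding measure_def by (intro tendsto_enn2real) simp_all
qed

lemma conv_prob_const: "conv_prob P (%n q. a) a"
 by (rule conv_probI) simp

text \<open>Continuity is required at the limit point alone. Sums, products and, by feeding the same
  sequence twice, functions of one argument are all instances.\<close>

lemma conv_prob_cont2:
 assumes Z[measurable]: "!!n. Z n \<in> bmf (P n)" and W[measurable]: "!!n. W n \<in> bmf (P n)"
  and cZ: "conv_prob P Z a" and cW: "conv_prob P W b"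
  and f: "isCont (%p. f (fst p) (snd p)) (a, b)"
 shows "conv_prob P (%n q. f (Z n q) (W n q)) (f a b)"
proof (rule conv_probI)
 fix ep :: real assume ep: "ep > 0"
 from f ep obtain dl where dl: "dl > 0" and D: "!!p. dist p (a, b) < dl ==> dist (f (fst p) (snd p)) (f a b) < ep"
  unfolding continuous_at_eps_delta by (metis fst_conv snd_conv)
 have inc: "{q \<in> space (P n). ep <= \<bar>f (Z n q) (W n q) - f a b\<bar>}
   \<subseteq> {q \<in> space (P n). dl / 2 <= \<bar>Z n q - a\<bar>} \<union> {q \<in> space (P n). dl / 2 <= \<bar>W n q - b\<bar>}" for n
 proof
  fix q assume q: "q \<in> {q \<in> space (P n). ep <= \<bar>f (Z n q) (W n q) - f a b\<bar>}"
  have "\<not> dist (Z n q, W n q) (a, b) < dl"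
   using D[of "(Z n q, W n q)"] q by (auto simp: dist_real_def)
  moreover have "dist (Z n q, W n q) (a, b) <= \<bar>Z n q - a\<bar> + \<bar>W n q - b\<bar>"
   using sqrt_sum_squares_le_sum_abs[of "Z n q - a" "W n q - b"] by (simp add: dist_Pair_Pair dist_real_def)
  ultimately show "q \<in> {q \<in> space (P n). dl / 2 <= \<bar>Z n q - a\<bar>} \<union> {q \<in> space (P n). dl / 2 <= \<bar>W n q - b\<bar>}"
   using q by auto
 qed
 have "measure (P n) {q \<in> space (P n). ep <= \<bar>f (Z n q) (W n q) - f a b\<bar>}
   <= measure (P n) {q \<in> space (P n). dl / 2 <= \<bar>Z n q - a\<bar>} + measure (P n) {q \<in> space (P n). dl / 2 <= \<bar>W n q - b\<bar>}" for n
 proof -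
  interpret prob_space "P n" by (rule prob)
  show ?thesis
   by (rule order_trans[OF finite_measure_mono[OF inc]]) (auto intro!: measure_Un_le)
 qed
 moreover have "(%n. measure (P n) {q \<in> space (P n). dl / 2 <= \<bar>Z n q - a\<bar>} + measure (P n) {q \<in> space (P n). dl / 2 <= \<bar>W n q - b\<bar>}) ---> 0 + 0"
  using dl by (intro tendsto_add conv_probD cZ cW) auto
 ultimately show "(%n. measure (P n) {q \<in> space (P n). ep <= \<bar>f (Z n q) (W n q) - f a b\<bar>}) ---> 0"
  by (intro tendsto_0_le_real[OF measure_nonneg]) simp_all
qed

lemma conv_prob_add:
 assumes "!!n. Z n \<in> bmf (P n)" "!!n. W n \<in> bmf (P n)"
  and "conv_prob P Z a" "conv_prob P W b"
 shows "conv_prob P (%n q. Z n q + W n q) (a + b)"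
 using assms by (rule conv_prob_cont2) (auto intro!: continuous_intros)

lemma conv_prob_diff:
 assumes "!!n. Z n \<in> bmf (P n)" "!!n. W n \<in> bmf (P n)"
  and "conv_prob P Z a" "conv_prob P W b"
 shows "conv_prob P (%n q. Z n q - W n q) (a - b)"
 using assms by (rule conv_prob_cont2) (auto intro!: continuous_intros)

lemma conv_prob_mult:
 assumes "!!n. Z n \<in> bmf (P n)" "!!n. W n \<in> bmf (P n)"
  and "conv_prob P Z a" "conv_prob P W b"
 shows "conv_prob P (%n q. Z n q * W n q) (a * b)"
 using assms by (rule conv_prob_cont2) (auto intro!: continuous_intros)

lemma conv_prob_sum:
 assumes "finite I" "!!n i. i \<in> I ==> Z i n \<in> bmf (P n)" "!!i. i \<in> I ==> conv_prob P (Z i) (a i)"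
 shows "conv_prob P (%n q. \<Sum>i\<in>I. Z i n q) (\<Sum>i\<in>I. a i)"
 using assms
proof (induction I rule: finite_induct)
 case empty
 then show ?case by (simp add: conv_prob_const)
next
 case (insert i I)
 have "conv_prob P (%n q. Z i n q + (\<Sum>i\<in>I. Z i n q)) (a i + (\<Sum>i\<in>I. a i))"
  using insert by (intro conv_prob_add) auto
 then show ?case using insert by simp
qed

lemma conv_prob_bound:
 assumes W[measurable]: "!!n. W n \<in> bmf (P n)" and Z[measurable]: "!!n. Z n \<in> bmf (P n)"
  and c: "conv_prob P W 0" and le: "!!n. AE q in P n. \<bar>Z n q - a\<bar> <= W n q"
 shows "conv_prob P Z a"
proof (rule conv_probI)
 fix ep :: real assume ep: "ep > 0"
 have "measure (P n) {q \<in> space (P n). ep <= \<bar>Z n q - a\<bar>} <= measure (P n) {q \<in> space (P n). ep <= \<bar>W n q - 0\<bar>}" for n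
 proof -
  interpret prob_space "P n" by (rule prob)
  show ?thesis
  proof (rule finite_measure_mono_AE)
   show "AE q in P n. q \<in> {q \<in> space (P n). ep <= \<bar>Z n q - a\<bar>} \<longrightarrow> q \<in> {q \<in> space (P n). ep <= \<bar>W n q - 0\<bar>}"
    using le[of n] by eventually_elim auto
  qed measurable
 qed
 then show "(%n. measure (P n) {q \<in> space (P n). ep <= \<bar>Z n q - a\<bar>}) ---> 0"
  by (rule tendsto_0_le_real[OF measure_nonneg _ conv_probD[OF c ep]])
qed

text \<open>Bounded convergence: off an event of vanishing probability the integrand is below r / 2,
  and on that event the cap C applies.\<close>

lemma conv_prob_integral_min:
 assumes Z[measurable]: "!!n. Z n \<in> bmf (P n)" and c: "conv_prob P Z 0" and C: "C > 0"
 shows "(%n. lint (P n) (%q. min C \<bar>Z n q\<bar>)) ---> 0"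
proof (rule LIMSEQ_I)
 fix r :: real assume r: "r > 0"
 have "(%n. C * measure (P n) {q \<in> space (P n). r / 2 <= \<bar>Z n q - 0\<bar>}) ---> C * 0"
  using r by (intro tendsto_mult tendsto_const conv_probD[OF c]) auto
 then obtain N where N: "!!n. n >= N ==> norm (C * measure (P n) {q \<in> space (P n). r / 2 <= \<bar>Z n q - 0\<bar>} - C * 0) < r / 2"
  using LIMSEQ_D[of _ _ "r / 2"] half_gt_zero[OF r] by blast
 show "\<exists>no. \<forall>n\<ge>no. norm ((lint (P n) (%q. min C \<bar>Z n q\<bar>)) - 0) < r"
 proof (intro exI allI impI)
  fix n assume n: "n >= N"
  interpret prob_space "P n" by (rule prob)
  define E where "E = {q \<in> space (P n). r / 2 <= \<bar>Z n q - 0\<bar>}"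
  have [measurable]: "E \<in> sets (P n)" unfolding E_def by measurable
  have "lint (P n) (%q. min C \<bar>Z n q\<bar>) <= lint (P n) (%q. r / 2 + C * indicator E q)"
  proof (rule integral_mono)
   show "integrable (P n) (%q. min C \<bar>Z n q\<bar>)" using C by (intro integrable_const_bound[where B=C]) auto
   show "integrable (P n) (%q. r / 2 + C * indicator E q)" by (auto simp: emeasure_eq_measure)
   show "min C \<bar>Z n q\<bar> <= r / 2 + C * indicator E q" if "q \<in> space (P n)" for q
    using that r C by (auto simp: E_def indicator_def)
  qed
  also have "... = r / 2 + C * measure (P n) E" by (simp add: prob_space emeasure_eq_measure)
  also have "... < r" using N[OF n] C by (simp add: E_def)
  finally show "norm ((lint (P n) (%q. min C \<bar>Z n q\<bar>)) - 0) < r"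
   using C by (simp add: integral_nonneg_AE)
 qed
qed

end

lemma measure_eqI_nn_integral:
 assumes "sets M = sets N" "!!f. f \<in> bmf M ==> (nint M (%x. f x)) = nint N (%x. f x)"
 shows "M = N"
proof (rule measure_eqI[OF assms(1)])
 fix A assume A: "A \<in> sets M"
 then have "emeasure M A = nint M (%x. indicator A x)" by simp
 also have "... = nint N (%x. indicator A x)" using A by (intro assms(2)) auto
 also have "... = emeasure N A" using A assms(1) by simp
 finally show "emeasure M A = emeasure N A" .
qed

subsection \<open>Laws of path segments\<close>

text \<open>\<open>law S a t\<close> is the law of the path over \<open>{a<..t}\<close> without resampling.  It is meaningful when
 \<open>a\<close> is the start of a segment (\<open>block S a\<close>), because then the past up to \<open>a\<close> plays no role.\<close>

definition law :: "('x, 'y) pf_model => nat => nat => (nat => 'x) measure" where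
 "law S a t = density (path_space S {a<..t}) (%x. ennreal (\<Prod>u\<in>{a<..t}. prop_at S u x))"

text \<open>The density reads \<open>z\<close> only within the segment that contains
  \<open>Suc n\<close>, so one and the same kernel serves paths from time 0 and paths that begin at
  a segment boundary.\<close>

definition next_law :: "('x, 'y) pf_model => nat => (nat => 'x) => 'x measure" where
 "next_law S n z = density (state_meas S) (%x. ennreal (prop_at S (Suc n) (z(Suc n := x))))"

definition weight_prod :: "('x, 'y) pf_model => nat => nat => (nat => 'x) => real" where
 "weight_prod S a t x = (\<Prod>u\<in>{a<..t}. weight_at S u x)"

text \<open>Unifies \<open>hfun\<close> (a = 0) and \<open>hfun_seg\<close> (a the start of a
  segment).\<close>

definition hrel :: "('x, 'y) pf_model => nat => nat => (nat => 'x) => real" where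
 "hrel S a t x = (eta S t / eta S a) / weight_prod S a t x"

definition block :: "('x, 'y) pf_model => nat => bool" where
 "block S a \<longleftrightarrow> (\<exists>j. a = j * seg_len S)"

lemma greaterThanAtMost_Suc: "a <= n ==> {a<..Suc n} = insert (Suc n) {a<..n}"
 by auto

context pf_setting
begin

abbreviation "nu == state_meas S"
abbreviation "U == horizon S"
abbreviation "PP == path_space S"
abbreviation (input) "bp a t == bmf (PP {a<..t})"
abbreviation (input) "sp a t == space (PP {a<..t})"
abbreviation (input) "nl == next_law S"
abbreviation (input) "lw == law S"
abbreviation (input) "hr == hrel S"

lemma PSF: "product_sigma_finite (%_. nu)"
 unfolding product_sigma_finite_def using sigma_finite by simp

lemma block_0[simp]: "block S 0" by (auto simp: block_def)

text \<open>Segments are consecutive, so the one containing \<open>u\<close> cannot begin before an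
  earlier boundary. Consequently proposals and weights after a boundary are functions of the path
  beyond it, which makes \<open>law\<close> from \<open>a\<close> on well behaved.\<close>

lemma seg_start_filter_ge: "block S a ==> a < u ==> a <= seg_start S (filter_of S u)"
proof -
 assume "block S a" "a < u"
 then obtain j where a: "a = j * seg_len S" unfolding block_def by blast
 with \<open>a < u\<close> have "j * seg_len S <= u - 1" by simp
 then have "j <= (u - 1) div seg_len S" using seg_len_pos by (simp add: less_eq_div_iff_mult_less_eq)
 then show ?thesis using a by (simp add: seg_start_def filter_of_def)
qed

lemma filter_of_eq: "j * seg_len S < u ==> u <= Suc j * seg_len S ==> filter_of S u = Suc j"
proof -
 assume u: "j * seg_len S < u" "u <= Suc j * seg_len S"
 have "(u - 1) div seg_len S = j"
  using u seg_len_pos by (intro div_nat_eqI) (auto simp: algebra_simps)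
 then show ?thesis by (simp add: filter_of_def)
qed

lemma update_in_PP:
 assumes "z \<in> sp a n" "x \<in> space nu" "a <= n"
 shows "z(Suc n := x) \<in> sp a (Suc n)"
 using assms unfolding path_space_def space_PiM greaterThanAtMost_Suc[OF assms(3)] by (intro PiE_fun_upd) auto

lemma measurable_update[measurable]:
 assumes "a <= n"
 shows "(%(z, x). z(Suc n := x)) \<in> measurable (PP {a<..n} >< nu) (PP {a<..Suc n})"
 unfolding path_space_def greaterThanAtMost_Suc[OF assms] by (rule measurable_add_dim)

lemma measurable_comp_update:
 assumes "a <= n" "f \<in> measurable (PP {a<..Suc n}) N"
 shows "(%(z, x). f (z(Suc n := x))) \<in> measurable (PP {a<..n} >< nu) N"
proof -
 have "(%(z, x). f (z(Suc n := x))) = (%p. f ((%(z, x). z(Suc n := x)) p))" by auto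
 then show ?thesis by (simp only: mcomp[OF measurable_update[OF assms(1)] assms(2)])
qed

lemma restrict_measurable: "B \<subseteq> A ==> (%x. restrict x B) \<in> measurable (PP A) (PP B)"
 unfolding path_space_def by (rule measurable_restrict_subset)

lemma prop_at_update: "prop_at S (Suc n) (z(Suc n := x)) = prop_dens S (Suc n) (restrict z {seg_start S (filter_of S (Suc n))<..<Suc n}) x"
proof -
 have "restrict (z(Suc n := x)) {seg_start S (filter_of S (Suc n))<..<Suc n} = restrict z {seg_start S (filter_of S (Suc n))<..<Suc n}"
  by (auto simp: restrict_def)
 then show ?thesis by (simp add: prop_at_def)
qed

lemma prop_at_measurable:
 assumes a: "block S a" "a < t" and t: "t <= b" "b <= U"
 shows "prop_at S t \<in> bp a b"
proof -
 let ?B = "{seg_start S (filter_of S t)<..<t}"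
 have B: "?B \<subseteq> {a<..b}" using seg_start_filter_ge[OF a] t by auto
 have m: "(%x. (restrict x ?B, x t)) \<in> measurable (PP {a<..b}) (PP ?B >< nu)"
  using restrict_measurable[OF B] a t by (intro measurable_Pair) (auto simp: path_space_def)
 have "t \<in> {1..U}" using a t by auto
 from mcomp[OF m prop_measurable[OF this]] show ?thesis by (simp add: prop_at_def[abs_def])
qed

lemma prop_at_nonneg:
 assumes a: "block S a" "a < t" and t: "t <= b" "b <= U" and x: "x \<in> sp a b"
 shows "prop_at S t x >= 0"
proof -
 let ?B = "{seg_start S (filter_of S t)<..<t}"
 have B: "?B \<subseteq> {a<..b}" using seg_start_filter_ge[OF a] t by auto
 have "restrict x ?B \<in> space (PP ?B)" using measurable_space[OF restrict_measurable[OF B] x] .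
 moreover have "x t \<in> space nu" using x a t by (auto simp: path_space_def space_PiM)
 ultimately show ?thesis unfolding prop_at_def using a t by (intro prop_nonneg) auto
qed

lemma next_dens_measurable:
 assumes a: "block S a" "a <= n" "n < U"
 shows "(%(z, x). prop_at S (Suc n) (z(Suc n := x))) \<in> bmf (PP {a<..n} >< nu)"
proof -
 have "prop_at S (Suc n) \<in> bp a (Suc n)"
  using a by (intro prop_at_measurable) auto
 from mcomp[OF measurable_update[OF a(2)] this] show ?thesis by (simp add: split_beta')
qed

lemma next_dens_nonneg:
 assumes "block S a" "a <= n" "n < U" "z \<in> sp a n" "x \<in> space nu"
 shows "prop_at S (Suc n) (z(Suc n := x)) >= 0"
 using assms by (intro prop_at_nonneg[of a "Suc n" "Suc n"] update_in_PP) auto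

lemma next_dens_prob:
 assumes a: "block S a" "a <= n" "n < U" and z: "z \<in> sp a n"
 shows "nint nu (%x. ennreal (prop_at S (Suc n) (z(Suc n := x)))) = 1"
proof -
 let ?B = "{seg_start S (filter_of S (Suc n))<..<Suc n}"
 have B: "?B \<subseteq> {a<..n}" using seg_start_filter_ge[of a "Suc n"] a by auto
 have "restrict z ?B \<in> space (PP ?B)" using measurable_space[OF restrict_measurable[OF B] z] .
 then show ?thesis unfolding prop_at_update using a by (intro prop_density) auto
qed

lemma next_dens_measurable1:
 assumes "block S a" "a <= n" "n < U" "z \<in> sp a n"
 shows "(%x. prop_at S (Suc n) (z(Suc n := x))) \<in> bmf nu"
 using mcomp[OF measurable_Pair1' next_dens_measurable[OF assms(1-3)], of z] assms by simp

lemma sets_next_law[simp, measurable_cong]: "sets (nl n z) = sets nu"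
 by (simp add: next_law_def)

lemma space_next_law[simp]: "space (nl n z) = space nu"
 by (simp add: next_law_def)

lemma prob_next_law:
 assumes "block S a" "a <= n" "n < U" "z \<in> sp a n"
 shows "prob_space (nl n z)"
proof (rule prob_spaceI)
 note [measurable] = next_dens_measurable1[OF assms]
 have "emeasure (nl n z) (space nu) = nint nu (%x. ennreal (prop_at S (Suc n) (z(Suc n := x))))"
  unfolding next_law_def by (subst emeasure_density) (auto intro!: nn_integral_cong)
 then show "emeasure (nl n z) (space (nl n z)) = 1" using next_dens_prob[OF assms] by simp
qed

lemma nn_next_law:
 assumes "block S a" "a <= n" "n < U" "z \<in> sp a n" "f \<in> bmf nu"
 shows "nint (nl n z) (%x. f x) = nint nu (%x. ennreal (prop_at S (Suc n) (z(Suc n := x))) * f x)"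
 unfolding next_law_def using next_dens_measurable1[OF assms(1-4)] assms(5) by (subst nn_integral_density) auto

lemma int_next_law:
 fixes f :: "'x => real"
 assumes "block S a" "a <= n" "n < U" "z \<in> sp a n" "f \<in> bmf nu"
 shows "lint (nl n z) (%x. f x) = lint nu (%x. prop_at S (Suc n) (z(Suc n := x)) * f x)"
  and "integrable (nl n z) f \<longleftrightarrow> integrable nu (%x. prop_at S (Suc n) (z(Suc n := x)) * f x)"
proof -
 have 2: "AE x in nu. 0 <= prop_at S (Suc n) (z(Suc n := x))" using next_dens_nonneg[OF assms(1-4)] by (intro AE_I2) auto
 note 1 = next_dens_measurable1[OF assms(1-4)]
 show "lint (nl n z) (%x. f x) = lint nu (%x. prop_at S (Suc n) (z(Suc n := x)) * f x)"
  unfolding next_law_def using integral_density[OF assms(5) 1 2] by simp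
 show "integrable (nl n z) f \<longleftrightarrow> integrable nu (%x. prop_at S (Suc n) (z(Suc n := x)) * f x)"
  unfolding next_law_def using integrable_density[OF assms(5) 1 2] by simp
qed

lemma nn_next_law_measurable:
 assumes a: "block S a" "a <= n" "n < U" and f[measurable]: "f \<in> bmf (PP {a<..n} >< nu)"
 shows "(%z. nint (nl n z) (%x. f (z, x))) \<in> bp a n"
proof -
 interpret nu: sigma_finite_measure nu by (rule sigma_finite)
 note [measurable] = next_dens_measurable[OF a]
 have "(%z. nint nu (%x. ennreal (prop_at S (Suc n) (z(Suc n := x))) * f (z, x))) \<in> bp a n"
  by (intro nu.borel_measurable_nn_integral) (simp add: split_beta')
 then show ?thesis
  by (rule measurable_cong[THEN iffD2, rotated]) (use mcomp[OF measurable_Pair1' f] in \<open>auto simp: nn_next_law[OF a]\<close>)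
qed

lemma int_next_law_measurable:
 fixes f :: "(nat => 'x) \<times> 'x => real"
 assumes a: "block S a" "a <= n" "n < U" and f[measurable]: "f \<in> bmf (PP {a<..n} >< nu)"
 shows "(%z. lint (nl n z) (%x. f (z, x))) \<in> bp a n"
proof -
 interpret nu: sigma_finite_measure nu by (rule sigma_finite)
 note [measurable] = next_dens_measurable[OF a]
 have "(%z. lint nu (%x. prop_at S (Suc n) (z(Suc n := x)) * f (z, x))) \<in> bp a n"
  by (intro nu.borel_measurable_lebesgue_integral) (simp add: split_beta')
 then show ?thesis
  by (rule measurable_cong[THEN iffD2, rotated]) (use mcomp[OF measurable_Pair1' f] in \<open>auto simp: int_next_law(1)[OF a]\<close>)
qed

lemma sets_law[simp, measurable_cong]: "sets (lw a t) = sets (PP {a<..t})"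
 by (simp add: law_def)

lemma space_law[simp]: "space (lw a t) = sp a t"
 by (simp add: law_def)

lemma measurable_law: "f \<in> measurable (PP {a<..t}) N ==> f \<in> measurable (lw a t) N"
 by (subst measurable_cong_sets[OF sets_law refl])

lemma prod_prop_measurable:
 assumes "block S a" "t <= U"
 shows "(%x. \<Prod>u\<in>{a<..t}. prop_at S u x) \<in> bp a t"
 using assms by (intro borel_measurable_prod prop_at_measurable) auto

lemma nn_law_Suc:
 assumes a: "block S a" "a <= n" "n < U" and f[measurable]: "f \<in> bp a (Suc n)"
 shows "nint (lw a (Suc n)) (%x. f x) = nint (lw a n) (%z. nint (nl n z) (%x. f (z(Suc n := x))))"
proof -
 interpret product_sigma_finite "%_. nu" by (rule PSF)
 let ?p = "%n x. \<Prod>u\<in>{a<..n}. prop_at S u x"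
 have pm[measurable]: "?p (Suc n) \<in> bp a (Suc n)" "?p n \<in> bp a n"
  using a by (auto intro!: prod_prop_measurable)
 have fu: "(%x. f (z(Suc n := x))) \<in> bmf nu" if "z \<in> sp a n" for z
  using mcomp[OF measurable_Pair1' mcomp[OF measurable_update[OF a(2)] f], of z] that by simp
 \<comment> \<open>The earlier factors do not look at the coordinate \<open>Suc n\<close>; the last
   factor is the density of the kernel.\<close>
 have split: "?p (Suc n) (z(Suc n := x)) = prop_at S (Suc n) (z(Suc n := x)) * ?p n z" for z x
 proof -
  have "prop_at S u (z(Suc n := x)) = prop_at S u z" if "u \<in> {a<..n}" for u
  proof -
   have "restrict (z(Suc n := x)) {seg_start S (filter_of S u)<..<u} = restrict z {seg_start S (filter_of S u)<..<u}"
    using that by (auto simp: restrict_def)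
   then show ?thesis using that by (simp add: prop_at_def)
  qed
  then show ?thesis using a by (simp add: greaterThanAtMost_Suc)
 qed
 have "nint (lw a (Suc n)) (%x. f x) = nint (PP {a<..Suc n}) (%x. ennreal (?p (Suc n) x) * f x)"
  unfolding law_def by (subst nn_integral_density) auto
 also have "... = nint (PP {a<..n}) (%z. nint nu (%x. ennreal (?p (Suc n) (z(Suc n := x))) * f (z(Suc n := x))))"
  unfolding path_space_def greaterThanAtMost_Suc[OF a(2)]
  by (rule product_nn_integral_insert) (use pm(1) f in \<open>auto simp: path_space_def greaterThanAtMost_Suc[OF a(2)]\<close>)
 also have "... = nint (PP {a<..n}) (%z. ennreal (?p n z) * nint (nl n z) (%x. f (z(Suc n := x))))"
 proof (rule nn_integral_cong)
  fix z assume z: "z \<in> sp a n"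
  have p0: "?p n z >= 0" using a z by (intro prod_nonneg) (auto intro!: prop_at_nonneg)
  have "nint nu (%x. ennreal (?p (Suc n) (z(Suc n := x))) * f (z(Suc n := x)))
   = nint nu (%x. ennreal (?p n z) * (ennreal (prop_at S (Suc n) (z(Suc n := x))) * f (z(Suc n := x))))"
   unfolding split using p0 next_dens_nonneg[OF a z]
   by (intro nn_integral_cong) (auto simp: ennreal_mult mult_ac)
  also have "... = ennreal (?p n z) * nint (nl n z) (%x. f (z(Suc n := x)))"
   using fu[OF z] next_dens_measurable1[OF a z] by (subst nn_integral_cmult) (auto simp: nn_next_law[OF a z])
  finally show "nint nu (%x. ennreal (?p (Suc n) (z(Suc n := x))) * f (z(Suc n := x)))
   = ennreal (?p n z) * nint (nl n z) (%x. f (z(Suc n := x)))" .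
 qed
 also have "... = nint (lw a n) (%z. nint (nl n z) (%x. f (z(Suc n := x))))"
  unfolding law_def
  using nn_next_law_measurable[OF a, of "%(z, x). f (z(Suc n := x))"] mcomp[OF measurable_update[OF a(2)] f]
  by (subst nn_integral_density) (auto simp: split_beta')
 finally show ?thesis .
qed

lemma prob_law:
 assumes a: "block S a" and t: "a <= t" "t <= U"
 shows "prob_space (lw a t)"
 using t
proof (induction t rule: dec_induct)
 case base
 have "lw a a = PiM {} (%_. nu)" by (simp add: law_def path_space_def density_1)
 then show ?case by (auto intro!: prob_space_PiM)
next
 case (step n)
 then interpret prob_space "lw a n" by simp
 show ?case
 proof (rule prob_spaceI)
  have "emeasure (lw a (Suc n)) (space (lw a (Suc n))) = nint (lw a (Suc n)) (%x. 1)" by simp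
  also have "... = nint (lw a n) (%z. nint (nl n z) (%x. 1))"
   using a step by (subst nn_law_Suc) auto
  also have "... = nint (lw a n) (%z. 1)"
   using prob_space.emeasure_space_1[OF prob_next_law[OF a]] step by (intro nn_integral_cong) auto
  finally show "emeasure (lw a (Suc n)) (space (lw a (Suc n))) = 1" using emeasure_space_1 by simp
 qed
qed

text \<open>Writing the one-step identity as an equality of image measures gives access to Fubini
  for signed functions.\<close>

lemma law_Suc_distr:
 assumes a: "block S a" "a <= n" "n < U"
 shows "lw a (Suc n) = distr (density (lw a n >< nu) (%(z, x). ennreal (prop_at S (Suc n) (z(Suc n := x)))))
   (PP {a<..Suc n}) (%(z, x). z(Suc n := x))"
  (is "_ = distr (density ?M ?d) _ ?g")
proof (rule measure_eqI_nn_integral)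
 interpret nu: sigma_finite_measure nu by (rule sigma_finite)
 note [measurable] = next_dens_measurable[OF a]
 have g: "?g \<in> measurable (density ?M ?d) (PP {a<..Suc n})"
  using measurable_update[OF a(2)] measurable_cong_sets[OF sets_pair_measure_cong[OF sets_law refl]] by simp
 have dm: "?d \<in> bmf ?M" by measurable
 fix f :: "_ => ennreal" assume f: "f \<in> bmf (lw a (Suc n))"
 then have f'[measurable]: "f \<in> bp a (Suc n)" by simp
 have fg: "(%x. f (?g x)) \<in> bmf ?M" using mcomp[OF g f'] by simp
 have fu: "(%x. f (z(Suc n := x))) \<in> bmf nu" if "z \<in> sp a n" for z
  using mcomp[OF measurable_Pair1' mcomp[OF measurable_update[OF a(2)] f'], of z] that by simp
 have "nint (distr (density ?M ?d) (PP {a<..Suc n}) ?g) (%x. f x) = nint ?M (%x. ?d x * f (?g x))"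
  using g f' fg dm by (subst nn_integral_distr, simp, simp, subst nn_integral_density, simp_all)
 also have "... = nint (lw a n) (%z. nint nu (%x. ?d (z, x) * f (?g (z, x))))"
  using dm fg by (subst nu.nn_integral_fst[symmetric]) auto
 also have "... = nint (lw a n) (%z. nint (nl n z) (%x. f (z(Suc n := x))))"
  by (intro nn_integral_cong) (auto simp: nn_next_law[OF a] fu)
 finally show "nint (lw a (Suc n)) (%x. f x) = nint (distr (density ?M ?d) (PP {a<..Suc n}) ?g) (%x. f x)"
  using nn_law_Suc[OF a f'] by simp
qed simp

lemma int_law_Suc:
 fixes f :: "(nat => 'x) => real"
 assumes a: "block S a" "a <= n" "n < U" and f: "integrable (lw a (Suc n)) f"
 shows "AE z in lw a n. integrable (nl n z) (%x. f (z(Suc n := x)))"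
  and "integrable (lw a n) (%z. lint (nl n z) (%x. f (z(Suc n := x))))"
  and "lint (lw a (Suc n)) (%x. f x) = lint (lw a n) (%z. lint (nl n z) (%x. f (z(Suc n := x))))"
proof -
 interpret nu: sigma_finite_measure nu by (rule sigma_finite)
 interpret L: prob_space "lw a n" using a by (intro prob_law) auto
 interpret pair_sigma_finite "lw a n" nu ..
 let ?M = "lw a n >< nu" and ?g = "%(z, x). z(Suc n := x)"
 define d where "d = (%(z, x). prop_at S (Suc n) (z(Suc n := x)))"
 have dm[measurable]: "d \<in> bmf ?M" unfolding d_def using next_dens_measurable[OF a] by measurable
 have fm: "f \<in> bp a (Suc n)" using f by (simp add: measurable_cong_sets[OF sets_law refl] borel_measurable_integrable)
 have g: "?g \<in> measurable ?M (PP {a<..Suc n})"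
  using measurable_update[OF a(2)] measurable_cong_sets[OF sets_pair_measure_cong[OF sets_law refl]] by blast
 then have g': "?g \<in> measurable (density ?M (%x. ennreal (d x))) (PP {a<..Suc n})" by simp
 have L: "lw a (Suc n) = distr (density ?M (%x. ennreal (d x))) (PP {a<..Suc n}) ?g"
  unfolding law_Suc_distr[OF a] d_def by (simp add: split_beta')
 have fg[measurable]: "(%x. f (?g x)) \<in> bmf ?M" using mcomp[OF g fm] .
 have d0: "AE x in ?M. 0 <= d x" using next_dens_nonneg[OF a] by (intro AE_I2) (auto simp: d_def space_pair_measure)
 have fi: "integrable (density ?M (%x. ennreal (d x))) (%x. f (?g x))"
  using f integrable_distr_eq[OF g' fm] unfolding L by simp
 then have fi': "integrable ?M (%x. d x * f (?g x))"
  using integrable_density[OF fg dm d0] by simp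
 have fu: "(%x. f (z(Suc n := x))) \<in> bmf nu" if "z \<in> sp a n" for z
  using mcomp[OF measurable_Pair1' mcomp[OF measurable_update[OF a(2)] fm], of z] that by simp
 show "AE z in lw a n. integrable (nl n z) (%x. f (z(Suc n := x)))"
  using AE_integrable_fst'[OF fi'] AE_space
 proof eventually_elim
  case (elim z)
  then show ?case by (simp add: int_next_law(2)[OF a] fu d_def)
 qed
 have eq: "lint nu (%x. d (z, x) * f (?g (z, x))) = lint (nl n z) (%x. f (z(Suc n := x)))" if "z \<in> space (lw a n)" for z
  using that by (simp add: int_next_law(1)[OF a] fu d_def)
 show "integrable (lw a n) (%z. lint (nl n z) (%x. f (z(Suc n := x))))"
  using integrable_fst'[OF fi'] by (subst (asm) Bochner_Integration.integrable_cong[OF refl eq]) auto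
 have "lint (lw a (Suc n)) (%x. f x) = lint (density ?M (%x. ennreal (d x))) (%x. f (?g x))"
  unfolding L by (rule integral_distr[OF g' fm])
 also have "... = lint ?M (%x. d x * f (?g x))"
  using integral_density[OF fg dm d0] by simp
 also have "... = lint (lw a n) (%z. lint nu (%x. d (z, x) * f (?g (z, x))))"
  by (rule integral_fst'[OF fi', symmetric])
 also have "... = lint (lw a n) (%z. lint (nl n z) (%x. f (z(Suc n := x))))"
  by (rule Bochner_Integration.integral_cong[OF refl eq])
 finally show "lint (lw a (Suc n)) (%x. f x) = lint (lw a n) (%z. lint (nl n z) (%x. f (z(Suc n := x))))" .
qed

abbreviation "glue a t == merge {0<..a} {a<..t}"

lemma measurable_glue: "a <= t ==> glue a t \<in> measurable (PP {0<..a} >< PP {a<..t}) (PP {0<..t})"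
 using measurable_merge[of "{0<..a}" "{a<..t}" "%_. nu"] by (simp add: path_space_def ivl_disj_un)

lemma glue_in_PP: "a <= t ==> z \<in> sp 0 a ==> y \<in> sp a t ==> glue a t (z, y) \<in> sp 0 t"
 using measurable_space[OF measurable_glue, of a t "(z, y)"] by (simp add: space_pair_measure)

lemma glue_update: "a <= n ==> glue a (Suc n) (z, y(Suc n := x)) = (glue a n (z, y))(Suc n := x)"
 by (auto simp: merge_def fun_eq_iff)

lemma next_law_glue:
 assumes "block S a" "a <= n"
 shows "nl n (glue a n (z, y)) = nl n y"
proof -
 have "restrict (glue a n (z, y)) {seg_start S (filter_of S (Suc n))<..<Suc n} = restrict y {seg_start S (filter_of S (Suc n))<..<Suc n}"
  using seg_start_filter_ge[OF assms(1), of "Suc n"] assms(2) by (auto simp: restrict_def merge_def fun_eq_iff)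
 then show ?thesis unfolding next_law_def prop_at_update by simp
qed

lemma law_refl: "lw a a = PiM {} (%_. nu)"
 by (simp add: law_def path_space_def density_1)

lemma nn_law_refl: "nint (lw a a) (%x. f x) = f (%_. undefined)"
 unfolding law_refl using product_sigma_finite.nn_integral_empty[OF PSF] by simp

text \<open>Distinct segments are independent without resampling: beyond the boundary
  \<open>a\<close> the transition kernel ignores the part \<open>z\<close> of the path, so each step
  of the induction acts on \<open>y\<close> alone.\<close>

lemma nn_law_glue:
 assumes a: "block S a" and t: "a <= t" "t <= U" and f: "f \<in> bp 0 t"
 shows "nint (lw 0 t) (%x. f x) = nint (lw 0 a) (%z. nint (lw a t) (%y. f (glue a t (z, y))))"
 using t f
proof (induction t arbitrary: f rule: dec_induct)
 case base
 have "glue a a (z, %_. undefined) = z" if "z \<in> sp 0 a" for z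
  using that by (auto simp: merge_def path_space_def space_PiM PiE_def extensional_def fun_eq_iff)
 then show ?case by (intro nn_integral_cong) (simp add: nn_law_refl)
next
 case (step n)
 have a0: "block S 0" "0 <= n" "n < U" using step by auto
 have an: "block S a" "a <= n" "n < U" using a step by auto
 let ?g = "%w. nint (nl n w) (%x. f (w(Suc n := x)))"
 have g: "?g \<in> bp 0 n"
  using nn_next_law_measurable[OF a0 measurable_comp_update[OF a0(2) step.prems(2)]] by (simp only: split_conv)
 have "nint (lw 0 (Suc n)) (%x. f x) = nint (lw 0 n) (%w. ?g w)"
  by (rule nn_law_Suc[OF a0 step.prems(2)])
 also have "... = nint (lw 0 a) (%z. nint (lw a n) (%y. ?g (glue a n (z, y))))"
  using an by (intro step.IH g) auto
 also have "... = nint (lw 0 a) (%z. nint (lw a (Suc n)) (%y. f (glue a (Suc n) (z, y))))"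
 proof (rule nn_integral_cong)
  fix z assume z: "z \<in> space (lw 0 a)"
  have "(%y. f (glue a (Suc n) (z, y))) \<in> bp a (Suc n)"
   using z an mcomp[OF measurable_Pair1' mcomp[OF measurable_glue step.prems(2)], of z a] by simp
  then have "nint (lw a (Suc n)) (%y. f (glue a (Suc n) (z, y))) = nint (lw a n) (%y. nint (nl n y) (%x. f (glue a (Suc n) (z, y(Suc n := x)))))"
   by (rule nn_law_Suc[OF an])
  then show "nint (lw a n) (%y. ?g (glue a n (z, y))) = nint (lw a (Suc n)) (%y. f (glue a (Suc n) (z, y)))"
   using an by (simp add: glue_update next_law_glue)
 qed
 finally show ?case .
qed

lemma sets_law_pair: "sets (lw 0 a >< lw a t) = sets (PP {0<..a} >< PP {a<..t})"
 by (rule sets_pair_measure_cong) simp_all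

lemma law_glue_distr:
 assumes a: "block S a" and t: "a <= t" "t <= U"
 shows "lw 0 t = distr (lw 0 a >< lw a t) (PP {0<..t}) (glue a t)"
proof (rule measure_eqI_nn_integral)
 interpret A: prob_space "lw a t" using assms by (intro prob_law)
 have g: "glue a t \<in> measurable (lw 0 a >< lw a t) (PP {0<..t})"
  using measurable_glue[OF t(1)] measurable_cong_sets[OF sets_law_pair refl] by blast
 fix f :: "_ => ennreal" assume "f \<in> bmf (lw 0 t)"
 then have f: "f \<in> bp 0 t" by simp
 have "nint (distr (lw 0 a >< lw a t) (PP {0<..t}) (glue a t)) (%x. f x) = nint (lw 0 a >< lw a t) (%x. f (glue a t x))"
  using g f by (subst nn_integral_distr) auto
 also have "... = nint (lw 0 a) (%z. nint (lw a t) (%y. f (glue a t (z, y))))"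
  using mcomp[OF g f] by (subst A.nn_integral_fst[symmetric]) auto
 finally show "nint (lw 0 t) (%x. f x) = nint (distr (lw 0 a >< lw a t) (PP {0<..t}) (glue a t)) (%x. f x)"
  using nn_law_glue[OF assms f] by simp
qed simp

lemma int_law_glue:
 fixes f :: "(nat => 'x) => real"
 assumes a: "block S a" and t: "a <= t" "t <= U" and f: "integrable (lw 0 t) f"
 shows "integrable (lw 0 a >< lw a t) (%x. f (glue a t x))"
  and "lint (lw 0 t) (%x. f x) = lint (lw 0 a >< lw a t) (%x. f (glue a t x))"
proof -
 have g: "glue a t \<in> measurable (lw 0 a >< lw a t) (PP {0<..t})"
  using measurable_glue[OF t(1)] measurable_cong_sets[OF sets_law_pair refl] by blast
 have fm: "f \<in> bp 0 t" using f by (simp add: measurable_cong_sets[OF sets_law refl] borel_measurable_integrable)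
 show "integrable (lw 0 a >< lw a t) (%x. f (glue a t x))"
  using f integrable_distr_eq[OF g fm] unfolding law_glue_distr[OF a t] by simp
 show "lint (lw 0 t) (%x. f x) = lint (lw 0 a >< lw a t) (%x. f (glue a t x))"
  unfolding law_glue_distr[OF a t] by (rule integral_distr[OF g fm])
qed

lemma restrict_PP_id: "x \<in> space (PP A) ==> restrict x A = x"
 by (auto simp: path_space_def space_PiM PiE_def extensional_restrict)

lemma nn_law_restrict:
 assumes a: "block S a" and ut: "a <= u" "u <= t" "t <= U" and f: "f \<in> bp a u"
 shows "nint (lw a t) (%x. f (restrict x {a<..u})) = nint (lw a u) (%x. f x)"
 using ut(2,3)
proof (induction t rule: dec_induct)
 case base
 show ?case by (intro nn_integral_cong) (simp add: restrict_PP_id)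
next
 case (step n)
 have an: "block S a" "a <= n" "n < U" using a ut step by auto
 have "(%x. f (restrict x {a<..u})) \<in> bp a (Suc n)"
  using step by (intro mcomp[OF restrict_measurable f]) auto
 then have "nint (lw a (Suc n)) (%x. f (restrict x {a<..u})) = nint (lw a n) (%z. nint (nl n z) (%x. f (restrict (z(Suc n := x)) {a<..u})))"
  by (rule nn_law_Suc[OF an])
 also have "... = nint (lw a n) (%z. f (restrict z {a<..u}))"
 proof (rule nn_integral_cong)
  fix z assume z: "z \<in> space (lw a n)"
  have "restrict (z(Suc n := x)) {a<..u} = restrict z {a<..u}" for x using step by (auto simp: restrict_def)
  then show "nint (nl n z) (%x. f (restrict (z(Suc n := x)) {a<..u})) = f (restrict z {a<..u})"
   using prob_space.emeasure_space_1[OF prob_next_law[OF an, of z]] z by simp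
 qed
 also have "... = nint (lw a u) (%x. f x)" using step by (intro step.IH) auto
 finally show ?case .
qed

lemma restrict_glue: "y \<in> sp a t ==> restrict (glue a t (z, y)) {a<..t} = y"
 by (auto simp: merge_def restrict_def path_space_def space_PiM PiE_def extensional_def fun_eq_iff)

text \<open>Times after \<open>t\<close> integrate to one because the kernels are probability
  measures; times up to \<open>a\<close> integrate to one because the remaining function of the path
  does not see them.\<close>

lemma law_restrict_block:
 assumes a: "block S a" and t: "a <= t" "t <= u" "u <= U"
 shows "distr (lw 0 u) (PP {a<..t}) (%x. restrict x {a<..t}) = lw a t"
proof (rule measure_eqI_nn_integral)
 interpret A: prob_space "lw 0 a" using assms by (intro prob_law) auto
 have r: "(%x. restrict x {a<..t}) \<in> measurable (lw 0 u) (PP {a<..t})"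
  using t by (intro measurable_law restrict_measurable) auto
 have rt: "(%x. restrict x {a<..t}) \<in> measurable (PP {0<..t}) (PP {a<..t})"
  by (intro restrict_measurable) auto
 fix f :: "_ => ennreal" assume "f \<in> bmf (distr (lw 0 u) (PP {a<..t}) (%x. restrict x {a<..t}))"
 then have f: "f \<in> bp a t" by simp
 have "nint (distr (lw 0 u) (PP {a<..t}) (%x. restrict x {a<..t})) (%x. f x) = nint (lw 0 u) (%x. f (restrict x {a<..t}))"
  using r f by (subst nn_integral_distr) auto
 also have "... = nint (lw 0 u) (%x. f (restrict (restrict x {0<..t}) {a<..t}))"
 proof -
  have "{0<..t} \<inter> {a<..t} = {a<..t}" by auto
  then show ?thesis by simp
 qed
 also have "... = nint (lw 0 t) (%x. f (restrict x {a<..t}))"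
  using t mcomp[OF rt f] by (intro nn_law_restrict) auto
 also have "... = nint (lw 0 a) (%z. nint (lw a t) (%y. f (restrict (glue a t (z, y)) {a<..t})))"
  using mcomp[OF rt f] t a by (intro nn_law_glue) auto
 also have "... = nint (lw 0 a) (%z. nint (lw a t) (%y. f y))"
  by (intro nn_integral_cong) (simp add: restrict_glue restrict_PP_id)
 also have "... = nint (lw a t) (%y. f y)" using A.emeasure_space_1 by simp
 finally show "nint (distr (lw 0 u) (PP {a<..t}) (%x. restrict x {a<..t})) (%x. f x) = nint (lw a t) (%x. f x)" .
qed simp

lemma atLeast1: "{1..n} = {0<..n::nat}" by auto

lemma prop_law_eq: "prop_law S = lw 0 U"
 by (simp add: prop_law_def law_def prop_path_dens_def atLeast1[unfolded One_nat_def] atLeast1)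

subsection \<open>Resampling weights\<close>

lemma weight_at_measurable:
 assumes a: "block S a" "a < t" and t: "t <= b" "b <= U"
 shows "weight_at S t \<in> bp a b"
proof -
 let ?B = "{seg_start S (filter_of S t)<..t}"
 have B: "?B \<subseteq> {a<..b}" using seg_start_filter_ge[OF a] t by auto
 have "t \<in> {1..U}" using a t by auto
 then show ?thesis
  unfolding weight_at_def using mcomp[OF restrict_measurable[OF B] weight_measurable] by simp
qed

lemma weight_at_pos:
 assumes a: "block S a" "a < t" and t: "t <= b" "b <= U" and x: "x \<in> sp a b"
 shows "weight_at S t x > 0"
proof -
 let ?B = "{seg_start S (filter_of S t)<..t}"
 have B: "?B \<subseteq> {a<..b}" using seg_start_filter_ge[OF a] t by auto
 have "restrict x ?B \<in> space (PP ?B)" using measurable_space[OF restrict_measurable[OF B] x] .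
 then show ?thesis unfolding weight_at_def using a t by (intro weight_pos) auto
qed

lemma weight_prod_measurable: "block S a ==> t <= b ==> b <= U ==> weight_prod S a t \<in> bp a b"
 unfolding weight_prod_def[abs_def] by (intro borel_measurable_prod weight_at_measurable) auto

lemma weight_prod_pos: "block S a ==> t <= b ==> b <= U ==> x \<in> sp a b ==> weight_prod S a t x > 0"
 unfolding weight_prod_def by (intro prod_pos weight_at_pos) auto

lemma weight_prod_refl[simp]: "weight_prod S a a x = 1"
 by (simp add: weight_prod_def)

lemma weight_at_cong:
 assumes "!!v. seg_start S (filter_of S u) < v ==> v <= u ==> x v = y v"
 shows "weight_at S u x = weight_at S u y"
proof -
 have "restrict x {seg_start S (filter_of S u)<..u} = restrict y {seg_start S (filter_of S u)<..u}"
  using assms by (auto simp: restrict_def)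
 then show ?thesis by (simp add: weight_at_def)
qed

lemma weight_prod_cong:
 assumes "block S a" "!!v. a < v ==> v <= t ==> x v = y v"
 shows "weight_prod S a t x = weight_prod S a t y"
 unfolding weight_prod_def using assms seg_start_filter_ge[OF assms(1)]
 by (intro prod.cong weight_at_cong) (auto intro!: assms(2) intro: le_less_trans)

lemma weight_prod_glue:
 assumes "block S a" "a <= t"
 shows "weight_prod S 0 t (glue a t (z, y)) = weight_prod S 0 a z * weight_prod S a t y"
proof -
 have "weight_prod S 0 t x = weight_prod S 0 a x * weight_prod S a t x" for x
  unfolding weight_prod_def using assms by (subst prod.union_disjoint[symmetric]) (auto simp: ivl_disj_un)
 moreover have "weight_prod S 0 a (glue a t (z, y)) = weight_prod S 0 a z"
  by (rule weight_prod_cong) (auto simp: merge_def)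
 moreover have "weight_prod S a t (glue a t (z, y)) = weight_prod S a t y"
  using assms by (intro weight_prod_cong) (auto simp: merge_def)
 ultimately show ?thesis by simp
qed

lemma nn_weight_prod0: "t <= U ==> (nint (lw 0 t) (%x. ennreal (weight_prod S 0 t x))) = ennreal (eta S t)"
proof -
 assume t: "t <= U"
 interpret prob_space "lw 0 U" by (rule prob_law) auto
 have m: "weight_prod S 0 t \<in> bp 0 t" by (rule weight_prod_measurable) (use t in auto)
 have m2: "weight_prod S 0 t \<in> bmf (lw 0 U)" using weight_prod_measurable[of 0 t U] t by simp
 have i: "integrable (lw 0 U) (weight_prod S 0 t)"
 \<comment> \<open>The hypothesis on \<open>eta\<close> covers times from 1 on; at time 0 the
   product is empty.\<close>
 proof (cases "t = 0")
  case True
  then have "weight_prod S 0 t = (%_. 1)" by (auto simp: fun_eq_iff)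
  then show ?thesis by simp
 next
  case False
  then show ?thesis using eta_finite[of t] t by (simp add: prop_law_eq weight_prod_def[abs_def] atLeast1[unfolded One_nat_def])
 qed
 have e: "eta S t = lint (lw 0 U) (%x. weight_prod S 0 t x)"
  by (simp add: eta_def prop_law_eq weight_prod_def atLeast1[unfolded One_nat_def])
 have "ennreal (eta S t) = nint (lw 0 U) (%x. ennreal (weight_prod S 0 t x))"
  unfolding e using i weight_prod_pos[of 0 t U] t by (intro nn_integral_eq_integral[symmetric] AE_I2) (auto intro: less_imp_le)
 also have "... = nint (lw 0 U) (%x. ennreal (weight_prod S 0 t (restrict x {0<..t})))"
  by (intro nn_integral_cong arg_cong[where f=ennreal] weight_prod_cong) auto
 also have "... = nint (lw 0 t) (%x. ennreal (weight_prod S 0 t x))"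
  using m t by (intro nn_law_restrict[where f="%x. ennreal (weight_prod S 0 t x)"]) auto
 finally show ?thesis by simp
qed

text \<open>A strictly positive function with integral zero would force the whole probability space
  to be null.\<close>

lemma eta_pos: "t <= U ==> eta S t > 0"
proof (rule ccontr)
 assume t: "t <= U" and "\<not> eta S t > 0"
 then have 0: "nint (lw 0 t) (%x. ennreal (weight_prod S 0 t x)) = 0" using nn_weight_prod0[of t] by (simp add: ennreal_neg)
 interpret prob_space "lw 0 t" using t by (intro prob_law) auto
 have m: "weight_prod S 0 t \<in> bp 0 t" by (rule weight_prod_measurable) (use t in auto)
 have "AE x in lw 0 t. ennreal (weight_prod S 0 t x) = 0"
  using 0 m by (subst (asm) nn_integral_0_iff_AE) auto
 then have "AE x in lw 0 t. False"
  using AE_space by eventually_elim (use weight_prod_pos[of 0 t t] t in force)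
 then show False by simp
qed

lemma eta_0: "eta S 0 = 1"
proof -
 interpret prob_space "lw 0 U" by (rule prob_law) auto
 show ?thesis using prob_space by (simp add: eta_def prop_law_eq)
qed

text \<open>The weight product up to \<open>t\<close> factors at the boundary, and the two parts are
  independent; dividing by \<open>eta S a\<close> isolates the part of the current segment. This is
  what gives the ratio of the etas its meaning as a mean.\<close>

lemma nn_weight_prod:
 assumes a: "block S a" and t: "a <= t" "t <= U"
 shows "nint (lw a t) (%x. ennreal (weight_prod S a t x)) = ennreal (eta S t / eta S a)"
proof -
 define X where "X = nint (lw a t) (%x. ennreal (weight_prod S a t x))"
 have m: "weight_prod S 0 t \<in> bp 0 t" by (rule weight_prod_measurable) (use t in auto)
 have ma: "weight_prod S a t \<in> bp a t" "weight_prod S 0 a \<in> bp 0 a"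
  using a t by (auto intro!: weight_prod_measurable)
 have "ennreal (eta S t) = nint (lw 0 a) (%z. nint (lw a t) (%y. ennreal (weight_prod S 0 t (glue a t (z, y)))))"
  using nn_weight_prod0[OF t(2)] nn_law_glue[OF a t, of "%x. ennreal (weight_prod S 0 t x)"] m by simp
 also have "... = nint (lw 0 a) (%z. nint (lw a t) (%y. ennreal (weight_prod S 0 a z) * ennreal (weight_prod S a t y)))"
  using weight_prod_pos[OF a, of t t] weight_prod_pos[of 0 a a] t
  by (intro nn_integral_cong) (auto simp: weight_prod_glue[OF a t(1)] ennreal_mult less_imp_le)
 also have "... = ennreal (eta S a) * X"
  using ma nn_weight_prod0[of a] t by (simp add: nn_integral_cmult nn_integral_multc X_def)
 finally have e: "ennreal (eta S t) = ennreal (eta S a) * X" .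
 have pos: "eta S a > 0" "eta S t > 0" using eta_pos t by auto
 have "X = ennreal (1 / eta S a) * (ennreal (eta S a) * X)"
  using pos by (simp flip: mult.assoc ennreal_mult)
 also have "... = ennreal (eta S t / eta S a)" unfolding e[symmetric] using pos by (simp flip: ennreal_mult)
 finally show ?thesis by (simp add: X_def)
qed

lemma hrel_measurable: "block S a ==> t <= b ==> b <= U ==> hr a t \<in> bp a b"
 unfolding hrel_def[abs_def] using weight_prod_measurable by measurable

lemma hrel_pos: "block S a ==> a <= t ==> t <= b ==> b <= U ==> x \<in> sp a b ==> hr a t x > 0"
 unfolding hrel_def by (intro divide_pos_pos eta_pos weight_prod_pos) auto

lemma hrel_refl: "a <= U ==> hr a a x = 1"
 using eta_pos[of a] by (simp add: hrel_def)

text \<open>1 / h is the weight product divided by its mean, hence a probability density. Its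
  empirical mean is the scalar shared by all history weights, whose limit is therefore 1.\<close>

lemma nn_inverse_hrel:
 assumes a: "block S a" and t: "a <= t" "t <= U"
 shows "nint (lw a t) (%x. ennreal (1 / hr a t x)) = 1"
proof -
 have pos: "eta S a > 0" "eta S t > 0" using eta_pos t by auto
 have ma: "weight_prod S a t \<in> bp a t" using a t by (auto intro!: weight_prod_measurable)
 have "nint (lw a t) (%x. ennreal (1 / hr a t x)) = nint (lw a t) (%x. ennreal (eta S a / eta S t) * ennreal (weight_prod S a t x))"
  using pos weight_prod_pos[OF a, of t t] t by (intro nn_integral_cong) (auto simp: hrel_def less_imp_le simp flip: ennreal_mult)
 also have "... = ennreal (eta S a / eta S t) * ennreal (eta S t / eta S a)"
  using ma by (simp add: nn_integral_cmult nn_weight_prod[OF assms])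
 also have "... = 1" using pos by (simp flip: ennreal_mult)
 finally show ?thesis .
qed

lemma integrable_law_meas: "integrable (lw a t) f ==> f \<in> bp a t"
 by (simp only: borel_measurable_integrable measurable_cong_sets[OF sets_law refl, symmetric])

lemma integrable_inverse_hrel:
 assumes a: "block S a" and t: "a <= t" "t <= U"
 shows "integrable (lw a t) (%z. 1 / hr a t z)" "lint (lw a t) (%z. 1 / hr a t z) = 1"
proof -
 have nn: "AE z in lw a t. 0 <= 1 / hr a t z"
  using hrel_pos[OF a t(1), of t] t by (intro AE_I2) (auto intro: less_imp_le)
 have m: "(%z. 1 / hr a t z) \<in> bmf (lw a t)"
  using hrel_measurable[OF a order_refl t(2)] by (intro measurable_law) simp
 show "integrable (lw a t) (%z. 1 / hr a t z)"
  using nn m nn_inverse_hrel[OF a t] by (intro integrableI_nonneg) auto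
 show "lint (lw a t) (%z. 1 / hr a t z) = 1"
  using integral_eq_nn_integral[OF m nn] nn_inverse_hrel[OF a t] by simp
qed

lemma block_mult: "block S (m * seg_len S)" by (auto simp: block_def)

lemma mT_le_U: "m <= n_filters S ==> m * seg_len S <= U" by (simp add: horizon_def)

lemma mT_le: "m * seg_len S <= Suc m * seg_len S" by simp

lemma hrel_glue: "block S a ==> a <= t ==> t <= U ==> hr 0 t (glue a t (z, y)) = hr 0 a z * hr a t y"
 using eta_pos[of a] eta_0 by (simp add: hrel_def weight_prod_glue)

lemma hrel_cong: "block S a ==> (!!v. a < v ==> v <= t ==> x v = y v) ==> hr a t x = hr a t y"
 unfolding hrel_def using weight_prod_cong by metis

lemma hrel_Suc:
 assumes "block S a" "a <= n" "n < U"
 shows "hr a (Suc n) (z(Suc n := x)) = hr a n z * (eta S (Suc n) / eta S n) / weight_at S (Suc n) (z(Suc n := x))"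
proof -
 have "weight_prod S a (Suc n) (z(Suc n := x)) = weight_at S (Suc n) (z(Suc n := x)) * weight_prod S a n (z(Suc n := x))"
  unfolding weight_prod_def using assms by (simp add: greaterThanAtMost_Suc)
 moreover have "weight_prod S a n (z(Suc n := x)) = weight_prod S a n z"
  using assms by (intro weight_prod_cong) auto
 ultimately show ?thesis using eta_pos[of n] assms by (simp add: hrel_def)
qed

lemma hfun_eq: "hfun S t x = hr 0 t x"
 by (simp add: hfun_def hrel_def weight_prod_def eta_0 atLeast1[unfolded One_nat_def])

lemma hfun_seg_eq: "hfun_seg S m t x = hr (seg_start S m) t x"
 by (simp add: hfun_seg_def hrel_def weight_prod_def)

end

declare One_nat_def [simp del] mult_Suc [simp del]

lemma subalgebra_vimage:
 assumes "f \<in> measurable M N"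
 shows "subalgebra M (vimage_algebra (space M) f N)"
proof -
 have "f \<in> space M \<rightarrow> space N" using measurable_space[OF assms] by auto
 then show ?thesis unfolding subalgebra_def using measurable_sets[OF assms]
  by (auto simp: sets_vimage_algebra2)
qed

subsection \<open>A single particle filter\<close>

text \<open>The recursions of the algorithm with the sample point as last argument, so that partial
  application is a random variable.\<close>

definition rpath :: "('x, 'y) pf_model => (nat => nat => 'w => 'x) => (nat => nat => 'w => nat) => nat => nat => nat => 'w => nat => 'x" where
 "rpath S X B m t k q = res_path S (%t k. X t k q) (%t k. B t k q) m t k"

definition hwt :: "('x, 'y) pf_model => nat => (nat => nat => 'w => 'x) => (nat => nat => 'w => nat) => nat => nat => nat => 'w => real" where
 "hwt S K X B m t k q = hist_weight S K (%t k. X t k q) (%t k. B t k q) m t k"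

definition nwt :: "('x, 'y) pf_model => nat => (nat => nat => 'w => 'x) => (nat => nat => 'w => nat) => nat => nat => nat => 'w => real" where
 "nwt S K X B m t k q = norm_weight S K (%t k. X t k q) (%t k. B t k q) m t k"

definition npath :: "('x, 'y) pf_model => (nat => nat => 'w => 'x) => (nat => nat => 'w => nat) => nat => nat => nat => 'w => nat => 'x" where
 "npath S X B m n k q = (rpath S X B m n k q)(Suc n := X (Suc n) k q)"

text \<open>Weighted empirical means: \<open>emp\<close> after resampling at time \<open>t\<close>, and \<open>empn\<close> between sampling
 at time \<open>n + 1\<close> and the resampling that follows.\<close>

definition emp :: "('x, 'y) pf_model => nat => (nat => nat => 'w => 'x) => (nat => nat => 'w => nat) => nat => nat => ((nat => 'x) => real) => 'w => real" where
 "emp S K X B m t f q = (\<Sum>k\<in>{1..K}. hwt S K X B m t k q * f (rpath S X B m t k q)) / real K"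

definition empn :: "('x, 'y) pf_model => nat => (nat => nat => 'w => 'x) => (nat => nat => 'w => nat) => nat => nat => ((nat => 'x) => real) => 'w => real" where
 "empn S K X B m n f q = (\<Sum>k\<in>{1..K}. hwt S K X B m n k q * f (npath S X B m n k q)) / real K"

lemma res_path_start: "t <= seg_start S m ==> res_path S xt b m t k = (%_. undefined)"
 by (cases t) simp_all

lemma hist_weight_start: "t <= seg_start S m ==> hist_weight S K xt b m t k = 1"
 by (cases t) simp_all

locale seg_run = pf_setting S + parallel_filters S K P X B
 for S :: "('x, 'y) pf_model" and K :: nat and P :: "'w measure"
  and X :: "nat => nat => 'w => 'x" and B :: "nat => nat => 'w => nat" +
 fixes j :: nat
 assumes K_pos: "K >= 1" and j_less: "j < n_filters S"
begin

abbreviation "a == j * seg_len S"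
abbreviation "e == Suc j * seg_len S"
abbreviation "rp == rpath S X B (Suc j)"
abbreviation "np == npath S X B (Suc j)"
abbreviation "hw == hwt S K X B (Suc j)"
abbreviation "nw == nwt S K X B (Suc j)"
abbreviation "\<mu> == emp S K X B (Suc j)"
abbreviation "\<mu>n == empn S K X B (Suc j)"
abbreviation "R t == \<mu> t (%z. 1 / hr a t z)"

lemma block_a[simp]: "block S a" by (auto simp: block_def)
lemma a_less_e: "a < e" using seg_len_pos by simp
lemma e_le_U: "e <= U" unfolding horizon_def using j_less by (intro mult_le_mono1) simp
lemma seg_start_eq[simp]: "seg_start S (Suc j) = a" by (simp add: seg_start_def)
lemma seg_end_eq[simp]: "seg_end S (Suc j) = e" by (simp add: seg_end_def)
lemma m_mem: "Suc j \<in> {1..n_filters S}" using j_less by auto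
lemma filter_in_seg: "a < u ==> u <= e ==> filter_of S u = Suc j" by (rule filter_of_eq)

lemma seg_step: "a <= n ==> n < e ==> block S a \<and> a <= n \<and> n < U" using e_le_U by auto

lemma rp_a: "rp a k q = (%_. undefined)"
 by (simp add: rpath_def res_path_start)

lemma hw_a: "hw a k q = 1"
 by (simp add: hwt_def hist_weight_start)

lemma rp_Suc: "a <= n ==> rp (Suc n) k q = np n (B (Suc n) k q) q"
 by (simp add: rpath_def npath_def)

lemma hw_Suc: "a <= n ==> hw (Suc n) k q = hw n (B (Suc n) k q) q / (real K * nw (Suc n) (B (Suc n) k q) q)"
 by (simp add: hwt_def nwt_def Let_def)

text \<open>Stated for an arbitrary \<open>N\<close> because measurability of paths and weights is
  needed with respect to \<open>P\<close>, to the two pasts of a stage and to the sigma-algebras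
  generated by groups of filters.\<close>

definition coord_meas :: "'w measure => nat => bool" where
 "coord_meas N t \<longleftrightarrow> (\<forall>u\<in>{a<..t}. \<forall>k\<in>{1..K}. X u k \<in> measurable N nu \<and> B u k \<in> measurable N (count_space {1..K}))"

lemma coord_meas_mono: "coord_meas N t ==> s <= t ==> coord_meas N s"
 by (auto simp: coord_meas_def)

lemma coord_meas_P: "t <= e ==> coord_meas P t"
 using e_le_U by (auto simp: coord_meas_def intro!: sample_measurable index_measurable)

lemma rp_measurable:
 assumes "a <= t" "t <= e" "coord_meas N t" "k \<in> {1..K}"
 shows "rp t k \<in> measurable N (PP {a<..t})"
 using assms
proof (induction t arbitrary: k rule: dec_induct)
 case base
 have "rp a k = (%_. %_. undefined)" by (auto simp: rp_a fun_eq_iff)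
 then show ?case by (auto simp: path_space_def space_PiM)
next
 case (step n)
 have an: "a <= n" using step by simp
 have IH: "rp n k \<in> measurable N (PP {a<..n})" if "k \<in> {1..K}" for k
  using step that coord_meas_mono[of N "Suc n" n] by auto
 have c: "X (Suc n) k \<in> measurable N nu" "B (Suc n) k \<in> measurable N (count_space {1..K})" if "k \<in> {1..K}" for k
  using step that by (auto simp: coord_meas_def)
 have np: "np n i \<in> measurable N (PP {a<..Suc n})" if "i \<in> {1..K}" for i
 proof -
  have "(%q. (rp n i q, X (Suc n) i q)) \<in> measurable N (PP {a<..n} >< nu)"
   using IH[OF that] c[OF that] by (intro measurable_Pair)
  from mcomp[OF this measurable_update[OF an]] show ?thesis
   by (simp add: npath_def[abs_def])
 qed
 \<comment> \<open>The ancestor index is random; measurability follows by composing the family over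
   all indices with a selector of finite range.\<close>
 have "(%q. np n (B (Suc n) k q) q) \<in> measurable N (PP {a<..Suc n})"
  by (rule measurable_compose_countable'[where f="np n" and I="{1..K}" and g="B (Suc n) k"])
   (use np c(2)[OF step.prems(3)] in auto)
 then show ?case using rp_Suc[OF an] by (simp add: fun_eq_iff cong: measurable_cong)
qed

lemma np_measurable:
 assumes "a <= n" "n < e" "coord_meas N n" "k \<in> {1..K}" "X (Suc n) k \<in> measurable N nu"
 shows "np n k \<in> measurable N (PP {a<..Suc n})"
proof -
 have "(%q. (rp n k q, X (Suc n) k q)) \<in> measurable N (PP {a<..n} >< nu)"
  using assms by (intro measurable_Pair rp_measurable) auto
 from mcomp[OF this measurable_update[OF assms(1)]] show ?thesis
  by (simp add: npath_def[abs_def])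
qed

lemma rp_space: "a <= t ==> t <= e ==> k \<in> {1..K} ==> q \<in> space P ==> rp t k q \<in> sp a t"
 using measurable_space[OF rp_measurable[OF _ _ coord_meas_P]] by blast

lemma np_space: "a <= n ==> n < e ==> k \<in> {1..K} ==> q \<in> space P ==> np n k q \<in> sp a (Suc n)"
 using measurable_space[OF np_measurable[of n P k]] coord_meas_P[of n] coord_meas_P[of "Suc n"] by (simp add: coord_meas_def)

lemma B_space: "a < t ==> t <= e ==> k \<in> {1..K} ==> q \<in> space P ==> B t k q \<in> {1..K}"
 using measurable_space[OF index_measurable[of t k]] e_le_U by fastforce

lemma nw_eq:
 assumes n: "a <= n" "n < e" and q: "!!i. i \<in> {1..K} ==> np n i q \<in> sp a (Suc n)" and k: "k \<in> {1..K}"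
 shows "nw (Suc n) k q = weight_at S (Suc n) (np n k q) / (\<Sum>i\<in>{1..K}. weight_at S (Suc n) (np n i q))"
proof -
 have w: "res_weight S (Suc n) (np n i q) = weight_at S (Suc n) (np n i q)" if "i \<in> {1..K}" for i
  using restrict_PP_id[OF q[OF that]] filter_in_seg[of "Suc n"] n by (simp add: weight_at_def)
 have "nw (Suc n) k q = res_weight S (Suc n) (np n k q) / (\<Sum>i\<in>{1..K}. res_weight S (Suc n) (np n i q))"
  using K_pos by (simp add: nwt_def norm_weight_def new_path_def npath_def rpath_def Let_def)
 then show ?thesis using w k by simp
qed

lemma nw_measurable:
 assumes n: "a <= n" "n < e" and c: "coord_meas N n" "!!k. k \<in> {1..K} ==> X (Suc n) k \<in> measurable N nu"
  and k: "k \<in> {1..K}"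
 shows "nw (Suc n) k \<in> bmf N"
proof -
 have np: "np n i \<in> measurable N (PP {a<..Suc n})" if "i \<in> {1..K}" for i
  using assms that by (intro np_measurable) auto
 have w: "(%q. weight_at S (Suc n) (np n i q)) \<in> bmf N" if "i \<in> {1..K}" for i
  using mcomp[OF np[OF that] weight_at_measurable[of a "Suc n" "Suc n"]] n seg_step[OF n] by auto
 have "(%q. weight_at S (Suc n) (np n k q) / (\<Sum>i\<in>{1..K}. weight_at S (Suc n) (np n i q))) \<in> bmf N"
  using w k by (intro borel_measurable_divide borel_measurable_sum) auto
 then show ?thesis
  by (rule measurable_cong[THEN iffD2, rotated]) (rule nw_eq[OF n measurable_space[OF np] k])
qed

lemma hw_measurable:
 assumes "a <= t" "t <= e" "coord_meas N t" "k \<in> {1..K}"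
 shows "hw t k \<in> bmf N"
 using assms
proof (induction t arbitrary: k rule: dec_induct)
 case base
 have "hw a k = (%_. 1)" by (auto simp: hw_a fun_eq_iff)
 then show ?case by simp
next
 case (step n)
 have an: "a <= n" "n < e" using step by auto
 have IH: "hw n k \<in> bmf N" if "k \<in> {1..K}" for k
  using step that coord_meas_mono[of N "Suc n" n] by auto
 have c: "X (Suc n) k \<in> measurable N nu" "B (Suc n) k \<in> measurable N (count_space {1..K})" if "k \<in> {1..K}" for k
  using step that by (auto simp: coord_meas_def)
 have "(%q. hw n i q / (real K * nw (Suc n) i q)) \<in> bmf N" if "i \<in> {1..K}" for i
  using IH[OF that] nw_measurable[OF an coord_meas_mono[OF step.prems(2)] c(1) that] by auto
 then have "(%q. hw n (B (Suc n) k q) q / (real K * nw (Suc n) (B (Suc n) k q) q)) \<in> bmf N"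
  by (intro measurable_compose_countable'[where f="%i q. hw n i q / (real K * nw (Suc n) i q)" and I="{1..K}", OF _ c(2)[OF step.prems(3)]]) auto
 then show ?case using hw_Suc[OF an(1)] by (simp add: fun_eq_iff cong: measurable_cong)
qed

lemma emp_measurable:
 assumes "a <= t" "t <= e" "coord_meas N t" "f \<in> bp a t"
 shows "\<mu> t f \<in> bmf N"
proof -
 have "(%q. f (rp t k q)) \<in> bmf N" if "k \<in> {1..K}" for k
  by (rule mcomp[OF rp_measurable[OF assms(1-3) that] assms(4)])
 then show ?thesis unfolding emp_def[abs_def] using hw_measurable[OF assms(1-3)]
  by (intro borel_measurable_divide borel_measurable_sum borel_measurable_times) auto
qed

lemma empn_measurable:
 assumes "a <= n" "n < e" "coord_meas N n" "!!k. k \<in> {1..K} ==> X (Suc n) k \<in> measurable N nu" "f \<in> bp a (Suc n)"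
 shows "\<mu>n n f \<in> bmf N"
proof -
 have "(%q. f (np n k q)) \<in> bmf N" if "k \<in> {1..K}" for k
  by (rule mcomp[OF np_measurable[OF assms(1-3) that assms(4)[OF that]] assms(5)])
 then show ?thesis unfolding empn_def[abs_def] using hw_measurable[OF assms(1) less_imp_le[OF assms(2)] assms(3)]
  by (intro borel_measurable_divide borel_measurable_sum borel_measurable_times) auto
qed

text \<open>The weights telescope: up to one scalar factor common to all particles, the history weight
 of a particle is a function of its path alone.\<close>

lemma weights_telescope:
 assumes t: "a <= t" "t <= e" and q: "q \<in> space P"
 shows "(\<forall>k\<in>{1..K}. hw t k q = hr a t (rp t k q) * R t q) \<and> R t q > 0 \<and>
  (t < e \<longrightarrow> \<mu>n t (%z. 1 / hr a (Suc t) z) q > 0 \<and>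
   (\<forall>i\<in>{1..K}. hw t i q / (real K * nw (Suc t) i q) = hr a (Suc t) (np t i q) * \<mu>n t (%z. 1 / hr a (Suc t) z) q) \<and>
   R (Suc t) q = \<mu>n t (%z. 1 / hr a (Suc t) z) q)"
proof -
 \<comment> \<open>Averaging the weight divided by h returns the common factor, so any scalar with
   the factorization property must be \<open>R\<close>.\<close>
 have R_of: "R t q = c" if "\<forall>k\<in>{1..K}. hw t k q = hr a t (rp t k q) * c" "a <= t" "t <= e" for t c
 proof -
  have "(\<Sum>k\<in>{1..K}. hw t k q * (1 / hr a t (rp t k q))) = (\<Sum>k\<in>{1..K}. c)"
  proof (rule sum.cong[OF refl])
   fix k assume k: "k \<in> {1..K}"
   have "hr a t (rp t k q) > 0" using that e_le_U by (intro hrel_pos[of _ _ t] rp_space k q) auto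
   then show "hw t k q * (1 / hr a t (rp t k q)) = c" using that(1) k by simp
  qed
  then show ?thesis using K_pos by (simp add: emp_def)
 qed
 have step: "R t q > 0 \<and> (t < e \<longrightarrow> \<mu>n t (%z. 1 / hr a (Suc t) z) q > 0 \<and>
   (\<forall>i\<in>{1..K}. hw t i q / (real K * nw (Suc t) i q) = hr a (Suc t) (np t i q) * \<mu>n t (%z. 1 / hr a (Suc t) z) q))"
  if H: "\<forall>k\<in>{1..K}. hw t k q = hr a t (rp t k q) * R t q" and t: "a <= t" "t <= e" and Rp: "R t q > 0" for t
 proof (intro conjI impI)
  show "R t q > 0" by (rule Rp)
  assume te: "t < e"
  define w where "w i = weight_at S (Suc t) (np t i q)" for i
  define r where "r = eta S (Suc t) / eta S t"
  have nps: "np t i q \<in> sp a (Suc t)" if "i \<in> {1..K}" for i using np_space t te that q by auto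
  have w0: "w i > 0" if "i \<in> {1..K}" for i unfolding w_def using nps[OF that] t te e_le_U by (intro weight_at_pos[of a _ "Suc t"]) auto
  have r0: "r > 0" unfolding r_def using eta_pos[of t] eta_pos[of "Suc t"] te e_le_U by auto
  have h0: "hr a t (rp t i q) > 0" if "i \<in> {1..K}" for i using t that e_le_U by (intro hrel_pos[of _ _ t] rp_space q) auto
  have hS: "hr a (Suc t) (np t i q) = hr a t (rp t i q) * r / w i" if "i \<in> {1..K}" for i
   unfolding npath_def r_def w_def using seg_step[OF t(1) te] by (subst hrel_Suc) auto
  have sw: "(\<Sum>i\<in>{1..K}. w i) > 0" using K_pos w0 by (intro sum_pos) auto
  \<comment> \<open>The scalar is updated by the mean resampling weight relative to the ratio of the
    etas; the remaining dependence on the particle is absorbed into the new h.\<close>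
  have c: "\<mu>n t (%z. 1 / hr a (Suc t) z) q = R t q * (\<Sum>i\<in>{1..K}. w i) / (r * real K)"
  proof -
   have "(\<Sum>i\<in>{1..K}. hw t i q * (1 / hr a (Suc t) (np t i q))) = (\<Sum>i\<in>{1..K}. R t q / r * w i)"
   proof (rule sum.cong[OF refl])
    fix i assume i: "i \<in> {1..K}"
    show "hw t i q * (1 / hr a (Suc t) (np t i q)) = R t q / r * w i"
     unfolding hS[OF i] H[rule_format, OF i] using h0[OF i] r0 w0[OF i] by (simp add: field_simps)
   qed
   also have "... = R t q / r * (\<Sum>i\<in>{1..K}. w i)" by (rule sum_distrib_left[symmetric])
   finally show ?thesis unfolding empn_def by simp
  qed
  then show "\<mu>n t (%z. 1 / hr a (Suc t) z) q > 0" using Rp sw r0 K_pos by simp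
  show "\<forall>i\<in>{1..K}. hw t i q / (real K * nw (Suc t) i q) = hr a (Suc t) (np t i q) * \<mu>n t (%z. 1 / hr a (Suc t) z) q"
  proof
   fix i assume i: "i \<in> {1..K}"
   have nwi: "nw (Suc t) i q = w i / (\<Sum>i\<in>{1..K}. w i)" unfolding w_def using t te nps i by (intro nw_eq) auto
   then show "hw t i q / (real K * nw (Suc t) i q) = hr a (Suc t) (np t i q) * \<mu>n t (%z. 1 / hr a (Suc t) z) q"
    unfolding nwi c hS[OF i] H[rule_format, OF i] using h0[OF i] r0 w0[OF i] sw K_pos by (simp add: field_simps)
  qed
 qed
 have all: "(\<forall>k\<in>{1..K}. hw t k q = hr a t (rp t k q) * R t q) \<and> R t q > 0" if "a <= t" "t <= e" for t
  using that
 proof (induction t rule: dec_induct)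
  case base
  \<comment> \<open>At the start of the segment the weights and h are all 1.\<close>
  have "\<forall>k\<in>{1..K}. hw a k q = hr a a (rp a k q) * 1" using order_trans[OF less_imp_le[OF a_less_e] e_le_U] by (simp add: hw_a hrel_refl)
  then show ?case using R_of[of a 1] a_less_e by simp
 next
  case (step n)
  then have n: "a <= n" "n < e" and IH: "\<forall>k\<in>{1..K}. hw n k q = hr a n (rp n k q) * R n q" "R n q > 0" by auto
  note st = \<open>!!t. \<forall>k\<in>{1..K}. hw t k q = hr a t (rp t k q) * R t q ==> a <= t ==> t <= e ==> R t q > 0 ==> _\<close>[OF IH(1) n(1) less_imp_le[OF n(2)] IH(2)]
  have H': "\<forall>k\<in>{1..K}. hw (Suc n) k q = hr a (Suc n) (rp (Suc n) k q) * \<mu>n n (%z. 1 / hr a (Suc n) z) q"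
   using st n B_space[OF _ _ _ q, of "Suc n"] by (auto simp: hw_Suc rp_Suc)
  have "R (Suc n) q = \<mu>n n (%z. 1 / hr a (Suc n) z) q" by (rule R_of[OF H']) (use n in auto)
  then show ?case using H' st n by auto
 qed
 show ?thesis
 proof (intro conjI impI)
  show 1: "\<forall>k\<in>{1..K}. hw t k q = hr a t (rp t k q) * R t q" "R t q > 0" using all[OF t] by auto
  assume te: "t < e"
  note st = step[OF 1(1) t 1(2)]
  show "\<mu>n t (%z. 1 / hr a (Suc t) z) q > 0"
   "\<forall>i\<in>{1..K}. hw t i q / (real K * nw (Suc t) i q) = hr a (Suc t) (np t i q) * \<mu>n t (%z. 1 / hr a (Suc t) z) q"
   using st te by auto
  then have H': "\<forall>k\<in>{1..K}. hw (Suc t) k q = hr a (Suc t) (rp (Suc t) k q) * \<mu>n t (%z. 1 / hr a (Suc t) z) q"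
   using t te B_space[OF _ _ _ q, of "Suc t"] by (auto simp: hw_Suc rp_Suc)
  show "R (Suc t) q = \<mu>n t (%z. 1 / hr a (Suc t) z) q" by (rule R_of[OF H']) (use t te in auto)
 qed
qed

lemma hw_eq: "a <= t ==> t <= e ==> q \<in> space P ==> k \<in> {1..K} ==> hw t k q = hr a t (rp t k q) * R t q"
 using weights_telescope by blast

lemma R_pos: "a <= t ==> t <= e ==> q \<in> space P ==> R t q > 0"
 using weights_telescope by blast

lemma hw_pos: "a <= t ==> t <= e ==> q \<in> space P ==> k \<in> {1..K} ==> hw t k q > 0"
 using hw_eq R_pos hrel_pos[of a t t] rp_space e_le_U by simp

lemma R_Suc: "a <= n ==> n < e ==> q \<in> space P ==> R (Suc n) q = \<mu>n n (%z. 1 / hr a (Suc n) z) q"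
 using weights_telescope[of n] by simp

lemma hw_new: "a <= n ==> n < e ==> q \<in> space P ==> i \<in> {1..K} ==>
  hw n i q / (real K * nw (Suc n) i q) = hr a (Suc n) (np n i q) * R (Suc n) q"
proof -
 assume n: "a <= n" "n < e" and q: "q \<in> space P" and i: "i \<in> {1..K}"
 show ?thesis unfolding R_Suc[OF n q]
  using weights_telescope[OF n(1) less_imp_le[OF n(2)] q] n(2) i by blast
qed

lemma nw_nonneg_sum:
 assumes n: "a <= n" "n < e" and q: "q \<in> space P"
 shows "!!i. i \<in> {1..K} ==> nw (Suc n) i q > 0" and "(\<Sum>i\<in>{1..K}. nw (Suc n) i q) = 1"
proof -
 have nps: "np n i q \<in> sp a (Suc n)" if "i \<in> {1..K}" for i using np_space n that q by auto
 have w0: "weight_at S (Suc n) (np n i q) > 0" if "i \<in> {1..K}" for i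
  using nps[OF that] n e_le_U by (intro weight_at_pos[of a _ "Suc n"]) auto
 have sw: "(\<Sum>i\<in>{1..K}. weight_at S (Suc n) (np n i q)) > 0" using K_pos w0 by (intro sum_pos) auto
 show "nw (Suc n) i q > 0" if "i \<in> {1..K}" for i
  using nw_eq[OF n nps that] w0[OF that] sw by simp
 show "(\<Sum>i\<in>{1..K}. nw (Suc n) i q) = 1"
  using nw_eq[OF n nps] sw by (simp add: sum_divide_distrib[symmetric])
qed

text \<open>Both pasts refer to stage \<open>Suc n\<close>: \<open>pastS n\<close> is the
  information before its samples are drawn, \<open>pastR n\<close> includes these samples but not
  the resampling indices of that stage.\<close>

definition pastS :: "nat => 'w measure" where
 "pastS n = past_algebra S K P X B ({a<..<Suc n} \<times> {1..K}) ({a<..<Suc n} \<times> {1..K})"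

definition pastR :: "nat => 'w measure" where
 "pastR n = past_algebra S K P X B ({a<..Suc n} \<times> {1..K}) ({a<..<Suc n} \<times> {1..K})"

lemma past_coords:
 assumes I: "I \<subseteq> {0<..U} \<times> {1..K}" and J: "J \<subseteq> {0<..U} \<times> {1..K}"
 shows "subalgebra P (past_algebra S K P X B I J)"
  and "(t, k) \<in> I ==> X t k \<in> measurable (past_algebra S K P X B I J) nu"
  and "(t, k) \<in> J ==> B t k \<in> measurable (past_algebra S K P X B I J) (count_space {1..K})"
proof -
 let ?f = "%q. (\<lambda>(t, k)\<in>I. X t k q, \<lambda>(t, k)\<in>J. B t k q)"
 let ?N = "PiM I (%_. nu) >< PiM J (%_. count_space {1..K})"
 have f: "?f \<in> measurable P ?N"
 proof (intro measurable_Pair measurable_restrict)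
  fix i assume "i \<in> I"
  then obtain t k where i: "i = (t, k)" "t \<in> {1..U}" "k \<in> {1..K}" using I by (cases i) force
  then show "(%q. case i of (t, k) => X t k q) \<in> measurable P nu" using sample_measurable[of t k] by simp
 next
  fix i assume "i \<in> J"
  then obtain t k where i: "i = (t, k)" "t \<in> {1..U}" "k \<in> {1..K}" using J by (cases i) force
  then show "(%q. case i of (t, k) => B t k q) \<in> measurable P (count_space {1..K})" using index_measurable[of t k] by simp
 qed
 show "subalgebra P (past_algebra S K P X B I J)"
  unfolding past_algebra_def by (rule subalgebra_vimage[OF f])
 have m: "?f \<in> measurable (past_algebra S K P X B I J) ?N"
  unfolding past_algebra_def using measurable_space[OF f] by (intro measurable_vimage_algebra1) auto
 show "X t k \<in> measurable (past_algebra S K P X B I J) nu" if "(t, k) \<in> I"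
 proof -
  have "(%q. fst (?f q) (t, k)) \<in> measurable (past_algebra S K P X B I J) nu"
   using that by (intro mcomp[OF mcomp[OF m measurable_fst] measurable_component_singleton])
  then show ?thesis using that by simp
 qed
 show "B t k \<in> measurable (past_algebra S K P X B I J) (count_space {1..K})" if "(t, k) \<in> J"
 proof -
  have "(%q. snd (?f q) (t, k)) \<in> measurable (past_algebra S K P X B I J) (count_space {1..K})"
   using that by (intro mcomp[OF mcomp[OF m measurable_snd] measurable_component_singleton])
  then show ?thesis using that by simp
 qed
qed

lemma pastS_coords:
 assumes "n < e"
 shows "subalgebra P (pastS n)" "coord_meas (pastS n) n"
 unfolding pastS_def coord_meas_def using assms e_le_U by (auto intro!: past_coords)

lemma pastR_coords:
 assumes "n < e"
 shows "subalgebra P (pastR n)" "coord_meas (pastR n) n" "a <= n ==> k \<in> {1..K} ==> X (Suc n) k \<in> measurable (pastR n) nu"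
 unfolding pastR_def coord_meas_def using assms e_le_U by (auto intro!: past_coords)

definition dS :: "nat => nat => 'w => 'x => real" where
 "dS n k q v = prop_at S (Suc n) ((rp n k q)(Suc n := v))"

lemma sampling_step:
 assumes n: "a <= n" "n < e"
 shows "cond_step P (pastS n) nu {1..K} (X (Suc n)) (dS n)"
proof (intro cond_step.intro cond_step_axioms.intro)
 have nU: "n < U" using n e_le_U by simp
 show "prob_space P" by (rule prob_space_axioms)
 show "subalgebra P (pastS n)" using pastS_coords n by simp
 show "sigma_finite_measure nu" using PSF by (simp add: product_sigma_finite_def)
 show "finite {1..K}" by simp
 show "X (Suc n) k \<in> measurable P nu" if "k \<in> {1..K}" for k using that nU by (intro sample_measurable) auto
 show "(%(q, v). dS n k q v) \<in> bmf (pastS n >< nu)" if "k \<in> {1..K}" for k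
 proof -
  have rp: "rp n k \<in> measurable (pastS n) (PP {a<..n})"
   using n that pastS_coords[OF n(2)] by (intro rp_measurable) auto
  have "(%x. (rp n k (fst x), snd x)) \<in> measurable (pastS n >< nu) (PP {a<..n} >< nu)"
   by (intro measurable_Pair mcomp[OF measurable_fst rp] measurable_snd)
  from mcomp[OF this next_dens_measurable[OF _ n(1) nU]] show ?thesis
   by (simp add: dS_def split_beta')
 qed
 show "0 <= dS n k q v" if "k \<in> {1..K}" "q \<in> space P" "v \<in> space nu" for k q v
  unfolding dS_def using that n by (intro next_dens_nonneg[OF block_a n(1) nU] rp_space) auto
 show "nint nu (%v. ennreal (dS n k q v)) = 1" if "k \<in> {1..K}" "q \<in> space P" for k q
  unfolding dS_def using that n by (intro next_dens_prob[OF block_a n(1) nU] rp_space) auto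
 fix A :: "nat => 'x set" assume A: "!!k. k \<in> {1..K} ==> A k \<in> sets nu"
 have "AE q in P. real_cond_exp P (pastS n) (indicator {q \<in> space P. \<forall>k\<in>{1..K}. X (Suc n) k q \<in> A k}) q =
   (\<Prod>k\<in>{1..K}. measure (density nu (%x. ennreal (prop_dens S (Suc n) (res_path S (%t k. X t k q) (%t k. B t k q) (Suc j) (Suc n - 1) k) x))) (A k))"
  unfolding pastS_def seg_start_eq[symmetric] using n by (intro sampling[OF m_mem _ A]) auto
 then show "AE q in P. real_cond_exp P (pastS n) (indicator {q \<in> space P. \<forall>k\<in>{1..K}. X (Suc n) k q \<in> A k}) q =
   (\<Prod>k\<in>{1..K}. measure (density nu (%v. ennreal (dS n k q v))) (A k))"
  using AE_space
 proof eventually_elim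
  case (elim q)
  have "prop_dens S (Suc n) (rp n k q) x = dS n k q x" if "k \<in> {1..K}" for k x
  proof -
   \<comment> \<open>The run feeds the resampled path itself to the proposal; being extensional on
     \<open>{a<..n}\<close> it equals the restriction that \<open>prop_at\<close> uses.\<close>
   have "restrict (rp n k q) {a<..<Suc n} = rp n k q"
    using restrict_PP_id[OF rp_space[OF n(1) less_imp_le[OF n(2)] that elim(2)]]
    unfolding greaterThanLessThan_def greaterThanAtMost_def lessThan_Suc_atMost .
   then show ?thesis unfolding dS_def prop_at_update using filter_in_seg[of "Suc n"] n by simp
  qed
  then show ?case unfolding elim(1) by (intro prod.cong refl arg_cong2[where f=measure] arg_cong2[where f=density] ext) (auto simp: rpath_def)
 qed
qed

text \<open>The run prescribes conditional probabilities of single index vectors. A box is a finite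
  disjoint union of such events, conditional expectation is additive, and the sum over the box of
  the products of weights is the product of the sums.\<close>

lemma resampling_step:
 assumes n: "a <= n" "n < e"
 shows "cond_step P (pastR n) (count_space {1..K}) {1..K} (B (Suc n)) (%_ q i. nw (Suc n) i q)"
proof (intro cond_step.intro cond_step_axioms.intro)
 let ?e = "%A. {q \<in> space P. \<forall>k\<in>{1..K}. B (Suc n) k q \<in> A k}"
 have nU: "n < U" using n e_le_U by simp
 show "prob_space P" by (rule prob_space_axioms)
 show "subalgebra P (pastR n)" using pastR_coords n by simp
 show "sigma_finite_measure (count_space {1..K})" by (rule sigma_finite_measure_count_space_finite) simp
 show "finite {1..K}" by simp
 show Bm: "B (Suc n) k \<in> measurable P (count_space {1..K})" if "k \<in> {1..K}" for k using that nU by (intro index_measurable) auto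
 show "(%(q, i). nw (Suc n) i q) \<in> bmf (pastR n >< count_space {1..K})" if "k \<in> {1..K}" for k
 proof -
  have "(%x. nw (Suc n) (snd x) (fst x)) \<in> bmf (pastR n >< count_space {1..K})"
  proof (rule measurable_compose_countable'[of "{1..K}" "%i x. nw (Suc n) i (fst x)" _ _ snd])
   fix i assume "i \<in> {1..K}"
   then show "(%x. nw (Suc n) i (fst x)) \<in> bmf (pastR n >< count_space {1..K})"
    using pastR_coords[OF n(2)] n by (intro mcomp[OF measurable_fst] nw_measurable) auto
  qed auto
  then show ?thesis by (simp add: split_beta')
 qed
 show "0 <= nw (Suc n) i q" if "k \<in> {1..K}" "q \<in> space P" "i \<in> space (count_space {1..K})" for k q i
  using nw_nonneg_sum(1)[OF n that(2)] that(3) by (auto intro: less_imp_le)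
 show d1: "nint (count_space {1..K}) (%i. ennreal (nw (Suc n) i q)) = 1" if "k \<in> {1..K}" "q \<in> space P" for k q
 proof -
  have "(\<Sum>i\<in>{1..K}. ennreal (nw (Suc n) i q)) = ennreal (\<Sum>i\<in>{1..K}. nw (Suc n) i q)"
   using nw_nonneg_sum(1)[OF n that(2)] by (intro sum_ennreal) (auto intro: less_imp_le)
  then show ?thesis using nw_nonneg_sum(2)[OF n that(2)] by (subst nn_integral_count_space_finite) auto
 qed
 fix A :: "nat => nat set" assume A: "!!k. k \<in> {1..K} ==> A k \<in> sets (count_space {1..K})"
 define E where "E \<beta> = {q \<in> space P. \<forall>k\<in>{1..K}. B (Suc n) k q = \<beta> k}" for \<beta>
 define Z where "Z = Pi\<^sub>E {1..K} A"
 have Af: "finite (A k)" "A k \<subseteq> {1..K}" if "k \<in> {1..K}" for k using A[OF that] finite_subset[of "A k" "{1..K}"] by auto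
 have Zf: "finite Z" unfolding Z_def using Af by (intro finite_PiE) auto
 have Em[measurable]: "E \<beta> \<in> sets P" for \<beta>
 proof -
  have "{q \<in> space P. B (Suc n) k q = \<beta> k} \<in> sets P" if k: "k \<in> {1..K}" for k
  proof -
   have "{q \<in> space P. B (Suc n) k q = \<beta> k} = B (Suc n) k -` ({\<beta> k} \<inter> {1..K}) \<inter> space P"
    using measurable_space[OF Bm[OF k]] by fastforce
   then show ?thesis using measurable_sets[OF Bm[OF k], of "{\<beta> k} \<inter> {1..K}"] by simp
  qed
  then show ?thesis unfolding E_def by (intro sets.sets_Collect_finite_All') (use K_pos in auto)
 qed
 \<comment> \<open>Exactly one vector in the box can equal the restriction \<open>b\<close> of the
   indices at \<open>q\<close>, and it does so precisely if \<open>b\<close> lies in the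
   box.\<close>
 have ind: "indicator (?e A) q = (\<Sum>\<beta>\<in>Z. indicator (E \<beta>) q :: real)" if q: "q \<in> space P" for q
 proof -
  define b where "b = (\<lambda>k\<in>{1..K}. B (Suc n) k q)"
  have Eb: "q \<in> E \<beta> \<longleftrightarrow> \<beta> = b" if "\<beta> \<in> Z" for \<beta>
   using that q unfolding E_def Z_def b_def by (auto simp: PiE_def extensional_def fun_eq_iff)
  have "(\<Sum>\<beta>\<in>Z. indicator (E \<beta>) q :: real) = (\<Sum>\<beta>\<in>Z. if \<beta> = b then 1 else 0)"
   by (intro sum.cong) (auto simp: Eb indicator_def)
  also have "... = (if b \<in> Z then 1 else 0)" using Zf by simp
  also have "... = indicator (?e A) q"
   using q by (simp only: b_def Z_def indicator_def restrict_PiE_iff) simp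
  finally show ?thesis by simp
 qed
 interpret SF: finite_measure_subalgebra P "pastR n" by unfold_locales (use pastR_coords n in simp)
 have "AE q in P. real_cond_exp P (pastR n) (indicator (?e A)) q
   = real_cond_exp P (pastR n) (%q. \<Sum>\<beta>\<in>Z. indicator (E \<beta>) q) q"
 proof (rule SF.real_cond_exp_cong)
  show "AE q in P. indicator (?e A) q = (\<Sum>\<beta>\<in>Z. indicator (E \<beta>) q :: real)"
   using ind by (intro AE_I2)
  show m: "(%q. \<Sum>\<beta>\<in>Z. indicator (E \<beta>) q :: real) \<in> bmf P" by measurable
  show "(indicator (?e A) :: _ => real) \<in> bmf P"
   using m by (rule measurable_cong[THEN iffD2, rotated]) (rule ind)
 qed
 moreover have "AE q in P. real_cond_exp P (pastR n) (%q. \<Sum>\<beta>\<in>Z. indicator (E \<beta>) q) q = (\<Sum>\<beta>\<in>Z. real_cond_exp P (pastR n) (indicator (E \<beta>)) q)"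
  by (rule SF.real_cond_exp_sum) (simp add: emeasure_eq_measure)
 moreover have "AE q in P. \<forall>\<beta>\<in>Z. real_cond_exp P (pastR n) (indicator (E \<beta>)) q = (\<Prod>k\<in>{1..K}. nw (Suc n) (\<beta> k) q)"
 proof (rule AE_finite_allI[OF Zf])
  fix \<beta> assume "\<beta> \<in> Z"
  then have "!!k. k \<in> {1..K} ==> \<beta> k \<in> {1..K}" using Af by (fastforce simp: Z_def)
  then show "AE q in P. real_cond_exp P (pastR n) (indicator (E \<beta>)) q = (\<Prod>k\<in>{1..K}. nw (Suc n) (\<beta> k) q)"
   unfolding pastR_def E_def nwt_def seg_start_eq[symmetric] using n by (intro resampling[OF m_mem]) auto
 qed
 ultimately show "AE q in P. real_cond_exp P (pastR n) (indicator (?e A)) q =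
   (\<Prod>k\<in>{1..K}. measure (density (count_space {1..K}) (%i. ennreal (nw (Suc n) i q))) (A k))"
  using AE_space
 proof eventually_elim
  case (elim q)
  have "measure (density (count_space {1..K}) (%i. ennreal (nw (Suc n) i q))) (A k) = (\<Sum>i\<in>A k. nw (Suc n) i q)" if "k \<in> {1..K}" for k
  proof -
   have "emeasure (density (count_space {1..K}) (%i. ennreal (nw (Suc n) i q))) (A k) = nint (count_space {1..K}) (%i. ennreal (nw (Suc n) i q) * indicator (A k) i)"
    using Af[OF that] by (subst emeasure_density) auto
   also have "... = (\<Sum>i\<in>{1..K}. ennreal (nw (Suc n) i q) * indicator (A k) i)" by (simp add: nn_integral_count_space_finite)
   also have "... = (\<Sum>i\<in>A k. ennreal (nw (Suc n) i q))"
    using Af[OF that] by (intro sum.mono_neutral_cong_right) (auto simp: indicator_def)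
   also have "... = ennreal (\<Sum>i\<in>A k. nw (Suc n) i q)"
    using Af[OF that] nw_nonneg_sum(1)[OF n elim(4)] by (intro sum_ennreal) (auto intro!: less_imp_le)
   finally show ?thesis unfolding measure_def
    using Af[OF that] nw_nonneg_sum(1)[OF n elim(4)] by (simp add: sum_nonneg less_imp_le subset_iff)
  qed
  then have "(\<Prod>k\<in>{1..K}. measure (density (count_space {1..K}) (%i. ennreal (nw (Suc n) i q))) (A k)) = (\<Prod>k\<in>{1..K}. \<Sum>i\<in>A k. nw (Suc n) i q)"
   by (intro prod.cong) auto
  also have "... = (\<Sum>\<beta>\<in>Z. \<Prod>k\<in>{1..K}. nw (Suc n) (\<beta> k) q)"
   unfolding Z_def using Af by (intro prod_sum_PiE) auto
  finally show ?case using elim by simp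
 qed
qed

end

section \<open>Unbiasedness and one-step errors in mean\<close>

context seg_run
begin

text \<open>Extended nonnegative version of \<open>emp\<close>: unbiasedness can then be proved for
  all nonnegative measurable functions before any integrability is known.\<close>

definition nemp :: "nat => ((nat => 'x) => ennreal) => 'w => ennreal" where
 "nemp t f q = (\<Sum>k\<in>{1..K}. ennreal (hw t k q / real K) * f (rp t k q))"

definition nempn :: "nat => ((nat => 'x) => ennreal) => 'w => ennreal" where
 "nempn n f q = (\<Sum>k\<in>{1..K}. ennreal (hw n k q / real K) * f (np n k q))"

lemma hw_meas_P: "a <= t ==> t <= e ==> k \<in> {1..K} ==> hw t k \<in> bmf P"
 by (rule hw_measurable) (auto intro: coord_meas_P)

lemma rp_meas_P: "a <= t ==> t <= e ==> k \<in> {1..K} ==> rp t k \<in> measurable P (PP {a<..t})"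
 by (rule rp_measurable) (auto intro: coord_meas_P)

lemma np_meas_P: "a <= n ==> n < e ==> k \<in> {1..K} ==> np n k \<in> measurable P (PP {a<..Suc n})"
 using coord_meas_P[of "Suc n"] coord_meas_P[of n] by (intro np_measurable) (auto simp: coord_meas_def)

lemma emp_meas_P: "a <= t ==> t <= e ==> f \<in> bp a t ==> \<mu> t f \<in> bmf P"
 by (rule emp_measurable) (auto intro: coord_meas_P)

lemma empn_meas_P: "a <= n ==> n < e ==> f \<in> bp a (Suc n) ==> \<mu>n n f \<in> bmf P"
 using coord_meas_P[of "Suc n"] coord_meas_P[of n] by (intro empn_measurable) (auto simp: coord_meas_def)

lemma nemp_meas: "a <= t ==> t <= e ==> f \<in> bp a t ==> nemp t f \<in> bmf P"
proof -
 assume t: "a <= t" "t <= e" and f: "f \<in> bp a t"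
 have "(%q. f (rp t k q)) \<in> bmf P" if "k \<in> {1..K}" for k
  by (rule mcomp[OF rp_meas_P[OF t that] f])
 then show ?thesis unfolding nemp_def[abs_def] using hw_meas_P[OF t] by (intro borel_measurable_sum) auto
qed

lemma kp_sampling: "cond_step.kp nu (dS n) k q = nl n (rp n k q)" if "cond_step P (pastS n) nu {1..K} (X (Suc n)) (dS n)"
 unfolding cond_step.kp_def[OF that] next_law_def dS_def ..

text \<open>Given the past, the new state of particle k follows \<open>next_law\<close> at its
  current path, while its weight is already determined.\<close>

lemma nn_nempn_step:
 assumes n: "a <= n" "n < e" and f: "f \<in> bp a (Suc n)"
 shows "nint P (%q. nempn n f q) = nint P (%q. nemp n (%z. nint (nl n z) (%x. f (z(Suc n := x)))) q)"
proof -
 have nU: "n < U" using n e_le_U by simp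
 interpret C: cond_step P "pastS n" nu "{1..K}" "X (Suc n)" "dS n" by (rule sampling_step[OF n])
 have fu: "(%(z, x). f (z(Suc n := x))) \<in> bmf (PP {a<..n} >< nu)" by (rule measurable_comp_update[OF n(1) f])
 note cm = pastS_coords[OF n(2)]
 have one: "nint P (%q. ennreal (hw n k q / real K) * f (np n k q)) =
   (nint P (%q. ennreal (hw n k q / real K) * nint (nl n (rp n k q)) (%x. f ((rp n k q)(Suc n := x)))))" if k: "k \<in> {1..K}" for k
 proof -
  define g where "g = (%(q, v). ennreal (hw n k q / real K) * f ((rp n k q)(Suc n := v)))"
  have rp: "rp n k \<in> measurable (pastS n) (PP {a<..n})" using n cm(2) k by (intro rp_measurable) auto
  have h: "hw n k \<in> bmf (pastS n)" using n cm(2) k by (intro hw_measurable) auto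
  have "(%x. (rp n k (fst x), snd x)) \<in> measurable (pastS n >< nu) (PP {a<..n} >< nu)"
   by (intro measurable_Pair mcomp[OF measurable_fst rp] measurable_snd)
  from mcomp[OF this fu] have "(%x. f ((rp n k (fst x))(Suc n := snd x))) \<in> bmf (pastS n >< nu)" by (simp only: split_conv)
  then have gm: "g \<in> bmf (pastS n >< nu)"
   unfolding g_def split_beta' using mcomp[OF measurable_fst h] by (intro borel_measurable_times_ennreal mcomp[OF _ measurable_ennreal] borel_measurable_divide) auto
  have "nint P (%q. ennreal (hw n k q / real K) * f (np n k q)) = nint P (%q. g (q, X (Suc n) k q))"
   by (simp add: g_def npath_def)
  also have "... = nint P (%q. nint (C.kp k q) (%v. g (q, v)))" by (rule C.nn_joint1[OF gm k])
  also have "... = nint P (%q. ennreal (hw n k q / real K) * nint (nl n (rp n k q)) (%x. f ((rp n k q)(Suc n := x))))"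
  proof (rule nn_integral_cong)
   fix q assume q: "q \<in> space P"
   have "(%x. f ((rp n k q)(Suc n := x))) \<in> bmf nu"
    using mcomp[OF measurable_Pair1'[OF rp_space[OF n(1) _ k q]] fu] n by (simp only: split_conv less_imp_le)
   then show "nint (C.kp k q) (%v. g (q, v)) = ennreal (hw n k q / real K) * nint (nl n (rp n k q)) (%x. f ((rp n k q)(Suc n := x)))"
    unfolding kp_sampling[OF sampling_step[OF n]] g_def split_conv
    by (subst nn_integral_cmult) (auto simp: measurable_cong_sets[OF sets_next_law refl])
  qed
  finally show ?thesis .
 qed
 have m1: "(%q. ennreal (hw n k q / real K) * f (np n k q)) \<in> bmf P" if "k \<in> {1..K}" for k
  using hw_meas_P[OF n(1) _ that] mcomp[OF np_meas_P[OF n that] f] n by auto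
 have m2: "(%q. ennreal (hw n k q / real K) * nint (nl n (rp n k q)) (%x. f ((rp n k q)(Suc n := x)))) \<in> bmf P" if "k \<in> {1..K}" for k
  using hw_meas_P[OF n(1) _ that] mcomp[OF rp_meas_P[OF n(1) _ that] nn_next_law_measurable[OF block_a n(1) nU fu, unfolded split_conv]] n
  by auto
 show ?thesis unfolding nemp_def nempn_def using m1 m2 one
  by (subst (1 2) nn_integral_sum) auto
qed

text \<open>The probability \<open>nw\<close> of choosing particle i cancels against the factor 1 /
  (K nw) that its history weight acquires when it is chosen. Resampling therefore leaves the
  conditional mean unchanged.\<close>

lemma nn_nemp_Suc:
 assumes n: "a <= n" "n < e" and f: "f \<in> bp a (Suc n)"
 shows "nint P (%q. nemp (Suc n) f q) = nint P (%q. nempn n f q)"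
proof -
 let ?a = "%q. (\<Sum>i\<in>{1..K}. ennreal (hw n i q / real K / real K) * f (np n i q))"
 interpret C: cond_step P "pastR n" "count_space {1..K}" "{1..K}" "B (Suc n)" "%_ q i. nw (Suc n) i q" by (rule resampling_step[OF n])
 note cm = pastR_coords[OF n(2)]
 define g where "g = (%(q, i). ennreal (hw n i q / (real K * nw (Suc n) i q) / real K) * f (np n i q))"
 have gm: "g \<in> bmf (pastR n >< count_space {1..K})"
 proof -
  have "(%x. ennreal (hw n (snd x) (fst x) / (real K * nw (Suc n) (snd x) (fst x)) / real K) * f (np n (snd x) (fst x))) \<in> bmf (pastR n >< count_space {1..K})"
  proof (rule measurable_compose_countable'[where I="{1..K}" and g=snd and f="%i x. ennreal (hw n i (fst x) / (real K * nw (Suc n) i (fst x)) / real K) * f (np n i (fst x))"])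
   fix i assume i: "i \<in> {1..K}"
   have "np n i \<in> measurable (pastR n) (PP {a<..Suc n})" using n cm i by (intro np_measurable) auto
   then have "(%q. f (np n i q)) \<in> bmf (pastR n)" by (rule mcomp[OF _ f])
   moreover have "hw n i \<in> bmf (pastR n)" using n cm i by (intro hw_measurable) auto
   moreover have "nw (Suc n) i \<in> bmf (pastR n)" using n cm i by (intro nw_measurable) auto
   ultimately have "(%q. ennreal (hw n i q / (real K * nw (Suc n) i q) / real K) * f (np n i q)) \<in> bmf (pastR n)"
    by measurable
   then show "(%x. ennreal (hw n i (fst x) / (real K * nw (Suc n) i (fst x)) / real K) * f (np n i (fst x))) \<in> bmf (pastR n >< count_space {1..K})"
    by (rule mcomp[OF measurable_fst])
  qed auto
  then show ?thesis by (simp add: g_def split_beta')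
 qed
 have one: "nint P (%q. ennreal (hw (Suc n) k q / real K) * f (rp (Suc n) k q)) = nint P (%q. (?a q))" if k: "k \<in> {1..K}" for k
 proof -
  have "nint P (%q. ennreal (hw (Suc n) k q / real K) * f (rp (Suc n) k q)) = nint P (%q. g (q, B (Suc n) k q))"
   by (simp add: g_def hw_Suc[OF n(1)] rp_Suc[OF n(1)])
  also have "... = nint P (%q. nint (C.kp k q) (%i. g (q, i)))" by (rule C.nn_joint1[OF gm k])
  also have "... = nint P (%q. (?a q))"
  proof (rule nn_integral_cong)
   fix q assume q: "q \<in> space P"
   have "nint (C.kp k q) (%i. g (q, i)) = (\<Sum>i\<in>{1..K}. ennreal (nw (Suc n) i q) * g (q, i))"
    by (subst C.nn_kp[OF gm k q]) (simp add: nn_integral_count_space_finite)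
   also have "... = (?a q)"
   proof (rule sum.cong[OF refl])
    fix i assume i: "i \<in> {1..K}"
    have p: "nw (Suc n) i q > 0" "hw n i q > 0" using nw_nonneg_sum(1)[OF n q i] hw_pos[OF n(1) _ q i] n by auto
    have "ennreal (nw (Suc n) i q) * ennreal (hw n i q / (real K * nw (Suc n) i q) / real K) = ennreal (hw n i q / real K / real K)"
     using p K_pos by (simp add: field_simps flip: ennreal_mult)
    then show "ennreal (nw (Suc n) i q) * g (q, i) = ennreal (hw n i q / real K / real K) * f (np n i q)"
     unfolding g_def split_conv mult.assoc[symmetric] by simp
   qed
   finally show "nint (C.kp k q) (%i. g (q, i)) = (?a q)" .
  qed
  finally show ?thesis .
 qed
 have m1: "(%q. ennreal (hw (Suc n) k q / real K) * f (rp (Suc n) k q)) \<in> bmf P" if "k \<in> {1..K}" for k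
  using hw_meas_P[of "Suc n", OF _ _ that] mcomp[OF rp_meas_P[of "Suc n", OF _ _ that] f] n by auto
 have m2: "(%q. \<Sum>i\<in>{1..K}. ennreal (hw n i q / real K / real K) * f (np n i q)) \<in> bmf P"
  using hw_meas_P[of n] mcomp[OF np_meas_P[OF n] f] n by (intro borel_measurable_sum) auto
 have "nint P (%q. nemp (Suc n) f q) = (\<Sum>k\<in>{1..K}. nint P (%q. (?a q)))"
  unfolding nemp_def using m1 one by (subst nn_integral_sum) auto
 also have "... = of_nat K * nint P (%q. (?a q))" by simp
 also have "... = nint P (%q. of_nat K * (?a q))"
  using m2 by (rule nn_integral_cmult[symmetric])
 also have "... = nint P (%q. nempn n f q)"
 proof (rule nn_integral_cong)
  fix q assume q: "q \<in> space P"
  have "of_nat K * ennreal (hw n i q / real K / real K) = ennreal (hw n i q / real K)" if "i \<in> {1..K}" for i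
   using K_pos hw_pos[OF n(1) _ q that] n by (simp add: ennreal_of_nat_eq_real_of_nat flip: ennreal_mult)
  then show "of_nat K * (?a q) = nempn n f q"
   unfolding nempn_def sum_distrib_left mult.assoc[symmetric] by (intro sum.cong) auto
 qed
 finally show ?thesis .
qed

text \<open>Both halves of a stage preserve means, so the weighted empirical measure has the law
  without resampling as its mean for every number of particles. This exactness is the source of all
  later L1 bounds.\<close>

lemma nn_nemp:
 assumes t: "a <= t" "t <= e" and f: "f \<in> bp a t"
 shows "nint P (%q. nemp t f q) = nint (lw a t) (%z. f z)"
 using t f
proof (induction t arbitrary: f rule: dec_induct)
 case base
 have "nemp a f q = f (%_. undefined)" for q
 proof -
  have "nemp a f q = of_nat K * (ennreal (1 / real K) * f (%_. undefined))" by (simp add: nemp_def hw_a rp_a)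
  also have "... = (of_nat K * ennreal (1 / real K)) * f (%_. undefined)" by (simp add: mult.assoc)
  also have "of_nat K * ennreal (1 / real K) = 1" using K_pos by (simp add: ennreal_of_nat_eq_real_of_nat flip: ennreal_mult)
  finally show ?thesis by simp
 qed
 then show ?case by (simp add: nn_law_refl emeasure_space_1)
next
 case (step n)
 then have n: "a <= n" "n < e" and nU: "n < U" using e_le_U by auto
 have "nint P (%q. nemp (Suc n) f q) = nint P (%q. nemp n (%z. nint (nl n z) (%x. f (z(Suc n := x)))) q)"
  by (rule trans[OF nn_nemp_Suc[OF n step.prems(2)] nn_nempn_step[OF n step.prems(2)]])
 also have "... = nint (lw a n) (%z. nint (nl n z) (%x. f (z(Suc n := x))))"
  by (rule step.IH[OF less_imp_le[OF n(2)] nn_next_law_measurable[OF block_a n(1) nU measurable_comp_update[OF n(1) step.prems(2)], unfolded split_conv]])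
 also have "... = nint (lw a (Suc n)) (%z. f z)" by (rule nn_law_Suc[OF block_a n(1) nU step.prems(2), symmetric])
 finally show ?case .
qed

lemma nn_nempn:
 assumes n: "a <= n" "n < e" and f: "f \<in> bp a (Suc n)"
 shows "nint P (%q. nempn n f q) = nint (lw a (Suc n)) (%z. f z)"
 using nn_nemp[of "Suc n" f] nn_nemp_Suc[OF n f] n f by simp

lemma ennreal_emp:
 assumes "a <= t" "t <= e" "q \<in> space P" "!!z. z \<in> sp a t ==> f z >= 0"
 shows "ennreal (\<mu> t f q) = nemp t (%z. ennreal (f z)) q"
proof -
 have "nemp t (%z. ennreal (f z)) q = (\<Sum>k\<in>{1..K}. ennreal (hw t k q / real K * f (rp t k q)))"
  unfolding nemp_def using assms rp_space[OF assms(1,2) _ assms(3)] hw_pos[OF assms(1-3)]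
  by (intro sum.cong refl ennreal_mult[symmetric]) (auto intro: less_imp_le)
 also have "... = ennreal (\<Sum>k\<in>{1..K}. hw t k q / real K * f (rp t k q))"
  using assms rp_space[OF assms(1,2) _ assms(3)] hw_pos[OF assms(1-3)] by (intro sum_ennreal mult_nonneg_nonneg divide_nonneg_nonneg) (auto intro: less_imp_le)
 finally show ?thesis by (simp add: emp_def sum_divide_distrib)
qed

lemma ennreal_empn:
 assumes "a <= n" "n < e" "q \<in> space P" "!!z. z \<in> sp a (Suc n) ==> f z >= 0"
 shows "ennreal (\<mu>n n f q) = nempn n (%z. ennreal (f z)) q"
proof -
 have "nempn n (%z. ennreal (f z)) q = (\<Sum>k\<in>{1..K}. ennreal (hw n k q / real K * f (np n k q)))"
  unfolding nempn_def using assms np_space[OF assms(1,2) _ assms(3)] hw_pos[OF assms(1) less_imp_le[OF assms(2)] assms(3)]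
  by (intro sum.cong refl ennreal_mult[symmetric]) (auto intro: less_imp_le)
 also have "... = ennreal (\<Sum>k\<in>{1..K}. hw n k q / real K * f (np n k q))"
  using assms np_space[OF assms(1,2) _ assms(3)] hw_pos[OF assms(1) less_imp_le[OF assms(2)] assms(3)]
  by (intro sum_ennreal mult_nonneg_nonneg divide_nonneg_nonneg) (auto intro: less_imp_le)
 finally show ?thesis by (simp add: empn_def sum_divide_distrib)
qed

lemma nn_emp:
 assumes "a <= t" "t <= e" "!!z. z \<in> sp a t ==> f z >= 0" "f \<in> bp a t"
 shows "nint P (%q. ennreal (\<mu> t f q)) = nint (lw a t) (%z. ennreal (f z))"
proof -
 have "nint P (%q. ennreal (\<mu> t f q)) = nint P (%q. nemp t (%z. ennreal (f z)) q)"
  by (intro nn_integral_cong ennreal_emp assms)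
 then show ?thesis using nn_nemp[OF assms(1,2), of "%z. ennreal (f z)"] assms(4) by simp
qed

lemma nn_empn:
 assumes "a <= n" "n < e" "!!z. z \<in> sp a (Suc n) ==> f z >= 0" "f \<in> bp a (Suc n)"
 shows "nint P (%q. ennreal (\<mu>n n f q)) = nint (lw a (Suc n)) (%z. ennreal (f z))"
proof -
 have "nint P (%q. ennreal (\<mu>n n f q)) = nint P (%q. nempn n (%z. ennreal (f z)) q)"
  by (intro nn_integral_cong ennreal_empn assms)
 then show ?thesis using nn_nempn[OF assms(1,2), of "%z. ennreal (f z)"] assms(4) by simp
qed

text \<open>By unbiasedness an exceptional null set has empirical mass zero in mean, hence almost
  surely; as every particle carries positive weight, no particle lies in it.\<close>

lemma AE_rp:
 assumes t: "a <= t" "t <= e" and Q: "AE z in lw a t. Q z"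
 shows "AE q in P. \<forall>k\<in>{1..K}. Q (rp t k q)"
proof -
 from Q obtain N where N: "{z \<in> sp a t. \<not> Q z} \<subseteq> N" "N \<in> sets (PP {a<..t})" "emeasure (lw a t) N = 0"
  by (auto elim!: AE_E)
 have m: "(indicator N :: _ => ennreal) \<in> bp a t" using N by auto
 have "nint P (%q. nemp t (indicator N) q) = 0"
  using nn_nemp[OF t m] N by (simp add: nn_integral_indicator)
 then have "AE q in P. nemp t (indicator N) q = 0"
  using nemp_meas[OF t m] by (subst (asm) nn_integral_0_iff_AE) auto
 then show ?thesis using AE_space
 proof eventually_elim
  case (elim q)
  show ?case
  proof
   fix k assume k: "k \<in> {1..K}"
   have "ennreal (hw t k q / real K) * indicator N (rp t k q) = 0"
    using elim(1) k unfolding nemp_def by (subst (asm) sum_eq_0_iff) auto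
   moreover have "hw t k q / real K > 0" using hw_pos[OF t elim(2) k] K_pos by simp
   ultimately have "rp t k q \<notin> N" by (auto simp: indicator_def split: if_splits)
   then show "Q (rp t k q)" using N(1) rp_space[OF t k elim(2)] by auto
  qed
 qed
qed

lemma nn_R: "a <= t ==> t <= e ==> (nint P (%q. ennreal (R t q))) = 1"
 using nn_emp[of t "%z. 1 / hr a t z"] nn_inverse_hrel[of a t] hrel_pos[of a t t] hrel_measurable[of a t t] e_le_U
 by (auto simp: less_imp_le)

lemma R_meas: "a <= t ==> t <= e ==> R t \<in> bmf P"
 using emp_meas_P[of t "%z. 1 / hr a t z"] hrel_measurable[of a t t] e_le_U by auto

lemma AE_rp_next:
 assumes n: "a <= n" "n < e" and Q: "AE z in lw a n. Q z"
 shows "AE q in P. \<forall>k\<in>{1..K}. Q (rp n k q) \<and> rp n k q \<in> sp a n \<and> q \<in> space P"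
 using AE_rp[OF n(1) less_imp_le[OF n(2)] Q] AE_space
 by eventually_elim (use rp_space[OF n(1) less_imp_le[OF n(2)]] in blast)

lemma comp_update1:
 assumes "a <= n" "f \<in> bp a (Suc n)" "z \<in> sp a n"
 shows "(%x. f (z(Suc n := x))) \<in> bmf nu"
 using mcomp[OF measurable_Pair1'[OF assms(3)] measurable_comp_update[OF assms(1,2)]] by (simp only: split_conv)

lemma samp_meas:
 assumes n: "a <= n" "n < e" and f: "f \<in> bp a (Suc n)" and k: "k \<in> {1..K}"
 shows "(%(q, v). f ((rp n k q)(Suc n := v))) \<in> bmf (pastS n >< nu)"
proof -
 have rp: "rp n k \<in> measurable (pastS n) (PP {a<..n})" using n pastS_coords(2)[OF n(2)] k by (intro rp_measurable) auto
 have "(%x. (rp n k (fst x), snd x)) \<in> measurable (pastS n >< nu) (PP {a<..n} >< nu)"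
  by (intro measurable_Pair mcomp[OF measurable_fst rp] measurable_snd)
 from mcomp[OF this measurable_comp_update[OF n(1) f]] show ?thesis by (simp only: split_conv split_beta' fst_conv snd_conv)
qed

text \<open>h at time n does not depend on the next state and leaves the inner integral; being
  positive, it transfers finiteness to the conditional second moment. What remains is the
  decomposition of the variance as second moment minus squared mean.\<close>

lemma square_next_law:
 fixes f :: "(nat => 'x) => real"
 assumes n: "a <= n" "n < e" and f: "f \<in> bp a (Suc n)"
  and fb: "AE z in lw a n. fb z = lint (nl n z) (%x. f (z(Suc n := x)))"
  and sq: "nint (lw a (Suc n)) (%z. ennreal ((f z)\<^sup>2 * hr a n z)) <= ennreal b"
 shows "AE z in lw a n. integrable (nl n z) (%x. (f (z(Suc n := x)))\<^sup>2) \<and>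
   integrable (nl n z) (%x. (f (z(Suc n := x)) - fb z)\<^sup>2) \<and>
   (lint (nl n z) (%x. f (z(Suc n := x)) - fb z)) = 0 \<and>
   (lint (nl n z) (%x. (f (z(Suc n := x)) - fb z)\<^sup>2)) = lint (nl n z) (%x. (f (z(Suc n := x)))\<^sup>2) - (fb z)\<^sup>2"
  and "nint (lw a n) (%z. ennreal (hr a n z * lint (nl n z) (%x. (f (z(Suc n := x)))\<^sup>2))) <= nint (lw a (Suc n)) (%z. ennreal ((f z)\<^sup>2 * hr a n z))"
  and "(%z. lint (nl n z) (%x. (f (z(Suc n := x)))\<^sup>2)) \<in> bp a n"
proof -
 let ?f = "%z. (%x. (f (z(Suc n := x)))\<^sup>2)"
 let ?e = "%z. (%x. ennreal ((f (z(Suc n := x)))\<^sup>2))"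
 have nU: "n < U" using n e_le_U by simp
 have hm: "hr a n \<in> bp a (Suc n)" "hr a n \<in> bp a n"
  using nU by (auto intro!: hrel_measurable)
 have h0: "hr a n z > 0" if "z \<in> sp a n" for z using hrel_pos[of a n n z] that nU n by simp
 have hu: "hr a n (z(Suc n := x)) = hr a n z" for z x by (rule hrel_cong) auto
 have f2: "(%z. (f z)\<^sup>2) \<in> bp a (Suc n)" using f by simp
 have eq: "nint (lw a (Suc n)) (%z. ennreal ((f z)\<^sup>2 * hr a n z)) = nint (lw a n) (%z. ennreal (hr a n z) * nint (nl n z) (?e z))"
 proof -
  have "nint (lw a (Suc n)) (%z. ennreal ((f z)\<^sup>2 * hr a n z)) = nint (lw a n) (%z. nint (nl n z) (%x. ennreal ((f (z(Suc n := x)))\<^sup>2 * hr a n (z(Suc n := x)))))"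
   using f hm by (intro nn_law_Suc[OF block_a n(1) nU]) auto
  also have "... = nint (lw a n) (%z. ennreal (hr a n z) * nint (nl n z) (?e z))"
  proof (rule nn_integral_cong)
   fix z assume z: "z \<in> space (lw a n)"
   then have z': "z \<in> sp a n" by simp
   have "nint (nl n z) (%x. ennreal ((f (z(Suc n := x)))\<^sup>2 * hr a n (z(Suc n := x)))) = nint (nl n z) (%x. ennreal (hr a n z) * ennreal ((f (z(Suc n := x)))\<^sup>2))"
    using h0[OF z'] by (intro nn_integral_cong) (simp add: hu ennreal_mult mult.commute)
   also have "... = ennreal (hr a n z) * nint (nl n z) (?e z)"
    using comp_update1[OF n(1) f2 z'] by (intro nn_integral_cmult) (simp add: measurable_cong_sets[OF sets_next_law refl])
   finally show "nint (nl n z) (%x. ennreal ((f (z(Suc n := x)))\<^sup>2 * hr a n (z(Suc n := x)))) = ennreal (hr a n z) * nint (nl n z) (?e z)" .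
  qed
  finally show ?thesis .
 qed
 have "(%(z, x). ennreal ((f (z(Suc n := x)))\<^sup>2)) \<in> bmf (PP {a<..n} >< nu)"
  using mcomp[OF measurable_comp_update[OF n(1) f2] measurable_ennreal] by (simp add: split_beta')
 from nn_next_law_measurable[OF block_a n(1) nU this] have m: "(%z. nint (nl n z) (?e z)) \<in> bp a n"
  by (simp only: split_conv)
 show m2: "(%z. lint (nl n z) (?f z)) \<in> bp a n"
  using int_next_law_measurable[OF block_a n(1) nU measurable_comp_update[OF n(1) f2]] by (simp only: split_conv)
 have fin: "AE z in lw a n. ennreal (hr a n z) * nint (nl n z) (?e z) ~= \<infinity>"
 proof (rule nn_integral_PInf_AE)
  show "(%z. ennreal (hr a n z) * nint (nl n z) (?e z)) \<in> bmf (lw a n)"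
   using hm m by (intro measurable_law borel_measurable_times_ennreal mcomp[OF _ measurable_ennreal])
  show "nint (lw a n) (%z. ennreal (hr a n z) * nint (nl n z) (?e z)) ~= \<infinity>"
   using sq unfolding eq[symmetric] by (auto simp: top_unique)
 qed
 have int: "AE z in lw a n. integrable (nl n z) (?f z)"
  using fin AE_space
 proof eventually_elim
  case (elim z)
  then have z: "z \<in> sp a n" by simp
  have "nint (nl n z) (?e z) ~= \<infinity>"
   using elim(1) h0[OF z] by (auto simp: ennreal_mult_eq_top_iff)
  then show ?case using comp_update1[OF n(1) f2 z]
   by (intro integrableI_nonneg) (auto simp: measurable_cong_sets[OF sets_next_law refl] less_top)
 qed
 show "AE z in lw a n. integrable (nl n z) (?f z) \<and>
   integrable (nl n z) (%x. (f (z(Suc n := x)) - fb z)\<^sup>2) \<and>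
   (lint (nl n z) (%x. f (z(Suc n := x)) - fb z)) = 0 \<and>
   (lint (nl n z) (%x. (f (z(Suc n := x)) - fb z)\<^sup>2)) = lint (nl n z) (?f z) - (fb z)\<^sup>2"
  using int fb AE_space
 proof eventually_elim
  case (elim z)
  then have z: "z \<in> sp a n" by simp
  interpret N: prob_space "nl n z" by (rule prob_next_law[OF block_a n(1) nU z])
  have fm: "(%x. f (z(Suc n := x))) \<in> bmf (nl n z)"
   using comp_update1[OF n(1) f z] by (simp add: measurable_cong_sets[OF sets_next_law refl])
  have i1: "integrable (nl n z) (%x. f (z(Suc n := x)))"
   using fm elim(1) by (rule N.square_integrable_imp_integrable)
  have e: "(f (z(Suc n := x)) - fb z)\<^sup>2 = (f (z(Suc n := x)))\<^sup>2 - 2 * fb z * f (z(Suc n := x)) + (fb z)\<^sup>2" for x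
   by (simp add: power2_eq_square algebra_simps)
  have "lint (nl n z) (%x. (f (z(Suc n := x)) - fb z)\<^sup>2) = lint (nl n z) (?f z) - 2 * fb z * fb z + (fb z)\<^sup>2"
   unfolding e using elim(1) i1 by (simp add: N.prob_space[simplified] elim(2)[symmetric])
  then show ?case using elim(1) i1 elim(2) unfolding e by (auto simp: N.prob_space[simplified] power2_eq_square)
 qed
 show "nint (lw a n) (%z. ennreal (hr a n z * lint (nl n z) (?f z))) <= nint (lw a (Suc n)) (%z. ennreal ((f z)\<^sup>2 * hr a n z))"
  unfolding eq
 proof (rule nn_integral_mono_AE, use int AE_space in eventually_elim)
  case (elim z)
  then have z: "z \<in> sp a n" by simp
  then show ?case using elim(1) h0[OF z] by (simp add: nn_integral_eq_integral ennreal_mult)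
 qed
qed

text \<open>The conditional variance involves the square of the history weight. Writing one of the
  two factors as h times \<open>R\<close> turns the sum into \<open>R\<close> times an empirical
  mean of h times the conditional second moment, divided by K. Unbiasedness bounds the mean of the
  latter by b / K, and \<open>centred_sum_L1\<close> applies.\<close>

lemma emp_sampling_L1:
 fixes f fb :: "(nat => 'x) => real"
 assumes n: "a <= n" "n < e" and f: "f \<in> bp a (Suc n)" and fbm: "fb \<in> bp a n"
  and fb: "AE z in lw a n. fb z = lint (nl n z) (%x. f (z(Suc n := x)))"
  and sq: "nint (lw a (Suc n)) (%z. ennreal ((f z)\<^sup>2 * hr a n z)) <= ennreal b" and b: "b >= 0"
 shows "nint P (%q. ennreal \<bar>\<mu>n n f q - \<mu> n fb q\<bar>) <= ennreal (sqrt (b / real K))"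
proof -
 have nU: "n < U" using n e_le_U by simp
 note SN = square_next_law[OF n f fb sq]
 interpret C: cond_step P "pastS n" nu "{1..K}" "X (Suc n)" "dS n" by (rule sampling_step[OF n])
 note kp = kp_sampling[OF sampling_step[OF n]]
 define F2 where "F2 z = lint (nl n z) (%x. (f (z(Suc n := x)))\<^sup>2)" for z
 define xi where "xi k q v = hw n k q / real K * (f ((rp n k q)(Suc n := v)) - fb (rp n k q))" for k q v
 define Y where "Y q = \<mu> n (%z. hr a n z * F2 z) q / real K" for q
 have hm: "hr a n \<in> bp a n" using nU by (auto intro!: hrel_measurable)
 have h0: "hr a n z > 0" if "z \<in> sp a n" for z using hrel_pos[of a n n z] that nU n by simp
 have F20: "F2 z >= 0" for z unfolding F2_def by simp
 have hF: "(%z. hr a n z * F2 z) \<in> bp a n" using hm SN(3) unfolding F2_def by simp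
 have Km: "(%q. hw n k q / real K) \<in> bmf (pastS n)" "(%q. fb (rp n k q)) \<in> bmf (pastS n)" if "k \<in> {1..K}" for k
  using hw_measurable[of n "pastS n" k] mcomp[OF rp_measurable[of n "pastS n" k] fbm] pastS_coords(2)[OF n(2)] n that by auto
 have main: "nint P (%q. ennreal \<bar>\<Sum>k\<in>{1..K}. xi k q (X (Suc n) k q)\<bar>) <= ennreal (sqrt (1 * (b / real K)))"
 proof (rule C.centred_sum_L1[where X="R n" and Y=Y])
  show "(%(q, v). xi k q v) \<in> bmf (pastS n >< nu)" if "k \<in> {1..K}" for k
   unfolding xi_def split_beta' using samp_meas[OF n f that] Km[OF that]
   by (intro borel_measurable_times borel_measurable_diff) (auto simp: split_beta' intro: mcomp[OF measurable_fst])
  show "R n \<in> bmf P" using n by (intro R_meas) auto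
  show "Y \<in> bmf P" unfolding Y_def using emp_meas_P[OF n(1) _ hF] n by simp
  show "nint P (%q. ennreal (R n q)) <= ennreal 1" using nn_R[of n] n by simp
  have "nint P (%q. ennreal (Y q)) = nint P (%q. ennreal (1 / real K) * ennreal (\<mu> n (%z. hr a n z * F2 z) q))"
   unfolding Y_def by (intro nn_integral_cong) (simp flip: ennreal_mult')
  also have "... = ennreal (1 / real K) * nint (lw a n) (%z. ennreal (hr a n z * F2 z))"
   using emp_meas_P[OF n(1) _ hF] nn_emp[of n "%z. hr a n z * F2 z"] hF F20 h0 n by (simp add: nn_integral_cmult less_imp_le)
  also have "... <= ennreal (1 / real K) * ennreal b"
   using order_trans[OF SN(2) sq] unfolding F2_def by (intro mult_left_mono) auto
  also have "... = ennreal (b / real K)" using b by (simp flip: ennreal_mult)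
  finally show "nint P (%q. ennreal (Y q)) <= ennreal (b / real K)" .
  show "AE q in P. (\<forall>k\<in>{1..K}. integrable (C.kp k q) (%v. (xi k q v)\<^sup>2) \<and> (lint (C.kp k q) (%v. xi k q v)) = 0) \<and>
    (\<Sum>k\<in>{1..K}. lint (C.kp k q) (%v. (xi k q v)\<^sup>2)) <= R n q * Y q \<and> 0 <= R n q \<and> 0 <= Y q"
   using AE_rp_next[OF n SN(1)] AE_space
  proof eventually_elim
   case (elim q)
   note q = elim(2)
   have hwp: "hw n k q = hr a n (rp n k q) * R n q" "hw n k q > 0" "hr a n (rp n k q) > 0" if "k \<in> {1..K}" for k
    using hw_eq[OF n(1) _ q that] hw_pos[OF n(1) _ q that] h0 elim(1) that n by auto
   have Rp: "R n q > 0" using R_pos[OF n(1) _ q] n by simp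
   have 1: "integrable (C.kp k q) (%v. (xi k q v)\<^sup>2) \<and> (lint (C.kp k q) (%v. xi k q v)) = 0 \<and>
     (lint (C.kp k q) (%v. (xi k q v)\<^sup>2)) = (hw n k q / real K)\<^sup>2 * (F2 (rp n k q) - (fb (rp n k q))\<^sup>2)" if "k \<in> {1..K}" for k
    using elim(1)[rule_format, OF that] unfolding kp xi_def power_mult_distrib F2_def by simp
   have "(\<Sum>k\<in>{1..K}. lint (C.kp k q) (%v. (xi k q v)\<^sup>2)) <= (\<Sum>k\<in>{1..K}. R n q / (real K * real K) * (hw n k q * (hr a n (rp n k q) * F2 (rp n k q))))"
   proof (rule sum_mono)
    fix k assume k: "k \<in> {1..K}"
    have "lint (C.kp k q) (%v. (xi k q v)\<^sup>2) <= (hw n k q / real K)\<^sup>2 * F2 (rp n k q)"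
     using 1[OF k] by (simp add: mult_left_mono)
    also have "... = R n q / (real K * real K) * (hw n k q * (hr a n (rp n k q) * F2 (rp n k q)))"
     using hwp(1)[OF k] by (simp add: power2_eq_square)
    finally show "lint (C.kp k q) (%v. (xi k q v)\<^sup>2) <= R n q / (real K * real K) * (hw n k q * (hr a n (rp n k q) * F2 (rp n k q)))" .
   qed
   also have "... = R n q * Y q" unfolding Y_def emp_def sum_distrib_left[symmetric] by simp
   finally have 2: "(\<Sum>k\<in>{1..K}. lint (C.kp k q) (%v. (xi k q v)\<^sup>2)) <= R n q * Y q" .
   have 3: "0 <= Y q" unfolding Y_def emp_def using hwp F20
    by (intro divide_nonneg_nonneg sum_nonneg mult_nonneg_nonneg) (auto intro: less_imp_le)
   show ?case using 1 2 3 Rp by simp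
  qed
 qed (use b in auto)
 have "(\<Sum>k\<in>{1..K}. xi k q (X (Suc n) k q)) = \<mu>n n f q - \<mu> n fb q" for q
  unfolding xi_def empn_def emp_def npath_def by (simp add: right_diff_distrib sum_subtractf diff_divide_distrib sum_divide_distrib)
 then show ?thesis using main by simp
qed

lemma resamp_meas:
 assumes n: "a <= n" "n < e" and g: "!!i. i \<in> {1..K} ==> g i \<in> bmf (pastR n)"
 shows "(%(q, i). g i q) \<in> bmf (pastR n >< count_space {1..K})"
proof -
 have "(%x. g (snd x) (fst x)) \<in> bmf (pastR n >< count_space {1..K})"
  by (rule measurable_compose_countable'[where I="{1..K}" and g=snd and f="%i x. g i (fst x)"])
   (use mcomp[OF measurable_fst g] in auto)
 then show ?thesis by (simp add: split_beta')
qed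

lemma int_resampling:
 fixes g :: "nat => real" and k :: nat
 assumes n: "a <= n" "n < e" and q: "q \<in> space P"
 shows "lint (cond_step.kp (count_space {1..K}) (%_ q i. nw (Suc n) i q) k q) (%i. g i) = (\<Sum>i\<in>{1..K}. nw (Suc n) i q * g i)"
  and "integrable (cond_step.kp (count_space {1..K}) (%_ q i. nw (Suc n) i q) k q) g"
proof -
 interpret C: cond_step P "pastR n" "count_space {1..K}" "{1..K}" "B (Suc n)" "%_ q i. nw (Suc n) i q" by (rule resampling_step[OF n])
 have nn: "AE i in count_space {1..K}. 0 <= nw (Suc n) i q" using nw_nonneg_sum(1)[OF n q] by (intro AE_I2) (auto intro: less_imp_le)
 show "lint (C.kp k q) (%i. g i) = (\<Sum>i\<in>{1..K}. nw (Suc n) i q * g i)"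
  unfolding C.kp_def using nn by (subst integral_density) (auto simp: lebesgue_integral_count_space_finite)
 show "integrable (C.kp k q) g"
  unfolding C.kp_def using nn by (subst integrable_density) (auto simp: integrable_count_space)
qed

lemma nw_hw:
 assumes n: "a <= n" "n < e" and q: "q \<in> space P" and i: "i \<in> {1..K}"
 shows "nw (Suc n) i q * (hr a (Suc n) (np n i q) * R (Suc n) q) = hw n i q / real K"
 using hw_new[OF n q i] nw_nonneg_sum(1)[OF n q i] K_pos by (simp add: field_simps)

lemma emp_Suc: "a <= n ==> \<mu> (Suc n) f q = (\<Sum>k\<in>{1..K}. hw n (B (Suc n) k q) q / (real K * nw (Suc n) (B (Suc n) k q) q) * f (np n (B (Suc n) k q) q)) / real K"
 unfolding emp_def by (simp add: hw_Suc rp_Suc)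

text \<open>\<open>A i\<close> is the contribution of particle i if it is chosen, and equals h times
  \<open>R\<close> times f. Its mean under the resampling probabilities is the empirical mean before
  resampling; its second moment is \<open>R\<close> times an empirical mean of f^2 h, again
  accessible through unbiasedness.\<close>

lemma emp_resampling_L1:
 fixes f :: "(nat => 'x) => real"
 assumes n: "a <= n" "n < e" and f: "f \<in> bp a (Suc n)"
  and sq: "nint (lw a (Suc n)) (%z. ennreal ((f z)\<^sup>2 * hr a (Suc n) z)) <= ennreal b" and b: "b >= 0"
 shows "nint P (%q. ennreal \<bar>\<mu> (Suc n) f q - \<mu>n n f q\<bar>) <= ennreal (sqrt (b / real K))"
proof -
 have nU: "Suc n <= U" using n e_le_U by simp
 interpret C: cond_step P "pastR n" "count_space {1..K}" "{1..K}" "B (Suc n)" "%_ q i. nw (Suc n) i q" by (rule resampling_step[OF n])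
 note cm = pastR_coords[OF n(2)]
 define A where "A i q = hw n i q / (real K * nw (Suc n) i q) * f (np n i q)" for i q
 define xi where "xi = (%(k::nat) q i. (A i q - \<mu>n n f q) / real K)"
 define Y where "Y q = \<mu>n n (%z. (f z)\<^sup>2 * hr a (Suc n) z) q / real K" for q
 have hm: "hr a (Suc n) \<in> bp a (Suc n)" using nU by (auto intro!: hrel_measurable)
 have h0: "hr a (Suc n) z > 0" if "z \<in> sp a (Suc n)" for z using hrel_pos[of a "Suc n" "Suc n" z] that nU n by simp
 have fh: "(%z. (f z)\<^sup>2 * hr a (Suc n) z) \<in> bp a (Suc n)" using hm f by simp
 have Am: "A i \<in> bmf (pastR n)" if i: "i \<in> {1..K}" for i
 proof -
  have "(%q. f (np n i q)) \<in> bmf (pastR n)"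
   using n cm i by (intro mcomp[OF np_measurable f]) auto
  moreover have "hw n i \<in> bmf (pastR n)" using n cm i by (intro hw_measurable) auto
  moreover have "nw (Suc n) i \<in> bmf (pastR n)" using n cm i by (intro nw_measurable) auto
  ultimately show ?thesis unfolding A_def by measurable
 qed
 have mm: "\<mu>n n f \<in> bmf (pastR n)" using n cm f by (intro empn_measurable) auto
 have main: "nint P (%q. ennreal \<bar>\<Sum>k\<in>{1..K}. xi k q (B (Suc n) k q)\<bar>) <= ennreal (sqrt (1 * (b / real K)))"
 proof (rule C.centred_sum_L1[where X="R (Suc n)" and Y=Y])
  show "(%(q, i). xi k q i) \<in> bmf (pastR n >< count_space {1..K})" if "k \<in> {1..K}" for k
   unfolding xi_def using resamp_meas[OF n, of "%i q. (A i q - \<mu>n n f q) / real K"] Am mm by auto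
  show "R (Suc n) \<in> bmf P" using n by (intro R_meas) auto
  show "Y \<in> bmf P" unfolding Y_def using empn_meas_P[OF n fh] by simp
  show "nint P (%q. ennreal (R (Suc n) q)) <= ennreal 1" using nn_R[of "Suc n"] n by simp
  have "nint P (%q. ennreal (Y q)) = nint P (%q. ennreal (1 / real K) * ennreal (\<mu>n n (%z. (f z)\<^sup>2 * hr a (Suc n) z) q))"
   unfolding Y_def by (intro nn_integral_cong) (simp flip: ennreal_mult')
  also have "... = ennreal (1 / real K) * nint (lw a (Suc n)) (%z. ennreal ((f z)\<^sup>2 * hr a (Suc n) z))"
   using empn_meas_P[OF n fh] nn_empn[OF n, of "%z. (f z)\<^sup>2 * hr a (Suc n) z"] fh h0 by (simp add: nn_integral_cmult less_imp_le)
  also have "... <= ennreal (1 / real K) * ennreal b" by (intro mult_left_mono sq) auto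
  also have "... = ennreal (b / real K)" using b by (simp flip: ennreal_mult)
  finally show "nint P (%q. ennreal (Y q)) <= ennreal (b / real K)" .
  show "AE q in P. (\<forall>k\<in>{1..K}. integrable (C.kp k q) (%i. (xi k q i)\<^sup>2) \<and> (lint (C.kp k q) (%i. xi k q i)) = 0) \<and>
    (\<Sum>k\<in>{1..K}. lint (C.kp k q) (%i. (xi k q i)\<^sup>2)) <= R (Suc n) q * Y q \<and> 0 <= R (Suc n) q \<and> 0 <= Y q"
  proof (rule AE_I2)
   fix q assume q: "q \<in> space P"
   have nws: "(\<Sum>i\<in>{1..K}. nw (Suc n) i q) = 1" by (rule nw_nonneg_sum(2)[OF n q])
   have Rp: "R (Suc n) q > 0" using R_pos[of "Suc n" q] n q by simp
   have Ah: "A i q = hr a (Suc n) (np n i q) * R (Suc n) q * f (np n i q)" if "i \<in> {1..K}" for i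
    unfolding A_def hw_new[OF n q that] ..
   have nA: "nw (Suc n) i q * A i q = hw n i q / real K * f (np n i q)" if "i \<in> {1..K}" for i
    unfolding Ah[OF that] nw_hw[OF n q that, symmetric] by simp
   have sA: "(\<Sum>i\<in>{1..K}. nw (Suc n) i q * A i q) = \<mu>n n f q"
    using nA by (simp add: empn_def sum_divide_distrib)
   have mean: "lint (C.kp k q) (%i. xi k q i) = 0" for k
   proof -
    have "lint (C.kp k q) (%i. xi k q i) = (\<Sum>i\<in>{1..K}. nw (Suc n) i q * A i q - nw (Suc n) i q * \<mu>n n f q) / real K"
     unfolding xi_def int_resampling(1)[OF n q] by (simp add: sum_divide_distrib right_diff_distrib)
    also have "... = 0" using nws sA by (simp add: sum_subtractf sum_distrib_right[symmetric])
    finally show ?thesis .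
   qed
   have sq2: "lint (C.kp k q) (%i. (xi k q i)\<^sup>2) <= R (Suc n) q * Y q / real K" for k
   proof -
    have "lint (C.kp k q) (%i. (xi k q i)\<^sup>2) = (\<Sum>i\<in>{1..K}. nw (Suc n) i q * (A i q)\<^sup>2 - 2 * \<mu>n n f q * (nw (Suc n) i q * A i q) + (\<mu>n n f q)\<^sup>2 * nw (Suc n) i q) / (real K)\<^sup>2"
     unfolding xi_def int_resampling(1)[OF n q] by (simp add: sum_divide_distrib power2_eq_square algebra_simps)
    also have "... = ((\<Sum>i\<in>{1..K}. nw (Suc n) i q * (A i q)\<^sup>2) - (\<mu>n n f q)\<^sup>2) / (real K)\<^sup>2"
     using nws sA by (simp add: sum.distrib sum_subtractf sum_distrib_left[symmetric] power2_eq_square)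
    also have "... <= (\<Sum>i\<in>{1..K}. nw (Suc n) i q * (A i q)\<^sup>2) / (real K)\<^sup>2"
     by (intro divide_right_mono) auto
    also have "(\<Sum>i\<in>{1..K}. nw (Suc n) i q * (A i q)\<^sup>2) = (\<Sum>i\<in>{1..K}. R (Suc n) q * (hw n i q * ((f (np n i q))\<^sup>2 * hr a (Suc n) (np n i q)) / real K))"
    proof (rule sum.cong[OF refl])
     fix i assume i: "i \<in> {1..K}"
     have "nw (Suc n) i q * (A i q)\<^sup>2 = (nw (Suc n) i q * A i q) * A i q" by (simp add: power2_eq_square)
     also have "... = hw n i q / real K * f (np n i q) * (hr a (Suc n) (np n i q) * R (Suc n) q * f (np n i q))"
      by (subst nA[OF i], subst Ah[OF i], rule refl)
     finally show "nw (Suc n) i q * (A i q)\<^sup>2 = R (Suc n) q * (hw n i q * ((f (np n i q))\<^sup>2 * hr a (Suc n) (np n i q)) / real K)"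
      by (simp add: power2_eq_square)
    qed
    also have "... = R (Suc n) q * (Y q * real K)"
     unfolding sum_distrib_left[symmetric] sum_divide_distrib[symmetric] Y_def empn_def using K_pos by simp
    also have "R (Suc n) q * (Y q * real K) / (real K)\<^sup>2 = R (Suc n) q * Y q / real K"
     using K_pos by (simp add: power2_eq_square)
    finally show ?thesis .
   qed
   have "(\<Sum>k\<in>{1..K}. lint (C.kp k q) (%i. (xi k q i)\<^sup>2)) <= (\<Sum>k\<in>{1..K}. R (Suc n) q * Y q / real K)"
    by (intro sum_mono sq2)
   also have "... = R (Suc n) q * Y q" using K_pos by simp
   finally have v: "(\<Sum>k\<in>{1..K}. lint (C.kp k q) (%i. (xi k q i)\<^sup>2)) <= R (Suc n) q * Y q" .
   have Y0: "0 <= Y q" unfolding Y_def empn_def using hw_pos[OF n(1) _ q] h0[OF np_space[OF n _ q]] n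
    by (intro divide_nonneg_nonneg sum_nonneg mult_nonneg_nonneg) (auto intro: less_imp_le)
   show "(\<forall>k\<in>{1..K}. integrable (C.kp k q) (%i. (xi k q i)\<^sup>2) \<and> (lint (C.kp k q) (%i. xi k q i)) = 0) \<and>
    (\<Sum>k\<in>{1..K}. lint (C.kp k q) (%i. (xi k q i)\<^sup>2)) <= R (Suc n) q * Y q \<and> 0 <= R (Suc n) q \<and> 0 <= Y q"
    using int_resampling(2)[OF n q] mean v Y0 Rp by simp
  qed
 qed (use b in auto)
 have "(\<Sum>k\<in>{1..K}. xi k q (B (Suc n) k q)) = \<mu> (Suc n) f q - \<mu>n n f q" for q
  unfolding emp_Suc[OF n(1)] xi_def A_def using K_pos by (simp add: sum_subtractf diff_divide_distrib sum_divide_distrib)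
 then show ?thesis using main by simp
qed

end

section \<open>One-step comparison of characteristic functions\<close>

lemma min_1_mult_le: "0 <= r ==> 0 <= c ==> min 1 (r * c) <= (1 + r) * min 1 (c::real)"
proof -
 assume r: "0 <= r" and c: "0 <= c"
 show ?thesis
 proof (cases "c <= 1")
  case True
  then have "min 1 (r * c) <= r * c" by simp
  also have "... <= (1 + r) * c" using c by (intro mult_right_mono) auto
  finally show ?thesis using True by (simp add: min_absorb2)
 next
  case False
  then show ?thesis using r by (simp add: min_absorb1 min.coboundedI1)
 qed
qed

lemma min_1_add_le: "0 <= y ==> min 1 (x + y) <= min 1 x + (y::real)"
 by (auto simp: min_def)

lemma square_diff_le: "((x::real) - y)\<^sup>2 <= 2 * x\<^sup>2 + 2 * y\<^sup>2"
 using zero_le_power2[of "x + y"] by (simp add: power2_eq_square algebra_simps)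

context seg_run
begin

text \<open>The sum of the conditional variances is exactly \<open>R\<close> times the empirical
  mean of \<open>G\<close>. In the Lindeberg term \<open>R\<close> sits inside the minimum and is
  pulled out at the price of the factor 1 + \<open>R\<close>. Both \<open>G\<close> and
  \<open>ph\<close> are then functions of the path alone, so that empirical means of them can be
  evaluated in the limit.\<close>

lemma emp_sampling_char:
 fixes f fb :: "(nat => 'x) => real" and ze :: "'w => complex" and s \<sigma>2 :: real and n :: nat
 defines "ph == %z. hr a n z * lint (nl n z) (%x. (f (z(Suc n := x)) - fb z)\<^sup>2 * min 1 (\<bar>s\<bar> * \<bar>f (z(Suc n := x)) - fb z\<bar> * hr a n z / sqrt (real K)))"
  and "G == %z. hr a n z * ((lint (nl n z) (%x. (f (z(Suc n := x)))\<^sup>2)) - (fb z)\<^sup>2)"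
 assumes n: "a <= n" "n < e" and f: "f \<in> bp a (Suc n)" and fbm: "fb \<in> bp a n"
  and fb: "AE z in lw a n. fb z = lint (nl n z) (%x. f (z(Suc n := x)))"
  and sq: "nint (lw a (Suc n)) (%z. ennreal ((f z)\<^sup>2 * hr a n z)) <= ennreal b"
  and ze: "ze \<in> bmf (pastS n)" "!!q. cmod (ze q) <= 1" and \<sigma>2: "\<sigma>2 >= 0"
 shows "cmod ((CLINT q|P. ze q * iexp (s * (sqrt (real K) * (\<mu>n n f q - \<mu> n fb q)))) - of_real (exp (- (s\<^sup>2 * \<sigma>2 / 2))) * (CLINT q|P. ze q))
  <= lint P (%q. min 2 (2 * s\<^sup>2 * (R n q * (1 + R n q) * \<mu> n ph q) + s\<^sup>2 / 2 * \<bar>R n q * \<mu> n G q - \<sigma>2\<bar>))"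
  and "ph \<in> bp a n" and "G \<in> bp a n"
proof -
 let ?A = "%q. (2 * s\<^sup>2 * (R n q * (1 + R n q) * \<mu> n ph q) + s\<^sup>2 / 2 * \<bar>R n q * \<mu> n G q - \<sigma>2\<bar>)"
 have nU: "n < U" using n e_le_U by simp
 note SN = square_next_law[OF n f fb sq]
 interpret C: cond_step P "pastS n" nu "{1..K}" "X (Suc n)" "dS n" by (rule sampling_step[OF n])
 note kp = kp_sampling[OF sampling_step[OF n]]
 define F2 where "F2 z = lint (nl n z) (%x. (f (z(Suc n := x)))\<^sup>2)" for z
 define D where "D z x = f (z(Suc n := x)) - fb z" for z x
 define xi where "xi k q v = hw n k q / sqrt (real K) * D (rp n k q) v" for k q v
 have hm: "hr a n \<in> bp a n" using nU by (auto intro!: hrel_measurable)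
 have h0: "hr a n z > 0" if "z \<in> sp a n" for z using hrel_pos[of a n n z] that nU n by simp
 have Dm: "(%(z, x). D z x) \<in> bmf (PP {a<..n} >< nu)"
  unfolding D_def split_beta'
  by (rule borel_measurable_diff[OF measurable_comp_update[OF n(1) f, unfolded split_beta'] mcomp[OF measurable_fst fbm]])
 show phm: "ph \<in> bp a n"
 proof -
  have "(%p. (D (fst p) (snd p))\<^sup>2 * min 1 (\<bar>s\<bar> * \<bar>D (fst p) (snd p)\<bar> * hr a n (fst p) / sqrt (real K))) \<in> bmf (PP {a<..n} >< nu)"
  proof -
   have [measurable]: "(%p. D (fst p) (snd p)) \<in> bmf (PP {a<..n} >< nu)"
    "(%p. hr a n (fst p)) \<in> bmf (PP {a<..n} >< nu)"
    using Dm mcomp[OF measurable_fst hm] by (auto simp: split_beta')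
   show ?thesis by measurable
  qed
  from int_next_law_measurable[OF block_a n(1) nU this] show ?thesis
   unfolding ph_def using hm by (simp add: D_def)
 qed
 show Gm: "G \<in> bp a n" unfolding G_def using hm SN(3) fbm by simp
 have Km: "(%q. hw n k q / sqrt (real K)) \<in> bmf (pastS n)" "(%q. fb (rp n k q)) \<in> bmf (pastS n)" if "k \<in> {1..K}" for k
  using hw_measurable[of n "pastS n" k] mcomp[OF rp_measurable[of n "pastS n" k] fbm] pastS_coords(2)[OF n(2)] n that by auto
 have xim: "(%(q, v). xi k q v) \<in> bmf (pastS n >< nu)" if "k \<in> {1..K}" for k
  unfolding xi_def D_def split_beta'
  by (rule borel_measurable_times[OF mcomp[OF measurable_fst Km(1)[OF that]]
   borel_measurable_diff[OF samp_meas[OF n f that, unfolded split_beta'] mcomp[OF measurable_fst Km(2)[OF that]]]])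
 have ae: "AE q in P. \<forall>k\<in>{1..K}. integrable (C.kp k q) (%v. (xi k q v)\<^sup>2) \<and> (lint (C.kp k q) (%v. xi k q v)) = 0"
  using AE_rp_next[OF n SN(1)]
 proof eventually_elim
  case (elim q)
  then show ?case unfolding kp xi_def D_def power_mult_distrib by simp
 qed
 have Kp: "real K > 0" "sqrt (real K) > 0" using K_pos by auto
 have sumeq: "(\<Sum>k\<in>{1..K}. xi k q (X (Suc n) k q)) = sqrt (real K) * (\<mu>n n f q - \<mu> n fb q)" for q
 proof -
  have "sqrt (real K) * (\<mu>n n f q - \<mu> n fb q) = sqrt (real K) / real K * (\<Sum>k\<in>{1..K}. hw n k q * D (rp n k q) (X (Suc n) k q))"
   unfolding empn_def emp_def npath_def D_def by (simp add: right_diff_distrib sum_subtractf diff_divide_distrib)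
  also have "sqrt (real K) / real K = 1 / sqrt (real K)" using Kp by (simp add: field_simps)
  finally show ?thesis unfolding xi_def sum_distrib_left by simp
 qed
 define La where "La q = (\<Sum>k\<in>{1..K}. lint (C.kp k q) (%v. (xi k q v)\<^sup>2 * min 1 \<bar>s * xi k q v\<bar>))" for q
 define v where "v q = (\<Sum>k\<in>{1..K}. lint (C.kp k q) (%v. (xi k q v)\<^sup>2))" for q
 let ?L = "%q. (2 * s\<^sup>2 * La q + s\<^sup>2 / 2 * \<bar>v q - \<sigma>2\<bar>)"
 note ch = C.centred_sum_char(1)[OF xim ae ze \<sigma>2, of s] C.centred_sum_char(2)[OF xim ae ze \<sigma>2] C.centred_sum_char(3)[OF xim ae ze \<sigma>2, of s]
 have [measurable]: "La \<in> bmf P" "v \<in> bmf P"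
  using C.F_into_P[OF ch(2)] C.F_into_P[OF ch(3)] unfolding La_def[abs_def] v_def[abs_def] by simp_all
 have [measurable]: "R n \<in> bmf P" "\<mu> n ph \<in> bmf P" "\<mu> n G \<in> bmf P"
  using R_meas[of n] emp_meas_P[OF n(1) _ phm] emp_meas_P[OF n(1) _ Gm] n by auto
 have main: "AE q in P. v q = R n q * \<mu> n G q \<and> La q <= R n q * (1 + R n q) * \<mu> n ph q \<and> La q >= 0"
  using AE_rp_next[OF n SN(1)] AE_space
 proof eventually_elim
  case (elim q)
  note q = elim(2)
  have hwp: "hw n k q = hr a n (rp n k q) * R n q" "hw n k q > 0" "hr a n (rp n k q) > 0" if "k \<in> {1..K}" for k
   using hw_eq[OF n(1) _ q that] hw_pos[OF n(1) _ q that] h0 elim(1) that n by auto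
  have Rp: "R n q > 0" using R_pos[OF n(1) _ q] n by simp
  have veq: "v q = R n q * \<mu> n G q"
  proof -
   have "v q = (\<Sum>k\<in>{1..K}. R n q / real K * (hw n k q * G (rp n k q)))"
    unfolding v_def
   proof (rule sum.cong[OF refl])
    fix k assume k: "k \<in> {1..K}"
    have "lint (C.kp k q) (%v. (xi k q v)\<^sup>2) = (hw n k q / sqrt (real K))\<^sup>2 * (F2 (rp n k q) - (fb (rp n k q))\<^sup>2)"
     using elim(1)[rule_format, OF k] unfolding kp xi_def D_def power_mult_distrib F2_def by simp
    also have "(hw n k q / sqrt (real K))\<^sup>2 = R n q / real K * hw n k q * hr a n (rp n k q)"
     using hwp(1)[OF k] Kp by (simp add: power_divide power2_eq_square)
    finally show "lint (C.kp k q) (%v. (xi k q v)\<^sup>2) = R n q / real K * (hw n k q * G (rp n k q))"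
     unfolding G_def F2_def by simp
   qed
   then show ?thesis unfolding emp_def sum_distrib_left[symmetric] by simp
  qed
  have Lle: "La q <= R n q * (1 + R n q) * \<mu> n ph q"
  proof -
   have "La q <= (\<Sum>k\<in>{1..K}. R n q * (1 + R n q) / real K * (hw n k q * ph (rp n k q)))"
    unfolding La_def
   proof (rule sum_mono)
    fix k assume k: "k \<in> {1..K}"
    define z where "z = rp n k q"
    define c where "c v = \<bar>s\<bar> * \<bar>D z v\<bar> * hr a n z / sqrt (real K)" for v
    have z: "z \<in> sp a n" using elim(1) k by (simp add: z_def)
    have D2: "integrable (nl n z) (%v. (D z v)\<^sup>2)"
     using elim(1)[rule_format, OF k] by (simp add: z_def D_def)
    have Dzm: "D z \<in> bmf (nl n z)"
     using comp_update1[OF n(1) f z] unfolding D_def[abs_def] by (auto simp: measurable_cong_sets[OF sets_next_law refl])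
    have c0: "c v >= 0" for v unfolding c_def using h0[OF z] by simp
    have cm: "c \<in> bmf (nl n z)" unfolding c_def[abs_def] using Dzm by measurable
    have i1: "integrable (nl n z) (%v. (D z v)\<^sup>2 * min 1 (c v))"
     using c0 cm Dzm by (intro int_bound[OF D2]) (auto simp: abs_mult mult_left_le)
    have sx: "\<bar>s * xi k q v\<bar> = R n q * c v" for v
     unfolding xi_def c_def z_def using hwp[OF k] Rp by (simp add: abs_mult)
    \<comment> \<open>Only the square of the weight remains here; one of its factors is later
      exchanged for h times \<open>R\<close>.\<close>
    have x2: "(xi k q v)\<^sup>2 = (hw n k q)\<^sup>2 / real K * (D z v)\<^sup>2" for v
     unfolding xi_def z_def using Kp by (simp add: power_mult_distrib power_divide)
    have cm2: "(%v. (hw n k q)\<^sup>2 / real K * (D z v)\<^sup>2 * min 1 (R n q * c v)) \<in> bmf (nl n z)" using cm Dzm by measurable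
    have i2: "integrable (nl n z) (%v. (hw n k q)\<^sup>2 / real K * (D z v)\<^sup>2 * min 1 (R n q * c v))"
    proof (rule int_bound[OF integrable_mult_right[OF D2, of "(hw n k q)\<^sup>2 / real K"] cm2], rule AE_I2)
     fix v
     have "0 <= min 1 (R n q * c v)" "min 1 (R n q * c v) <= 1" using Rp c0 by auto
     then have "norm (min 1 (R n q * c v)) <= 1" by simp
     then show "norm ((hw n k q)\<^sup>2 / real K * (D z v)\<^sup>2 * min 1 (R n q * c v)) <= norm ((hw n k q)\<^sup>2 / real K * (D z v)\<^sup>2)"
      by (subst norm_mult) (rule mult_left_le, auto)
    qed
    have "lint (C.kp k q) (%v. (xi k q v)\<^sup>2 * min 1 \<bar>s * xi k q v\<bar>) = lint (nl n z) (%v. (hw n k q)\<^sup>2 / real K * (D z v)\<^sup>2 * min 1 (R n q * c v))"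
     unfolding kp sx x2 z_def ..
    also have "... <= lint (nl n z) (%v. (hw n k q)\<^sup>2 / real K * (1 + R n q) * ((D z v)\<^sup>2 * min 1 (c v)))"
    proof (rule integral_mono[OF i2 integrable_mult_right[OF i1]])
     fix v
     have "(hw n k q)\<^sup>2 / real K * (D z v)\<^sup>2 * min 1 (R n q * c v) <= (hw n k q)\<^sup>2 / real K * (D z v)\<^sup>2 * ((1 + R n q) * min 1 (c v))"
      using Rp c0 by (intro mult_left_mono min_1_mult_le mult_nonneg_nonneg) auto
     then show "(hw n k q)\<^sup>2 / real K * (D z v)\<^sup>2 * min 1 (R n q * c v) <= (hw n k q)\<^sup>2 / real K * (1 + R n q) * ((D z v)\<^sup>2 * min 1 (c v))"
      by (simp add: mult_ac)
    qed
    also have "... = (hw n k q)\<^sup>2 / real K * (1 + R n q) * lint (nl n z) (%v. (D z v)\<^sup>2 * min 1 (c v))" by simp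
    also have "(hw n k q)\<^sup>2 = hw n k q * hr a n z * R n q" using hwp(1)[OF k] by (simp add: z_def power2_eq_square)
    finally show "lint (C.kp k q) (%v. (xi k q v)\<^sup>2 * min 1 \<bar>s * xi k q v\<bar>) <= R n q * (1 + R n q) / real K * (hw n k q * ph (rp n k q))"
     unfolding ph_def z_def[symmetric] c_def D_def by (simp add: mult_ac)
   qed
   then show ?thesis unfolding emp_def sum_distrib_left[symmetric] by simp
  qed
  have "La q >= 0" unfolding La_def by (intro sum_nonneg integral_nonneg_AE AE_I2) auto
  then show ?case using veq Lle by simp
 qed
 have "cmod ((CLINT q|P. ze q * iexp (s * (\<Sum>k\<in>{1..K}. xi k q (X (Suc n) k q)))) - of_real (exp (- (s\<^sup>2 * \<sigma>2 / 2))) * (CLINT q|P. ze q))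
  <= lint P (%q. min 2 (?L q))"
  using ch(1) unfolding La_def v_def .
 also have "... <= lint P (%q. min 2 (?A q))"
 proof (rule integral_mono_AE)
  show "AE q in P. min 2 (?L q) <= min 2 (?A q)"
   using main
  proof eventually_elim
   case (elim q)
   have "2 * s\<^sup>2 * La q <= 2 * s\<^sup>2 * (R n q * (1 + R n q) * \<mu> n ph q)" using elim by (intro mult_left_mono) auto
   then show ?case using elim by (intro min.mono) auto
  qed
  show "integrable P (%q. min 2 (?L q))"
  proof (rule integrable_const_bound[where B=2])
   show "AE q in P. norm (min 2 (?L q)) <= 2"
    using main by eventually_elim simp
  qed measurable
  show "integrable P (%q. min 2 (?A q))"
  proof (rule integrable_const_bound[where B=2])
   show "AE q in P. norm (min 2 (?A q)) <= 2"
    using main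
   proof eventually_elim
    case (elim q)
    then have "0 <= 2 * s\<^sup>2 * (R n q * (1 + R n q) * \<mu> n ph q)" by (intro mult_nonneg_nonneg[of "2 * s\<^sup>2"]) auto
    then show ?case by simp
   qed
  qed measurable
 qed
 finally show "cmod ((CLINT q|P. ze q * iexp (s * (sqrt (real K) * (\<mu>n n f q - \<mu> n fb q)))) - of_real (exp (- (s\<^sup>2 * \<sigma>2 / 2))) * (CLINT q|P. ze q))
  <= lint P (%q. min 2 (?A q))"
  unfolding sumeq .
qed

text \<open>In contrast to sampling, the centring is the random empirical mean of f, common to all
  particles. It is separated from the particle's own term by (A - m)^2 <= 2 A^2 + 2 m^2 and by
  splitting the argument of the minimum; the terms in m are kept explicit since they vanish only in
  the limit and only for mean zero.\<close>

lemma emp_resampling_char: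
 fixes f :: "(nat => 'x) => real" and ze :: "'w => complex" and s \<sigma>2 :: real and n :: nat
 defines "ph == %z. (f z)\<^sup>2 * hr a (Suc n) z * min 1 (\<bar>s\<bar> * \<bar>f z\<bar> * hr a (Suc n) z / sqrt (real K))"
  and "W == %z. (f z)\<^sup>2 * hr a (Suc n) z"
 assumes n: "a <= n" "n < e" and f: "f \<in> bp a (Suc n)"
  and ze: "ze \<in> bmf (pastR n)" "!!q. cmod (ze q) <= 1" and \<sigma>2: "\<sigma>2 >= 0"
 shows "cmod ((CLINT q|P. ze q * iexp (s * (sqrt (real K) * (\<mu> (Suc n) f q - \<mu>n n f q)))) - of_real (exp (- (s\<^sup>2 * \<sigma>2 / 2))) * (CLINT q|P. ze q))
  <= (lint P (%q. min 2 (2 * s\<^sup>2 * (2 * (R (Suc n) q * (1 + R (Suc n) q) * \<mu>n n ph q) + 2 * (R (Suc n) q * \<mu>n n W q) * (\<bar>s\<bar> * \<bar>\<mu>n n f q\<bar> / sqrt (real K)) + 2 * (\<mu>n n f q)\<^sup>2)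
    + s\<^sup>2 / 2 * \<bar>R (Suc n) q * \<mu>n n W q - (\<mu>n n f q)\<^sup>2 - \<sigma>2\<bar>)))"
proof -
 have nU: "Suc n <= U" using n e_le_U by simp
 interpret C: cond_step P "pastR n" "count_space {1..K}" "{1..K}" "B (Suc n)" "%_ q i. nw (Suc n) i q" by (rule resampling_step[OF n])
 note cm = pastR_coords[OF n(2)]
 define A where "A i q = hw n i q / (real K * nw (Suc n) i q) * f (np n i q)" for i q
 define xi where "xi = (%(k::nat) q i. (A i q - \<mu>n n f q) / sqrt (real K))"
 have hm: "hr a (Suc n) \<in> bp a (Suc n)" using nU by (auto intro!: hrel_measurable)
 have h0: "hr a (Suc n) z > 0" if "z \<in> sp a (Suc n)" for z using hrel_pos[of a "Suc n" "Suc n" z] that nU n by simp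
 have Am: "A i \<in> bmf (pastR n)" if i: "i \<in> {1..K}" for i
 proof -
  have "(%q. f (np n i q)) \<in> bmf (pastR n)"
   using n cm i by (intro mcomp[OF np_measurable f]) auto
  moreover have "hw n i \<in> bmf (pastR n)" using n cm i by (intro hw_measurable) auto
  moreover have "nw (Suc n) i \<in> bmf (pastR n)" using n cm i by (intro nw_measurable) auto
  ultimately show ?thesis unfolding A_def by measurable
 qed
 have mm: "\<mu>n n f \<in> bmf (pastR n)" using n cm f by (intro empn_measurable) auto
 have Kp: "real K > 0" "sqrt (real K) > 0" using K_pos by auto
 have xim: "(%(q, i). xi k q i) \<in> bmf (pastR n >< count_space {1..K})" if "k \<in> {1..K}" for k
  unfolding xi_def using resamp_meas[OF n, of "%i q. (A i q - \<mu>n n f q) / sqrt (real K)"] Am mm by auto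
 have sumeq: "(\<Sum>k\<in>{1..K}. xi k q (B (Suc n) k q)) = sqrt (real K) * (\<mu> (Suc n) f q - \<mu>n n f q)" for q
 proof -
  have "(\<Sum>k\<in>{1..K}. xi k q (B (Suc n) k q)) = ((\<Sum>k\<in>{1..K}. A (B (Suc n) k q) q) - real K * \<mu>n n f q) / sqrt (real K)"
   unfolding xi_def sum_divide_distrib[symmetric] sum_subtractf by simp
  also have "(\<Sum>k\<in>{1..K}. A (B (Suc n) k q) q) = real K * \<mu> (Suc n) f q"
   unfolding emp_Suc[OF n(1)] A_def using Kp by simp
  also have "(real K * \<mu> (Suc n) f q - real K * \<mu>n n f q) / sqrt (real K) = (real K / sqrt (real K)) * (\<mu> (Suc n) f q - \<mu>n n f q)"
   by (simp add: right_diff_distrib diff_divide_distrib)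
  also have "real K / sqrt (real K) = sqrt (real K)" using Kp by (simp add: real_div_sqrt)
  finally show ?thesis .
 qed
 have main: "lint (C.kp k q) (%i. xi k q i) = 0 \<and>
   (\<Sum>k\<in>{1..K}. lint (C.kp k q) (%i. (xi k q i)\<^sup>2)) = R (Suc n) q * \<mu>n n W q - (\<mu>n n f q)\<^sup>2 \<and>
   (\<Sum>k\<in>{1..K}. lint (C.kp k q) (%i. (xi k q i)\<^sup>2 * min 1 \<bar>s * xi k q i\<bar>)) \<le>
    2 * (R (Suc n) q * (1 + R (Suc n) q) * \<mu>n n ph q) + 2 * (R (Suc n) q * \<mu>n n W q) * (\<bar>s\<bar> * \<bar>\<mu>n n f q\<bar> / sqrt (real K)) + 2 * (\<mu>n n f q)\<^sup>2"
  if q: "q \<in> space P" for q k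
 proof -
  define r where "r = R (Suc n) q"
  define m where "m = \<mu>n n f q"
  define h where "h i = hr a (Suc n) (np n i q)" for i
  have nws: "(\<Sum>i\<in>{1..K}. nw (Suc n) i q) = 1" by (rule nw_nonneg_sum(2)[OF n q])
  have nw0: "nw (Suc n) i q > 0" if "i \<in> {1..K}" for i using nw_nonneg_sum(1)[OF n q that] .
  have Rp: "r > 0" unfolding r_def using R_pos[of "Suc n" q] n q by simp
  have hp: "h i > 0" if "i \<in> {1..K}" for i unfolding h_def using h0[OF np_space[OF n that q]] .
  have Ah: "A i q = h i * r * f (np n i q)" if "i \<in> {1..K}" for i
   unfolding A_def hw_new[OF n q that] h_def r_def ..
  have nh: "nw (Suc n) i q * (h i * r) = hw n i q / real K" if "i \<in> {1..K}" for i
   unfolding h_def r_def by (rule nw_hw[OF n q that])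
  have nA: "nw (Suc n) i q * A i q = hw n i q / real K * f (np n i q)" if "i \<in> {1..K}" for i
   unfolding Ah[OF that] nh[OF that, symmetric] by simp
  have sA: "(\<Sum>i\<in>{1..K}. nw (Suc n) i q * A i q) = m"
   using nA by (simp add: empn_def sum_divide_distrib m_def)
  have nA2: "nw (Suc n) i q * (A i q)\<^sup>2 = r * (hw n i q * W (np n i q) / real K)" if i: "i \<in> {1..K}" for i
  proof -
   have "nw (Suc n) i q * (A i q)\<^sup>2 = (nw (Suc n) i q * (h i * r)) * (h i * r * (f (np n i q))\<^sup>2)"
    unfolding Ah[OF i] by (simp add: power2_eq_square)
   also have "... = (hw n i q / real K) * (h i * r * (f (np n i q))\<^sup>2)" by (subst nh[OF i]) (rule refl)
   finally show ?thesis unfolding W_def h_def by (simp add: mult_ac)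
  qed
  have sA2: "(\<Sum>i\<in>{1..K}. nw (Suc n) i q * (A i q)\<^sup>2) = r * \<mu>n n W q"
   using nA2 by (simp add: empn_def sum_divide_distrib sum_distrib_left)
  have mean: "lint (C.kp k q) (%i. xi k q i) = 0"
  proof -
   have "lint (C.kp k q) (%i. xi k q i) = (\<Sum>i\<in>{1..K}. nw (Suc n) i q * A i q - nw (Suc n) i q * m) / sqrt (real K)"
    unfolding xi_def int_resampling(1)[OF n q] m_def by (simp add: sum_divide_distrib right_diff_distrib)
   also have "... = 0" using nws sA by (simp add: sum_subtractf sum_distrib_right[symmetric])
   finally show ?thesis .
  qed
  have sq2: "lint (C.kp k q) (%i. (xi k q i)\<^sup>2) = (r * \<mu>n n W q - m\<^sup>2) / real K" for k
  proof -
   have "lint (C.kp k q) (%i. (xi k q i)\<^sup>2) = (\<Sum>i\<in>{1..K}. nw (Suc n) i q * (A i q)\<^sup>2 - 2 * m * (nw (Suc n) i q * A i q) + m\<^sup>2 * nw (Suc n) i q) / real K"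
    unfolding xi_def int_resampling(1)[OF n q] sum_divide_distrib m_def[symmetric] using Kp
    by (intro sum.cong) (auto simp: power_divide power2_eq_square algebra_simps)
   also have "... = ((\<Sum>i\<in>{1..K}. nw (Suc n) i q * (A i q)\<^sup>2) - m\<^sup>2) / real K"
    using nws sA by (simp add: sum.distrib sum_subtractf sum_distrib_left[symmetric] power2_eq_square)
   finally show ?thesis unfolding sA2 .
  qed
  have v: "(\<Sum>k\<in>{1..K}. lint (C.kp k q) (%i. (xi k q i)\<^sup>2)) = r * \<mu>n n W q - m\<^sup>2"
   unfolding sq2 using Kp by simp
  define qq where "qq = \<bar>s\<bar> * \<bar>m\<bar> / sqrt (real K)"
  have q0: "qq >= 0" unfolding qq_def by simp
  have L1: "lint (C.kp k q) (%i. (xi k q i)\<^sup>2 * min 1 \<bar>s * xi k q i\<bar>) <= (2 * (r * (1 + r) * \<mu>n n ph q) + 2 * (r * \<mu>n n W q) * qq + 2 * m\<^sup>2) / real K" for k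
  proof -
   have "lint (C.kp k q) (%i. (xi k q i)\<^sup>2 * min 1 \<bar>s * xi k q i\<bar>) = (\<Sum>i\<in>{1..K}. nw (Suc n) i q * ((xi k q i)\<^sup>2 * min 1 \<bar>s * xi k q i\<bar>))"
    by (rule int_resampling(1)[OF n q])
   also have "... <= (\<Sum>i\<in>{1..K}. (2 * (r * (1 + r) * (hw n i q * ph (np n i q) / real K)) + 2 * (nw (Suc n) i q * (A i q)\<^sup>2) * qq + 2 * m\<^sup>2 * nw (Suc n) i q) / real K)"
   proof (rule sum_mono)
    fix i assume i: "i \<in> {1..K}"
    \<comment> \<open>\<open>r * c\<close> is the scaled size of the contribution of particle i, and
      \<open>qq\<close> that of the common centring.\<close>
    define c where "c = \<bar>s\<bar> * \<bar>f (np n i q)\<bar> * h i / sqrt (real K)"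
    have c0: "c >= 0" unfolding c_def using hp[OF i] by simp
    have sx: "\<bar>s * xi k q i\<bar> <= r * c + qq"
    proof -
     have "\<bar>s * xi k q i\<bar> = \<bar>s\<bar> * \<bar>A i q - m\<bar> / sqrt (real K)" unfolding xi_def m_def by (simp add: abs_mult)
     also have "... <= \<bar>s\<bar> * (\<bar>A i q\<bar> + \<bar>m\<bar>) / sqrt (real K)" by (intro divide_right_mono mult_left_mono) auto
     also have "... = r * c + qq" unfolding Ah[OF i] c_def qq_def using hp[OF i] Rp by (simp add: abs_mult algebra_simps add_divide_distrib)
     finally show ?thesis .
    qed
    have "min 1 \<bar>s * xi k q i\<bar> <= min 1 (r * c + qq)" using sx by (intro min.mono) auto
    also have "... <= min 1 (r * c) + qq" by (rule min_1_add_le[OF q0])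
    also have "... <= (1 + r) * min 1 c + qq" using min_1_mult_le[of r c] Rp c0 by simp
    finally have mb: "min 1 \<bar>s * xi k q i\<bar> <= (1 + r) * min 1 c + qq" .
    have "(A i q - m)\<^sup>2 * min 1 \<bar>s * xi k q i\<bar> <= (2 * (A i q)\<^sup>2 + 2 * m\<^sup>2) * min 1 \<bar>s * xi k q i\<bar>"
     by (intro mult_right_mono square_diff_le) auto
    also have "... = 2 * (A i q)\<^sup>2 * min 1 \<bar>s * xi k q i\<bar> + 2 * m\<^sup>2 * min 1 \<bar>s * xi k q i\<bar>" by (simp add: distrib_right)
    also have "... <= 2 * (A i q)\<^sup>2 * ((1 + r) * min 1 c + qq) + 2 * m\<^sup>2 * 1"
     using mb by (intro add_mono mult_left_mono) auto
    finally have "(A i q - m)\<^sup>2 * min 1 \<bar>s * xi k q i\<bar> <= 2 * (A i q)\<^sup>2 * ((1 + r) * min 1 c + qq) + 2 * m\<^sup>2" by simp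
    then have "nw (Suc n) i q * ((A i q - m)\<^sup>2 * min 1 \<bar>s * xi k q i\<bar>) / real K <= nw (Suc n) i q * (2 * (A i q)\<^sup>2 * ((1 + r) * min 1 c + qq) + 2 * m\<^sup>2) / real K"
     using nw0[OF i] Kp by (intro divide_right_mono mult_left_mono) auto
    moreover have "nw (Suc n) i q * ((xi k q i)\<^sup>2 * min 1 \<bar>s * xi k q i\<bar>) = nw (Suc n) i q * ((A i q - m)\<^sup>2 * min 1 \<bar>s * xi k q i\<bar>) / real K"
    proof -
     have "(xi k q i)\<^sup>2 = (A i q - m)\<^sup>2 / real K" unfolding xi_def m_def using Kp by (simp add: power_divide)
     then show ?thesis by simp
    qed
    moreover have "nw (Suc n) i q * (2 * (A i q)\<^sup>2 * ((1 + r) * min 1 c + qq) + 2 * m\<^sup>2)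
     = 2 * (nw (Suc n) i q * (A i q)\<^sup>2) * ((1 + r) * min 1 c) + 2 * (nw (Suc n) i q * (A i q)\<^sup>2) * qq + 2 * m\<^sup>2 * nw (Suc n) i q"
     by (simp add: algebra_simps)
    moreover have "2 * (nw (Suc n) i q * (A i q)\<^sup>2) * ((1 + r) * min 1 c) = 2 * (r * (1 + r) * (hw n i q * ph (np n i q) / real K))"
     unfolding nA2[OF i] ph_def W_def c_def h_def by simp
    ultimately show "nw (Suc n) i q * ((xi k q i)\<^sup>2 * min 1 \<bar>s * xi k q i\<bar>) <= (2 * (r * (1 + r) * (hw n i q * ph (np n i q) / real K)) + 2 * (nw (Suc n) i q * (A i q)\<^sup>2) * qq + 2 * m\<^sup>2 * nw (Suc n) i q) / real K"
     by simp
   qed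
   also have "... = (2 * (r * (1 + r) * (\<Sum>i\<in>{1..K}. hw n i q * ph (np n i q) / real K)) + 2 * (\<Sum>i\<in>{1..K}. nw (Suc n) i q * (A i q)\<^sup>2) * qq + 2 * m\<^sup>2 * (\<Sum>i\<in>{1..K}. nw (Suc n) i q)) / real K"
    unfolding sum_divide_distrib[symmetric] by (simp add: sum.distrib sum_distrib_left sum_distrib_right sum_divide_distrib)
   finally show ?thesis unfolding sA2 nws by (simp add: empn_def sum_divide_distrib)
  qed
  have "(\<Sum>k\<in>{1..K}. lint (C.kp k q) (%i. (xi k q i)\<^sup>2 * min 1 \<bar>s * xi k q i\<bar>)) <= (\<Sum>k\<in>{1..K}. (2 * (r * (1 + r) * \<mu>n n ph q) + 2 * (r * \<mu>n n W q) * qq + 2 * m\<^sup>2) / real K)"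
   by (intro sum_mono L1)
  also have "... = 2 * (r * (1 + r) * \<mu>n n ph q) + 2 * (r * \<mu>n n W q) * qq + 2 * m\<^sup>2" using Kp by simp
  finally show ?thesis using mean v unfolding qq_def r_def m_def by simp
 qed
 have ae: "AE q in P. \<forall>k\<in>{1..K}. integrable (C.kp k q) (%i. (xi k q i)\<^sup>2) \<and> (lint (C.kp k q) (%i. xi k q i)) = 0"
  using main int_resampling(2)[OF n] by (intro AE_I2) auto
 note ch = C.centred_sum_char(1)[OF xim ae ze \<sigma>2, of s] C.centred_sum_char(2)[OF xim ae ze \<sigma>2] C.centred_sum_char(3)[OF xim ae ze \<sigma>2, of s]
 define L where "L q = 2 * (R (Suc n) q * (1 + R (Suc n) q) * \<mu>n n ph q) + 2 * (R (Suc n) q * \<mu>n n W q) * (\<bar>s\<bar> * \<bar>\<mu>n n f q\<bar> / sqrt (real K)) + 2 * (\<mu>n n f q)\<^sup>2" for q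
 let ?D = "%q. (2 * s\<^sup>2 * L q + s\<^sup>2 / 2 * \<bar>R (Suc n) q * \<mu>n n W q - (\<mu>n n f q)\<^sup>2 - \<sigma>2\<bar>)"
 define La where "La q = (\<Sum>k\<in>{1..K}. lint (C.kp k q) (%v. (xi k q v)\<^sup>2 * min 1 \<bar>s * xi k q v\<bar>))" for q
 define v where "v q = (\<Sum>k\<in>{1..K}. lint (C.kp k q) (%v. (xi k q v)\<^sup>2))" for q
 have [measurable]: "La \<in> bmf P" "v \<in> bmf P"
  using C.F_into_P[OF ch(2)] C.F_into_P[OF ch(3)] unfolding La_def[abs_def] v_def[abs_def] by simp_all
 have phm: "ph \<in> bp a (Suc n)" "W \<in> bp a (Suc n)" unfolding ph_def W_def using f hm by simp_all
 have Rm[measurable]: "R (Suc n) \<in> bmf P" "\<mu>n n f \<in> bmf P" "\<mu>n n W \<in> bmf P" "\<mu>n n ph \<in> bmf P"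
  using R_meas[of "Suc n"] empn_meas_P[OF n f] empn_meas_P[OF n phm(1)] empn_meas_P[OF n phm(2)] n by auto
 have [measurable]: "L \<in> bmf P" unfolding L_def[abs_def] by measurable
 have La0: "La q >= 0" for q unfolding La_def by (intro sum_nonneg integral_nonneg_AE AE_I2) auto
 have Lv: "v q = R (Suc n) q * \<mu>n n W q - (\<mu>n n f q)\<^sup>2" "La q <= L q" if "q \<in> space P" for q
  using main[OF that] unfolding v_def La_def L_def by auto
 have "cmod ((CLINT q|P. ze q * iexp (s * (\<Sum>k\<in>{1..K}. xi k q (B (Suc n) k q)))) - of_real (exp (- (s\<^sup>2 * \<sigma>2 / 2))) * (CLINT q|P. ze q))
  <= lint P (%q. min 2 (2 * s\<^sup>2 * La q + s\<^sup>2 / 2 * \<bar>v q - \<sigma>2\<bar>))"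
  using ch(1) unfolding La_def v_def .
 also have "... <= lint P (%q. min 2 (?D q))"
 proof (rule integral_mono)
  show "min 2 (2 * s\<^sup>2 * La q + s\<^sup>2 / 2 * \<bar>v q - \<sigma>2\<bar>) <= min 2 (?D q)"
   if "q \<in> space P" for q
   unfolding Lv(1)[OF that, symmetric] using Lv(2)[OF that] by (intro min.mono add_mono mult_left_mono) auto
  show "integrable P (%q. min 2 (2 * s\<^sup>2 * La q + s\<^sup>2 / 2 * \<bar>v q - \<sigma>2\<bar>))"
   using La0 by (intro integrable_const_bound[where B=2]) auto
  show "integrable P (%q. min 2 (?D q))"
  proof (rule integrable_const_bound[where B=2], rule AE_I2)
   fix q assume "q \<in> space P"
   then have "L q >= 0" using order_trans[OF La0 Lv(2)] by simp
   then show "norm (min 2 (?D q)) <= 2" by simp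
  qed measurable
 qed
 finally show ?thesis unfolding sumeq L_def .
qed

end

section \<open>Laws of large numbers for one filter\<close>

lemma tendsto_0_approx_ennreal:
 fixes u :: "nat => ennreal"
 assumes "!!ep. ep > 0 ==> \<exists>v. (\<forall>i. u i <= v i + ennreal ep) \<and> v ---> 0"
 shows "u ---> 0"
proof (rule order_tendstoI)
 fix y :: ennreal assume "0 < y"
 then obtain c where c: "0 < c" "c < y" using dense by blast
 then obtain r where r: "0 < r" "ennreal r < y" by (cases c) auto
 obtain v where v: "!!i. u i <= v i + ennreal (r / 2)" "v ---> 0" using assms[of "r / 2"] r by auto
 have "eventually (%i. v i < ennreal (r / 2)) sequentially"
  using v(2) r by (intro order_tendstoD(2)) auto
 then show "eventually (%i. u i < y) sequentially"
 proof eventually_elim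
  case (elim i)
  have "u i <= ennreal (r / 2) + ennreal (r / 2)"
   using v(1)[of i] elim by (meson add_right_mono less_imp_le order_trans)
  also have "... = ennreal r" using r by (simp flip: ennreal_plus)
  finally show ?case using r by simp
 qed
qed simp

lemma add_tendsto_0_ennreal:
 fixes u v :: "nat => ennreal"
 assumes "u ---> 0" "v ---> 0"
 shows "(%i. u i + v i) ---> 0"
 using tendsto_add[OF assms] by simp

lemma sqrt_div_Suc_tendsto_0: "(%i. ennreal (sqrt (b / real (Suc i)))) ---> 0"
proof -
 have "(%i. b / real (Suc i)) ---> 0" by (rule LIMSEQ_Suc[OF lim_const_over_n])
 then have "(%i. sqrt (b / real (Suc i))) ---> sqrt 0" by (intro tendsto_real_sqrt)
 then show ?thesis using tendsto_ennrealI by fastforce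
qed

text \<open>Runs exist from one particle on, so the sequence is indexed by i with
  \<open>Suc i\<close> particles.\<close>

locale run_seq = pf_setting S
 for S :: "('x, 'y) pf_model" +
 fixes P :: "nat => 'w measure"
  and X :: "nat => nat => nat => 'w => 'x"
  and B :: "nat => nat => nat => 'w => nat"
 assumes run: "!!K. K >= 1 ==> parallel_filters S K (P K) (X K) (B K)"
begin

abbreviation "pr i == P (Suc i)"
abbreviation (input) "rt i == sqrt (real (Suc i))"

lemma prob_pr: "prob_space (pr i)"
 using run[of "Suc i"] by (simp add: parallel_filters_def)

sublocale prob_seq pr by (rule prob_seq.intro) (rule prob_pr)

end

locale run_seq_seg = run_seq S P X B
 for S :: "('x, 'y) pf_model" and P :: "nat => 'w measure"
  and X :: "nat => nat => nat => 'w => 'x" and B :: "nat => nat => nat => 'w => nat" +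
 fixes j :: nat
 assumes j_less: "j < n_filters S"
begin

abbreviation "a == j * seg_len S"
abbreviation "e == Suc j * seg_len S"
abbreviation "em i == emp S (Suc i) (X (Suc i)) (B (Suc i)) (Suc j)"
abbreviation "en i == empn S (Suc i) (X (Suc i)) (B (Suc i)) (Suc j)"
abbreviation "Rr i t == em i t (%z. 1 / hr a t z)"

lemma SR: "seg_run S (Suc i) (pr i) (X (Suc i)) (B (Suc i)) j"
 unfolding seg_run_def seg_run_axioms_def using pf_setting_axioms run[of "Suc i"] j_less by simp

lemma block_a: "block S a" by (auto simp: block_def)
lemma a_less_e: "a < e" using seg_len_pos by simp
lemma e_le_U: "e <= U" unfolding horizon_def using j_less by (intro mult_le_mono1) simp

lemma em_meas: "a <= t ==> t <= e ==> f \<in> bp a t ==> em i t f \<in> bmf (pr i)"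
 by (rule seg_run.emp_meas_P[OF SR])

lemma en_meas: "a <= n ==> n < e ==> f \<in> bp a (Suc n) ==> en i n f \<in> bmf (pr i)"
 by (rule seg_run.empn_meas_P[OF SR])

lemma em_add: "em i t (%z. f z + g z) q = em i t f q + em i t g q"
 unfolding emp_def by (simp add: distrib_left sum.distrib add_divide_distrib)

lemma en_add: "en i n (%z. f z + g z) q = en i n f q + en i n g q"
 unfolding empn_def by (simp add: distrib_left sum.distrib add_divide_distrib)

text \<open>Positive weights let the absolute value move inside, and unbiasedness evaluates the
  resulting mean: the contraction in L1.\<close>

lemma em_abs:
 assumes "a <= t" "t <= e" "f \<in> bp a t"
 shows "nint (pr i) (%q. ennreal \<bar>em i t f q\<bar>) <= nint (lw a t) (%z. ennreal \<bar>f z\<bar>)"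
proof -
 have "nint (pr i) (%q. ennreal \<bar>em i t f q\<bar>) <= nint (pr i) (%q. ennreal (em i t (%z. \<bar>f z\<bar>) q))"
 proof (intro nn_integral_mono ennreal_leI)
  fix q assume q: "q \<in> space (pr i)"
  have "\<bar>hwt S (Suc i) (X (Suc i)) (B (Suc i)) (Suc j) t k q * f x\<bar> = hwt S (Suc i) (X (Suc i)) (B (Suc i)) (Suc j) t k q * \<bar>f x\<bar>" if "k \<in> {1..Suc i}" for k x
   using seg_run.hw_pos[OF SR assms(1,2) q that] by (simp add: abs_mult)
  then show "\<bar>em i t f q\<bar> <= em i t (%z. \<bar>f z\<bar>) q"
   unfolding emp_def abs_divide using sum_abs[of "%k. hwt S (Suc i) (X (Suc i)) (B (Suc i)) (Suc j) t k q * f (rpath S (X (Suc i)) (B (Suc i)) (Suc j) t k q)" "{1..Suc i}"]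
   by (simp add: divide_right_mono)
 qed
 also have "... = nint (lw a t) (%z. ennreal \<bar>f z\<bar>)" using assms by (intro seg_run.nn_emp[OF SR]) auto
 finally show ?thesis .
qed

lemma en_abs:
 assumes "a <= n" "n < e" "f \<in> bp a (Suc n)"
 shows "nint (pr i) (%q. ennreal \<bar>en i n f q\<bar>) <= nint (lw a (Suc n)) (%z. ennreal \<bar>f z\<bar>)"
proof -
 have "nint (pr i) (%q. ennreal \<bar>en i n f q\<bar>) <= nint (pr i) (%q. ennreal (en i n (%z. \<bar>f z\<bar>) q))"
 proof (intro nn_integral_mono ennreal_leI)
  fix q assume q: "q \<in> space (pr i)"
  have "\<bar>hwt S (Suc i) (X (Suc i)) (B (Suc i)) (Suc j) n k q * f x\<bar> = hwt S (Suc i) (X (Suc i)) (B (Suc i)) (Suc j) n k q * \<bar>f x\<bar>" if "k \<in> {1..Suc i}" for k x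
   using seg_run.hw_pos[OF SR assms(1) less_imp_le[OF assms(2)] q that] by (simp add: abs_mult)
  then show "\<bar>en i n f q\<bar> <= en i n (%z. \<bar>f z\<bar>) q"
   unfolding empn_def abs_divide using sum_abs[of "%k. hwt S (Suc i) (X (Suc i)) (B (Suc i)) (Suc j) n k q * f (npath S (X (Suc i)) (B (Suc i)) (Suc j) n k q)" "{1..Suc i}"]
   by (simp add: divide_right_mono)
 qed
 also have "... = nint (lw a (Suc n)) (%z. ennreal \<bar>f z\<bar>)" using assms by (intro seg_run.nn_empn[OF SR]) auto
 finally show ?thesis .
qed

text \<open>A law of large numbers in mean for functions that are bounded and vanish where the weight \<open>h\<close> is
 large extends to all integrable functions by truncation, since the empirical measure is a
 contraction in mean.\<close>

lemma lln_truncation: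
 fixes T :: "nat => ((nat => 'x) => real) => 'w => real" and h :: "(nat => 'x) => real"
 assumes L: "prob_space L" and sL: "sets L = sets (PP I)" and hm[measurable]: "h \<in> bmf (PP I)"
  and meas[measurable]: "!!f i. f \<in> bmf (PP I) ==> T i f \<in> bmf (pr i)"
  and add: "!!f g i q. T i (%z. f z + g z) q = T i f q + T i g q"
  and bd: "!!f i. f \<in> bmf (PP I) ==> (nint (pr i) (%q. ennreal \<bar>T i f q\<bar>)) <= nint L (%z. ennreal \<bar>f z\<bar>)"
  and nice: "!!f C. f \<in> bmf (PP I) ==> C >= 0 ==> (!!z. \<bar>f z\<bar> <= C) ==> (!!z. f z ~= 0 ==> h z <= C) ==>
   (%i. nint (pr i) (%q. ennreal \<bar>T i f q - lint L (%z. f z)\<bar>)) ---> 0"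
  and f: "integrable L f"
 shows "(%i. nint (pr i) (%q. ennreal \<bar>T i f q - lint L (%z. f z)\<bar>)) ---> 0"
proof (rule tendsto_0_approx_ennreal)
 interpret L: prob_space L by (rule L)
 note [measurable_cong] = sL
 have fm[measurable]: "f \<in> bmf (PP I)" using f measurable_cong_sets[OF sL refl] by blast
 fix ep :: real assume ep: "ep > 0"
 \<comment> \<open>Where \<open>g\<close> is nonzero both |f| and h are at most n, so g^2 h is
   bounded and the one-step error bounds apply; the discarded part is dominated by |f|.\<close>
 define g where "g n z = (if \<bar>f z\<bar> <= real n \<and> h z <= real n then f z else 0)" for n :: nat and z
 have gm[measurable]: "g n \<in> bmf (PP I)" for n unfolding g_def[abs_def] by measurable
 have gi: "integrable L (g n)" for n by (rule int_bound[OF f]) (auto simp: g_def)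
 have "(%n. lint L (%z. \<bar>f z - g n z\<bar>)) ---> (lint L (%z. 0))"
 proof (rule integral_dominated_convergence[where w="%z. \<bar>f z\<bar>"])
  show "AE z in L. (%n. \<bar>f z - g n z\<bar>) ---> 0"
  proof (rule AE_I2)
   fix z
   obtain N where N: "max \<bar>f z\<bar> (h z) <= real N" using real_arch_simple by blast
   have "eventually (%n. \<bar>f z - g n z\<bar> = 0) sequentially"
    using eventually_ge_at_top[of N]
   proof eventually_elim
    case (elim n)
    then have "real N <= real n" by simp
    then show ?case using N by (auto simp: g_def)
   qed
   then show "(%n. \<bar>f z - g n z\<bar>) ---> 0" by (rule tendsto_eventually)
  qed
  show "AE z in L. norm \<bar>f z - g n z\<bar> <= \<bar>f z\<bar>" for n by (auto simp: g_def)
 qed (use f in auto)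
 then have "eventually (%n. (lint L (%z. \<bar>f z - g n z\<bar>)) < ep / 2) sequentially"
  using ep by (intro order_tendstoD(2)[where y="lint L (%z. 0)"]) auto
 then obtain n where n: "lint L (%z. \<bar>f z - g n z\<bar>) < ep / 2" by (auto simp: eventually_sequentially)
 let ?v = "%i. nint (pr i) (%q. ennreal \<bar>T i (g n) q - lint L (%z. g n z)\<bar>)"
 have "nint (pr i) (%q. ennreal \<bar>T i f q - lint L (%z. f z)\<bar>) <= ?v i + ennreal ep" for i
 proof -
  interpret Pi: prob_space "pr i" by (rule prob_pr)
  define r where "r z = f z - g n z" for z
  have rm[measurable]: "r \<in> bmf (PP I)" unfolding r_def[abs_def] by measurable
  have ri: "integrable L r" unfolding r_def[abs_def] using f gi by simp
  have Tf: "T i f q = T i (g n) q + T i r q" for q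
   using add[of i "g n" r q] by (simp add: r_def)
  have If: "lint L (%z. f z) = lint L (%z. g n z) + lint L (%z. r z)" unfolding r_def using f gi by simp
  have rI: "nint L (%z. ennreal \<bar>r z\<bar>) <= ennreal (ep / 2)"
   using n ri unfolding r_def[symmetric] by (subst nn_integral_eq_integral) (auto intro: ennreal_leI)
  have "nint (pr i) (%q. ennreal \<bar>T i f q - lint L (%z. f z)\<bar>) <= nint (pr i) (%q. ennreal \<bar>T i (g n) q - lint L (%z. g n z)\<bar> + (ennreal \<bar>T i r q\<bar> + ennreal (ep / 2)))"
  proof (rule nn_integral_mono)
   fix q
   have "\<bar>lint L (%z. r z)\<bar> <= ep / 2" using integral_abs_bound[of L r] n unfolding r_def by linarith
   then have "\<bar>T i f q - lint L (%z. f z)\<bar> <= \<bar>T i (g n) q - lint L (%z. g n z)\<bar> + (\<bar>T i r q\<bar> + ep / 2)"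
    unfolding Tf If by linarith
   then show "ennreal \<bar>T i f q - lint L (%z. f z)\<bar> <= ennreal \<bar>T i (g n) q - lint L (%z. g n z)\<bar> + (ennreal \<bar>T i r q\<bar> + ennreal (ep / 2))"
    using ep by (simp add: ennreal_leI flip: ennreal_plus)
  qed
  also have "... = ?v i + ((nint (pr i) (%q. ennreal \<bar>T i r q\<bar>)) + ennreal (ep / 2))"
   using Pi.emeasure_space_1 by (simp add: nn_integral_add)
  also have "... <= ?v i + (ennreal (ep / 2) + ennreal (ep / 2))"
   using order_trans[OF bd[OF rm] rI] by (intro add_mono) auto
  also have "ennreal (ep / 2) + ennreal (ep / 2) = ennreal ep" using ep by (simp flip: ennreal_plus)
  finally show ?thesis .
 qed
 moreover have "?v ---> 0" by (rule nice[of _ "real n"]) (auto simp: g_def split: if_splits)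
 ultimately show "\<exists>v. (\<forall>i. (nint (pr i) (%q. ennreal \<bar>T i f q - lint L (%z. f z)\<bar>)) <= v i + ennreal ep) \<and> v ---> 0" by (intro exI[of _ ?v] conjI allI)
qed

lemma L1_add_split:
 assumes [measurable]: "g \<in> bmf (pr i)" "h \<in> bmf (pr i)"
 shows "nint (pr i) (%q. ennreal \<bar>g q - c\<bar>) <= nint (pr i) (%q. ennreal \<bar>g q - h q\<bar>) + nint (pr i) (%q. ennreal \<bar>h q - c\<bar>)"
proof -
 have "nint (pr i) (%q. ennreal \<bar>g q - c\<bar>) <= nint (pr i) (%q. ennreal \<bar>g q - h q\<bar> + ennreal \<bar>h q - c\<bar>)"
  by (intro nn_integral_mono) (simp add: ennreal_leI flip: ennreal_plus)
 then show ?thesis by (simp add: nn_integral_add)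
qed

lemma nn_nice_square:
 assumes L: "prob_space L" and C: "C >= 0" "!!z. \<bar>f z\<bar> <= C" "!!z. f z ~= 0 ==> h z <= C"
 shows "nint L (%z. ennreal ((f z)\<^sup>2 * h z)) <= ennreal (C ^ 3)"
proof -
 interpret prob_space L by (rule L)
 have "(f z)\<^sup>2 * h z <= C ^ 3" for z
 proof (cases "f z = 0")
  case False
  have "(f z)\<^sup>2 * h z <= (f z)\<^sup>2 * C" using C(3)[OF False] by (intro mult_left_mono) auto
  also have "(f z)\<^sup>2 <= C\<^sup>2" using C(2)[of z] C(1) by (simp add: abs_le_square_iff[symmetric])
  then have "(f z)\<^sup>2 * C <= C\<^sup>2 * C" using C(1) by (rule mult_right_mono)
  finally show ?thesis by (simp add: power2_eq_square power3_eq_cube)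
 qed (use C in simp)
 then have "nint L (%z. ennreal ((f z)\<^sup>2 * h z)) <= nint L (%z. ennreal (C ^ 3))" by (intro nn_integral_mono ennreal_leI)
 then show ?thesis by (simp add: emeasure_space_1)
qed

text \<open>For truncated functions the sampling error is of order K^(-1/2) in mean. What is left is
  the empirical mean of the conditional expectation \<open>fb\<close> at the previous time, to which
  the induction hypothesis applies.\<close>

lemma lln_en_step:
 assumes n: "a <= n" "n < e"
  and IH: "!!f. integrable (lw a n) f ==> (%i. nint (pr i) (%q. ennreal \<bar>em i n f q - lint (lw a n) (%z. f z)\<bar>)) ---> 0"
  and f: "integrable (lw a (Suc n)) f"
 shows "(%i. nint (pr i) (%q. ennreal \<bar>en i n f q - lint (lw a (Suc n)) (%z. f z)\<bar>)) ---> 0"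
proof (rule lln_truncation[where T="%i. en i n" and L="lw a (Suc n)" and I="{a<..Suc n}" and h="hr a n"])
 have nU: "n < U" using n e_le_U by simp
 show L: "prob_space (lw a (Suc n))" using n nU by (intro prob_law block_a) auto
 show "sets (lw a (Suc n)) = sets (PP {a<..Suc n})" by simp
 show "hr a n \<in> bp a (Suc n)" using nU by (intro hrel_measurable block_a) auto
 show mm: "en i n f \<in> bmf (pr i)" if "f \<in> bp a (Suc n)" for f i
  by (rule en_meas[OF n that])
 show "en i n (%z. f z + g z) q = en i n f q + en i n g q" for f g i q by (rule en_add)
 show "nint (pr i) (%q. ennreal \<bar>en i n f q\<bar>) <= nint (lw a (Suc n)) (%z. ennreal \<bar>f z\<bar>)" if "f \<in> bp a (Suc n)" for f i
  by (rule en_abs[OF n that])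
 show "integrable (lw a (Suc n)) f" by (rule f)
 fix f C assume f: "f \<in> bp a (Suc n)" and C: "(C::real) >= 0" "!!z. \<bar>f z\<bar> <= C" "!!z. f z ~= 0 ==> hr a n z <= C"
 interpret L: prob_space "lw a (Suc n)" by (rule L)
 define fb where "fb z = lint (nl n z) (%x. f (z(Suc n := x)))" for z
 have fi: "integrable (lw a (Suc n)) f" using f C by (intro L.integrable_const_bound[where B=C]) (auto simp: measurable_cong_sets[OF sets_law refl])
 note FI = int_law_Suc[OF block_a n(1) nU fi, folded fb_def]
 have fbm: "fb \<in> bp a n"
  using FI(2) measurable_cong_sets[OF sets_law refl] by blast
 show "(%i. nint (pr i) (%q. ennreal \<bar>en i n f q - lint (lw a (Suc n)) (%z. f z)\<bar>)) ---> 0"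
 proof (rule tendsto_0_le_ennreal)
  fix i
  show "nint (pr i) (%q. ennreal \<bar>en i n f q - lint (lw a (Suc n)) (%z. f z)\<bar>) \<le>
    ennreal (sqrt (C ^ 3 / real (Suc i))) + nint (pr i) (%q. ennreal \<bar>em i n fb q - lint (lw a (Suc n)) (%z. f z)\<bar>)"
   using L1_add_split[OF mm[OF f] em_meas[OF n(1) less_imp_le[OF n(2)] fbm], of i "lint (lw a (Suc n)) (%z. f z)"]
    seg_run.emp_sampling_L1[OF SR n f fbm AE_I2[OF fb_def] nn_nice_square[OF L C], of i] C(1)
   by (meson add_right_mono order_trans zero_le_power)
  show "(%i. ennreal (sqrt (C ^ 3 / real (Suc i))) + nint (pr i) (%q. ennreal \<bar>em i n fb q - lint (lw a (Suc n)) (%z. f z)\<bar>)) ---> 0"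
   unfolding FI(3) by (intro add_tendsto_0_ennreal sqrt_div_Suc_tendsto_0 IH FI(2))
 qed
qed

text \<open>Same scheme as for sampling, except that resampling keeps the function and that the
  truncation refers to h at the current time.\<close>

lemma lln_em_step:
 assumes n: "a <= n" "n < e"
  and IH: "!!f. integrable (lw a (Suc n)) f ==> (%i. nint (pr i) (%q. ennreal \<bar>en i n f q - lint (lw a (Suc n)) (%z. f z)\<bar>)) ---> 0"
  and f: "integrable (lw a (Suc n)) f"
 shows "(%i. nint (pr i) (%q. ennreal \<bar>em i (Suc n) f q - lint (lw a (Suc n)) (%z. f z)\<bar>)) ---> 0"
proof (rule lln_truncation[where T="%i. em i (Suc n)" and L="lw a (Suc n)" and I="{a<..Suc n}" and h="hr a (Suc n)"])
 have nU: "n < U" using n e_le_U by simp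
 have Sn: "a <= Suc n" "Suc n <= e" using n by auto
 show L: "prob_space (lw a (Suc n))" using n nU by (intro prob_law block_a) auto
 show "sets (lw a (Suc n)) = sets (PP {a<..Suc n})" by simp
 show "hr a (Suc n) \<in> bp a (Suc n)" using nU by (intro hrel_measurable block_a) auto
 show mm: "em i (Suc n) f \<in> bmf (pr i)" if "f \<in> bp a (Suc n)" for f i
  by (rule em_meas[OF Sn that])
 show "em i (Suc n) (%z. f z + g z) q = em i (Suc n) f q + em i (Suc n) g q" for f g i q by (rule em_add)
 show "nint (pr i) (%q. ennreal \<bar>em i (Suc n) f q\<bar>) <= nint (lw a (Suc n)) (%z. ennreal \<bar>f z\<bar>)" if "f \<in> bp a (Suc n)" for f i
  by (rule em_abs[OF Sn that])
 show "integrable (lw a (Suc n)) f" by (rule f)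
 fix f C assume f: "f \<in> bp a (Suc n)" and C: "(C::real) >= 0" "!!z. \<bar>f z\<bar> <= C" "!!z. f z ~= 0 ==> hr a (Suc n) z <= C"
 interpret L: prob_space "lw a (Suc n)" by (rule L)
 have fi: "integrable (lw a (Suc n)) f" using f C by (intro L.integrable_const_bound[where B=C]) (auto simp: measurable_cong_sets[OF sets_law refl])
 show "(%i. nint (pr i) (%q. ennreal \<bar>em i (Suc n) f q - lint (lw a (Suc n)) (%z. f z)\<bar>)) ---> 0"
 proof (rule tendsto_0_le_ennreal)
  fix i
  show "nint (pr i) (%q. ennreal \<bar>em i (Suc n) f q - lint (lw a (Suc n)) (%z. f z)\<bar>) \<le>
    ennreal (sqrt (C ^ 3 / real (Suc i))) + nint (pr i) (%q. ennreal \<bar>en i n f q - lint (lw a (Suc n)) (%z. f z)\<bar>)"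
   using L1_add_split[OF mm[OF f] en_meas[OF n f], of i "lint (lw a (Suc n)) (%z. f z)"]
    seg_run.emp_resampling_L1[OF SR n f nn_nice_square[OF L C], of i] C(1)
   by (meson add_right_mono order_trans zero_le_power)
  show "(%i. ennreal (sqrt (C ^ 3 / real (Suc i))) + nint (pr i) (%q. ennreal \<bar>en i n f q - lint (lw a (Suc n)) (%z. f z)\<bar>)) ---> 0"
   by (intro add_tendsto_0_ennreal sqrt_div_Suc_tendsto_0 IH fi)
 qed
qed

lemma em_a: "em i a f q = f (%_. undefined)"
 unfolding emp_def by (simp add: seg_run.rp_a[OF SR] seg_run.hw_a[OF SR] del: of_nat_Suc)

lemma int_law_a: "lint (lw a a) (%z. (f z :: real)) = f (%_. undefined)"
 unfolding law_refl PiM_empty by (simp add: lebesgue_integral_count_space_finite)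

lemma lln_em:
 assumes t: "a <= t" "t <= e" and f: "integrable (lw a t) f"
 shows "(%i. nint (pr i) (%q. ennreal \<bar>em i t f q - lint (lw a t) (%z. f z)\<bar>)) ---> 0"
 using t f
proof (induction t arbitrary: f rule: dec_induct)
 case base
 show ?case by (simp add: em_a int_law_a)
next
 case (step n)
 then have n: "a <= n" "n < e" by auto
 show ?case
  by (rule lln_em_step[OF n lln_en_step[OF n step.IH[OF less_imp_le[OF n(2)]]] step.prems(2)])
qed

lemma lln_en:
 assumes n: "a <= n" "n < e" and f: "integrable (lw a (Suc n)) f"
 shows "(%i. nint (pr i) (%q. ennreal \<bar>en i n f q - lint (lw a (Suc n)) (%z. f z)\<bar>)) ---> 0"
 by (rule lln_en_step[OF n lln_em[OF n(1) less_imp_le[OF n(2)]] f])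

lemma em_conv_prob: "a <= t ==> t <= e ==> integrable (lw a t) f ==> conv_prob pr (%i. em i t f) (lint (lw a t) (%z. f z))"
 by (rule conv_prob_L1[OF em_meas[OF _ _ integrable_law_meas] lln_em])

lemma en_conv_prob: "a <= n ==> n < e ==> integrable (lw a (Suc n)) f ==> conv_prob pr (%i. en i n f) (lint (lw a (Suc n)) (%z. f z))"
 by (rule conv_prob_L1[OF en_meas[OF _ _ integrable_law_meas] lln_en])

lemma R_conv_prob:
 assumes "a <= t" "t <= e"
 shows "conv_prob pr (%i. Rr i t) 1"
proof -
 have U: "t <= U" using assms(2) e_le_U by (rule order_trans)
 show ?thesis
  using em_conv_prob[OF assms integrable_inverse_hrel(1)[OF block_a assms(1) U]] unfolding integrable_inverse_hrel(2)[OF block_a assms(1) U] .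
qed

end

subsection \<open>Central limit theorem for a single filter\<close>

text \<open>A martingale \<open>F t(X\<^sub>a\<^sub>+\<^sub>1, \<dots>, X\<^sub>t)\<close> under the law without resampling, with the second moments that
 control the fluctuations of its empirical means.\<close>

definition mart_chain :: "('x, 'y) pf_model => nat => nat => (nat => (nat => 'x) => real) => bool" where
 "mart_chain S a e F \<longleftrightarrow>
   (\<forall>t\<in>{a..e}. F t \<in> bmf (path_space S {a<..t})) \<and>
   (\<forall>n\<in>{a..<e}. AE z in law S a n. F n z = lint (next_law S n z) (%x. F (Suc n) (z(Suc n := x)))) \<and>
   (\<forall>n\<in>{a..<e}. integrable (law S a (Suc n)) (%z. (F (Suc n) z)\<^sup>2 * hrel S a n z)) \<and>
   (\<forall>n\<in>{a..<e}. integrable (law S a (Suc n)) (%z. (F (Suc n) z)\<^sup>2 * hrel S a (Suc n) z))"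

text \<open>With t = n + 1, \<open>varS\<close> and \<open>varR\<close> are the limiting variances
  of the sampling and the resampling increment at time t. No squared mean is subtracted in
  \<open>varR\<close>, in accordance with chains that start at zero.\<close>

definition varS :: "('x, 'y) pf_model => nat => (nat => (nat => 'x) => real) => nat => real" where
 "varS S a F n = lint (law S a (Suc n)) (%z. (F (Suc n) z)\<^sup>2 * hrel S a n z) - lint (law S a n) (%z. (F n z)\<^sup>2 * hrel S a n z)"

definition varR :: "('x, 'y) pf_model => nat => (nat => (nat => 'x) => real) => nat => real" where
 "varR S a F n = lint (law S a (Suc n)) (%z. (F (Suc n) z)\<^sup>2 * hrel S a (Suc n) z)"

context run_seq_seg
begin

lemma mart_chain_meas: "mart_chain S a e F ==> a <= t ==> t <= e ==> F t \<in> bp a t"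
 by (auto simp: mart_chain_def)

lemma mart_chainD:
 assumes "mart_chain S a e F" "a <= n" "n < e"
 shows "AE z in lw a n. F n z = lint (nl n z) (%x. F (Suc n) (z(Suc n := x)))"
  and "integrable (lw a (Suc n)) (%z. (F (Suc n) z)\<^sup>2 * hr a n z)"
  and "integrable (lw a (Suc n)) (%z. (F (Suc n) z)\<^sup>2 * hr a (Suc n) z)"
 using assms by (auto simp: mart_chain_def)

lemma hpos: "a <= u ==> u <= t ==> t <= e ==> z \<in> sp a t ==> hr a u z > 0"
 using e_le_U by (intro hrel_pos[OF block_a, of u t]) auto

lemma hmeas: "u <= t ==> t <= e ==> hr a u \<in> bp a t"
 using e_le_U by (intro hrel_measurable block_a) auto

lemma nn_of_int:
 assumes "integrable (lw a t) (%z. (f z)\<^sup>2 * hr a u z)" "a <= u" "u <= t" "t <= e"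
 shows "nint (lw a t) (%z. ennreal ((f z)\<^sup>2 * hr a u z)) <= ennreal (lint (lw a t) (%z. (f z)\<^sup>2 * hr a u z))"
  and "0 <= lint (lw a t) (%z. (f z)\<^sup>2 * hr a u z)"
proof -
 have nn: "AE z in lw a t. 0 <= (f z)\<^sup>2 * hr a u z"
  using hpos[OF assms(2-4)] by (intro AE_I2) (simp add: less_imp_le)
 show "nint (lw a t) (%z. ennreal ((f z)\<^sup>2 * hr a u z)) <= ennreal (lint (lw a t) (%z. (f z)\<^sup>2 * hr a u z))"
  using nn_integral_eq_integral[OF assms(1) nn] by simp
 show "0 <= lint (lw a t) (%z. (f z)\<^sup>2 * hr a u z)" using nn by (rule integral_nonneg_AE)
qed

text \<open>The inequality 2 |x| <= x^2 h + 1 / h bounds the function by two integrable ones, since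
  1 / h is a probability density.\<close>

lemma mart_chain_integrable:
 assumes c: "mart_chain S a e F" and n: "a <= n" "n < e"
 shows "integrable (lw a (Suc n)) (F (Suc n))"
proof (rule int_bound)
 show "integrable (lw a (Suc n)) (%z. (F (Suc n) z)\<^sup>2 * hr a (Suc n) z + 1 / hr a (Suc n) z)"
  using mart_chainD(3)[OF c n] integrable_inverse_hrel(1)[OF block_a, of "Suc n"] n e_le_U by auto
 show "F (Suc n) \<in> bmf (lw a (Suc n))"
  using mart_chain_meas[OF c, of "Suc n"] n by (intro measurable_law) auto
 show "AE z in lw a (Suc n). norm (F (Suc n) z) <= norm ((F (Suc n) z)\<^sup>2 * hr a (Suc n) z + 1 / hr a (Suc n) z)"
 proof (rule AE_I2)
  fix z assume "z \<in> space (lw a (Suc n))"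
  then have h: "hr a (Suc n) z > 0" using n by (intro hpos[of _ "Suc n"]) auto
  define x where "x = \<bar>F (Suc n) z\<bar>"
  have "0 <= (x * hr a (Suc n) z - 1)\<^sup>2" by simp
  then have "2 * x * hr a (Suc n) z <= (x * hr a (Suc n) z)\<^sup>2 + 1" by (simp add: power2_eq_square algebra_simps)
  then have "2 * x <= ((x * hr a (Suc n) z)\<^sup>2 + 1) / hr a (Suc n) z" using h by (simp add: pos_le_divide_eq)
  also have "... = x\<^sup>2 * hr a (Suc n) z + 1 / hr a (Suc n) z" using h by (simp add: add_divide_distrib power2_eq_square)
  also have "x\<^sup>2 = (F (Suc n) z)\<^sup>2" by (simp add: x_def)
  finally have "2 * x <= (F (Suc n) z)\<^sup>2 * hr a (Suc n) z + 1 / hr a (Suc n) z" .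
  moreover have "x >= 0" by (simp add: x_def)
  ultimately have "x <= (F (Suc n) z)\<^sup>2 * hr a (Suc n) z + 1 / hr a (Suc n) z" by linarith
  then show "norm (F (Suc n) z) <= norm ((F (Suc n) z)\<^sup>2 * hr a (Suc n) z + 1 / hr a (Suc n) z)"
   unfolding x_def real_norm_def by (rule order_trans[OF _ abs_ge_self])
 qed
qed

lemma mart_chain_mean:
 assumes c: "mart_chain S a e F" and t: "a <= t" "t <= e"
 shows "lint (lw a t) (%z. F t z) = F a (%_. undefined)"
 using t
proof (induction t rule: dec_induct)
 case base
 show ?case by (rule int_law_a)
next
 case (step n)
 then have n: "a <= n" "n < e" "n < U" using e_le_U by auto
 note I = int_law_Suc[OF block_a n(1,3) mart_chain_integrable[OF c n(1,2)]]
 have "lint (lw a (Suc n)) (%z. F (Suc n) z) = lint (lw a n) (%z. F n z)"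
  unfolding I(3)
  using mart_chainD(1)[OF c n(1,2)] mart_chain_meas[OF c n(1) less_imp_le[OF n(2)]] I(2)
  by (intro integral_cong_AE) (auto intro: measurable_law borel_measurable_integrable)
 then show ?case using step n by simp
qed

text \<open>The martingale property makes the successive conditional means cancel, so the one-step
  errors add up. The constant depends only on weighted second moments, which is essential when the
  chain itself is random with second moments tending to zero.\<close>

lemma em_chain_L1:
 assumes c: "mart_chain S a e F" and t: "a <= t" "t <= e"
 shows "nint (pr i) (%q. ennreal \<bar>em i t (F t) q - F a (%_. undefined)\<bar>) \<le>
  ennreal ((\<Sum>n\<in>{a..<t}. sqrt (lint (lw a (Suc n)) (%z. (F (Suc n) z)\<^sup>2 * hr a n z)) + sqrt (lint (lw a (Suc n)) (%z. (F (Suc n) z)\<^sup>2 * hr a (Suc n) z))) / rt i)"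
 using t
proof (induction t rule: dec_induct)
 case base
 show ?case by (simp add: em_a)
next
 case (step n)
 then have n: "a <= n" "n < e" by auto
 define bS where "bS n = lint (lw a (Suc n)) (%z. (F (Suc n) z)\<^sup>2 * hr a n z)" for n
 define bR where "bR n = lint (lw a (Suc n)) (%z. (F (Suc n) z)\<^sup>2 * hr a (Suc n) z)" for n
 have Fm: "F (Suc n) \<in> bp a (Suc n)" "F n \<in> bp a n"
  using mart_chain_meas[OF c] n by auto
 have bS0: "0 <= bS n" "0 <= bR n" if "a <= n" "n < e" for n
  unfolding bS_def bR_def using nn_of_int(2)[OF mart_chainD(2)[OF c that]] nn_of_int(2)[OF mart_chainD(3)[OF c that]] that by auto
 have 1: "nint (pr i) (%q. ennreal \<bar>en i n (F (Suc n)) q - em i n (F n) q\<bar>) <= ennreal (sqrt (bS n / real (Suc i)))"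
  unfolding bS_def
  using nn_of_int[OF mart_chainD(2)[OF c n]] n by (intro seg_run.emp_sampling_L1[OF SR n Fm mart_chainD(1)[OF c n]]) auto
 have 2: "nint (pr i) (%q. ennreal \<bar>em i (Suc n) (F (Suc n)) q - en i n (F (Suc n)) q\<bar>) <= ennreal (sqrt (bR n / real (Suc i)))"
  unfolding bR_def
  using nn_of_int[OF mart_chainD(3)[OF c n]] n by (intro seg_run.emp_resampling_L1[OF SR n Fm(1)]) auto
 define c0 where "c0 = F a (%_. undefined)"
 have "nint (pr i) (%q. ennreal \<bar>em i (Suc n) (F (Suc n)) q - c0\<bar>) \<le>
  (nint (pr i) (%q. ennreal \<bar>em i (Suc n) (F (Suc n)) q - en i n (F (Suc n)) q\<bar>)) + nint (pr i) (%q. ennreal \<bar>en i n (F (Suc n)) q - c0\<bar>)"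
  using n Fm by (intro L1_add_split em_meas en_meas) auto
 also have "... <= nint (pr i) (%q. ennreal \<bar>em i (Suc n) (F (Suc n)) q - en i n (F (Suc n)) q\<bar>) +
   ((nint (pr i) (%q. ennreal \<bar>en i n (F (Suc n)) q - em i n (F n) q\<bar>)) + nint (pr i) (%q. ennreal \<bar>em i n (F n) q - c0\<bar>))"
  using n Fm by (intro add_left_mono L1_add_split em_meas en_meas) auto
 also have "... <= ennreal (sqrt (bR n / real (Suc i))) + (ennreal (sqrt (bS n / real (Suc i))) + ennreal ((\<Sum>n\<in>{a..<n}. sqrt (bS n) + sqrt (bR n)) / rt i))"
  using step.IH n 1 2 unfolding c0_def bS_def[symmetric] bR_def[symmetric] by (intro add_mono) auto
 also have "... = ennreal (sqrt (bR n / real (Suc i)) + (sqrt (bS n / real (Suc i)) + (\<Sum>n\<in>{a..<n}. sqrt (bS n) + sqrt (bR n)) / rt i))"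
 proof -
  have "0 <= (\<Sum>n\<in>{a..<n}. sqrt (bS n) + sqrt (bR n)) / rt i"
   using bS0 n by (intro divide_nonneg_nonneg sum_nonneg add_nonneg_nonneg) auto
  moreover have "0 <= sqrt (bS n / real (Suc i))" "0 <= sqrt (bR n / real (Suc i))" using bS0[OF n] by auto
  ultimately show ?thesis by (simp only: ennreal_plus add_nonneg_nonneg)
 qed
 also have "sqrt (bR n / real (Suc i)) + (sqrt (bS n / real (Suc i)) + (\<Sum>n\<in>{a..<n}. sqrt (bS n) + sqrt (bR n)) / rt i)
  = (\<Sum>n\<in>{a..<Suc n}. sqrt (bS n) + sqrt (bR n)) / rt i"
  using n by (simp add: real_sqrt_divide add_divide_distrib)
 finally show ?case unfolding c0_def bS_def bR_def .
qed

text \<open>\<open>G\<close> is h times the conditional variance, and its integral collapses to the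
  difference in \<open>varS\<close>. The Lindeberg function \<open>ph\<close> is dominated by
  \<open>G\<close> and tends to zero by two dominated convergences, one over the next state and one
  over the path.\<close>

lemma sampling_limit:
 fixes F s n
 defines "G == %z. hr a n z * ((lint (nl n z) (%x. (F (Suc n) (z(Suc n := x)))\<^sup>2)) - (F n z)\<^sup>2)"
  and "ph == %i z. hr a n z * lint (nl n z) (%x. (F (Suc n) (z(Suc n := x)) - F n z)\<^sup>2 * min 1 (\<bar>s\<bar> * \<bar>F (Suc n) (z(Suc n := x)) - F n z\<bar> * hr a n z / rt i))"
 assumes c: "mart_chain S a e F" and n: "a <= n" "n < e"
 shows "integrable (lw a n) G" "lint (lw a n) (%z. G z) = varS S a F n" "varS S a F n >= 0"
  and "(!!i. ph i \<in> bp a n) ==> (%i. nint (lw a n) (%z. ennreal \<bar>ph i z\<bar>)) ---> 0"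
proof -
 have nU: "n < U" using n e_le_U by simp
 have Fm: "F (Suc n) \<in> bp a (Suc n)" "F n \<in> bp a n"
  using mart_chain_meas[OF c] n by auto
 have sq: "nint (lw a (Suc n)) (%z. ennreal ((F (Suc n) z)\<^sup>2 * hr a n z)) <= ennreal (lint (lw a (Suc n)) (%z. (F (Suc n) z)\<^sup>2 * hr a n z))"
  using n by (intro nn_of_int(1)[OF mart_chainD(2)[OF c n]]) auto
 note SN = seg_run.square_next_law[OF SR n Fm(1) mart_chainD(1)[OF c n] sq]
 define F2 where "F2 z = lint (nl n z) (%x. (F (Suc n) (z(Suc n := x)))\<^sup>2)" for z
 have hm: "hr a n \<in> bp a n" using n by (intro hmeas) auto
 have h0: "hr a n z > 0" if "z \<in> sp a n" for z using that n by (intro hpos[of _ n]) auto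
 have hu: "hr a n (z(Suc n := x)) = hr a n z" for z x by (rule hrel_cong[OF block_a]) auto
 note I = int_law_Suc[OF block_a n(1) nU mart_chainD(2)[OF c n]]
 have e1: "lint (nl n z) (%x. (F (Suc n) (z(Suc n := x)))\<^sup>2 * hr a n (z(Suc n := x))) = hr a n z * F2 z" for z
  unfolding hu F2_def by (simp add: mult.commute)
 have hF2: "integrable (lw a n) (%z. hr a n z * F2 z)" "lint (lw a n) (%z. hr a n z * F2 z) = lint (lw a (Suc n)) (%z. (F (Suc n) z)\<^sup>2 * hr a n z)"
  using I(2,3) unfolding e1 by auto
 have le: "AE z in lw a n. (F n z)\<^sup>2 <= F2 z \<and> (lint (nl n z) (%x. (F (Suc n) (z(Suc n := x)) - F n z)\<^sup>2)) = F2 z - (F n z)\<^sup>2"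
  using SN(1)
 proof eventually_elim
  case (elim z)
  have "0 <= lint (nl n z) (%x. (F (Suc n) (z(Suc n := x)) - F n z)\<^sup>2)" by simp
  then show ?case using elim unfolding F2_def by linarith
 qed
 have hF: "integrable (lw a n) (%z. (F n z)\<^sup>2 * hr a n z)"
 proof (rule int_bound[OF hF2(1)])
  show "(%z. (F n z)\<^sup>2 * hr a n z) \<in> bmf (lw a n)" using hm Fm(2) by (intro measurable_law) simp
  show "AE z in lw a n. norm ((F n z)\<^sup>2 * hr a n z) <= norm (hr a n z * F2 z)"
   using le AE_space
  proof eventually_elim
   case (elim z)
   then have "hr a n z > 0" using h0 by simp
   moreover have "0 <= F2 z" unfolding F2_def by simp
   ultimately show ?case using elim by (simp add: abs_mult mult.commute mult_left_mono)
  qed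
 qed
 have G: "G = (%z. hr a n z * F2 z - (F n z)\<^sup>2 * hr a n z)" by (auto simp: G_def F2_def algebra_simps)
 show Gi: "integrable (lw a n) G" unfolding G using hF2(1) hF by simp
 show Gv: "lint (lw a n) (%z. G z) = varS S a F n" unfolding G varS_def using hF2 hF by simp
 have G0: "AE z in lw a n. 0 <= G z"
  using le AE_space by eventually_elim (use h0 in \<open>simp add: G_def F2_def[symmetric] less_imp_le\<close>)
 show "varS S a F n >= 0" unfolding Gv[symmetric] using G0 by (rule integral_nonneg_AE)
 assume phm: "!!i. ph i \<in> bp a n"
 have AEz: "AE z in lw a n. (%i. ph i z) ---> 0 \<and> (\<forall>i. 0 <= ph i z \<and> ph i z <= G z)"
  using SN(1) le AE_space
 proof eventually_elim
  case (elim z)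
  then have z: "z \<in> sp a n" by simp
  define D where "D x = F (Suc n) (z(Suc n := x)) - F n z" for x
  define cc where "cc i x = \<bar>s\<bar> * \<bar>D x\<bar> * hr a n z / rt i" for i x
  have D2: "integrable (nl n z) (%x. (D x)\<^sup>2)" using elim(1) by (simp add: D_def)
  have Dm: "D \<in> bmf (nl n z)"
   using seg_run.comp_update1[OF SR n(1) Fm(1) z] unfolding D_def[abs_def] by (auto simp: measurable_cong_sets[OF sets_next_law refl])
  have c0: "cc i x >= 0" for i x unfolding cc_def using h0[OF z] by simp
  have cm: "cc i \<in> bmf (nl n z)" for i unfolding cc_def[abs_def] using Dm by measurable
  have lim: "(%i. lint (nl n z) (%x. (D x)\<^sup>2 * min 1 (cc i x))) ---> (lint (nl n z) (%x. 0))"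
  proof (rule integral_dominated_convergence[where w="%x. (D x)\<^sup>2"])
   show "(%x. (D x)\<^sup>2 * min 1 (cc i x)) \<in> bmf (nl n z)" for i using Dm cm[of i] by measurable
   show "AE x in nl n z. (%i. (D x)\<^sup>2 * min 1 (cc i x)) ---> 0"
   proof (rule AE_I2)
    fix x
    have "(%i. inverse (rt i)) ---> 0"
     by (intro tendsto_inverse_0_at_top filterlim_compose[OF sqrt_at_top] filterlim_compose[OF filterlim_real_sequentially filterlim_Suc])
    then have "(%i. (D x)\<^sup>2 * min 1 (\<bar>s\<bar> * \<bar>D x\<bar> * hr a n z * inverse (rt i))) ---> (D x)\<^sup>2 * min 1 (\<bar>s\<bar> * \<bar>D x\<bar> * hr a n z * 0)"
     by (intro tendsto_intros)
    then show "(%i. (D x)\<^sup>2 * min 1 (cc i x)) ---> 0" by (simp add: cc_def divide_inverse)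
   qed
   show "AE x in nl n z. norm ((D x)\<^sup>2 * min 1 (cc i x)) <= (D x)\<^sup>2" for i
    using c0 by (intro AE_I2) (simp add: abs_mult mult_left_le)
  qed (use D2 in simp_all)
  have phe: "ph i z = hr a n z * lint (nl n z) (%x. (D x)\<^sup>2 * min 1 (cc i x))" for i
   unfolding ph_def D_def cc_def ..
  have "(%i. ph i z) ---> hr a n z * 0"
   unfolding phe using lim by (intro tendsto_mult tendsto_const) simp
  moreover have "0 <= ph i z" for i
   unfolding phe using h0[OF z] c0 by (intro mult_nonneg_nonneg integral_nonneg_AE AE_I2) auto
  moreover have "ph i z <= G z" for i
  proof -
   have "lint (nl n z) (%x. (D x)\<^sup>2 * min 1 (cc i x)) <= lint (nl n z) (%x. (D x)\<^sup>2)"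
   proof (rule integral_mono[OF _ D2])
    show "integrable (nl n z) (%x. (D x)\<^sup>2 * min 1 (cc i x))"
     using c0 Dm cm[of i] by (intro int_bound[OF D2]) (auto simp: abs_mult mult_left_le)
    show "(D x)\<^sup>2 * min 1 (cc i x) <= (D x)\<^sup>2" for x by (rule mult_left_le) auto
   qed
   also have "... = F2 z - (F n z)\<^sup>2" using elim(2) by (simp add: D_def)
   finally show ?thesis unfolding phe G_def F2_def using h0[OF z] by (intro mult_left_mono) auto
  qed
  ultimately show ?case by simp
 qed
 have "(%i. lint (lw a n) (%z. ph i z)) ---> (lint (lw a n) (%z. 0))"
 proof (rule integral_dominated_convergence[where w=G])
  show "ph i \<in> bmf (lw a n)" for i using phm by (rule measurable_law)
  show "AE z in lw a n. (%i. ph i z) ---> 0" using AEz by eventually_elim simp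
  show "AE z in lw a n. norm (ph i z) <= G z" for i using AEz by eventually_elim simp
 qed (use Gi in simp_all)
 then have "(%i. ennreal (lint (lw a n) (%z. ph i z))) ---> 0" using tendsto_ennrealI by fastforce
 moreover have "nint (lw a n) (%z. ennreal \<bar>ph i z\<bar>) = ennreal (lint (lw a n) (%z. ph i z))" for i
 proof -
  have "integrable (lw a n) (ph i)"
  proof (rule int_bound[OF Gi])
   show "ph i \<in> bmf (lw a n)" using phm by (rule measurable_law)
   show "AE z in lw a n. norm (ph i z) <= norm (G z)" using AEz
   proof eventually_elim
    case (elim z)
    then have "0 <= ph i z" "ph i z <= G z" by auto
    then show ?case by simp
   qed
  qed
  moreover have "AE z in lw a n. 0 <= ph i z" using AEz by eventually_elim simp
  ultimately have "nint (lw a n) (%z. ennreal (ph i z)) = ennreal (lint (lw a n) (%z. ph i z))" by (rule nn_integral_eq_integral)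
  moreover have "nint (lw a n) (%z. ennreal \<bar>ph i z\<bar>) = nint (lw a n) (%z. ennreal (ph i z))"
   by (rule nn_integral_cong_AE, use AEz in eventually_elim) simp
  ultimately show ?thesis by simp
 qed
 ultimately show "(%i. nint (lw a n) (%z. ennreal \<bar>ph i z\<bar>)) ---> 0" by simp
qed

text \<open>Capped at 2, an error that vanishes in probability also vanishes in mean, so
  multiplication by the Gaussian factor survives in the limit.\<close>

lemma char_tendsto_step:
 fixes A Z :: "nat => complex" and W :: "nat => 'w => real"
 assumes W: "!!i. W i \<in> bmf (pr i)" "conv_prob pr W 0"
  and le: "!!i. cmod (A i - c * Z i) <= lint (pr i) (%q. min 2 (W i q))" and Z: "Z ---> z"
 shows "A ---> c * z"
proof -
 have "(%i. lint (pr i) (%q. min 2 \<bar>W i q\<bar>)) ---> 0"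
  by (rule conv_prob_integral_min[OF W]) simp
 moreover have "cmod (A i - c * Z i) <= lint (pr i) (%q. min 2 \<bar>W i q\<bar>)" for i
 proof (cases "integrable (pr i) (%q. min 2 (W i q))")
  case True
  interpret prob_space "pr i" by (rule prob_pr)
  have "lint (pr i) (%q. min 2 (W i q)) <= lint (pr i) (%q. min 2 \<bar>W i q\<bar>)"
   using W(1)[of i] by (intro integral_mono True integrable_const_bound[where B=2]) auto
  then show ?thesis using le[of i] by simp
 next
  \<comment> \<open>A non-integrable function has integral 0 by convention, so the assumed bound is
    then even stronger than needed.\<close>
  case False
  then have "lint (pr i) (%q. min 2 (W i q)) = 0" by (rule not_integrable_integral_eq)
  moreover have "0 <= lint (pr i) (%q. min 2 \<bar>W i q\<bar>)" by (intro integral_nonneg_AE AE_I2) auto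
  ultimately show ?thesis using le[of i] by simp
 qed
 ultimately have "(%i. cmod (A i - c * Z i)) ---> 0"
  by (intro tendsto_0_le_real[of "%i. cmod (A i - c * Z i)"]) auto
 then have "(%i. A i - c * Z i) ---> 0" by (rule tendsto_norm_zero_cancel)
 then have "(%i. (A i - c * Z i) + c * Z i) ---> 0 + c * z" by (intro tendsto_intros Z)
 then show ?thesis by simp
qed

text \<open>The exponential of the scaled error so far is measurable with respect to the past of the
  stage, so it serves as the factor \<open>ze\<close>. By the laws of large numbers the conditional
  variance tends to \<open>varS\<close> and the Lindeberg term to zero.\<close>

lemma clt_sampling:
 assumes c: "mart_chain S a e F" and n: "a <= n" "n < e" and F0: "F a (%_. undefined) = 0"
  and IH: "(%i. CLINT q|pr i. iexp (s * (rt i * em i n (F n) q))) ---> L"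
 shows "(%i. CLINT q|pr i. iexp (s * (rt i * en i n (F (Suc n)) q))) ---> of_real (exp (- (s\<^sup>2 * varS S a F n / 2))) * L"
proof -
 have Fm: "F (Suc n) \<in> bp a (Suc n)" "F n \<in> bp a n"
  using mart_chain_meas[OF c] n by auto
 define G where "G z = hr a n z * ((lint (nl n z) (%x. (F (Suc n) (z(Suc n := x)))\<^sup>2)) - (F n z)\<^sup>2)" for z
 define ph where "ph i z = hr a n z * lint (nl n z) (%x. (F (Suc n) (z(Suc n := x)) - F n z)\<^sup>2 * min 1 (\<bar>s\<bar> * \<bar>F (Suc n) (z(Suc n := x)) - F n z\<bar> * hr a n z / rt i))" for i z
 have sq: "nint (lw a (Suc n)) (%z. ennreal ((F (Suc n) z)\<^sup>2 * hr a n z)) <= ennreal (lint (lw a (Suc n)) (%z. (F (Suc n) z)\<^sup>2 * hr a n z))"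
  using n by (intro nn_of_int(1)[OF mart_chainD(2)[OF c n]]) auto
 note SL = sampling_limit(1-3)[OF c n, folded G_def]
 define ze where "ze i q = iexp (s * (rt i * em i n (F n) q))" for i q
 define W where "W i q = 2 * s\<^sup>2 * (Rr i n q * (1 + Rr i n q) * em i n (ph i) q) + s\<^sup>2 / 2 * \<bar>Rr i n q * em i n G q - varS S a F n\<bar>" for i q
 have step: "cmod ((CLINT q|pr i. ze i q * iexp (s * (rt i * (en i n (F (Suc n)) q - em i n (F n) q)))) - of_real (exp (- (s\<^sup>2 * varS S a F n / 2))) * (CLINT q|pr i. ze i q))
   <= lint (pr i) (%q. min 2 (W i q))" "ph i \<in> bp a n" for i
 proof -
  interpret r: seg_run S "Suc i" "pr i" "X (Suc i)" "B (Suc i)" j by (rule SR)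
  have zem: "ze i \<in> bmf (r.pastS n)"
   unfolding ze_def[abs_def] using r.emp_measurable[OF n(1) less_imp_le[OF n(2)] r.pastS_coords(2)[OF n(2)] Fm(2)] by measurable
  have ze1: "cmod (ze i q) <= 1" for q by (simp add: ze_def)
  note ch = r.emp_sampling_char(1)[OF n Fm mart_chainD(1)[OF c n] sq zem ze1 SL(3), where s=s, folded ph_def G_def]
  show "cmod ((CLINT q|pr i. ze i q * iexp (s * (rt i * (en i n (F (Suc n)) q - em i n (F n) q)))) - of_real (exp (- (s\<^sup>2 * varS S a F n / 2))) * (CLINT q|pr i. ze i q))
   <= lint (pr i) (%q. min 2 (W i q))"
   unfolding W_def by (rule ch)
  show "ph i \<in> bp a n"
   using r.emp_sampling_char(2)[OF n Fm mart_chainD(1)[OF c n] sq zem ze1 SL(3), where s=s] unfolding ph_def .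
 qed
 have Gm: "G \<in> bp a n" using SL(1) by (rule integrable_law_meas)
 have mm[measurable]: "Rr i n \<in> bmf (pr i)" "em i n (ph i) \<in> bmf (pr i)" "em i n G \<in> bmf (pr i)" for i
  using n step(2)[of i] Gm hmeas[of n n] by (auto intro!: em_meas)
 have cR: "conv_prob pr (%i. Rr i n) 1" using n by (intro R_conv_prob) auto
 have cG: "conv_prob pr (%i. em i n G) (varS S a F n)"
  using em_conv_prob[OF n(1) less_imp_le[OF n(2)] SL(1)] unfolding SL(2) .
 have cph: "conv_prob pr (%i. em i n (ph i)) 0"
 proof (rule conv_prob_L1[OF mm(2)])
  show "(%i. nint (pr i) (%q. ennreal \<bar>em i n (ph i) q - 0\<bar>)) ---> 0"
   using em_abs[OF n(1) less_imp_le[OF n(2)] step(2)] by (intro tendsto_0_le_ennreal[OF _ sampling_limit(4)[OF c n, where s=s, folded ph_def, OF step(2)]]) simp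
 qed
 have "conv_prob pr (%i q. 2 * s\<^sup>2 * (Rr i n q * (1 + Rr i n q) * em i n (ph i) q)) (2 * s\<^sup>2 * (1 * (1 + 1) * 0))"
  by (rule conv_prob_cont2[where f="%x y. 2 * s\<^sup>2 * (x * (1 + x) * y)", OF mm(1,2) cR cph]) (intro continuous_intros)
 moreover have "conv_prob pr (%i q. s\<^sup>2 / 2 * \<bar>Rr i n q * em i n G q - varS S a F n\<bar>) (s\<^sup>2 / 2 * \<bar>1 * varS S a F n - varS S a F n\<bar>)"
  by (rule conv_prob_cont2[where f="%x y. s\<^sup>2 / 2 * \<bar>x * y - varS S a F n\<bar>", OF mm(1,3) cR cG]) (intro continuous_intros)
 ultimately have "conv_prob pr W (2 * s\<^sup>2 * (1 * (1 + 1) * 0) + s\<^sup>2 / 2 * \<bar>1 * varS S a F n - varS S a F n\<bar>)"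
  unfolding W_def[abs_def] by (intro conv_prob_add) measurable
 then have cW: "conv_prob pr W 0" by simp
 have Wm: "W i \<in> bmf (pr i)" for i unfolding W_def[abs_def] by measurable
 have "(%i. CLINT q|pr i. ze i q * iexp (s * (rt i * (en i n (F (Suc n)) q - em i n (F n) q)))) ---> of_real (exp (- (s\<^sup>2 * varS S a F n / 2))) * L"
  by (rule char_tendsto_step[OF Wm cW step(1)]) (use IH in \<open>simp add: ze_def\<close>)
 moreover have "ze i q * iexp (s * (rt i * (en i n (F (Suc n)) q - em i n (F n) q))) = iexp (s * (rt i * en i n (F (Suc n)) q))" for i q
  unfolding ze_def exp_add[symmetric] by (simp add: algebra_simps)
 ultimately show ?thesis by simp
qed

text \<open>As for sampling, with the additional terms in the empirical mean of f; these disappear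
  because that mean tends to zero.\<close>

lemma clt_resampling:
 assumes c: "mart_chain S a e F" and n: "a <= n" "n < e" and F0: "F a (%_. undefined) = 0"
  and IH: "(%i. CLINT q|pr i. iexp (s * (rt i * en i n (F (Suc n)) q))) ---> L"
 shows "(%i. CLINT q|pr i. iexp (s * (rt i * em i (Suc n) (F (Suc n)) q))) ---> of_real (exp (- (s\<^sup>2 * varR S a F n / 2))) * L"
proof -
 have Sn: "a <= Suc n" "Suc n <= e" using n by auto
 define f where "f = F (Suc n)"
 let ?c = "%i q. (\<bar>s\<bar> * \<bar>en i n f q\<bar> / rt i)"
 have Fm: "f \<in> bp a (Suc n)" unfolding f_def using mart_chain_meas[OF c] n by auto
 define V where "V z = (f z)\<^sup>2 * hr a (Suc n) z" for z
 define ph where "ph i z = (f z)\<^sup>2 * hr a (Suc n) z * min 1 (\<bar>s\<bar> * \<bar>f z\<bar> * hr a (Suc n) z / rt i)" for i z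
 have Vi: "integrable (lw a (Suc n)) V" unfolding V_def[abs_def] f_def by (rule mart_chainD(3)[OF c n])
 have Vv: "lint (lw a (Suc n)) (%z. V z) = varR S a F n" unfolding V_def f_def varR_def ..
 have hm: "hr a (Suc n) \<in> bp a (Suc n)" using n by (intro hmeas) auto
 have h0: "hr a (Suc n) z > 0" if "z \<in> sp a (Suc n)" for z using that n by (intro hpos[of _ "Suc n"]) auto
 have v0: "varR S a F n >= 0" unfolding varR_def using n by (intro nn_of_int(2)[OF mart_chainD(3)[OF c n]]) auto
 have fi: "integrable (lw a (Suc n)) f" unfolding f_def by (rule mart_chain_integrable[OF c n])
 \<comment> \<open>Mean zero makes the squared empirical mean, which the centring subtracts from the
   conditional variance, vanish in the limit.\<close>
 have f0: "lint (lw a (Suc n)) (%z. f z) = 0" unfolding f_def using mart_chain_mean[OF c Sn] F0 by simp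
 have Vm: "V \<in> bp a (Suc n)" using Vi by (rule integrable_law_meas)
 have phm: "ph i \<in> bp a (Suc n)" for i unfolding ph_def[abs_def] using hm Fm by simp
 have phb: "0 <= ph i z \<and> ph i z <= V z" if "z \<in> sp a (Suc n)" for i z
 proof -
  have "0 <= \<bar>s\<bar> * \<bar>f z\<bar> * hr a (Suc n) z / rt i" using h0[OF that] by simp
  moreover have "0 <= V z" unfolding V_def using h0[OF that] by simp
  ultimately show ?thesis unfolding ph_def V_def by (auto intro!: mult_nonneg_nonneg mult_left_le)
 qed
 have lim: "(%i. lint (lw a (Suc n)) (%z. ph i z)) ---> (lint (lw a (Suc n)) (%z. 0))"
 proof (rule integral_dominated_convergence[where w=V])
  show "ph i \<in> bmf (lw a (Suc n))" for i using phm by (rule measurable_law)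
  show "AE z in lw a (Suc n). (%i. ph i z) ---> 0"
  proof (rule AE_I2)
   fix z
   have "(%i. inverse (rt i)) ---> 0"
    by (intro tendsto_inverse_0_at_top filterlim_compose[OF sqrt_at_top] filterlim_compose[OF filterlim_real_sequentially filterlim_Suc])
   then have "(%i. (f z)\<^sup>2 * hr a (Suc n) z * min 1 (\<bar>s\<bar> * \<bar>f z\<bar> * hr a (Suc n) z * inverse (rt i))) ---> (f z)\<^sup>2 * hr a (Suc n) z * min 1 (\<bar>s\<bar> * \<bar>f z\<bar> * hr a (Suc n) z * 0)"
    by (intro tendsto_intros)
   then show "(%i. ph i z) ---> 0" by (simp add: ph_def divide_inverse)
  qed
  show "AE z in lw a (Suc n). norm (ph i z) <= V z" for i using phb by (intro AE_I2) simp
 qed (use Vi in simp_all)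
 then have "(%i. ennreal (lint (lw a (Suc n)) (%z. ph i z))) ---> 0" using tendsto_ennrealI by fastforce
 moreover have "nint (lw a (Suc n)) (%z. ennreal \<bar>ph i z\<bar>) = ennreal (lint (lw a (Suc n)) (%z. ph i z))" for i
 proof -
  have "integrable (lw a (Suc n)) (ph i)"
  proof (rule int_bound[OF Vi])
   show "ph i \<in> bmf (lw a (Suc n))" using phm by (rule measurable_law)
   show "AE z in lw a (Suc n). norm (ph i z) <= norm (V z)"
   proof (rule AE_I2)
    fix z assume "z \<in> space (lw a (Suc n))"
    then have "0 <= ph i z \<and> ph i z <= V z" using phb by simp
    then show "norm (ph i z) <= norm (V z)" by simp
   qed
  qed
  then have "nint (lw a (Suc n)) (%z. ennreal (ph i z)) = ennreal (lint (lw a (Suc n)) (%z. ph i z))"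
   using phb by (intro nn_integral_eq_integral AE_I2) auto
  moreover have "nint (lw a (Suc n)) (%z. ennreal \<bar>ph i z\<bar>) = nint (lw a (Suc n)) (%z. ennreal (ph i z))"
   using phb by (intro nn_integral_cong) simp
  ultimately show ?thesis by simp
 qed
 ultimately have ph0: "(%i. nint (lw a (Suc n)) (%z. ennreal \<bar>ph i z\<bar>)) ---> 0" by simp
 define ze where "ze i q = iexp (s * (rt i * en i n f q))" for i q
 define W where "W i q = 2 * s\<^sup>2 * (2 * (Rr i (Suc n) q * (1 + Rr i (Suc n) q) * en i n (ph i) q) + 2 * (Rr i (Suc n) q * en i n V q) * (?c i q) + 2 * (en i n f q)\<^sup>2)
    + s\<^sup>2 / 2 * \<bar>Rr i (Suc n) q * en i n V q - (en i n f q)\<^sup>2 - varR S a F n\<bar>" for i q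
 have step: "cmod ((CLINT q|pr i. ze i q * iexp (s * (rt i * (em i (Suc n) f q - en i n f q)))) - of_real (exp (- (s\<^sup>2 * varR S a F n / 2))) * (CLINT q|pr i. ze i q))
   <= lint (pr i) (%q. min 2 (W i q))" for i
 proof -
  interpret r: seg_run S "Suc i" "pr i" "X (Suc i)" "B (Suc i)" j by (rule SR)
  have "en i n f \<in> bmf (r.pastR n)"
   using r.pastR_coords[OF n(2)] n Fm by (intro r.empn_measurable) auto
  then have zem: "ze i \<in> bmf (r.pastR n)" unfolding ze_def[abs_def] by measurable
  have ze1: "cmod (ze i q) <= 1" for q by (simp add: ze_def)
  show ?thesis unfolding W_def
   by (rule r.emp_resampling_char[OF n Fm zem ze1 v0, of s, folded ph_def V_def])
 qed
 have mm[measurable]: "Rr i (Suc n) \<in> bmf (pr i)" "en i n (ph i) \<in> bmf (pr i)" "en i n V \<in> bmf (pr i)" "en i n f \<in> bmf (pr i)" for i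
  using Sn n phm[of i] Vm Fm hm by (auto intro!: em_meas en_meas)
 have cR: "conv_prob pr (%i. Rr i (Suc n)) 1" using n by (intro R_conv_prob) auto
 have cV: "conv_prob pr (%i. en i n V) (varR S a F n)" using en_conv_prob[OF n Vi] unfolding Vv .
 have cf: "conv_prob pr (%i. en i n f) 0" using en_conv_prob[OF n fi] unfolding f0 .
 have cph: "conv_prob pr (%i. en i n (ph i)) 0"
 proof (rule conv_prob_L1[OF mm(2)])
  show "(%i. nint (pr i) (%q. ennreal \<bar>en i n (ph i) q - 0\<bar>)) ---> 0"
   using en_abs[OF n phm] by (intro tendsto_0_le_ennreal[OF _ ph0]) simp
 qed
 have cabs: "conv_prob pr (%i q. \<bar>s\<bar> * \<bar>en i n f q\<bar>) (\<bar>s\<bar> * \<bar>0\<bar>)"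
  by (rule conv_prob_cont2[where f="%x y. \<bar>s\<bar> * \<bar>x\<bar>", OF mm(4,4) cf cf]) (intro continuous_intros)
 have cq: "conv_prob pr (%i q. \<bar>s\<bar> * \<bar>en i n f q\<bar> / rt i) 0"
 proof (rule conv_prob_bound[where W="%i q. \<bar>s\<bar> * \<bar>en i n f q\<bar>"])
  show "AE q in pr i. \<bar>\<bar>s\<bar> * \<bar>en i n f q\<bar> / rt i - 0\<bar> <= \<bar>s\<bar> * \<bar>en i n f q\<bar>" for i
  proof (rule AE_I2)
   fix q
   have "1 <= rt i" by simp
   then have "\<bar>s\<bar> * \<bar>en i n f q\<bar> / rt i <= \<bar>s\<bar> * \<bar>en i n f q\<bar> / 1" by (intro divide_left_mono) auto
   then show "\<bar>\<bar>s\<bar> * \<bar>en i n f q\<bar> / rt i - 0\<bar> <= \<bar>s\<bar> * \<bar>en i n f q\<bar>" by simp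
  qed
 qed (use cabs in simp_all)
 have m1: "(%q. Rr i (Suc n) q * (1 + Rr i (Suc n) q) * en i n (ph i) q) \<in> bmf (pr i)" for i by measurable
 have c1: "conv_prob pr (%i q. Rr i (Suc n) q * (1 + Rr i (Suc n) q) * en i n (ph i) q) (1 * (1 + 1) * 0)"
  by (rule conv_prob_cont2[where f="%x y. x * (1 + x) * y", OF mm(1,2) cR cph]) (intro continuous_intros)
 have m2: "(%q. Rr i (Suc n) q * en i n V q) \<in> bmf (pr i)" for i by measurable
 have c2: "conv_prob pr (%i q. Rr i (Suc n) q * en i n V q) (1 * varR S a F n)" by (rule conv_prob_mult[OF mm(1,3) cR cV])
 have m3: "(%q. \<bar>s\<bar> * \<bar>en i n f q\<bar> / rt i) \<in> bmf (pr i)" for i by measurable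
 have c3: "conv_prob pr (%i q. 2 * (Rr i (Suc n) q * en i n V q) * (?c i q)) (2 * (1 * varR S a F n) * 0)"
  by (rule conv_prob_cont2[where f="%x y. 2 * x * y", OF m2 m3 c2 cq]) (intro continuous_intros)
 have m3': "(%q. 2 * (Rr i (Suc n) q * en i n V q) * (?c i q)) \<in> bmf (pr i)" for i by measurable
 have c4: "conv_prob pr (%i q. 2 * (Rr i (Suc n) q * (1 + Rr i (Suc n) q) * en i n (ph i) q) + 2 * (Rr i (Suc n) q * en i n V q) * (?c i q)) (2 * (1 * (1 + 1) * 0) + 2 * (1 * varR S a F n) * 0)"
  by (rule conv_prob_cont2[where f="%x y. 2 * x + y", OF m1 m3' c1 c3]) (intro continuous_intros)
 have m4: "(%q. 2 * (Rr i (Suc n) q * (1 + Rr i (Suc n) q) * en i n (ph i) q) + 2 * (Rr i (Suc n) q * en i n V q) * (?c i q)) \<in> bmf (pr i)" for i by measurable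
 have c5: "conv_prob pr (%i q. 2 * s\<^sup>2 * (2 * (Rr i (Suc n) q * (1 + Rr i (Suc n) q) * en i n (ph i) q) + 2 * (Rr i (Suc n) q * en i n V q) * (?c i q) + 2 * (en i n f q)\<^sup>2)) (2 * s\<^sup>2 * (2 * (1 * (1 + 1) * 0) + 2 * (1 * varR S a F n) * 0 + 2 * 0\<^sup>2))"
  by (rule conv_prob_cont2[where f="%x y. 2 * s\<^sup>2 * (x + 2 * y\<^sup>2)", OF m4 mm(4) c4 cf]) (intro continuous_intros)
 have c6: "conv_prob pr (%i q. s\<^sup>2 / 2 * \<bar>Rr i (Suc n) q * en i n V q - (en i n f q)\<^sup>2 - varR S a F n\<bar>) (s\<^sup>2 / 2 * \<bar>1 * varR S a F n - 0\<^sup>2 - varR S a F n\<bar>)"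
  by (rule conv_prob_cont2[where f="%x y. s\<^sup>2 / 2 * \<bar>x - y\<^sup>2 - varR S a F n\<bar>", OF m2 mm(4) c2 cf]) (intro continuous_intros)
 have "conv_prob pr W (2 * s\<^sup>2 * (2 * (1 * (1 + 1) * 0) + 2 * (1 * varR S a F n) * 0 + 2 * 0\<^sup>2) + s\<^sup>2 / 2 * \<bar>1 * varR S a F n - 0\<^sup>2 - varR S a F n\<bar>)"
  unfolding W_def[abs_def] by (rule conv_prob_add[OF _ _ c5 c6]) measurable
 then have cW: "conv_prob pr W 0" by simp
 have Wm: "W i \<in> bmf (pr i)" for i unfolding W_def[abs_def] by measurable
 have "(%i. CLINT q|pr i. ze i q * iexp (s * (rt i * (em i (Suc n) f q - en i n f q)))) ---> of_real (exp (- (s\<^sup>2 * varR S a F n / 2))) * L"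
  by (rule char_tendsto_step[OF Wm cW step]) (use IH in \<open>simp add: ze_def f_def\<close>)
 moreover have "ze i q * iexp (s * (rt i * (em i (Suc n) f q - en i n f q))) = iexp (s * (rt i * em i (Suc n) f q))" for i q
  unfolding ze_def exp_add[symmetric] by (simp add: algebra_simps)
 ultimately show ?thesis by (simp add: f_def)
qed

lemma clt_em:
 assumes c: "mart_chain S a e F" and F0: "F a (%_. undefined) = 0" and t: "a <= t" "t <= e"
 shows "(%i. CLINT q|pr i. iexp (s * (rt i * em i t (F t) q))) \<longlonglongrightarrow>
   of_real (exp (- (s\<^sup>2 * (\<Sum>n\<in>{a..<t}. varS S a F n + varR S a F n) / 2)))"
 using t
proof (induction t rule: dec_induct)
 case base
 have "(CLINT q|pr i. iexp (s * (rt i * em i a (F a) q))) = 1" for i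
  using prob_space.prob_space[OF prob_pr[of i]] by (simp add: em_a F0)
 then show ?case by simp
next
 case (step n)
 then have n: "a <= n" "n < e" by auto
 have "(%i. CLINT q|pr i. iexp (s * (rt i * em i (Suc n) (F (Suc n)) q))) \<longlonglongrightarrow>
  of_real (exp (- (s\<^sup>2 * varR S a F n / 2))) * (of_real (exp (- (s\<^sup>2 * varS S a F n / 2))) * of_real (exp (- (s\<^sup>2 * (\<Sum>n\<in>{a..<n}. varS S a F n + varR S a F n) / 2))))"
  by (rule clt_resampling[OF c n F0 clt_sampling[OF c n F0 step.IH[OF less_imp_le[OF n(2)]]]])
 also have "of_real (exp (- (s\<^sup>2 * varR S a F n / 2))) * (of_real (exp (- (s\<^sup>2 * varS S a F n / 2))) * of_real (exp (- (s\<^sup>2 * (\<Sum>n\<in>{a..<n}. varS S a F n + varR S a F n) / 2))))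
  = complex_of_real (exp (- (s\<^sup>2 * (\<Sum>n\<in>{a..<Suc n}. varS S a F n + varR S a F n) / 2)))"
 proof -
  have "- (s\<^sup>2 * varR S a F n / 2) + (- (s\<^sup>2 * varS S a F n / 2) + - (s\<^sup>2 * (\<Sum>n\<in>{a..<n}. varS S a F n + varR S a F n) / 2)) = - (s\<^sup>2 * (\<Sum>n\<in>{a..<Suc n}. varS S a F n + varR S a F n) / 2)"
   using n(1) by (simp add: algebra_simps add_divide_distrib)
  then show ?thesis by (simp only: of_real_mult[symmetric] exp_add[symmetric])
 qed
 finally show ?case .
qed

lemma varR_nonneg: "mart_chain S a e F ==> a <= n ==> n < e ==> varR S a F n >= 0"
 unfolding varR_def by (intro nn_of_int(2)[OF mart_chainD(3)]) auto

lemma varS_nonneg: "mart_chain S a e F ==> a <= n ==> n < e ==> varS S a F n >= 0"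
 by (rule sampling_limit(3))

end

subsection \<open>Joined paths of several filters\<close>

text \<open>Joining the first \<open>m\<close> filters; \<open>jemp\<close> is the normalized sum over all index tuples.\<close>

primrec jpath :: "('x, 'y) pf_model => (nat => nat => 'w => 'x) => (nat => nat => 'w => nat) => nat => (nat => nat) => 'w => nat => 'x" where
 "jpath S X B 0 kp q = (%_. undefined)"
| "jpath S X B (Suc m) kp q = merge {0<..m * seg_len S} {m * seg_len S<..Suc m * seg_len S}
   (jpath S X B m kp q, rpath S X B (Suc m) (Suc m * seg_len S) (kp (Suc m)) q)"

definition jwt :: "('x, 'y) pf_model => nat => (nat => nat => 'w => 'x) => (nat => nat => 'w => nat) => nat => (nat => nat) => 'w => real" where
 "jwt S K X B m kp q = (\<Prod>n\<in>{1..m}. hwt S K X B n (n * seg_len S) (kp n) q)"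

definition jemp :: "('x, 'y) pf_model => nat => (nat => nat => 'w => 'x) => (nat => nat => 'w => nat) => nat => ((nat => 'x) => real) => 'w => real" where
 "jemp S K X B m f q = (\<Sum>kp\<in>{1..m} \<rightarrow>\<^sub>E {1..K}. jwt S K X B m kp q * f (jpath S X B m kp q)) / real K ^ m"

lemma sum_PiE_Suc:
 fixes g :: "(nat => 'a) => 'b::comm_monoid_add"
 assumes "finite A"
 shows "(\<Sum>kp\<in>{1..Suc m} \<rightarrow>\<^sub>E A. g kp) = (\<Sum>kp\<in>{1..m} \<rightarrow>\<^sub>E A. \<Sum>k\<in>A. g (kp(Suc m := k)))"
proof -
 have I: "{1..Suc m} = insert (Suc m) {1..m}" by auto
 have inj: "inj_on (%(y, kp). kp(Suc m := y)) (A \<times> ({1..m} \<rightarrow>\<^sub>E A))"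
  using inj_combinator[of "Suc m" "{1..m}" "%_. A"] by simp
 have "(\<Sum>kp\<in>{1..Suc m} \<rightarrow>\<^sub>E A. g kp) = (\<Sum>p\<in>A \<times> ({1..m} \<rightarrow>\<^sub>E A). g ((snd p)(Suc m := fst p)))"
  unfolding I PiE_insert_eq by (subst sum.reindex[OF inj]) (simp add: split_beta)
 also have "... = (\<Sum>k\<in>A. \<Sum>kp\<in>{1..m} \<rightarrow>\<^sub>E A. g (kp(Suc m := k)))"
  by (simp add: sum.cartesian_product split_beta)
 finally show ?thesis by (subst sum.swap)
qed

lemma jpath_cong: "(!!n. 1 <= n ==> n <= m ==> kp n = kp' n) ==> jpath S X B m kp q = jpath S X B m kp' q"
 by (induction m) auto

lemma jwt_Suc: "jwt S K X B (Suc m) (kp(Suc m := k)) q = jwt S K X B m kp q * hwt S K X B (Suc m) (Suc m * seg_len S) k q"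
proof -
 have "{1..Suc m} = insert (Suc m) {1..m}" by auto
 then show ?thesis by (auto simp: jwt_def intro!: prod.cong)
qed

lemma jpath_Suc: "jpath S X B (Suc m) (kp(Suc m := k)) q = merge {0<..m * seg_len S} {m * seg_len S<..Suc m * seg_len S}
   (jpath S X B m kp q, rpath S X B (Suc m) (Suc m * seg_len S) k q)"
 using jpath_cong[of m "kp(Suc m := k)" kp S X B q] by simp

lemma jemp_0: "jemp S K X B 0 f q = f (%_. undefined)"
 by (simp add: jemp_def jwt_def)

lemma jemp_diff: "jemp S K X B m (%z. f z - g z) q = jemp S K X B m f q - jemp S K X B m g q"
 by (simp add: jemp_def right_diff_distrib sum_subtractf diff_divide_distrib)

text \<open>Summing over the index of the last filter first exhibits the joined mean as a mean over
  the earlier paths of a single-filter empirical mean with the earlier path frozen.\<close>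

lemma jemp_Suc: "jemp S K X B (Suc m) f q = jemp S K X B m (%z. emp S K X B (Suc m) (Suc m * seg_len S)
   (%y. f (merge {0<..m * seg_len S} {m * seg_len S<..Suc m * seg_len S} (z, y))) q) q"
proof -
 have "jemp S K X B (Suc m) f q = (\<Sum>kp\<in>{1..m} \<rightarrow>\<^sub>E {1..K}. \<Sum>k\<in>{1..K}. jwt S K X B m kp q * hwt S K X B (Suc m) (Suc m * seg_len S) k q *
   f (merge {0<..m * seg_len S} {m * seg_len S<..Suc m * seg_len S} (jpath S X B m kp q, rpath S X B (Suc m) (Suc m * seg_len S) k q))) / real K ^ Suc m"
  unfolding jemp_def by (subst sum_PiE_Suc) (simp_all only: jwt_Suc jpath_Suc finite_atLeastAtMost)
 also have "... = (\<Sum>kp\<in>{1..m} \<rightarrow>\<^sub>E {1..K}. jwt S K X B m kp q * (\<Sum>k\<in>{1..K}. hwt S K X B (Suc m) (Suc m * seg_len S) k q *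
   f (merge {0<..m * seg_len S} {m * seg_len S<..Suc m * seg_len S} (jpath S X B m kp q, rpath S X B (Suc m) (Suc m * seg_len S) k q)))) / real K ^ Suc m"
  by (simp only: sum_distrib_left mult.assoc)
 also have "... = jemp S K X B m (%z. emp S K X B (Suc m) (Suc m * seg_len S)
   (%y. f (merge {0<..m * seg_len S} {m * seg_len S<..Suc m * seg_len S} (z, y))) q) q"
  unfolding jemp_def emp_def by (simp flip: sum_divide_distrib)
 finally show ?thesis .
qed

text \<open>Interchange of finite sums. The two sample points may differ, as required when earlier
  and current filters are evaluated at separate points.\<close>

lemma jemp_emp_swap: "jemp S K X B m (%z. emp S K X' B' n t (g z) q') q = emp S K X' B' n t (%y. jemp S K X B m (%z. g z y) q) q'"
proof -
 have "jemp S K X B m (%z. emp S K X' B' n t (g z) q') q =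
  (\<Sum>kp\<in>{1..m} \<rightarrow>\<^sub>E {1..K}. \<Sum>k\<in>{1..K}. jwt S K X B m kp q * (hwt S K X' B' n t k q' * g (jpath S X B m kp q) (rpath S X' B' n t k q'))) / (real K * real K ^ m)"
  by (simp add: jemp_def emp_def sum_distrib_left sum_divide_distrib)
 also have "... = (\<Sum>k\<in>{1..K}. \<Sum>kp\<in>{1..m} \<rightarrow>\<^sub>E {1..K}. jwt S K X B m kp q * (hwt S K X' B' n t k q' * g (jpath S X B m kp q) (rpath S X' B' n t k q'))) / (real K * real K ^ m)"
  by (subst sum.swap) (rule refl)
 also have "... = emp S K X' B' n t (%y. jemp S K X B m (%z. g z y) q) q'"
  by (simp add: jemp_def emp_def sum_distrib_left sum_divide_distrib mult.left_commute mult.commute)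
 finally show ?thesis .
qed

locale multi_run = pf_setting S + parallel_filters S K P X B
 for S :: "('x, 'y) pf_model" and K :: nat and P :: "'w measure"
  and X :: "nat => nat => 'w => 'x" and B :: "nat => nat => 'w => nat" +
 assumes K_pos: "K >= 1"
begin

abbreviation "T == seg_len S"
abbreviation "M == n_filters S"
abbreviation "jp == jpath S X B"
abbreviation "jw == jwt S K X B"
abbreviation "je == jemp S K X B"
abbreviation "mu j == emp S K X B (Suc j) (Suc j * T)"
abbreviation "ZZ m == {1..m} \<rightarrow>\<^sub>E {1..K}"

lemma SR: "j < M ==> seg_run S K P X B j"
 unfolding seg_run_def seg_run_axioms_def using pf_setting_axioms parallel_filters_axioms K_pos by simp

definition coords :: "'w measure => nat => bool" where
 "coords N j \<longleftrightarrow> (\<forall>u\<in>{j * T<..Suc j * T}. \<forall>k\<in>{1..K}. X u k \<in> measurable N nu \<and> B u k \<in> measurable N (count_space {1..K}))"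

lemma coords_seg: "j < M ==> coords N j ==> seg_run.coord_meas S K X B j N (Suc j * T)"
 by (simp add: seg_run.coord_meas_def[OF SR] coords_def)

lemma rp_meas: "j < M ==> coords N j ==> k \<in> {1..K} ==> rpath S X B (Suc j) (Suc j * T) k \<in> measurable N (PP {j * T<..Suc j * T})"
 by (rule seg_run.rp_measurable[OF SR _ _ coords_seg]) simp_all

lemma hw_meas: "j < M ==> coords N j ==> k \<in> {1..K} ==> hwt S K X B (Suc j) (Suc j * T) k \<in> bmf N"
 by (rule seg_run.hw_measurable[OF SR _ _ coords_seg]) simp_all

lemma PiE_D: "kp \<in> ZZ m ==> 1 <= n ==> n <= m ==> kp n \<in> {1..K}"
 by (metis PiE_mem atLeastAtMost_iff)

lemma jp_meas:
 assumes "m <= M" "!!j. j < m ==> coords N j" "!!n. 1 <= n ==> n <= m ==> kp n \<in> {1..K}"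
 shows "jp m kp \<in> measurable N (PP {0<..m * T})"
 using assms
proof (induction m)
 case 0
 have "jp 0 kp = (%_ _. undefined)" by (simp add: fun_eq_iff)
 then show ?case by (auto simp: path_space_def space_PiM)
next
 case (Suc m)
 have "(%q. (jp m kp q, rpath S X B (Suc m) (Suc m * T) (kp (Suc m)) q)) \<in> measurable N (PP {0<..m * T} >< PP {m * T<..Suc m * T})"
  using Suc by (intro measurable_Pair Suc.IH rp_meas) auto
 from mcomp[OF this measurable_glue[OF mT_le]] show ?case by (simp add: fun_eq_iff cong: measurable_cong)
qed

lemma jw_meas:
 assumes "m <= M" "!!j. j < m ==> coords N j" "!!n. 1 <= n ==> n <= m ==> kp n \<in> {1..K}"
 shows "jw m kp \<in> bmf N"
 unfolding jwt_def[abs_def]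
proof (intro borel_measurable_prod)
 fix n assume "n \<in> {1..m}"
 then obtain j where n: "n = Suc j" by (cases n) auto
 have "j < m" using n \<open>n \<in> {1..m}\<close> by simp
 then show "hwt S K X B n (n * T) (kp n) \<in> bmf N"
  unfolding n using assms by (intro hw_meas) auto
qed

lemma jw_pos:
 assumes "m <= M" "kp \<in> ZZ m" "q \<in> space P"
 shows "jw m kp q > 0"
 unfolding jwt_def
proof (intro prod_pos)
 fix n assume n': "n \<in> {1..m}"
 then obtain j where n: "n = Suc j" by (cases n) auto
 have j: "j < M" "kp (Suc j) \<in> {1..K}" using n n' assms PiE_D[OF assms(2), of n] by auto
 show "hwt S K X B n (n * T) (kp n) q > 0" unfolding n
  by (rule seg_run.hw_pos[OF SR[OF j(1)] mT_le order_refl assms(3) j(2)])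
qed

lemma coords_P: "j < M ==> coords P j"
 using seg_run.coord_meas_P[OF SR, of j "Suc j * T"] by (simp add: coords_def seg_run.coord_meas_def[OF SR])

lemma jp_space: "m <= M ==> kp \<in> ZZ m ==> q \<in> space P ==> jp m kp q \<in> sp 0 (m * T)"
 by (rule measurable_space[OF jp_meas]) (auto intro: coords_P PiE_D)

lemma je_mono:
 assumes "m <= M" "q \<in> space P" "!!z. z \<in> sp 0 (m * T) ==> f z <= g z"
 shows "je m f q <= je m g q"
 unfolding jemp_def
proof (intro divide_right_mono sum_mono)
 fix kp assume kp: "kp \<in> ZZ m"
 show "jw m kp q * f (jp m kp q) <= jw m kp q * g (jp m kp q)"
  using jw_pos[OF assms(1) kp assms(2)] assms(3)[OF jp_space[OF assms(1) kp assms(2)]] by simp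
qed simp

lemma je_nonneg:
 assumes "m <= M" "q \<in> space P" "!!z. z \<in> sp 0 (m * T) ==> 0 <= f z"
 shows "0 <= je m f q"
 using je_mono[OF assms(1,2), of "%_. 0" f] assms(3) by (simp add: jemp_def)

lemma je_abs:
 assumes "m <= M" "q \<in> space P"
 shows "\<bar>je m f q\<bar> <= je m (%z. \<bar>f z\<bar>) q"
proof -
 have "je m f q <= je m (%z. \<bar>f z\<bar>) q" using assms by (intro je_mono) auto
 moreover have "je m (%z. - f z) q <= je m (%z. \<bar>f z\<bar>) q" using assms by (intro je_mono) auto
 moreover have "je m (%z. - f z) q = - je m f q" by (simp add: jemp_def sum_negf)
 ultimately show ?thesis by linarith
qed

text \<open>The positive joined weights define a discrete inner product; inserting h and 1 / h
  leaves as first factor a joined mean of 1 / h, which for the h of the path law has limit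
  1.\<close>

lemma je_Cauchy_Schwarz:
 assumes m: "m <= M" "q \<in> space P" and h: "!!z. z \<in> sp 0 (m * T) ==> h z > 0"
 shows "(je m g q)\<^sup>2 <= je m (%z. 1 / h z) q * je m (%z. (g z)\<^sup>2 * h z) q"
proof -
 define u where "u kp = sqrt (jw m kp q / h (jp m kp q))" for kp
 define v where "v kp = sqrt (jw m kp q * h (jp m kp q)) * g (jp m kp q)" for kp
 have p: "jw m kp q > 0" "h (jp m kp q) > 0" if "kp \<in> ZZ m" for kp
  using jw_pos[OF m(1) that m(2)] h[OF jp_space[OF m(1) that m(2)]] by auto
 have 1: "u kp * v kp = jw m kp q * g (jp m kp q)" if "kp \<in> ZZ m" for kp
  using p[OF that] by (simp add: u_def v_def real_sqrt_divide real_sqrt_mult)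
 have 2: "(u kp)\<^sup>2 = jw m kp q * (1 / h (jp m kp q))" if "kp \<in> ZZ m" for kp
  using p[OF that] by (simp add: u_def)
 have 3: "(v kp)\<^sup>2 = jw m kp q * ((g (jp m kp q))\<^sup>2 * h (jp m kp q))" if "kp \<in> ZZ m" for kp
  using p[OF that] by (simp add: v_def power_mult_distrib)
 have "(\<Sum>kp\<in>ZZ m. u kp * v kp)\<^sup>2 <= (\<Sum>kp\<in>ZZ m. (u kp)\<^sup>2) * (\<Sum>kp\<in>ZZ m. (v kp)\<^sup>2)" by (rule Cauchy_Schwarz_ineq_sum)
 also have "(\<Sum>kp\<in>ZZ m. u kp * v kp) = (\<Sum>kp\<in>ZZ m. jw m kp q * g (jp m kp q))" by (intro sum.cong 1 refl)
 also have "(\<Sum>kp\<in>ZZ m. (u kp)\<^sup>2) = (\<Sum>kp\<in>ZZ m. jw m kp q * (1 / h (jp m kp q)))" by (intro sum.cong 2 refl)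
 also have "(\<Sum>kp\<in>ZZ m. (v kp)\<^sup>2) = (\<Sum>kp\<in>ZZ m. jw m kp q * ((g (jp m kp q))\<^sup>2 * h (jp m kp q)))" by (intro sum.cong 3 refl)
 finally have "(\<Sum>kp\<in>ZZ m. jw m kp q * g (jp m kp q))\<^sup>2 / (real K ^ m)\<^sup>2 \<le>
   ((\<Sum>kp\<in>ZZ m. jw m kp q * (1 / h (jp m kp q))) * (\<Sum>kp\<in>ZZ m. jw m kp q * ((g (jp m kp q))\<^sup>2 * h (jp m kp q)))) / (real K ^ m)\<^sup>2"
  by (intro divide_right_mono) auto
 then show ?thesis unfolding jemp_def by (simp add: power_divide power2_eq_square)
qed

text \<open>Joint measurability in sample point and parameter, over any sigma-algebra that carries
  the coordinates of the first m filters; it feeds the evaluation at two different points.\<close>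

lemma je_param_meas:
 assumes "m <= M" "!!j. j < m ==> coords G j"
  and g: "(%(y, z). g y z) \<in> bmf (N >< PP {0<..m * T})"
 shows "(%(q, y). je m (g y) q) \<in> bmf (G >< N)"
proof -
 have "(%p. jw m kp (fst p) * g (snd p) (jp m kp (fst p))) \<in> bmf (G >< N)" if kp: "kp \<in> ZZ m" for kp
 proof -
  have jm: "jp m kp \<in> measurable G (PP {0<..m * T})" "jw m kp \<in> bmf G"
   using assms PiE_D[OF kp] by (auto intro!: jp_meas jw_meas)
  have "(%p. (snd p, jp m kp (fst p))) \<in> measurable (G >< N) (N >< PP {0<..m * T})"
   by (intro measurable_Pair measurable_snd mcomp[OF measurable_fst jm(1)])
  from mcomp[OF this g] have "(%p. g (snd p) (jp m kp (fst p))) \<in> bmf (G >< N)" by simp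
  then show ?thesis by (intro borel_measurable_times mcomp[OF measurable_fst jm(2)])
 qed
 then show ?thesis unfolding jemp_def split_beta by (intro borel_measurable_divide borel_measurable_sum) auto
qed

lemma mu_param_meas:
 assumes "j < M" "coords G j"
  and g: "(%(z, y). g z y) \<in> bmf (N >< PP {j * T<..Suc j * T})"
 shows "(%(q, z). mu j (g z) q) \<in> bmf (G >< N)"
proof -
 have "(%p. hwt S K X B (Suc j) (Suc j * T) k (fst p) * g (snd p) (rpath S X B (Suc j) (Suc j * T) k (fst p))) \<in> bmf (G >< N)" if k: "k \<in> {1..K}" for k
 proof -
  have "(%p. (snd p, rpath S X B (Suc j) (Suc j * T) k (fst p))) \<in> measurable (G >< N) (N >< PP {j * T<..Suc j * T})"
   by (intro measurable_Pair measurable_snd mcomp[OF measurable_fst rp_meas[OF assms(1,2) k]])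
  from mcomp[OF this g] have "(%p. g (snd p) (rpath S X B (Suc j) (Suc j * T) k (fst p))) \<in> bmf (G >< N)" by simp
  then show ?thesis by (intro borel_measurable_times mcomp[OF measurable_fst hw_meas[OF assms(1,2) k]])
 qed
 then show ?thesis unfolding emp_def split_beta by (intro borel_measurable_divide borel_measurable_sum) auto
qed

end

section \<open>Independence of groups of filters\<close>

text \<open>The identity map, viewed as a variable into each of the two generated sigma-algebras,
  gives an independent pair; hence the image of the measure under q to (q, q) is a product measure,
  and integrating along the diagonal equals a double integral. No explicit factorization of
  \<open>Ph\<close> through the generating variables is required.\<close>

lemma (in prob_space) indep_var_nn_integral_diagonal:
 assumes ind: "indep_var N1 Y1 N2 Y2"
  and Ph: "Ph \<in> bmf (vimage_algebra (space M) Y1 N1 >< vimage_algebra (space M) Y2 N2)"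
 shows "nint M (%q. Ph (q, q)) = nint M (%q. nint M (%q'. Ph (q, q')))"
proof -
 define G1 where "G1 = vimage_algebra (space M) Y1 N1"
 define G2 where "G2 = vimage_algebra (space M) Y2 N2"
 note E = iffD1[OF indep_var_eq ind]
 have rv: "Y1 \<in> measurable M N1" "Y2 \<in> measurable M N2" using E by auto
 have sub: "subalgebra M G1" "subalgebra M G2" unfolding G1_def G2_def by (intro subalgebra_vimage rv)+
 have sp: "space G1 = space M" "space G2 = space M" using sub by (auto simp: subalgebra_def)
 have id: "(%q. q) \<in> measurable M G1" "(%q. q) \<in> measurable M G2"
  using sub by (auto simp: subalgebra_def intro!: measurableI)
 have eq: "{(%q. q) -` A \<inter> space M |A. A \<in> sets G} = sets G" if "subalgebra M G" for G
 proof -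
  have "A \<inter> space M = A" if "A \<in> sets G" for A
   using that \<open>subalgebra M G\<close> sets.sets_into_space[of A M] by (auto simp: subalgebra_def)
  then show ?thesis by auto
 qed
 have "indep_var G1 (%q. q) G2 (%q. q)"
 proof (rule iffD2[OF indep_var_eq], intro conjI id)
  have s1: "sigma_sets (space M) {(%q. q) -` A \<inter> space M |A. A \<in> sets G1} = sigma_sets (space M) {Y1 -` A \<inter> space M |A. A \<in> sets N1}"
   unfolding eq[OF sub(1)] using sets.sigma_sets_eq[of G1] unfolding sp G1_def sets_vimage_algebra by simp
  have s2: "sigma_sets (space M) {(%q. q) -` A \<inter> space M |A. A \<in> sets G2} = sigma_sets (space M) {Y2 -` A \<inter> space M |A. A \<in> sets N2}"
   unfolding eq[OF sub(2)] using sets.sigma_sets_eq[of G2] unfolding sp G2_def sets_vimage_algebra by simp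
  show "indep_set (sigma_sets (space M) {(%q. q) -` A \<inter> space M |A. A \<in> sets G1}) (sigma_sets (space M) {(%q. q) -` A \<inter> space M |A. A \<in> sets G2})"
   unfolding s1 s2 using E by blast
 qed
 then have d: "distr M G1 (%q. q) >< distr M G2 (%q. q) = distr M (G1 >< G2) (%q. (q, q))"
  unfolding indep_var_distribution_eq by blast
 interpret D1: prob_space "distr M G1 (%q. q)" using id(1) by (rule prob_space_distr)
 interpret D2: prob_space "distr M G2 (%q. q)" using id(2) by (rule prob_space_distr)
 have Ph': "Ph \<in> bmf (G1 >< G2)" using Ph unfolding G1_def G2_def .
 have Ph'': "Ph \<in> bmf (distr M G1 (%q. q) >< distr M G2 (%q. q))"
  using Ph' by (simp cong: measurable_cong_sets add: sets_pair_measure_cong[OF sets_distr sets_distr])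
 have "nint M (%q. Ph (q, q)) = nint (distr M (G1 >< G2) (%q. (q, q))) (%p. Ph p)"
  using Ph' id by (subst nn_integral_distr) auto
 also have "... = nint (distr M G1 (%q. q)) (%q. nint (distr M G2 (%q. q)) (%q'. Ph (q, q')))"
  unfolding d[symmetric] by (rule D2.nn_integral_fst[OF Ph'', symmetric])
 also have "... = nint M (%q. nint (distr M G2 (%q. q)) (%q'. Ph (q, q')))"
 proof (rule nn_integral_distr[OF id(1)])
  show "(%q. nint (distr M G2 (%q. q)) (%q'. Ph (q, q'))) \<in> bmf (distr M G1 (%q. q))"
   unfolding measurable_distr_eq1
   using D2.borel_measurable_nn_integral_fst[of Ph G1] Ph' by (simp cong: measurable_cong_sets add: sets_pair_measure_cong[OF refl sets_distr])
 qed
 also have "... = nint M (%q. nint M (%q'. Ph (q, q')))"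
 proof (rule nn_integral_cong, rule nn_integral_distr[OF id(2)])
  fix q assume "q \<in> space M"
  then show "(%q'. Ph (q, q')) \<in> bmf (distr M G2 (%q. q))"
   unfolding measurable_distr_eq1
   using Ph' measurable_compose_Pair1[of q G1 Ph G2 borel] by (simp add: sp)
 qed
 finally show ?thesis .
qed

context multi_run
begin

abbreviation "seg_space n == PiM ({seg_start S n<..seg_end S n} \<times> {1..K}) (%_. nu >< count_space {1..K})"

definition seg_rv :: "nat => 'w => nat \<times> nat => 'x \<times> nat" where
 "seg_rv n q = (\<lambda>(t, k)\<in>{seg_start S n<..seg_end S n} \<times> {1..K}. (X t k q, B t k q))"

text \<open>All information of the filters in A, as opposed to \<open>Falg n\<close> for a single
  filter; disjoint groups are independent.\<close>

definition Galg :: "nat set => 'w measure" where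
 "Galg A = vimage_algebra (space P) (%q. restrict (%n. seg_rv n q) A) (PiM A seg_space)"

definition Falg :: "nat => 'w measure" where
 "Falg n = vimage_algebra (space P) (seg_rv n) (seg_space n)"

lemma seg_indep: "indep_vars seg_space seg_rv {1..M}"
 using filters_indep unfolding seg_rv_def[abs_def] .

lemma seg_rv_meas: "n \<in> {1..M} ==> seg_rv n \<in> measurable P (seg_space n)"
 using seg_indep by (simp add: indep_vars_def)

lemma coords_from_seg:
 assumes "seg_rv (Suc j) \<in> measurable N (seg_space (Suc j))"
 shows "coords N j"
 unfolding coords_def
proof (intro ballI)
 fix u k assume u: "u \<in> {j * T<..Suc j * T}" and k: "k \<in> {1..K}"
 then have mem: "(u, k) \<in> {seg_start S (Suc j)<..seg_end S (Suc j)} \<times> {1..K}" by (simp add: seg_start_def seg_end_def)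
 have "(%q. seg_rv (Suc j) q (u, k)) \<in> measurable N (nu >< count_space {1..K})"
  by (rule mcomp[OF assms measurable_component_singleton[OF mem]])
 then have "(%q. (X u k q, B u k q)) \<in> measurable N (nu >< count_space {1..K})"
  using mem by (simp add: seg_rv_def)
 from mcomp[OF this measurable_fst] mcomp[OF this measurable_snd]
 show "X u k \<in> measurable N nu \<and> B u k \<in> measurable N (count_space {1..K})" by simp
qed

lemma coords_Falg: "j < M ==> coords (Falg (Suc j)) j"
 using seg_rv_meas[of "Suc j"] unfolding Falg_def
 by (intro coords_from_seg measurable_vimage_algebra1) (auto dest: measurable_space)

lemma coords_Galg:
 assumes "Suc j \<in> A" "A \<subseteq> {1..M}"
 shows "coords (Galg A) j"
proof (rule coords_from_seg)
 have "(%q. restrict (%n. seg_rv n q) A) \<in> measurable P (PiM A seg_space)"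
  using assms(2) by (intro measurable_restrict seg_rv_meas) auto
 then have "(%q. restrict (%n. seg_rv n q) A) \<in> measurable (Galg A) (PiM A seg_space)"
  unfolding Galg_def by (intro measurable_vimage_algebra1) (auto dest: measurable_space)
 from mcomp[OF this measurable_component_singleton[OF assms(1)]]
 show "seg_rv (Suc j) \<in> measurable (Galg A) (seg_space (Suc j))" using assms(1) by simp
qed

lemma nn_diagonal:
 assumes "A \<inter> A' = {}" "A \<subseteq> {1..M}" "A' \<subseteq> {1..M}" "Ph \<in> bmf (Galg A >< Galg A')"
 shows "nint P (%q. Ph (q, q)) = nint P (%q. nint P (%q'. Ph (q, q')))"
 using assms(4) unfolding Galg_def
 by (rule indep_var_nn_integral_diagonal[OF indep_var_restrict[OF seg_indep assms(1-3)]])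

text \<open>The events described by \<open>Z n\<close> are events of filter n, and independence
  passes to smaller families of events.\<close>

lemma indep_seg_functions:
 assumes "!!n. n \<in> {1..M} ==> Z n \<in> bmf (Falg n)"
 shows "indep_vars (%_. borel) Z {1..M}"
proof -
 have sub: "subalgebra P (Falg n)" if "n \<in> {1..M}" for n
  unfolding Falg_def by (rule subalgebra_vimage[OF seg_rv_meas[OF that]])
 have sets_F: "sets (Falg n) = {seg_rv n -` A \<inter> space P | A. A \<in> sets (seg_space n)}" if "n \<in> {1..M}" for n
  unfolding Falg_def using measurable_space[OF seg_rv_meas[OF that]] by (intro sets_vimage_algebra2) auto
 have "indep_sets (%n. {seg_rv n -` A \<inter> space P | A. A \<in> sets (seg_space n)}) {1..M}"
  using seg_indep unfolding indep_vars_def2 by blast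
 then have "indep_sets (%n. {Z n -` A \<inter> space P | A. A \<in> sets borel}) {1..M}"
 proof (rule indep_sets_mono_sets)
  fix n assume n: "n \<in> {1..M}"
  show "{Z n -` A \<inter> space P | A. A \<in> sets borel} \<subseteq> {seg_rv n -` A \<inter> space P | A. A \<in> sets (seg_space n)}"
   unfolding sets_F[OF n, symmetric] using measurable_sets[OF assms[OF n]] sub[OF n] by (auto simp: subalgebra_def)
 qed
 moreover have "Z n \<in> bmf P" if "n \<in> {1..M}" for n
  using measurable_from_subalg[OF sub[OF that] assms[OF that]] .
 ultimately show ?thesis unfolding indep_vars_def2 by blast
qed

end

context multi_run
begin

lemma subalgebra_Galg: "A \<subseteq> {1..M} ==> subalgebra P (Galg A)"
 unfolding Galg_def by (intro subalgebra_vimage measurable_restrict seg_rv_meas) auto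

lemma je_meas:
 assumes "m <= M" "f \<in> bp 0 (m * T)"
 shows "je m f \<in> bmf P"
proof -
 have "(%q. jw m kp q * f (jp m kp q)) \<in> bmf P" if kp: "kp \<in> ZZ m" for kp
 proof -
  have jm: "jp m kp \<in> measurable P (PP {0<..m * T})" "jw m kp \<in> bmf P"
   using assms PiE_D[OF kp] by (auto intro!: jp_meas jw_meas coords_P)
  show ?thesis by (intro borel_measurable_times jm(2) mcomp[OF jm(1) assms(2)])
 qed
 then show ?thesis unfolding jemp_def[abs_def] by (intro borel_measurable_divide borel_measurable_sum) auto
qed

lemma glue_section:
 assumes "a <= t" "f \<in> bp 0 t"
 shows "(%(z, y). f (glue a t (z, y))) \<in> bmf (PP {0<..a} >< PP {a<..t})"
 using mcomp[OF measurable_glue[OF assms(1)] assms(2)] by (simp add: split_beta')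

lemma mu_glue_meas:
 assumes "m < M" "coords G m" "f \<in> bp 0 (Suc m * T)"
 shows "(%(q, z). mu m (%y. f (glue (m * T) (Suc m * T) (z, y))) q) \<in> bmf (G >< PP {0<..m * T})"
 using glue_section[OF mT_le assms(3)] by (intro mu_param_meas assms(1,2)) simp

text \<open>The sample point occurs twice: in the paths of the first m filters and in the parameter
  supplied by the next filter. The diagonal identity separates the occurrences, and unbiasedness
  integrates the first. Unbiasedness is a premise here since it is itself proved by induction with
  the help of this statement.\<close>

lemma nn_je_param_aux:
 assumes m: "m < M" and G: "(%(q, z). G q z) \<in> bmf (Galg {Suc m} >< PP {0<..m * T})"
  and nn: "!!q z. q \<in> space P ==> z \<in> sp 0 (m * T) ==> 0 <= G q z"
  and unb: "!!f. f \<in> bp 0 (m * T) ==> (!!z. z \<in> sp 0 (m * T) ==> 0 <= f z) ==>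
   (nint P (%q. ennreal (je m f q))) = nint (lw 0 (m * T)) (%z. ennreal (f z))"
 shows "nint P (%q. ennreal (je m (G q) q)) = nint (lw 0 (m * T)) (%z. nint P (%q. ennreal (G q z)))"
proof -
 have A: "{Suc m} \<inter> {1..m} = {}" "{Suc m} \<subseteq> {1..M}" "{1..m} \<subseteq> {1..M}" using m by auto
 have sp: "space (Galg {Suc m}) = space P" using subalgebra_Galg[OF A(2)] by (simp add: subalgebra_def)
 have "(%(q, q'). je m (G q') q) \<in> bmf (Galg {1..m} >< Galg {Suc m})"
  using m A(3) by (intro je_param_meas[OF _ _ G] coords_Galg) auto
 from measurable_pair_swap[OF this]
 have mm: "(%(q', q). ennreal (je m (G q') q)) \<in> bmf (Galg {Suc m} >< Galg {1..m})"
  by (simp add: split_beta')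
 have "nint P (%q. ennreal (je m (G q) q)) = nint P (%q'. nint P (%q. ennreal (je m (G q') q)))"
  using nn_diagonal[OF A mm] by simp
 also have "... = nint P (%q'. nint (lw 0 (m * T)) (%z. ennreal (G q' z)))"
 proof (intro nn_integral_cong unb nn)
  fix q' assume "q' \<in> space P"
  then show "G q' \<in> bp 0 (m * T)"
   using measurable_compose_Pair1[OF _ G, of q'] sp by simp
 qed
 also have "... = nint (lw 0 (m * T)) (%z. nint P (%q. ennreal (G q z)))"
 proof -
  interpret L: prob_space "lw 0 (m * T)" using m by (intro prob_law mT_le_U) auto
  interpret PL: pair_sigma_finite P "lw 0 (m * T)" ..
  have id: "(%q. q) \<in> measurable P (Galg {Suc m})"
   using subalgebra_Galg[OF A(2)] by (auto simp: subalgebra_def intro!: measurableI)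
  have "(%p. (fst p, snd p)) \<in> measurable (P >< lw 0 (m * T)) (Galg {Suc m} >< PP {0<..m * T})"
   by (intro measurable_Pair mcomp[OF measurable_fst id]) (simp add: measurable_cong_sets[OF refl sets_law[symmetric]])
  from mcomp[OF this G] have "(%(q, z). ennreal (G q z)) \<in> bmf (P >< lw 0 (m * T))"
   by (simp add: split_beta')
  then show ?thesis by (rule PL.Fubini'[symmetric])
 qed
 finally show ?thesis .
qed

text \<open>The expectation is evaluated filter by filter: freezing the earlier path reduces to
  unbiasedness of one filter, and independence of the segments reassembles the law of the joined
  path.\<close>

lemma nn_je:
 assumes "m <= M" "f \<in> bp 0 (m * T)" "!!z. z \<in> sp 0 (m * T) ==> 0 <= f z"
 shows "nint P (%q. ennreal (je m f q)) = nint (lw 0 (m * T)) (%z. ennreal (f z))"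
 using assms
proof (induction m arbitrary: f)
 case 0
 show ?case by (simp add: jemp_0 nn_law_refl emeasure_space_1)
next
 case (Suc m)
 then have m: "m < M" by simp
 have "coords (Galg {Suc m}) m" using m by (intro coords_Galg) auto
 note G = mu_glue_meas[OF m this Suc.prems(2)]
 have fs: "(%y. f (glue (m * T) (Suc m * T) (z, y))) \<in> bp (m * T) (Suc m * T)"
  if "z \<in> sp 0 (m * T)" for z
  using measurable_compose_Pair1[OF that glue_section[OF mT_le Suc.prems(2)]] by simp
 have fnn: "0 <= f (glue (m * T) (Suc m * T) (z, y))" if "z \<in> sp 0 (m * T)" "y \<in> sp (m * T) (Suc m * T)" for z y
  using Suc.prems(3) glue_in_PP[OF mT_le that] by blast
 have nn: "0 <= mu m (%y. f (glue (m * T) (Suc m * T) (z, y))) q" if "q \<in> space P" "z \<in> sp 0 (m * T)" for q z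
  unfolding emp_def
 proof (intro divide_nonneg_nonneg sum_nonneg mult_nonneg_nonneg)
  fix k assume k: "k \<in> {1..K}"
  show "0 <= hwt S K X B (Suc m) (Suc m * T) k q"
   using seg_run.hw_pos[OF SR[OF m] mT_le order_refl that(1) k] by simp
  show "0 <= f (glue (m * T) (Suc m * T) (z, rpath S X B (Suc m) (Suc m * T) k q))"
   using fnn[OF that(2) seg_run.rp_space[OF SR[OF m] mT_le order_refl k that(1)]] .
 qed simp
 have "nint P (%q. ennreal (je (Suc m) f q)) = nint P (%q. ennreal (je m (%z. mu m (%y. f (glue (m * T) (Suc m * T) (z, y))) q) q))"
  by (simp only: jemp_Suc)
 also have "... = nint (lw 0 (m * T)) (%z. nint P (%q. ennreal (mu m (%y. f (glue (m * T) (Suc m * T) (z, y))) q)))"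
  using m by (intro nn_je_param_aux[OF m G nn Suc.IH]) auto
 also have "... = nint (lw 0 (m * T)) (%z. nint (lw (m * T) (Suc m * T)) (%y. ennreal (f (glue (m * T) (Suc m * T) (z, y)))))"
 proof (rule nn_integral_cong)
  fix z assume "z \<in> space (lw 0 (m * T))"
  then have z: "z \<in> sp 0 (m * T)" by simp
  show "nint P (%q. ennreal (mu m (%y. f (glue (m * T) (Suc m * T) (z, y))) q)) = nint (lw (m * T) (Suc m * T)) (%y. ennreal (f (glue (m * T) (Suc m * T) (z, y))))"
   by (rule seg_run.nn_emp[OF SR[OF m] mT_le order_refl fnn[OF z] fs[OF z]])
 qed
 also have "... = nint (lw 0 (Suc m * T)) (%z. ennreal (f z))"
  using Suc.prems by (intro nn_law_glue[OF block_mult mT_le mT_le_U, symmetric]) auto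
 finally show ?case .
qed

lemmas nn_je_param = nn_je_param_aux[OF _ _ _ nn_je[OF less_imp_le]]

lemma AE_jp:
 assumes m: "m <= M" and Q: "AE z in lw 0 (m * T). Q z"
 shows "AE q in P. \<forall>kp\<in>ZZ m. Q (jp m kp q)"
proof -
 from Q obtain N where N: "{z \<in> space (lw 0 (m * T)). \<not> Q z} \<subseteq> N" "emeasure (lw 0 (m * T)) N = 0" "N \<in> sets (lw 0 (m * T))"
  by (rule AE_E)
 have Nm: "N \<in> sets (PP {0<..m * T})" using N(3) by simp
 have im: "indicat_real N \<in> bp 0 (m * T)" using Nm by simp
 have "nint P (%q. ennreal (je m (indicator N) q)) = nint (lw 0 (m * T)) (%z. indicator N z)"
  using nn_je[OF m im] by (simp add: ennreal_indicator)
 also have "... = 0" using N by simp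
 finally have "nint P (%q. ennreal (je m (indicator N) q)) = 0" .
 moreover have "(%q. ennreal (je m (indicator N) q)) \<in> bmf P" using je_meas[OF m im] by simp
 ultimately have "AE q in P. ennreal (je m (indicator N) q) = 0" by (simp add: nn_integral_0_iff_AE)
 then show ?thesis using AE_space
 proof eventually_elim
  case (elim q)
  show ?case
  proof
   fix kp assume kp: "kp \<in> ZZ m"
   have t: "0 <= jw m kp' q * indicator N (jp m kp' q)" if "kp' \<in> ZZ m" for kp'
    using jw_pos[OF m that elim(2)] by (simp add: less_imp_le)
   have "je m (indicator N) q >= 0" using m elim(2) by (intro je_nonneg) auto
   then have "je m (indicator N) q = 0" using elim(1) by simp
   then have "(\<Sum>kp\<in>ZZ m. jw m kp q * indicator N (jp m kp q)) = 0"
    using K_pos by (simp add: jemp_def)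
   then have "jw m kp q * indicator N (jp m kp q) = 0"
    using t kp by (subst (asm) sum_nonneg_eq_0_iff) (auto intro: finite_PiE)
   then have "jp m kp q \<notin> N" using jw_pos[OF m kp elim(2)] by (auto simp: indicator_def split: if_splits)
   then show "Q (jp m kp q)" using N(1) jp_space[OF m kp elim(2)] by auto
  qed
 qed
qed

end

section \<open>Law of large numbers for joined paths\<close>

context run_seq
begin

abbreviation "T == seg_len S"
abbreviation "M == n_filters S"
abbreviation "ji i == jemp S (Suc i) (X (Suc i)) (B (Suc i))"
abbreviation "mi i j == emp S (Suc i) (X (Suc i)) (B (Suc i)) (Suc j) (Suc j * T)"

lemma MR: "multi_run S (Suc i) (pr i) (X (Suc i)) (B (Suc i))"
 unfolding multi_run_def multi_run_axioms_def using pf_setting_axioms run[of "Suc i"] by simp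

lemma SG: "j < M ==> run_seq_seg S P X B j"
 unfolding run_seq_seg_def run_seq_seg_axioms_def using run_seq_axioms by simp

lemma ji_meas: "m <= M ==> f \<in> bp 0 (m * T) ==> ji i m f \<in> bmf (pr i)"
 by (rule multi_run.je_meas[OF MR])

lemma int_section:
 fixes g :: "(nat => 'x) => real"
 assumes b: "block S a" and t: "a <= t" "t <= U" and g: "integrable (lw 0 t) g"
 shows "AE z in lw 0 a. integrable (lw a t) (%y. g (glue a t (z, y)))"
  and "integrable (lw 0 a) (%z. lint (lw a t) (%y. g (glue a t (z, y))))"
  and "lint (lw 0 a) (%z. lint (lw a t) (%y. g (glue a t (z, y)))) = lint (lw 0 t) (%z. g z)"
  and "AE y in lw a t. integrable (lw 0 a) (%z. g (glue a t (z, y)))"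
  and "integrable (lw a t) (%y. lint (lw 0 a) (%z. g (glue a t (z, y))))"
  and "lint (lw a t) (%y. lint (lw 0 a) (%z. g (glue a t (z, y)))) = lint (lw 0 t) (%z. g z)"
proof -
 interpret L0: prob_space "lw 0 a" using t by (intro prob_law) auto
 interpret L1: prob_space "lw a t" using t by (intro prob_law b) auto
 interpret Q: pair_sigma_finite "lw 0 a" "lw a t" ..
 note I = int_law_glue[OF b t g]
 have I1: "integrable (lw 0 a >< lw a t) (%(z, y). g (glue a t (z, y)))" using I(1) by (simp add: split_beta')
 show "AE z in lw 0 a. integrable (lw a t) (%y. g (glue a t (z, y)))" using Q.AE_integrable_fst[OF I1] .
 show "integrable (lw 0 a) (%z. lint (lw a t) (%y. g (glue a t (z, y))))" using Q.integrable_fst[OF I1] .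
 show "lint (lw 0 a) (%z. lint (lw a t) (%y. g (glue a t (z, y)))) = lint (lw 0 t) (%z. g z)"
  unfolding I(2) using Q.integral_fst[OF I1] by (simp add: split_beta')
 show "AE y in lw a t. integrable (lw 0 a) (%z. g (glue a t (z, y)))" using Q.AE_integrable_snd[OF I1] .
 show "integrable (lw a t) (%y. lint (lw 0 a) (%z. g (glue a t (z, y))))" using Q.integrable_snd[OF I1] .
 show "lint (lw a t) (%y. lint (lw 0 a) (%z. g (glue a t (z, y)))) = lint (lw 0 t) (%z. g z)"
  unfolding I(2) using Q.integral_snd[OF I1] by (simp add: split_beta')
qed

lemma L1_triangle:
 assumes [measurable]: "f \<in> bmf N" "g \<in> bmf N" and "!!q. q \<in> space N ==> \<bar>Z q\<bar> <= \<bar>f q\<bar> + \<bar>g q :: real\<bar>"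
 shows "nint N (%q. ennreal \<bar>Z q\<bar>) <= nint N (%q. ennreal \<bar>f q\<bar>) + nint N (%q. ennreal \<bar>g q\<bar>)"
proof -
 have "nint N (%q. ennreal \<bar>Z q\<bar>) <= nint N (%q. ennreal \<bar>f q\<bar> + ennreal \<bar>g q\<bar>)"
  using assms(3) by (intro nn_integral_mono) (simp flip: ennreal_plus)
 also have "... = nint N (%q. ennreal \<bar>f q\<bar>) + nint N (%q. ennreal \<bar>g q\<bar>)" by (rule nn_integral_add) measurable
 finally show ?thesis .
qed

text \<open>Given the path z of the earlier filters, the next filter estimates the section of g at
  z. Unbiasedness of the joined mean replaces the random z by an integral over the path law, under
  which the single-filter law of large numbers holds for almost every section.\<close>

lemma lln_step:
 assumes m: "m < M" and g: "integrable (lw 0 (Suc m * T)) g"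
 defines "gs == %z y. g (glue (m * T) (Suc m * T) (z, y))"
 defines "gb == %z. lint (lw (m * T) (Suc m * T)) (%y. gs z y)"
 shows "(%i. nint (pr i) (%q. ennreal (ji i m (%z. \<bar>mi i m (gs z) q - gb z\<bar>) q))) ---> 0"
  and "(%q. ji i m (%z. \<bar>mi i m (gs z) q - gb z\<bar>) q) \<in> bmf (pr i)"
proof -
 interpret G: run_seq_seg S P X B m by (rule SG[OF m])
 have U: "Suc m * T <= U" using m by (intro mT_le_U) simp
 have gs': "g (glue (m * T) (Suc m * T) (z, y)) = gs z y" for z y by (simp only: gs_def)
 have gb': "lint (lw (m * T) (Suc m * T)) (%y. gs z y) = gb z" for z by (simp only: gb_def)
 note I = int_section[OF block_mult mT_le U g, unfolded gs' gb']
 have gm: "g \<in> bp 0 (Suc m * T)" using g by (rule integrable_law_meas)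
 have gbm: "gb \<in> bp 0 (m * T)" using I(2) by (rule integrable_law_meas)
 have GM: "(%(q, z). \<bar>mi i m (gs z) q - gb z\<bar>) \<in> bmf (N >< PP {0<..m * T})" if "multi_run.coords S (Suc i) (X (Suc i)) (B (Suc i)) N m" for N i
 proof -
  have "(%(q, z). mi i m (gs z) q) \<in> bmf (N >< PP {0<..m * T})"
   unfolding gs_def by (rule multi_run.mu_glue_meas[OF MR m that gm])
  moreover have "(%(q, z). gb z) \<in> bmf (N >< PP {0<..m * T})"
   using mcomp[OF measurable_snd gbm] by (simp add: split_beta')
  ultimately show ?thesis unfolding split_beta' by (intro borel_measurable_abs borel_measurable_diff)
 qed
 have GMP: "(%(q, z). \<bar>mi i m (gs z) q - gb z\<bar>) \<in> bmf (pr i >< PP {0<..m * T})" for i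
  by (rule GM[OF multi_run.coords_P[OF MR m]])
 define u where "u i z = nint (pr i) (%q. ennreal \<bar>mi i m (gs z) q - gb z\<bar>)" for i z
 have eq: "nint (pr i) (%q. ennreal (ji i m (%z. \<bar>mi i m (gs z) q - gb z\<bar>) q)) = nint (lw 0 (m * T)) (%z. u i z)" for i
  unfolding u_def using m by (intro multi_run.nn_je_param[OF MR m GM] multi_run.coords_Galg[OF MR]) auto
 have um: "u i \<in> bmf (lw 0 (m * T))" for i
 proof -
  interpret Pi: prob_space "pr i" by (rule prob_pr)
  have "(%(z, q). ennreal \<bar>mi i m (gs z) q - gb z\<bar>) \<in> bmf (PP {0<..m * T} >< pr i)"
   using measurable_pair_swap[OF GMP[of i]] by (simp add: split_beta')
  from Pi.borel_measurable_nn_integral[OF this] show ?thesis unfolding u_def by (intro measurable_law)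
 qed
 \<comment> \<open>Uniform in the number of particles: by contraction the mean error of a section is
   at most its L1 norm plus |gb|, and both are integrable over the earlier path.\<close>
 define w where "w z = nint (lw (m * T) (Suc m * T)) (%y. ennreal \<bar>gs z y\<bar>) + ennreal \<bar>gb z\<bar>" for z
 have gsm: "gs z \<in> bp (m * T) (Suc m * T)" if "z \<in> sp 0 (m * T)" for z
  using measurable_compose_Pair1[OF that multi_run.glue_section[OF MR mT_le gm]] by (simp add: gs_def)
 interpret L1: prob_space "lw (m * T) (Suc m * T)" by (intro prob_law block_mult mT_le U)
 have wm1: "(%z. nint (lw (m * T) (Suc m * T)) (%y. ennreal \<bar>gs z y\<bar>)) \<in> bmf (lw 0 (m * T))"
 proof (rule measurable_law, rule L1.borel_measurable_nn_integral)
  have "(%(z, y). g (glue (m * T) (Suc m * T) (z, y))) \<in> bmf (PP {0<..m * T} >< lw (m * T) (Suc m * T))"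
   using multi_run.glue_section[OF MR mT_le gm] by (simp cong: measurable_cong_sets add: sets_pair_measure_cong[OF refl sets_law])
  then show "(%(z, y). ennreal \<bar>gs z y\<bar>) \<in> bmf (PP {0<..m * T} >< lw (m * T) (Suc m * T))"
   unfolding gs_def by (simp add: split_beta')
 qed
 have wm2: "(%z. ennreal \<bar>gb z\<bar>) \<in> bmf (lw 0 (m * T))" using gbm by (intro measurable_law) simp
 have "(%i. nint (lw 0 (m * T)) (%z. u i z)) ---> (nint (lw 0 (m * T)) (%z. 0))"
 proof (rule nn_integral_dominated_convergence[where w=w])
  show "w \<in> bmf (lw 0 (m * T))" unfolding w_def using wm1 wm2 by (intro borel_measurable_add)
  show "AE z in lw 0 (m * T). u i z <= w z" for i
  proof (rule AE_I2)
   fix z assume "z \<in> space (lw 0 (m * T))"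
   then have z: "z \<in> sp 0 (m * T)" by simp
   interpret Pi: prob_space "pr i" by (rule prob_pr)
   have "u i z <= nint (pr i) (%q. ennreal \<bar>mi i m (gs z) q\<bar>) + nint (pr i) (%q. ennreal \<bar>gb z\<bar>)"
    unfolding u_def using gsm[OF z] by (intro L1_triangle G.em_meas) auto
   also have "... <= w z" unfolding w_def using gsm[OF z] Pi.emeasure_space_1 by (intro add_mono G.em_abs) auto
   finally show "u i z <= w z" .
  qed
  show "nint (lw 0 (m * T)) (%z. w z) < \<infinity>"
  proof -
   have e1: "nint (lw 0 (m * T)) (%z. w z) = nint (lw 0 (m * T)) (%z. nint (lw (m * T) (Suc m * T)) (%y. ennreal \<bar>gs z y\<bar>)) + nint (lw 0 (m * T)) (%z. ennreal \<bar>gb z\<bar>)"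
    unfolding w_def using wm1 wm2 by (rule nn_integral_add)
   have e2: "nint (lw 0 (m * T)) (%z. nint (lw (m * T) (Suc m * T)) (%y. ennreal \<bar>gs z y\<bar>)) = nint (lw 0 (Suc m * T)) (%z. ennreal \<bar>g z\<bar>)"
    unfolding gs_def using gm by (intro nn_law_glue[OF block_mult mT_le U, symmetric]) simp
   have "nint (lw 0 (Suc m * T)) (%z. ennreal \<bar>g z\<bar>) < \<infinity>" "nint (lw 0 (m * T)) (%z. ennreal \<bar>gb z\<bar>) < \<infinity>"
    using g I(2) by (simp_all add: integrable_iff_bounded)
   then show ?thesis unfolding e1 e2 by simp
  qed
  show "AE z in lw 0 (m * T). (%i. u i z) ---> 0"
   using I(1)
  proof eventually_elim
   case (elim z)
   show ?case unfolding u_def gb_def by (rule G.lln_em[OF mT_le order_refl elim])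
  qed
 qed (use um in simp_all)
 then show "(%i. nint (pr i) (%q. ennreal (ji i m (%z. \<bar>mi i m (gs z) q - gb z\<bar>) q))) ---> 0" unfolding eq by simp
 show "(%q. ji i m (%z. \<bar>mi i m (gs z) q - gb z\<bar>) q) \<in> bmf (pr i)" for i
 proof -
  have "(%(q', q). ji i m (%z. \<bar>mi i m (gs z) q - gb z\<bar>) q') \<in> bmf (pr i >< pr i)"
   using m by (intro multi_run.je_param_meas[OF MR _ _ GMP] multi_run.coords_P[OF MR]) auto
  from mcomp[OF measurable_Pair[OF measurable_ident_sets measurable_ident_sets, OF refl refl] this] show ?thesis by simp
 qed
qed

text \<open>The error splits into that of the last filter with the earlier path frozen, handled by
  \<open>lln_step\<close>, and that of the earlier filters for the conditional mean
  \<open>gb\<close>.\<close>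

lemma lln_je:
 assumes "m <= M" "integrable (lw 0 (m * T)) g"
 shows "(%i. nint (pr i) (%q. ennreal \<bar>ji i m g q - lint (lw 0 (m * T)) (%z. g z)\<bar>)) ---> 0"
 using assms
proof (induction m arbitrary: g)
 case 0
 have "lint (lw 0 (0 * T)) (%z. g z) = g (%_. undefined)"
  unfolding mult_0 law_refl PiM_empty by (simp add: lebesgue_integral_count_space_finite)
 then show ?case by (simp add: jemp_0)
next
 case (Suc m)
 then have m: "m < M" by simp
 have U: "Suc m * T <= U" using m by (intro mT_le_U) simp
 define gs where "gs z y = g (glue (m * T) (Suc m * T) (z, y))" for z y
 define gb where "gb z = lint (lw (m * T) (Suc m * T)) (%y. gs z y)" for z
 note I = int_section[OF block_mult mT_le U Suc.prems(2), folded gs_def, folded gb_def]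
 note LS = lln_step[OF m Suc.prems(2), folded gs_def, folded gb_def]
 have IH: "(%i. nint (pr i) (%q. ennreal \<bar>ji i m gb q - lint (lw 0 (Suc m * T)) (%z. g z)\<bar>)) ---> 0"
  using Suc.IH[OF _ I(2)] m unfolding I(3) by simp
 show ?case
 proof (rule tendsto_0_le_ennreal[OF _ add_tendsto_0_ennreal[OF LS(1) IH]])
  fix i
  define D where "D q = ji i m (%z. \<bar>mi i m (gs z) q - gb z\<bar>) q" for q
  define c where "c = lint (lw 0 (Suc m * T)) (%z. g z)"
  have D0: "0 <= D q" if "q \<in> space (pr i)" for q
   unfolding D_def using m that by (intro multi_run.je_nonneg[OF MR]) auto
  have "nint (pr i) (%q. ennreal \<bar>ji i (Suc m) g q - c\<bar>) <= nint (pr i) (%q. ennreal \<bar>D q\<bar>) + nint (pr i) (%q. ennreal \<bar>ji i m gb q - c\<bar>)"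
  proof (rule L1_triangle)
   show "D \<in> bmf (pr i)" unfolding D_def[abs_def] by (rule LS(2))
   show "(%q. ji i m gb q - c) \<in> bmf (pr i)"
    using ji_meas[OF less_imp_le[OF m] integrable_law_meas[OF I(2)], of i] by simp
   fix q assume q: "q \<in> space (pr i)"
   have "ji i (Suc m) g q - ji i m gb q = ji i m (%z. mi i m (gs z) q - gb z) q"
    unfolding jemp_Suc gs_def[symmetric] jemp_diff ..
   moreover have "\<bar>ji i m (%z. mi i m (gs z) q - gb z) q\<bar> <= D q"
    unfolding D_def using m by (intro multi_run.je_abs[OF MR _ q]) simp
   ultimately show "\<bar>ji i (Suc m) g q - c\<bar> <= \<bar>D q\<bar> + \<bar>ji i m gb q - c\<bar>" by linarith
  qed
  also have "nint (pr i) (%q. ennreal \<bar>D q\<bar>) = nint (pr i) (%q. ennreal (D q))"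
   using D0 by (intro nn_integral_cong) simp
  finally show "nint (pr i) (%q. ennreal \<bar>ji i (Suc m) g q - lint (lw 0 (Suc m * T)) (%z. g z)\<bar>) \<le>
   (nint (pr i) (%q. ennreal (ji i m (%z. \<bar>mi i m (gs z) q - gb z\<bar>) q))) + nint (pr i) (%q. ennreal \<bar>ji i m gb q - lint (lw 0 (Suc m * T)) (%z. g z)\<bar>)"
   unfolding D_def c_def .
 qed
qed

end

subsection \<open>Reduction to single-filter errors\<close>

text \<open>\<open>gcond S G t\<close> is \<open>E\<^sub>q[G | X\<^sub>1, \<dots>, X\<^sub>t]\<close>, computed by integrating out the times \<open>U, \<dots>, t + 1\<close>
 one after the other, and \<open>seg_mean S G a t\<close> is the conditional mean given the times in \<open>{a<..t}\<close>.\<close>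

primrec gback :: "('x, 'y) pf_model => ((nat => 'x) => real) => nat => (nat => 'x) => real" where
 "gback S G 0 z = G z"
| "gback S G (Suc n) z = lint (next_law S (horizon S - Suc n) z) (%x. gback S G n (z(Suc (horizon S - Suc n) := x)))"

definition gcond :: "('x, 'y) pf_model => ((nat => 'x) => real) => nat => (nat => 'x) => real" where
 "gcond S G t = gback S G (horizon S - t)"

definition seg_mean :: "('x, 'y) pf_model => ((nat => 'x) => real) => nat => nat => (nat => 'x) => real" where
 "seg_mean S G a t y = lint (law S 0 a) (%z. gcond S G t (merge {0<..a} {a<..t} (z, y)))"

locale target = pf_setting S
 for S :: "('x, 'y) pf_model" +
 fixes G :: "(nat => 'x) => real"
 assumes G_int: "integrable (law S 0 (horizon S)) G"
begin

abbreviation "gc == gcond S G"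
abbreviation "sm == seg_mean S G"

lemma gc_U: "gc U = G"
 by (simp add: gcond_def fun_eq_iff)

lemma gc_step: "n < U ==> gc n z = lint (nl n z) (%x. gc (Suc n) (z(Suc n := x)))"
proof -
 assume n: "n < U"
 then have e: "U - n = Suc (U - Suc n)" "U - Suc (U - Suc n) = n" by auto
 show ?thesis unfolding gcond_def e(1) gback.simps e(2) ..
qed

lemma gc_int: "t <= U ==> integrable (lw 0 t) (gc t) \<and> (lint (lw 0 t) (%z. gc t z)) = lint (lw 0 U) (%z. G z)"
proof (induction t rule: inc_induct)
 case base
 then show ?case using G_int by (simp add: gc_U)
next
 case (step n)
 then have n: "n < U" by simp
 note I = int_law_Suc[OF block_0 le0 n conjunct1[OF step.IH]]
 show ?case unfolding gc_step[OF n, abs_def] using I(2) I(3)[symmetric] step.IH by (simp only: simp_thms)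
qed

lemma gc_meas: "t <= U ==> gc t \<in> bp 0 t"
 using gc_int by (intro integrable_law_meas) blast

text \<open>An event concerning the times up to t is unaffected when a later coordinate is
  integrated out, so it can be carried through the backward recursion.\<close>

lemma gc_cond:
 assumes "t <= s" "s <= U" and A: "A \<in> sets (PP {0<..t})"
 shows "lint (lw 0 U) (%x. indicator A (restrict x {0<..t}) * G x) = lint (lw 0 s) (%x. indicator A (restrict x {0<..t}) * gc s x)"
 using assms(2,1)
proof (induction s rule: inc_induct)
 case base
 show ?case by (simp add: gc_U)
next
 case (step n)
 then have n: "n < U" "t <= n" by auto
 define f where "f x = indicator A (restrict x {0<..t}) * gc (Suc n) x" for x
 have fm: "f \<in> bp 0 (Suc n)"
  unfolding f_def[abs_def] using n gc_meas[of "Suc n"] A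
  by (intro borel_measurable_times mcomp[OF restrict_measurable]) auto
 have "integrable (lw 0 (Suc n)) f"
  using gc_int[of "Suc n"] n measurable_law[OF fm]
  by (intro int_bound[of _ "gc (Suc n)" f]) (auto simp: f_def indicator_def)
 note I = int_law_Suc(3)[OF block_0 le0 n(1) this]
 have r: "restrict (z(Suc n := x)) {0<..t} = restrict z {0<..t}" for z x using n by auto
 have e: "lint (nl n z) (%x. f (z(Suc n := x))) = indicator A (restrict z {0<..t}) * gc n z" for z
  unfolding f_def r gc_step[OF n(1)] by (rule integral_mult_right_zero)
 have "lint (lw 0 U) (%x. indicator A (restrict x {0<..t}) * G x) = lint (lw 0 (Suc n)) (%x. f x)"
  unfolding f_def using step.IH n(2) by (simp only: le_Suc_eq simp_thms)
 then show ?case unfolding I e .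
qed

text \<open>Every event of the generated sigma-algebra is a preimage under the restriction, so
  testing against such preimages characterizes the conditional expectation. This connects the
  abstract conditional means of the variance formula with explicit integrals.\<close>

lemma cond_mean_eq:
 assumes I: "I \<subseteq> {0<..U}" and f: "f \<in> bmf (PP I)"
  and fi: "integrable (lw 0 U) (%x. f (restrict x I))"
  and eq: "!!A. A \<in> sets (PP I) ==> (lint (lw 0 U) (%x. indicator A (restrict x I) * G x)) = lint (lw 0 U) (%x. indicator A (restrict x I) * f (restrict x I))"
 shows "AE x in lw 0 U. cond_mean S I G x = f (restrict x I)"
proof -
 define F where "F = vimage_algebra (space (lw 0 U)) (%x. restrict x I) (PP I)"
 have rm: "(%x. restrict x I) \<in> measurable (lw 0 U) (PP I)" using I by (intro measurable_law restrict_measurable)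
 have sub: "subalgebra (lw 0 U) F" unfolding F_def using rm by (rule subalgebra_vimage)
 have pi: "(%x. restrict x I) \<in> space (lw 0 U) \<rightarrow> space (PP I)" using measurable_space[OF rm] by auto
 interpret L: prob_space "lw 0 U" by (intro prob_law) auto
 interpret Fs: finite_measure_subalgebra "lw 0 U" F by (unfold_locales) (rule sub)
 have "AE x in lw 0 U. real_cond_exp (lw 0 U) F G x = f (restrict x I)"
 proof (rule Fs.real_cond_exp_charact)
  show "integrable (lw 0 U) G" by (rule G_int)
  show "integrable (lw 0 U) (%x. f (restrict x I))" by (rule fi)
  show "(%x. f (restrict x I)) \<in> bmf F"
   unfolding F_def by (rule mcomp[OF measurable_vimage_algebra1[OF pi] f])
  fix B assume "B \<in> sets F"
  then obtain A where A: "A \<in> sets (PP I)" "B = (%x. restrict x I) -` A \<inter> space (lw 0 U)"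
   unfolding F_def sets_vimage_algebra2[OF pi] by blast
  have B: "indicat_real B x = indicator A (restrict x I)" if "x \<in> space (lw 0 U)" for x
   using that by (simp add: A(2) indicator_def)
  have "(\<integral>x\<in>B. G x \<partial>lw 0 U) = lint (lw 0 U) (%x. indicator A (restrict x I) * G x)"
   unfolding set_lebesgue_integral_def using B by (intro Bochner_Integration.integral_cong) auto
  also have "... = lint (lw 0 U) (%x. indicator A (restrict x I) * f (restrict x I))" by (rule eq[OF A(1)])
  also have "... = (\<integral>x\<in>B. f (restrict x I) \<partial>lw 0 U)"
   unfolding set_lebesgue_integral_def using B by (intro Bochner_Integration.integral_cong) auto
  finally show "(\<integral>x\<in>B. G x \<partial>lw 0 U) = (\<integral>x\<in>B. f (restrict x I) \<partial>lw 0 U)" .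
 qed
 then show ?thesis unfolding cond_mean_def prop_law_eq F_def .
qed

lemma int_law_restrict_block:
 fixes f :: "(nat => 'x) => real"
 assumes a: "block S a" and t: "a <= t" "t <= u" "u <= U" and f: "f \<in> bp a t"
 shows "lint (lw 0 u) (%x. f (restrict x {a<..t})) = lint (lw a t) (%x. f x)"
  and "integrable (lw 0 u) (%x. f (restrict x {a<..t})) \<longleftrightarrow> integrable (lw a t) f"
proof -
 have rm: "(%x. restrict x {a<..t}) \<in> measurable (lw 0 u) (PP {a<..t})" using t by (intro measurable_law restrict_measurable) auto
 note d = law_restrict_block[OF a t]
 show "lint (lw 0 u) (%x. f (restrict x {a<..t})) = lint (lw a t) (%x. f x)"
  unfolding d[symmetric] using rm f by (simp add: integral_distr)
 show "integrable (lw 0 u) (%x. f (restrict x {a<..t})) \<longleftrightarrow> integrable (lw a t) f"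
  unfolding d[symmetric] using rm f by (simp add: integrable_distr_eq)
qed

lemma gc_cond_mean:
 assumes t: "t <= U"
 shows "AE x in lw 0 U. cond_mean S {1..t} G x = gc t (restrict x {0<..t})"
 unfolding atLeast1
proof (rule cond_mean_eq)
 note R = int_law_restrict_block[OF block_0 le0 t order_refl]
 show "{0<..t} \<subseteq> {0<..U}" using t by auto
 show gm: "gc t \<in> bp 0 t" by (rule gc_meas[OF t])
 show "integrable (lw 0 U) (%x. gc t (restrict x {0<..t}))" using R(2)[OF gm] gc_int[OF t] by simp
 fix A assume A: "A \<in> sets (PP {0<..t})"
 have "(%x. indicator A x * gc t x) \<in> bp 0 t" using A gm by auto
 from R(1)[OF this] have "lint (lw 0 U) (%x. indicator A (restrict x {0<..t}) * gc t (restrict x {0<..t})) = lint (lw 0 t) (%x. indicator A x * gc t x)" .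
 also have "... = lint (lw 0 t) (%x. indicator A (restrict x {0<..t}) * gc t x)"
  by (intro Bochner_Integration.integral_cong) (auto simp: restrict_PP_id)
 also have "... = lint (lw 0 U) (%x. indicator A (restrict x {0<..t}) * G x)" by (rule gc_cond[OF order_refl t A, symmetric])
 finally show "lint (lw 0 U) (%x. indicator A (restrict x {0<..t}) * G x) = lint (lw 0 U) (%x. indicator A (restrict x {0<..t}) * gc t (restrict x {0<..t}))" by (rule sym)
qed

lemma sm_int:
 assumes a: "block S a" and t: "a <= t" "t <= U"
 shows "integrable (lw a t) (sm a t)" "sm a t \<in> bp a t"
proof -
 interpret L0: prob_space "lw 0 a" using t by (intro prob_law) auto
 interpret L1: prob_space "lw a t" using t by (intro prob_law a) auto
 interpret Q: pair_sigma_finite "lw 0 a" "lw a t" ..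
 have I1: "integrable (lw 0 a >< lw a t) (%(z, y). gc t (glue a t (z, y)))"
  using int_law_glue(1)[OF a t conjunct1[OF gc_int[OF t(2)]]] by (simp add: split_beta')
 show "integrable (lw a t) (sm a t)" unfolding seg_mean_def[abs_def] using Q.integrable_snd[OF I1] .
 then show "sm a t \<in> bp a t" by (rule integrable_law_meas)
qed

text \<open>An event over the current segment is also an event over all times up to t, which brings
  in \<open>gc\<close>; since the earlier segments are independent of it, Fubini moves their
  integral inside and produces the segment mean.\<close>

lemma sm_cond_mean:
 assumes a: "block S a" and t: "a <= t" "t <= U"
 shows "AE x in lw 0 U. cond_mean S {a<..t} G x = sm a t (restrict x {a<..t})"
proof (rule cond_mean_eq)
 note R = int_law_restrict_block[OF a t order_refl]
 show "{a<..t} \<subseteq> {0<..U}" using t by auto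
 show fm: "sm a t \<in> bp a t" by (rule sm_int(2)[OF a t])
 show "integrable (lw 0 U) (%x. sm a t (restrict x {a<..t}))" using R(2)[OF fm] sm_int(1)[OF a t] by simp
 fix A assume A: "A \<in> sets (PP {a<..t})"
 interpret L0: prob_space "lw 0 a" using t by (intro prob_law) auto
 interpret L1: prob_space "lw a t" using t by (intro prob_law a) auto
 interpret Q: pair_sigma_finite "lw 0 a" "lw a t" ..
 define A' where "A' = (%x. restrict x {a<..t}) -` A \<inter> sp 0 t"
 have A': "A' \<in> sets (PP {0<..t})" unfolding A'_def using A by (intro measurable_sets[OF restrict_measurable]) auto
 define f where "f x = indicator A (restrict x {a<..t}) * gc t x" for x
 have fm': "f \<in> bp 0 t"
  unfolding f_def[abs_def] using A gc_meas[OF t(2)] t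
  by (intro borel_measurable_times mcomp[OF restrict_measurable]) auto
 have fi: "integrable (lw 0 t) f"
  using gc_int[OF t(2)] measurable_law[OF fm']
  by (intro int_bound[of _ "gc t" f]) (auto simp: f_def indicator_def)
 have "lint (lw 0 U) (%x. indicator A (restrict x {a<..t}) * G x) = lint (lw 0 U) (%x. indicator A' (restrict x {0<..t}) * G x)"
 proof (rule Bochner_Integration.integral_cong[OF refl])
  fix x assume "x \<in> space (lw 0 U)"
  then have "restrict x {0<..t} \<in> sp 0 t" using measurable_space[OF restrict_measurable[of "{0<..t}" "{0<..U}"], of x] t by (simp add: Ioc_subset_iff)
  moreover have "restrict (restrict x {0<..t}) {a<..t} = restrict x {a<..t}" by auto
  ultimately show "indicator A (restrict x {a<..t}) * G x = indicator A' (restrict x {0<..t}) * G x"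
   by (simp add: A'_def indicator_def)
 qed
 also have "... = lint (lw 0 t) (%x. indicator A' (restrict x {0<..t}) * gc t x)" by (rule gc_cond[OF order_refl t(2) A'])
 also have "... = lint (lw 0 t) (%x. f x)"
  by (intro Bochner_Integration.integral_cong) (auto simp: f_def A'_def indicator_def restrict_PP_id)
 also have "... = lint (lw a t) (%y. lint (lw 0 a) (%z. f (glue a t (z, y))))"
  unfolding int_law_glue(2)[OF a t fi] using int_law_glue(1)[OF a t fi] Q.integral_snd[of "%z y. f (glue a t (z, y))"] by (simp add: split_beta')
 also have "... = lint (lw a t) (%y. indicator A y * sm a t y)"
 proof (rule Bochner_Integration.integral_cong[OF refl])
  fix y assume "y \<in> space (lw a t)"
  then have "f (glue a t (z, y)) = indicator A y * gc t (glue a t (z, y))" for z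
   unfolding f_def by (subst restrict_glue) simp_all
  then show "lint (lw 0 a) (%z. f (glue a t (z, y))) = indicator A y * sm a t y" by (simp add: seg_mean_def)
 qed
 also have "... = lint (lw 0 U) (%x. indicator A (restrict x {a<..t}) * sm a t (restrict x {a<..t}))"
 proof -
  have "(%x. indicator A x * sm a t x) \<in> bp a t" using A fm by auto
  from R(1)[OF this] show ?thesis by (rule sym)
 qed
 finally show "lint (lw 0 U) (%x. indicator A (restrict x {a<..t}) * G x) = lint (lw 0 U) (%x. indicator A (restrict x {a<..t}) * sm a t (restrict x {a<..t}))" .
qed

end

section \<open>Martingale chains built from the target\<close>

context run_seq_seg
begin

lemma sq_lin_bound: "(c * x + d * y)\<^sup>2 <= 2 * c\<^sup>2 * x\<^sup>2 + 2 * d\<^sup>2 * (y :: real)\<^sup>2"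
proof -
 have "0 <= (c * x - d * y)\<^sup>2" by simp
 then show ?thesis by (simp add: power2_eq_square algebra_simps)
qed

lemma sq_lin_integrable:
 assumes F: "F \<in> bp a t" "F' \<in> bp a t"
  and u: "a <= u" "u <= t" "t <= e"
  and i: "integrable (lw a t) (%z. (F z)\<^sup>2 * hr a u z)" "integrable (lw a t) (%z. (F' z)\<^sup>2 * hr a u z)"
 shows "integrable (lw a t) (%z. (c * F z + d * F' z)\<^sup>2 * hr a u z)"
proof (rule int_bound)
 show "integrable (lw a t) (%z. 2 * c\<^sup>2 * ((F z)\<^sup>2 * hr a u z) + 2 * d\<^sup>2 * ((F' z)\<^sup>2 * hr a u z))"
  using i by simp
 show "(%z. (c * F z + d * F' z)\<^sup>2 * hr a u z) \<in> bmf (lw a t)"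
  using F hmeas[OF u(2,3)] by (intro measurable_law) simp
 show "AE z in lw a t. norm ((c * F z + d * F' z)\<^sup>2 * hr a u z) <= norm (2 * c\<^sup>2 * ((F z)\<^sup>2 * hr a u z) + 2 * d\<^sup>2 * ((F' z)\<^sup>2 * hr a u z))"
 proof (rule AE_I2)
  fix z assume "z \<in> space (lw a t)"
  then have h: "hr a u z > 0" using hpos[OF u] by simp
  have "(c * F z + d * F' z)\<^sup>2 * hr a u z <= (2 * c\<^sup>2 * (F z)\<^sup>2 + 2 * d\<^sup>2 * (F' z)\<^sup>2) * hr a u z"
   using h by (intro mult_right_mono sq_lin_bound) simp
  moreover have "0 <= (c * F z + d * F' z)\<^sup>2 * hr a u z" using h by simp
  ultimately show "norm ((c * F z + d * F' z)\<^sup>2 * hr a u z) <= norm (2 * c\<^sup>2 * ((F z)\<^sup>2 * hr a u z) + 2 * d\<^sup>2 * ((F' z)\<^sup>2 * hr a u z))"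
   by (simp add: algebra_simps)
 qed
qed

text \<open>Chains form a vector space; integrability of the components is what makes the one-step
  identity additive. This is needed since the chain seen by a filter is a weighted sum over earlier
  particles.\<close>

lemma mart_chain_lin:
 assumes F: "mart_chain S a e F" and F': "mart_chain S a e F'"
 shows "mart_chain S a e (%t z. c * F t z + d * F' t z)"
 unfolding mart_chain_def
proof (intro conjI ballI)
 show "(%z. c * F t z + d * F' t z) \<in> bp a t" if "t \<in> {a..e}" for t
  using mart_chain_meas[OF F, of t] mart_chain_meas[OF F', of t] that by simp
 fix n assume "n \<in> {a..<e}"
 then have n: "a <= n" "n < e" "n < U" using e_le_U by auto
 note I = int_law_Suc(1)[OF block_a n(1,3)]
 show "AE z in lw a n. c * F n z + d * F' n z = lint (nl n z) (%x. c * F (Suc n) (z(Suc n := x)) + d * F' (Suc n) (z(Suc n := x)))"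
  using I[OF mart_chain_integrable[OF F n(1,2)]] I[OF mart_chain_integrable[OF F' n(1,2)]] mart_chainD(1)[OF F n(1,2)] mart_chainD(1)[OF F' n(1,2)]
  by eventually_elim simp
 have m: "F (Suc n) \<in> bp a (Suc n)" "F' (Suc n) \<in> bp a (Suc n)"
  using mart_chain_meas[OF F, of "Suc n"] mart_chain_meas[OF F', of "Suc n"] n by auto
 show "integrable (lw a (Suc n)) (%z. (c * F (Suc n) z + d * F' (Suc n) z)\<^sup>2 * hr a n z)"
  using n by (intro sq_lin_integrable m mart_chainD(2)[OF F n(1,2)] mart_chainD(2)[OF F' n(1,2)]) auto
 show "integrable (lw a (Suc n)) (%z. (c * F (Suc n) z + d * F' (Suc n) z)\<^sup>2 * hr a (Suc n) z)"
  using n by (intro sq_lin_integrable m mart_chainD(3)[OF F n(1,2)] mart_chainD(3)[OF F' n(1,2)]) auto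
qed

lemma mart_chain_sum:
 assumes "finite I" "!!i. i \<in> I ==> mart_chain S a e (F i)"
 shows "mart_chain S a e (%t z. \<Sum>i\<in>I. c i * F i t z)"
 using assms
proof (induction I rule: finite_induct)
 case empty
 show ?case by (auto simp: mart_chain_def)
next
 case (insert i I)
 have "mart_chain S a e (%t z. c i * F i t z + 1 * (\<Sum>i\<in>I. c i * F i t z))"
  using insert by (intro mart_chain_lin) auto
 then show ?case using insert by simp
qed

end

text \<open>\<open>sq0\<close> and \<open>sq1\<close> are the weighted second moments relevant for
  sampling and for resampling at time \<open>Suc n\<close>.\<close>

locale target_run = run_seq S P X B + target S G
 for S :: "('x, 'y) pf_model" and P :: "nat => 'w measure"
  and X :: "nat => nat => nat => 'w => 'x" and B :: "nat => nat => nat => 'w => nat" and G +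
 assumes sq0: "!!n. n < horizon S ==> integrable (law S 0 (Suc n)) (%x. (gcond S G (Suc n) x)\<^sup>2 * hrel S 0 n x)"
  and sq1: "!!n. n < horizon S ==> integrable (law S 0 (Suc n)) (%x. (gcond S G (Suc n) x)\<^sup>2 * hrel S 0 (Suc n) x)"
  and mean0: "lint (law S 0 (horizon S)) (%x. G x) = 0"
begin

lemma hrel_glue_le:
 assumes "block S a" "a <= s" "s <= t" "t <= U"
 shows "hr 0 s (glue a t (z, y)) = hr 0 a z * hr a s y"
proof -
 have "hr 0 s (glue a t (z, y)) = hr 0 s (glue a s (z, y))"
  using assms by (intro hrel_cong block_0) (auto simp: merge_def)
 then show ?thesis using hrel_glue[of a s z y] assms by simp
qed

text \<open>h on a glued path is the product of its values on the two pieces. Fubini therefore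
  distributes one moment condition on the whole path over sections in either variable; a positive
  factor that is constant on a section can be divided out.\<close>

lemma sq_section:
 assumes a: "block S a" and st: "a <= s" "s <= t" "t <= U"
  and I: "integrable (lw 0 t) (%x. (gc t x)\<^sup>2 * hr 0 s x)"
 shows "AE z in lw 0 a. integrable (lw a t) (%y. (gc t (glue a t (z, y)))\<^sup>2 * hr a s y)"
  and "AE y in lw a t. integrable (lw 0 a) (%z. (gc t (glue a t (z, y)))\<^sup>2 * hr 0 a z)"
  and "integrable (lw a t) (%y. (lint (lw 0 a) (%z. (gc t (glue a t (z, y)))\<^sup>2 * hr 0 a z)) * hr a s y)"
proof -
 have at: "a <= t" using st by simp
 have e: "(gc t (glue a t (z, y)))\<^sup>2 * hr 0 s (glue a t (z, y)) = hr 0 a z * ((gc t (glue a t (z, y)))\<^sup>2 * hr a s y)" for z y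
  unfolding hrel_glue_le[OF a st] by simp
 have e': "hr 0 a z * ((gc t (glue a t (z, y)))\<^sup>2 * hr a s y) = hr a s y * ((gc t (glue a t (z, y)))\<^sup>2 * hr 0 a z)" for z y by simp
 note J = int_section[OF a at st(3) I, unfolded e]
 show "AE z in lw 0 a. integrable (lw a t) (%y. (gc t (glue a t (z, y)))\<^sup>2 * hr a s y)"
  using J(1) AE_space
 proof eventually_elim
  case (elim z)
  then have "hr 0 a z > 0" using st by (intro hrel_pos[of 0 a a]) auto
  with elim(1) show ?case by simp
 qed
 show "AE y in lw a t. integrable (lw 0 a) (%z. (gc t (glue a t (z, y)))\<^sup>2 * hr 0 a z)"
  using J(4) AE_space
 proof eventually_elim
  case (elim y)
  then have "hr a s y > 0" using st by (intro hrel_pos[OF a, of s t]) auto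
  with elim(1) show ?case unfolding e' by simp
 qed
 show "integrable (lw a t) (%y. (lint (lw 0 a) (%z. (gc t (glue a t (z, y)))\<^sup>2 * hr 0 a z)) * hr a s y)"
  using J(5) unfolding e' by (simp add: mult.commute)
qed

text \<open>Cauchy-Schwarz with respect to the probability density 1 / h of the earlier segments. It
  is what lets a second moment weighted by h control the square of an unweighted mean.\<close>

lemma sm_square_le:
 assumes a: "block S a" and t: "a <= t" "t <= U"
  and I: "integrable (lw 0 t) (%x. (gc t x)\<^sup>2 * hr 0 t x)"
 shows "AE y in lw a t. (sm a t y)\<^sup>2 <= lint (lw 0 a) (%z. (gc t (glue a t (z, y)))\<^sup>2 * hr 0 a z)"
 using sq_section(2)[OF a t(1) order_refl t(2) I] int_section(4)[OF a t conjunct1[OF gc_int[OF t(2)]]]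
proof eventually_elim
 case (elim y)
 have aU: "a <= U" using t by simp
 interpret L: prob_space "lw 0 a" using t by (intro prob_law) auto
 define c where "c = sm a t y"
 define h where "h = hr 0 a"
 define g where "g z = gc t (glue a t (z, y))" for z
 have hp: "h z > 0" if "z \<in> space (lw 0 a)" for z unfolding h_def using that aU by (intro hrel_pos[of 0 a a]) auto
 have ih: "integrable (lw 0 a) (%z. 1 / h z)" "lint (lw 0 a) (%z. 1 / h z) = 1"
  unfolding h_def by (intro integrable_inverse_hrel block_0 le0 aU)+
 have gi: "integrable (lw 0 a) (%z. (g z)\<^sup>2 * h z)" "integrable (lw 0 a) g" "lint (lw 0 a) (%z. g z) = c"
  using elim unfolding g_def h_def c_def seg_mean_def by auto
 \<comment> \<open>Expanding this nonnegative integral, with total mass 1 of 1 / h and mean c of g,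
   leaves exactly the desired inequality.\<close>
 have "0 <= lint (lw 0 a) (%z. (g z * h z - c)\<^sup>2 / h z)"
  using hp by (intro integral_nonneg_AE AE_I2) (simp add: less_imp_le)
 also have "... = lint (lw 0 a) (%z. (g z)\<^sup>2 * h z - 2 * c * g z + c\<^sup>2 * (1 / h z))"
 proof (rule Bochner_Integration.integral_cong[OF refl])
  fix z assume "z \<in> space (lw 0 a)"
  then have "h z ~= 0" using hp[of z] by simp
  then show "(g z * h z - c)\<^sup>2 / h z = (g z)\<^sup>2 * h z - 2 * c * g z + c\<^sup>2 * (1 / h z)"
   by (simp add: power2_eq_square field_simps)
 qed
 also have "... = lint (lw 0 a) (%z. (g z)\<^sup>2 * h z) - 2 * c * c + c\<^sup>2"
 proof -
  define r where "r z = 1 / h z" for z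
  have "integrable (lw 0 a) r" "lint (lw 0 a) (%z. r z) = 1" using ih unfolding r_def .
  then show ?thesis unfolding r_def[symmetric] using gi by simp
 qed
 finally show ?case unfolding c_def[symmetric] g_def[symmetric] h_def[symmetric] by (simp add: power2_eq_square)
qed

lemma section_chain:
 assumes j: "j < M"
 shows "AE z in lw 0 (j * T). mart_chain S (j * T) (Suc j * T) (%t y. gc t (glue (j * T) t (z, y)))"
proof -
 have U: "Suc j * T <= U" using j by (intro mT_le_U) simp
 have A: "AE z in lw 0 (j * T). \<forall>n\<in>{j * T..<Suc j * T}.
   integrable (lw (j * T) (Suc n)) (%y. (gc (Suc n) (glue (j * T) (Suc n) (z, y)))\<^sup>2 * hr (j * T) n y) \<and>
   integrable (lw (j * T) (Suc n)) (%y. (gc (Suc n) (glue (j * T) (Suc n) (z, y)))\<^sup>2 * hr (j * T) (Suc n) y)"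
 proof (rule AE_finite_allI)
  fix n assume "n \<in> {j * T..<Suc j * T}"
  then have n: "j * T <= n" "n < U" using U by auto
  show "AE z in lw 0 (j * T). integrable (lw (j * T) (Suc n)) (%y. (gc (Suc n) (glue (j * T) (Suc n) (z, y)))\<^sup>2 * hr (j * T) n y) \<and>
   integrable (lw (j * T) (Suc n)) (%y. (gc (Suc n) (glue (j * T) (Suc n) (z, y)))\<^sup>2 * hr (j * T) (Suc n) y)"
   using sq_section(1)[OF block_mult n(1) _ _ sq0[OF n(2)]] sq_section(1)[OF block_mult _ _ _ sq1[OF n(2)], of "j"] n by auto
 qed simp
 show ?thesis using A AE_space
 proof eventually_elim
  case (elim z)
  then have z: "z \<in> sp 0 (j * T)" by simp
  show ?case unfolding mart_chain_def
  proof (intro conjI ballI)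
   fix t assume "t \<in> {j * T..Suc j * T}"
   then have t: "j * T <= t" "t <= U" using U by auto
   show "(%y. gc t (glue (j * T) t (z, y))) \<in> bp (j * T) t"
    using measurable_compose_Pair1[OF z multi_run.glue_section[OF MR t(1) gc_meas[OF t(2)]]] by simp
  next
   fix n assume "n \<in> {j * T..<Suc j * T}"
   then have n: "j * T <= n" "n < U" using U by auto
   show "AE y in lw (j * T) n. gc n (glue (j * T) n (z, y)) = lint (nl n y) (%x. gc (Suc n) (glue (j * T) (Suc n) (z, y(Suc n := x))))"
    unfolding gc_step[OF n(2)] next_law_glue[OF block_mult n(1)] glue_update[OF n(1)] by simp
  qed (use elim in auto)
 qed
qed

text \<open>With nothing of the current segment revealed, the segment mean is the overall mean of
  \<open>G\<close>, which is zero.\<close>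

lemma sm_start:
 assumes "block S a" "a <= U"
 shows "sm a a (%_. undefined) = 0"
proof -
 have "sm a a (%_. undefined) = lint (lw 0 a) (%z. gc a z)"
  unfolding seg_mean_def
 proof (rule Bochner_Integration.integral_cong[OF refl])
  fix z assume "z \<in> space (lw 0 a)"
  then have z: "z \<in> sp 0 a" by simp
  have "merge {0<..a} {a<..a} (z, %_. undefined) = restrict z {0<..a}" by (auto simp: merge_def restrict_def)
  then show "gc a (merge {0<..a} {a<..a} (z, %_. undefined)) = gc a z" using restrict_PP_id[OF z] by simp
 qed
 then show ?thesis using gc_int[OF assms(2)] mean0 by simp
qed

text \<open>Two integrals are exchanged, over the earlier path and over the next state.
  \<open>k\<close> is the L1 norm over the earlier path; its total integral is the L1 norm of
  \<open>gc\<close>, so for almost every y the integrand is integrable on the product.\<close>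

lemma sm_step:
 assumes a: "block S a" and n: "a <= n" "n < U"
 shows "AE y in lw a n. sm a n y = lint (nl n y) (%x. sm a (Suc n) (y(Suc n := x)))"
proof -
 have S: "a <= Suc n" "Suc n <= U" using n by auto
 define g where "g z y = gc (Suc n) (glue a (Suc n) (z, y))" for z y
 have gm: "(%(z, y). g z y) \<in> bmf (PP {0<..a} >< PP {a<..Suc n})"
  unfolding g_def by (rule multi_run.glue_section[OF MR S(1) gc_meas[OF S(2)]])
 interpret L0: prob_space "lw 0 a" using n by (intro prob_law) auto
 have L0s: "sets (lw 0 a) = sets (PP {0<..a})" by simp
 define k where "k y = nint (lw 0 a) (%z. ennreal \<bar>g z y\<bar>)" for y
 have km: "k \<in> bp a (Suc n)"
 proof -
  have "(%(y, z). g z y) \<in> bmf (PP {a<..Suc n} >< PP {0<..a})"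
   using measurable_pair_swap[OF gm] by (simp add: split_beta')
  then have "(%(y, z). ennreal \<bar>g z y\<bar>) \<in> bmf (PP {a<..Suc n} >< lw 0 a)"
   by (simp add: split_beta' cong: measurable_cong_sets sets_pair_measure_cong)
  from L0.borel_measurable_nn_integral[OF this] show ?thesis unfolding k_def .
 qed
 have "nint (lw a (Suc n)) (%y. k y) = nint (lw 0 a) (%z. nint (lw a (Suc n)) (%y. ennreal \<bar>g z y\<bar>))"
 proof -
  interpret L1: prob_space "lw a (Suc n)" using S by (intro prob_law a) auto
  interpret Q: pair_sigma_finite "lw 0 a" "lw a (Suc n)" ..
  have "(%(z, y). ennreal \<bar>g z y\<bar>) \<in> bmf (lw 0 a >< lw a (Suc n))"
   using gm by (simp add: split_beta' cong: measurable_cong_sets[OF sets_law_pair refl])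
  then show ?thesis unfolding k_def by (rule Q.Fubini')
 qed
 also have "... = nint (lw 0 (Suc n)) (%z. ennreal \<bar>gc (Suc n) z\<bar>)"
  unfolding g_def using gc_meas[OF S(2)] by (intro nn_law_glue[OF a S, symmetric]) simp
 also have "... < \<infinity>" using gc_int[OF S(2)] by (simp add: integrable_iff_bounded)
 finally have "nint (lw a n) (%y. nint (nl n y) (%x. k (y(Suc n := x)))) < \<infinity>"
  unfolding nn_law_Suc[OF a n km] .
 moreover have "(%y. nint (nl n y) (%x. k (y(Suc n := x)))) \<in> bmf (lw a n)"
  using nn_next_law_measurable[OF a n measurable_comp_update[OF n(1) km]] by (intro measurable_law) simp
 ultimately have "AE y in lw a n. (nint (nl n y) (%x. k (y(Suc n := x)))) ~= \<infinity>"
  by (intro nn_integral_noteq_infinite) auto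
 then show ?thesis using AE_space
 proof eventually_elim
  case (elim y)
  then have y: "y \<in> sp a n" by simp
  interpret N: prob_space "nl n y" by (rule prob_next_law[OF a n y])
  interpret Q: pair_sigma_finite "nl n y" "lw 0 a" ..
  have m1: "(%(x, z). g z (y(Suc n := x))) \<in> bmf (nl n y >< lw 0 a)"
  proof -
   have "(%x. y(Suc n := x)) \<in> measurable nu (PP {a<..Suc n})"
    using measurable_compose_Pair1[OF y measurable_update[OF n(1)]] by simp
   then have "(%p. (snd p, y(Suc n := fst p))) \<in> measurable (nu >< PP {0<..a}) (PP {0<..a} >< PP {a<..Suc n})"
    by (intro measurable_Pair measurable_snd mcomp[OF measurable_fst])
   from mcomp[OF this gm] show ?thesis
    by (simp add: split_beta' cong: measurable_cong_sets sets_pair_measure_cong)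
  qed
  have i: "integrable (nl n y >< lw 0 a) (%(x, z). g z (y(Suc n := x)))"
  proof (rule iffD2[OF integrable_iff_bounded], intro conjI m1)
   have "nint (nl n y >< lw 0 a) (%p. ennreal (norm (case p of (x, z) => g z (y(Suc n := x))))) = nint (nl n y) (%x. k (y(Suc n := x)))"
    unfolding k_def using m1 by (subst L0.nn_integral_fst[symmetric]) (simp_all add: split_beta')
   then show "nint (nl n y >< lw 0 a) (%p. ennreal (norm (case p of (x, z) => g z (y(Suc n := x))))) < \<infinity>"
    using elim(1) by (simp add: less_top)
  qed
  have "sm a n y = lint (lw 0 a) (%z. lint (nl n y) (%x. g z (y(Suc n := x))))"
   unfolding seg_mean_def g_def gc_step[OF n(2)] next_law_glue[OF a n(1)] glue_update[OF n(1)] ..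
  also have "... = lint (nl n y) (%x. lint (lw 0 a) (%z. g z (y(Suc n := x))))"
   using Q.Fubini_integral[OF i] by simp
  finally show ?case unfolding g_def seg_mean_def .
 qed
qed

lemma sm_square_integrable:
 assumes a: "block S a" and st: "a <= s" "s <= t" "t <= U"
  and I: "integrable (lw 0 t) (%x. (gc t x)\<^sup>2 * hr 0 s x)" "integrable (lw 0 t) (%x. (gc t x)\<^sup>2 * hr 0 t x)"
 shows "integrable (lw a t) (%y. (sm a t y)\<^sup>2 * hr a s y)"
proof (rule int_bound[OF sq_section(3)[OF a st I(1)]])
 have at: "a <= t" using st by simp
 show "(%y. (sm a t y)\<^sup>2 * hr a s y) \<in> bmf (lw a t)"
  using sm_int(2)[OF a at st(3)] hrel_measurable[OF a st(2,3)] by (intro measurable_law) simp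
 show "AE y in lw a t. norm ((sm a t y)\<^sup>2 * hr a s y) <= norm ((lint (lw 0 a) (%z. (gc t (glue a t (z, y)))\<^sup>2 * hr 0 a z)) * hr a s y)"
  using sm_square_le[OF a at st(3) I(2)] AE_space
 proof eventually_elim
  case (elim y)
  then have "hr a s y > 0" using st by (intro hrel_pos[OF a, of s t]) auto
  moreover have "0 <= lint (lw 0 a) (%z. (gc t (glue a t (z, y)))\<^sup>2 * hr 0 a z)"
   using elim(1) zero_le_power2 order_trans by blast
  ultimately show ?case using elim(1) by (simp add: abs_mult)
 qed
qed

lemma sm_chain:
 assumes j: "j < M"
 shows "mart_chain S (j * T) (Suc j * T) (sm (j * T))"
proof -
 have U: "Suc j * T <= U" using j by (intro mT_le_U) simp
 show ?thesis unfolding mart_chain_def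
 proof (intro conjI ballI)
  fix t assume "t \<in> {j * T..Suc j * T}"
  then show "sm (j * T) t \<in> bp (j * T) t" using U by (intro sm_int(2) block_mult) auto
 next
  fix n assume "n \<in> {j * T..<Suc j * T}"
  then have n: "j * T <= n" "n < U" using U by auto
  show "AE y in lw (j * T) n. sm (j * T) n y = lint (nl n y) (%x. sm (j * T) (Suc n) (y(Suc n := x)))"
   by (rule sm_step[OF block_mult n])
  show "integrable (lw (j * T) (Suc n)) (%z. (sm (j * T) (Suc n) z)\<^sup>2 * hr (j * T) n z)"
   using n by (intro sm_square_integrable block_mult sq0 sq1) auto
  show "integrable (lw (j * T) (Suc n)) (%z. (sm (j * T) (Suc n) z)\<^sup>2 * hr (j * T) (Suc n) z)"
   using n by (intro sm_square_integrable block_mult sq0 sq1) auto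
 qed
qed

end

section \<open>Vanishing second moments of the deviation from the mean section\<close>

context prob_seq
begin

lemma conv_prob_nn_min:
 assumes Z[measurable]: "!!i. Z i \<in> bmf (P i)" and c: "conv_prob P Z 0" and C: "C > 0"
 shows "(%i. nint (P i) (%q. ennreal (min C \<bar>Z i q\<bar>))) ---> 0"
proof -
 have "nint (P i) (%q. ennreal (min C \<bar>Z i q\<bar>)) = ennreal (lint (P i) (%q. min C \<bar>Z i q\<bar>))" for i
 proof -
  interpret prob_space "P i" by (rule prob)
  show ?thesis using C by (intro nn_integral_eq_integral integrable_const_bound[where B=C]) auto
 qed
 then show ?thesis using tendsto_ennrealI[OF conv_prob_integral_min[OF Z c C]] by simp
qed

text \<open>The constant \<open>4 * A\<close> makes the truncated part integrable; what is cut off is controlled by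
 \<open>R - 1\<close> and \<open>Ak - A\<close>.\<close>

lemma quadratic_remainder:
 fixes f Ak :: "nat => 'w => 'b => real" and A :: "'b => real" and R :: "nat => 'w => real"
 assumes N: "sigma_finite_measure N"
  and f[measurable]: "!!i. (%(q, y). f i q y) \<in> bmf (P i >< N)"
  and Ak[measurable]: "!!i. (%(q, y). Ak i q y) \<in> bmf (P i >< N)"
  and R[measurable]: "!!i. R i \<in> bmf (P i)"
  and f0: "!!i q y. q \<in> space (P i) ==> y \<in> space N ==> 0 <= f i q y"
  and Ak0: "!!i q y. q \<in> space (P i) ==> y \<in> space N ==> 0 <= Ak i q y"
  and R0: "!!i q. q \<in> space (P i) ==> 0 <= R i q"
  and A0: "!!y. y \<in> space N ==> 0 <= A y"
  and A: "integrable N A"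
  and le: "!!i. AE y in N. \<forall>q\<in>space (P i). f i q y <= 2 * R i q * Ak i q y + 2 * A y"
  and pf: "AE y in N. conv_prob P (%i q. f i q y) 0"
  and pA: "AE y in N. (%i. nint (P i) (%q. ennreal \<bar>Ak i q y - A y\<bar>)) ---> 0"
  and unb: "!!i. AE y in N. (nint (P i) (%q. ennreal (Ak i q y))) = ennreal (A y)"
  and cR: "conv_prob P R 1"
 shows "(%i. nint (P i) (%q. min 1 (nint N (%y. ennreal (f i q y))))) ---> 0"
proof -
 let ?m = "%i q y. (min (f i q y) (4 * A y))"
 interpret N: sigma_finite_measure N by (rule N)
 have Am[measurable]: "A \<in> bmf N" using A by simp
 define a where "a = lint N (%y. A y)"
 let ?r = "%i q. (min 1 \<bar>R i q - 1\<bar>)"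
 let ?u = "%i q. (min 1 \<bar>2 * a * (R i q - 1)\<bar>)"
 have a0: "a >= 0" unfolding a_def using A0 by (intro integral_nonneg_AE AE_I2)
 have Aa: "nint N (%y. ennreal (A y)) = ennreal a" unfolding a_def using A A0 by (intro nn_integral_eq_integral AE_I2)
 define C where "C i q = nint N (%y. ennreal (?m i q y))" for i q
 define D where "D i q = nint N (%y. ennreal \<bar>Ak i q y - A y\<bar>)" for i q
 have Cj: "(%(q, y). ennreal (?m i q y)) \<in> bmf (P i >< N)" for i by measurable
 have Dj: "(%(q, y). ennreal \<bar>Ak i q y - A y\<bar>) \<in> bmf (P i >< N)" for i by measurable
 have Cm[measurable]: "C i \<in> bmf (P i)" for i
  using N.borel_measurable_nn_integral[OF Cj[of i]] unfolding C_def by simp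
 have Dm[measurable]: "D i \<in> bmf (P i)" for i
  using N.borel_measurable_nn_integral[OF Dj[of i]] unfolding D_def by simp
 have fub: "nint (P i) (%q. nint N (%y. g q y)) = nint N (%y. nint (P i) (%q. g q y))"
  "(%y. nint (P i) (%q. g q y)) \<in> bmf N"
  if g: "(%(q, y). g q y) \<in> bmf (P i >< N)" for g i
 proof -
  interpret Pi: prob_space "P i" by (rule prob)
  interpret Q: pair_sigma_finite "P i" N ..
  show "nint (P i) (%q. nint N (%y. g q y)) = nint N (%y. nint (P i) (%q. g q y))" using Q.Fubini'[OF g] by simp
  have "(%(y, q). g q y) \<in> bmf (N >< P i)" using measurable_pair_swap[OF g] by (simp add: split_beta')
  then show "(%y. nint (P i) (%q. g q y)) \<in> bmf N" by (rule Pi.borel_measurable_nn_integral)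
 qed
 have fs: "(%q. f i q y) \<in> bmf (P i)" "(%q. Ak i q y) \<in> bmf (P i)" if "y \<in> space N" for i y
  using mcomp[OF measurable_Pair2'[OF that] f[of i]] mcomp[OF measurable_Pair2'[OF that] Ak[of i]] by simp_all
 \<comment> \<open>Where \<open>A\<close> vanishes the truncated function vanishes too; elsewhere
   the cap is positive and capped convergence in probability applies. Dominated by 4 A.\<close>
 have C_lim: "(%i. nint (P i) (%q. C i q)) ---> 0"
 proof -
  have "(%i. nint N (%y. nint (P i) (%q. ennreal (?m i q y)))) ---> (nint N (%y. 0))"
  proof (rule nn_integral_dominated_convergence[where w="%y. ennreal (4 * A y)"])
   show "(%y. nint (P i) (%q. ennreal (?m i q y))) \<in> bmf N" for i by (rule fub(2)[OF Cj])
   show "AE y in N. (nint (P i) (%q. ennreal (?m i q y))) <= ennreal (4 * A y)" for i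
   proof (rule AE_I2)
    fix y
    interpret Pi: prob_space "P i" by (rule prob)
    have "nint (P i) (%q. ennreal (?m i q y)) <= nint (P i) (%q. ennreal (4 * A y))"
     by (intro nn_integral_mono ennreal_leI) simp
    then show "nint (P i) (%q. ennreal (?m i q y)) <= ennreal (4 * A y)"
     by (simp add: Pi.emeasure_space_1)
   qed
   have "nint N (%y. ennreal (4 * A y)) = ennreal (lint N (%y. 4 * A y))"
    using A A0 by (intro nn_integral_eq_integral AE_I2) auto
   then show "nint N (%y. ennreal (4 * A y)) < \<infinity>" by simp
   show "AE y in N. (%i. nint (P i) (%q. ennreal (?m i q y))) ---> 0"
    using pf AE_space
   proof eventually_elim
    case (elim y)
    show ?case
    proof (cases "A y = 0")
     case True
     then have "ennreal (?m i q y) = 0" for i q by (simp add: ennreal_neg)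
     then show ?thesis by simp
    next
     case False
     then have "4 * A y > 0" using A0[OF elim(2)] by simp
     from conv_prob_nn_min[OF fs(1)[OF elim(2)] elim(1) this]
     have "(%i. nint (P i) (%q. ennreal (min (4 * A y) \<bar>f i q y\<bar>))) ---> 0" .
     moreover have "nint (P i) (%q. ennreal (min (4 * A y) \<bar>f i q y\<bar>)) = nint (P i) (%q. ennreal (?m i q y))" for i
      using f0 elim(2) by (intro nn_integral_cong) (simp add: min.commute)
     ultimately show ?thesis by simp
    qed
   qed
  qed simp_all
  then show ?thesis unfolding C_def fub(1)[OF Cj] by simp
 qed
 \<comment> \<open>The exact mean \<open>unb\<close> bounds the mean error by 2 A for every i, which
   is the domination required.\<close>
 have D_lim: "(%i. nint (P i) (%q. D i q)) ---> 0"
 proof -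
  have "(%i. nint N (%y. nint (P i) (%q. ennreal \<bar>Ak i q y - A y\<bar>))) ---> (nint N (%y. 0))"
  proof (rule nn_integral_dominated_convergence[where w="%y. ennreal (2 * A y)"])
   show "(%y. nint (P i) (%q. ennreal \<bar>Ak i q y - A y\<bar>)) \<in> bmf N" for i by (rule fub(2)[OF Dj])
   show "AE y in N. (nint (P i) (%q. ennreal \<bar>Ak i q y - A y\<bar>)) <= ennreal (2 * A y)" for i
    using unb[of i] AE_space
   proof eventually_elim
    case (elim y)
    interpret Pi: prob_space "P i" by (rule prob)
    have "nint (P i) (%q. ennreal \<bar>Ak i q y - A y\<bar>) <= nint (P i) (%q. ennreal (Ak i q y) + ennreal (A y))"
    proof (rule nn_integral_mono)
     fix q assume q: "q \<in> space (P i)"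
     have "\<bar>Ak i q y - A y\<bar> <= Ak i q y + A y" using Ak0[OF q elim(2)] A0[OF elim(2)] by simp
     then show "ennreal \<bar>Ak i q y - A y\<bar> <= ennreal (Ak i q y) + ennreal (A y)"
      using Ak0[OF q elim(2)] A0[OF elim(2)] by (simp flip: ennreal_plus)
    qed
    also have "... = ennreal (A y) + ennreal (A y)"
     using fs(2)[OF elim(2), of i] elim(1) by (subst nn_integral_add) (simp_all add: Pi.emeasure_space_1)
    also have "... = ennreal (2 * A y)" using A0[OF elim(2)] by (simp flip: ennreal_plus)
    finally show ?case .
   qed
   have "nint N (%y. ennreal (2 * A y)) = ennreal (lint N (%y. 2 * A y))"
    using A A0 by (intro nn_integral_eq_integral AE_I2) auto
   then show "nint N (%y. ennreal (2 * A y)) < \<infinity>" by simp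
   show "AE y in N. (%i. nint (P i) (%q. ennreal \<bar>Ak i q y - A y\<bar>)) ---> 0" by (rule pA)
  qed simp_all
  then show ?thesis unfolding D_def fub(1)[OF Dj] by simp
 qed
 have cR1: "conv_prob P (%i q. R i q - 1) 0"
  using conv_prob_diff[OF R _ cR conv_prob_const[of 1]] by simp
 have cR2: "conv_prob P (%i q. 2 * a * (R i q - 1)) 0"
  using conv_prob_mult[OF _ _ conv_prob_const[of "2 * a"] cR1] by simp
 have lim: "(%i. ((nint (P i) (%q. C i q)) + 4 * nint (P i) (%q. D i q)) + ((nint (P i) (%q. ennreal (?r i q))) + nint (P i) (%q. ennreal (?u i q)))) ---> 0"
 proof (intro add_tendsto_0_ennreal C_lim conv_prob_nn_min cR1 cR2)
  show "(%i. 4 * nint (P i) (%q. D i q)) ---> 0" using ennreal_tendsto_cmult[OF _ D_lim, of 4] by simp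
 qed simp_all
 show ?thesis
 proof (rule tendsto_0_le_ennreal[OF _ lim])
  fix i
  \<comment> \<open>Writing \<open>R\<close> times \<open>Ak\<close> as A plus two errors turns the
    assumed bound into 2 A + 2 A plus errors; this is the origin of the constant 4.\<close>
  have leA: "AE y in N. \<forall>q\<in>space (P i). f i q y <= min (f i q y) (4 * A y) + (2 * R i q * \<bar>Ak i q y - A y\<bar> + 2 * \<bar>R i q - 1\<bar> * A y)"
   using le[of i] AE_space
  proof eventually_elim
   case (elim y)
   show ?case
   proof
    fix q assume q: "q \<in> space (P i)"
    have "R i q * Ak i q y = R i q * (Ak i q y - A y) + (R i q - 1) * A y + A y" by (simp add: algebra_simps)
    moreover have "R i q * (Ak i q y - A y) <= R i q * \<bar>Ak i q y - A y\<bar>" using R0[OF q] by (intro mult_left_mono) auto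
    moreover have "(R i q - 1) * A y <= \<bar>R i q - 1\<bar> * A y" using A0[OF elim(2)] by (intro mult_right_mono) auto
    moreover have "0 <= R i q * \<bar>Ak i q y - A y\<bar>" using R0[OF q] by simp
    moreover have "0 <= \<bar>R i q - 1\<bar> * A y" using A0[OF elim(2)] by simp
    moreover have "f i q y <= 2 * (R i q * Ak i q y) + 2 * A y" using elim(1) q by (simp add: mult.assoc)
    ultimately show "f i q y <= min (f i q y) (4 * A y) + (2 * R i q * \<bar>Ak i q y - A y\<bar> + 2 * \<bar>R i q - 1\<bar> * A y)"
     by (auto simp: min_def mult.assoc)
   qed
  qed
  have "nint (P i) (%q. min 1 (nint N (%y. ennreal (f i q y)))) \<le>
   (nint (P i) (%q. (C i q + 4 * D i q) + (ennreal (?r i q) + ennreal (?u i q))))"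
  proof (rule nn_integral_mono)
   fix q assume q: "q \<in> space (P i)"
   have sec: "(%y. f i q y) \<in> bmf N" "(%y. Ak i q y) \<in> bmf N"
    using measurable_compose_Pair1[OF q f[of i]] measurable_compose_Pair1[OF q Ak[of i]] by simp_all
   note [measurable] = sec
   have leE: "AE y in N. ennreal (f i q y) <= ennreal (?m i q y) + (ennreal (2 * R i q) * ennreal \<bar>Ak i q y - A y\<bar> + ennreal (2 * \<bar>R i q - 1\<bar>) * ennreal (A y))"
    using leA AE_space
   proof eventually_elim
    case (elim y)
    have "ennreal (f i q y) <= ennreal (min (f i q y) (4 * A y) + (2 * R i q * \<bar>Ak i q y - A y\<bar> + 2 * \<bar>R i q - 1\<bar> * A y))"
     using elim(1) q by (intro ennreal_leI) auto
    also have "... = ennreal (?m i q y) + (ennreal (2 * R i q) * ennreal \<bar>Ak i q y - A y\<bar> + ennreal (2 * \<bar>R i q - 1\<bar>) * ennreal (A y))"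
     using f0[OF q elim(2)] A0[OF elim(2)] R0[OF q] by (simp add: ennreal_plus ennreal_mult)
    finally show ?case .
   qed
   then have "nint N (%y. ennreal (f i q y)) <= nint N (%y. ennreal (?m i q y) + (ennreal (2 * R i q) * ennreal \<bar>Ak i q y - A y\<bar> + ennreal (2 * \<bar>R i q - 1\<bar>) * ennreal (A y)))"
    by (rule nn_integral_mono_AE)
   also have "... = C i q + (ennreal (2 * R i q) * D i q + ennreal (2 * \<bar>R i q - 1\<bar>) * ennreal a)"
    unfolding C_def D_def Aa[symmetric] by (simp add: nn_integral_add nn_integral_cmult)
   finally have V: "nint N (%y. ennreal (f i q y)) <= C i q + (ennreal (2 * R i q) * D i q + ennreal (2 * \<bar>R i q - 1\<bar>) * ennreal a)" .
   have e: "ennreal (2 * \<bar>R i q - 1\<bar>) * ennreal a = ennreal \<bar>2 * a * (R i q - 1)\<bar>"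
   proof -
    have "2 * \<bar>r\<bar> * a = \<bar>2 * a * r\<bar>" for r :: real using a0 by (simp add: abs_mult)
    then show ?thesis using a0 ennreal_mult[of "2 * \<bar>R i q - 1\<bar>" a] by (metis abs_ge_zero mult_nonneg_nonneg zero_le_numeral)
   qed
   show "min 1 (nint N (%y. ennreal (f i q y))) <= (C i q + 4 * D i q) + (ennreal (?r i q) + ennreal (?u i q))"
   \<comment> \<open>Outside this event one of the two capped terms is already 1 and dominates the
     left side.\<close>
   proof (cases "R i q <= 2 \<and> \<bar>2 * a * (R i q - 1)\<bar> <= 1")
    case True
    have "ennreal (2 * R i q) * D i q <= 4 * D i q"
    proof (rule mult_right_mono)
     have "ennreal (2 * R i q) <= ennreal 4" using True by (intro ennreal_leI) simp
     then show "ennreal (2 * R i q) <= 4" by simp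
    qed simp
    moreover have "ennreal \<bar>2 * a * (R i q - 1)\<bar> = ennreal (?u i q)" using True by simp
    ultimately have "C i q + (ennreal (2 * R i q) * D i q + ennreal (2 * \<bar>R i q - 1\<bar>) * ennreal a) <= C i q + (4 * D i q + ennreal (?u i q))"
     unfolding e by (intro add_left_mono add_mono) auto
    also have "... <= (C i q + 4 * D i q) + (ennreal (?r i q) + ennreal (?u i q))"
     unfolding add.assoc by (intro add_left_mono) simp
    finally show ?thesis using V by (meson min.coboundedI2 order_trans)
   next
    case False
    then have "\<bar>R i q - 1\<bar> >= 1 \<or> \<bar>2 * a * (R i q - 1)\<bar> >= 1" by auto
    then have "1 <= ennreal (?r i q) + ennreal (?u i q)"
    proof
     assume "\<bar>R i q - 1\<bar> >= 1"
     then have "ennreal (?r i q) = 1" by simp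
     then show ?thesis by simp
    next
     assume "\<bar>2 * a * (R i q - 1)\<bar> >= 1"
     then have "ennreal (?u i q) = 1" by simp
     then show ?thesis by simp
    qed
    then show ?thesis by (meson add_increasing min.coboundedI1 zero_le)
   qed
  qed
  also have "... = ((nint (P i) (%q. C i q)) + 4 * nint (P i) (%q. D i q)) + ((nint (P i) (%q. ennreal (?r i q))) + nint (P i) (%q. ennreal (?u i q)))"
   by (simp add: nn_integral_add nn_integral_cmult)
  finally show "nint (P i) (%q. min 1 (nint N (%y. ennreal (f i q y)))) <= ((nint (P i) (%q. C i q)) + 4 * nint (P i) (%q. D i q)) + ((nint (P i) (%q. ennreal (?r i q))) + nint (P i) (%q. ennreal (?u i q)))" .
 qed
qed

end

lemma ennreal_abs_mult_left: "0 <= h ==> ennreal \<bar>x * h - y * h\<bar> = ennreal h * ennreal \<bar>x - y\<bar>"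
proof -
 assume h: "0 <= h"
 have "\<bar>x * h - y * h\<bar> = h * \<bar>x - y\<bar>" unfolding left_diff_distrib[symmetric] abs_mult using h by simp
 then show ?thesis using h by (simp add: ennreal_mult)
qed

context target_run
begin

text \<open>The chain that filter j + 1 actually sees, a joined mean of sections over the earlier
  particles, minus the mean chain that replaces it.\<close>

definition dev :: "nat => nat => nat => 'w => (nat => 'x) => real" where
 "dev i j t q y = ji i j (%z. gc t (glue (j * T) t (z, y))) q - sm (j * T) t y"

lemma ji_glue_meas:
 assumes j: "j < M" and t: "j * T <= t" and f: "f \<in> bp 0 t" and h: "h \<in> bp 0 (j * T)"
  and ph: "ph \<in> bmf borel"
 shows "(%(q, y). ji i j (%z. ph (f (glue (j * T) t (z, y))) * h z) q) \<in> bmf (pr i >< PP {j * T<..t})"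
proof (intro multi_run.je_param_meas[OF MR] multi_run.coords_P[OF MR])
 have "(%(y, z). f (glue (j * T) t (z, y))) \<in> bmf (PP {j * T<..t} >< PP {0<..j * T})"
  using measurable_pair_swap[OF multi_run.glue_section[OF MR t f]] by (simp add: split_beta')
 from mcomp[OF this ph] have "(%p. ph (f (glue (j * T) t (snd p, fst p)))) \<in> bmf (PP {j * T<..t} >< PP {0<..j * T})"
  by (simp add: split_beta')
 from borel_measurable_times[OF this mcomp[OF measurable_snd h]]
 show "(%(y, z). ph (f (glue (j * T) t (z, y))) * h z) \<in> bmf (PP {j * T<..t} >< PP {0<..j * T})"
  by (simp add: split_beta')
qed (use j in auto)

lemma dev_meas:
 assumes j: "j < M" and t: "j * T <= t" "t <= U"
 shows "(%(q, y). dev i j t q y) \<in> bmf (pr i >< PP {j * T<..t})"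
proof -
 have "(%(q, y). ji i j (%z. gc t (glue (j * T) t (z, y))) q) \<in> bmf (pr i >< PP {j * T<..t})"
  using ji_glue_meas[OF j t(1) gc_meas[OF t(2)] borel_measurable_const[of "1::real"] measurable_ident, of i] by (simp only: mult_1_right id_apply)
 moreover have "(%(q, y). sm (j * T) t y) \<in> bmf (pr i >< PP {j * T<..t})"
  using mcomp[OF measurable_snd sm_int(2)[OF block_mult t]] by (simp add: split_beta')
 ultimately show ?thesis unfolding dev_def split_beta' by (rule borel_measurable_diff)
qed

text \<open>Instance of the quadratic remainder: Cauchy-Schwarz for the joined mean bounds the
  random section by \<open>R\<close> times a joined mean of weighted squares, and
  \<open>sm_square_le\<close> bounds the mean section by the limit of the same squares. Pointwise
  convergence in y comes from the law of large numbers for joined paths.\<close>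

lemma dev_square_limit:
 assumes j: "j < M" and st: "j * T <= s" "s <= t" "t <= U"
  and I: "integrable (lw 0 t) (%x. (gc t x)\<^sup>2 * hr 0 s x)" "integrable (lw 0 t) (%x. (gc t x)\<^sup>2 * hr 0 t x)"
 shows "(%i. nint (pr i) (%q. min 1 (nint (lw (j * T) t) (%y. ennreal ((dev i j t q y)\<^sup>2 * hr (j * T) s y))))) ---> 0"
proof -
 have t: "j * T <= t" using st by simp
 have jU: "j * T <= U" and jM: "j <= M" using j by (auto intro: mT_le_U)
 define h where "h = hr (j * T) s"
 define h0 where "h0 = hr 0 (j * T)"
 define g where "g y z = gc t (glue (j * T) t (z, y))" for y z
 let ?g = "%y. (%z. (g y z)\<^sup>2 * h0 z)"
 define A where "A y = lint (lw 0 (j * T)) (?g y)" for y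
 have hp: "h y > 0" if "y \<in> sp (j * T) t" for y
  unfolding h_def using that st by (intro hrel_pos[OF block_mult, of j s t]) auto
 have h0p: "h0 z > 0" if "z \<in> sp 0 (j * T)" for z
  unfolding h0_def using that jU by (intro hrel_pos[of 0 "j * T" "j * T"]) auto
 have hm: "h \<in> bp (j * T) t" unfolding h_def by (rule hrel_measurable[OF block_mult st(2,3)])
 have h0m: "h0 \<in> bp 0 (j * T)" unfolding h0_def using jU by (intro hrel_measurable) auto
 have gm: "g y \<in> bp 0 (j * T)" if "y \<in> sp (j * T) t" for y
  using mcomp[OF measurable_Pair2'[OF that] multi_run.glue_section[OF MR t gc_meas[OF st(3)]]] unfolding g_def by simp
 have A0: "0 <= A y" for y unfolding A_def using h0p by (intro integral_nonneg_AE AE_I2) (simp add: less_imp_le)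
 note SS = sq_section[OF block_mult st I(1), folded h_def]
 note SQ = sm_square_le[OF block_mult t st(3) I(2)]
 have law_pair: "sets (pr i >< lw (j * T) t) = sets (pr i >< PP {j * T<..t})" for i
  by (intro sets_pair_measure_cong refl) simp
 have hsnd: "(%p. h (snd p)) \<in> bmf (pr i >< PP {j * T<..t})" for i
  by (rule mcomp[OF measurable_snd hm])
 have L0m: "(%z. 1 / h0 z) \<in> bp 0 (j * T)" using h0m by simp
 have L1i: "integrable (lw 0 (j * T)) (%z. 1 / h0 z)" "lint (lw 0 (j * T)) (%z. 1 / h0 z) = 1"
  unfolding h0_def by (intro integrable_inverse_hrel block_0 le0 jU)+
 have "(%i. nint (pr i) (%q. min 1 (nint (lw (j * T) t) (%y. ennreal ((dev i j t q y)\<^sup>2 * h y))))) ---> 0"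
 proof (rule quadratic_remainder[where Ak="%i q y. ji i j (?g y) q * h y" and A="%y. A y * h y" and R="%i. ji i j (%z. 1 / h0 z)"])
  interpret L1: prob_space "lw (j * T) t" by (intro prob_law block_mult t st)
  show "sigma_finite_measure (lw (j * T) t)" ..
  show "(%(q, y). (dev i j t q y)\<^sup>2 * h y) \<in> bmf (pr i >< lw (j * T) t)" for i
   unfolding measurable_cong_sets[OF law_pair refl] split_beta'
   using dev_meas[OF j t st(3), of i] by (intro borel_measurable_times borel_measurable_power hsnd) (simp add: split_beta')
  have "(%(q, y). ji i j (?g y) q) \<in> bmf (pr i >< PP {j * T<..t})" for i
   unfolding g_def by (rule ji_glue_meas[OF j t gc_meas[OF st(3)] h0m, of "%x. x\<^sup>2"]) simp
  then show "(%(q, y). ji i j (?g y) q * h y) \<in> bmf (pr i >< lw (j * T) t)" for i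
   unfolding measurable_cong_sets[OF law_pair refl] split_beta' by (intro borel_measurable_times hsnd)
  show "ji i j (%z. 1 / h0 z) \<in> bmf (pr i)" for i by (rule ji_meas[OF jM L0m])
  show "0 <= (dev i j t q y)\<^sup>2 * h y" if "y \<in> space (lw (j * T) t)" for i q y using hp[of y] that by simp
  show "0 <= ji i j (?g y) q * h y" if "q \<in> space (pr i)" "y \<in> space (lw (j * T) t)" for i q y
   using hp[of y] that(2) h0p by (intro mult_nonneg_nonneg multi_run.je_nonneg[OF MR jM that(1)]) (auto simp: less_imp_le)
  show "0 <= ji i j (%z. 1 / h0 z) q" if "q \<in> space (pr i)" for i q
   using h0p by (intro multi_run.je_nonneg[OF MR jM that]) (simp add: less_imp_le)
  show "0 <= A y * h y" if "y \<in> space (lw (j * T) t)" for y using A0 hp[of y] that by simp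
  show "integrable (lw (j * T) t) (%y. A y * h y)" using SS(3) unfolding A_def g_def h0_def .
  show "AE y in lw (j * T) t. \<forall>q\<in>space (pr i). (dev i j t q y)\<^sup>2 * h y <= 2 * ji i j (%z. 1 / h0 z) q * (ji i j (?g y) q * h y) + 2 * (A y * h y)" for i
   using SQ AE_space
  proof eventually_elim
   case (elim y)
   have h: "h y > 0" using hp elim(2) by simp
   show ?case
   proof
    fix q assume q: "q \<in> space (pr i)"
    have cs: "(ji i j (g y) q)\<^sup>2 <= ji i j (%z. 1 / h0 z) q * ji i j (?g y) q"
     by (rule multi_run.je_Cauchy_Schwarz[OF MR jM q h0p])
    have qq: "(sm (j * T) t y)\<^sup>2 <= A y" using elim(1) unfolding A_def g_def h0_def .
    have "(dev i j t q y)\<^sup>2 <= 2 * (ji i j (g y) q)\<^sup>2 + 2 * (sm (j * T) t y)\<^sup>2"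
    proof -
     have "0 <= (ji i j (g y) q + sm (j * T) t y)\<^sup>2" by simp
     then show ?thesis unfolding dev_def g_def by (simp add: power2_eq_square algebra_simps)
    qed
    also have "... <= 2 * (ji i j (%z. 1 / h0 z) q * ji i j (?g y) q) + 2 * A y" using cs qq by simp
    finally have "(dev i j t q y)\<^sup>2 * h y <= (2 * (ji i j (%z. 1 / h0 z) q * ji i j (?g y) q) + 2 * A y) * h y"
     using h by (intro mult_right_mono) auto
    then show "(dev i j t q y)\<^sup>2 * h y <= 2 * ji i j (%z. 1 / h0 z) q * (ji i j (?g y) q * h y) + 2 * (A y * h y)"
     by (simp add: algebra_simps)
   qed
  qed
  show "AE y in lw (j * T) t. conv_prob pr (%i q. (dev i j t q y)\<^sup>2 * h y) 0"
   using int_section(4)[OF block_mult t st(3) conjunct1[OF gc_int[OF st(3)]]] AE_space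
  proof eventually_elim
   case (elim y)
   then have y: "y \<in> sp (j * T) t" by simp
   have c: "conv_prob pr (%i. ji i j (g y)) (sm (j * T) t y)"
    using lln_je[OF jM elim(1)] unfolding seg_mean_def g_def by (intro conv_prob_L1 ji_meas[OF jM] gm[OF y, unfolded g_def])
   have "conv_prob pr (%i q. (ji i j (g y) q - sm (j * T) t y)\<^sup>2 * h y) ((sm (j * T) t y - sm (j * T) t y)\<^sup>2 * h y)"
    by (rule conv_prob_cont2[where f="%x _. (x - sm (j * T) t y)\<^sup>2 * h y", OF ji_meas[OF jM gm[OF y]] ji_meas[OF jM gm[OF y]] c c])
     (intro continuous_intros)
   then show ?case unfolding dev_def g_def by simp
  qed
  show "AE y in lw (j * T) t. (%i. nint (pr i) (%q. ennreal \<bar>ji i j (?g y) q * h y - A y * h y\<bar>)) ---> 0"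
   using SS(2) AE_space
  proof eventually_elim
   case (elim y)
   then have y: "y \<in> sp (j * T) t" by simp
   have h: "0 <= h y" using hp[OF y] by simp
   have im: "integrable (lw 0 (j * T)) (?g y)" using elim(1) unfolding g_def h0_def .
   have "nint (pr i) (%q. ennreal \<bar>ji i j (?g y) q * h y - A y * h y\<bar>) = ennreal (h y) * nint (pr i) (%q. ennreal \<bar>ji i j (?g y) q - A y\<bar>)" for i
    unfolding ennreal_abs_mult_left[OF h] using ji_meas[OF jM integrable_law_meas[OF im], of i] by (intro nn_integral_cmult) simp
   moreover have "(%i. ennreal (h y) * nint (pr i) (%q. ennreal \<bar>ji i j (?g y) q - A y\<bar>)) ---> ennreal (h y) * 0"
    using lln_je[OF jM im] unfolding A_def by (intro ennreal_tendsto_cmult) auto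
   ultimately show ?case by simp
  qed
  show "AE y in lw (j * T) t. (nint (pr i) (%q. ennreal (ji i j (?g y) q * h y))) = ennreal (A y * h y)" for i
   using SS(2) AE_space
  proof eventually_elim
   case (elim y)
   then have y: "y \<in> sp (j * T) t" by simp
   have h: "0 <= h y" using hp[OF y] by simp
   have im: "integrable (lw 0 (j * T)) (?g y)" using elim(1) unfolding g_def h0_def .
   have mm: "(?g y) \<in> bp 0 (j * T)" by (rule integrable_law_meas[OF im])
   have nn: "0 <= (g y z)\<^sup>2 * h0 z" if "z \<in> sp 0 (j * T)" for z using h0p[OF that] by simp
   have "nint (pr i) (%q. ennreal (ji i j (?g y) q * h y)) = nint (pr i) (%q. ennreal (ji i j (?g y) q)) * ennreal (h y)"
    using ji_meas[OF jM mm, of i] h by (subst nn_integral_multc[symmetric]) (auto simp: ennreal_mult'' intro!: nn_integral_cong)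
   also have "nint (pr i) (%q. ennreal (ji i j (?g y) q)) = nint (lw 0 (j * T)) (%z. ennreal ((g y z)\<^sup>2 * h0 z))"
    by (rule multi_run.nn_je[OF MR jM mm nn])
   also have "... = ennreal (A y)" unfolding A_def using nn by (intro nn_integral_eq_integral[OF im] AE_I2) simp
   finally show ?case using h A0 by (simp add: ennreal_mult)
  qed
  show "conv_prob pr (%i. ji i j (%z. 1 / h0 z)) 1"
   using lln_je[OF jM L1i(1)] unfolding L1i(2) by (intro conv_prob_L1 ji_meas[OF jM L0m])
 qed
 then show ?thesis unfolding h_def .
qed

end

section \<open>Increments over the filters and linearization\<close>

lemma emp_diff: "emp S K X B m t (%z. f z - g z) q = emp S K X B m t f q - emp S K X B m t g q"
 by (simp add: emp_def right_diff_distrib sum_subtractf diff_divide_distrib)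

text \<open>sqrt v <= ep + v / ep by the arithmetic-geometric mean inequality, made compatible with
  the cap at 1; it passes from small second moments to small first moments.\<close>

lemma min_1_sqrt_le:
 assumes ep: "ep > 0" and v: "v >= 0"
 shows "min 1 (ennreal (sqrt v)) <= ennreal ep + ennreal (1 / ep) * min 1 (ennreal v)"
proof -
 have "min 1 (sqrt v) <= ep + 1 / ep * min 1 v"
 proof (cases "ep >= 1")
  case True
  have "0 <= 1 / ep * min 1 v" using ep v by simp
  then show ?thesis using True by linarith
 next
  case False
  show ?thesis
  proof (cases "v >= 1")
   case True
   then have "1 <= 1 / ep * min 1 v" using False ep by simp
   then show ?thesis using ep by linarith
  next
   case v1: False
   have "sqrt v * ep <= ep * ep + v"
   proof -
    have "0 <= (sqrt v - ep)\<^sup>2" by simp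
    moreover have "0 <= sqrt v * ep" using v ep by simp
    ultimately show ?thesis using v by (simp add: power2_diff power2_eq_square[of ep])
   qed
   then have "sqrt v <= (ep * ep + v) / ep" using ep by (simp add: pos_le_divide_eq)
   also have "... = ep + 1 / ep * min 1 v" using ep v1 by (simp add: add_divide_distrib)
   finally show ?thesis by linarith
  qed
 qed
 then have "ennreal (min 1 (sqrt v)) <= ennreal (ep + 1 / ep * min 1 v)" by (rule ennreal_leI)
 moreover have "min 1 (ennreal x) = ennreal (min 1 x)" if "0 <= x" for x
  using that by (auto simp: min_def ennreal_le_1 ennreal_1[symmetric] simp del: ennreal_1)
 moreover have "ennreal (ep + 1 / ep * min 1 v) = ennreal ep + ennreal (1 / ep) * ennreal (min 1 v)"
 proof -
  have "0 <= 1 / ep" "0 <= min 1 v" "0 <= ep" using ep v by auto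
  then show ?thesis by (simp only: ennreal_plus ennreal_mult mult_nonneg_nonneg)
 qed
 ultimately show ?thesis using v by (simp only: real_sqrt_ge_0_iff)
qed

lemma min_1_add_le_ennreal: "min 1 (x + y :: ennreal) <= min 1 x + min 1 y"
proof (cases "x <= 1 \<and> y <= 1")
 case True
 then show ?thesis by (simp add: min_absorb2)
next
 case False
 then have "1 <= min 1 x \<or> 1 <= min 1 y" by auto
 then have "1 <= min 1 x + min 1 y" using add_increasing add_increasing2 by (metis zero_le)
 then show ?thesis by (rule min.coboundedI1)
qed

lemma min_1_sum_le: "finite I ==> min 1 (\<Sum>i\<in>I. f i :: ennreal) <= (\<Sum>i\<in>I. min 1 (f i))"
proof (induction I rule: finite_induct)
 case (insert i I)
 then show ?case using order_trans[OF min_1_add_le_ennreal[of "f i" "\<Sum>i\<in>I. f i"] add_left_mono] by simp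
qed simp

context prob_seq
begin

lemma conv_prob_min_L1:
 assumes Z[measurable]: "!!i. Z i \<in> bmf (P i)"
  and lim: "(%i. nint (P i) (%q. min 1 (ennreal \<bar>Z i q\<bar>))) ---> 0"
 shows "conv_prob P Z 0"
proof (rule conv_probI)
 fix ep :: real assume ep: "ep > 0"
 have m1: "min 1 (ennreal x) = ennreal (min 1 x)" if "0 <= x" for x
  using that by (auto simp: min_def ennreal_le_1 ennreal_1[symmetric] simp del: ennreal_1)
 have "(%i. nint (P i) (%q. ennreal \<bar>min 1 \<bar>Z i q\<bar> - 0\<bar>)) ---> 0" using lim by (simp add: m1)
 then have "conv_prob P (%i q. min 1 \<bar>Z i q\<bar>) 0" by (intro conv_prob_L1) auto
 from conv_probD[OF this, of "min ep 1"] ep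
 have c: "(%i. measure (P i) {q \<in> space (P i). min ep 1 <= \<bar>min 1 \<bar>Z i q\<bar> - 0\<bar>}) ---> 0" by simp
 show "(%i. measure (P i) {q \<in> space (P i). ep <= \<bar>Z i q - 0\<bar>}) ---> 0"
 proof (rule tendsto_0_le_real[OF _ _ c])
  fix i
  interpret prob_space "P i" by (rule prob)
  show "measure (P i) {q \<in> space (P i). ep <= \<bar>Z i q - 0\<bar>} <= measure (P i) {q \<in> space (P i). min ep 1 <= \<bar>min 1 \<bar>Z i q\<bar> - 0\<bar>}"
   by (intro finite_measure_mono) auto
 qed simp
qed

end

context target_run
begin

text \<open>For almost every sample point all earlier joined paths avoid the exceptional set of
  \<open>section_chain\<close>, and \<open>dev\<close> is a finite linear combination of the
  resulting chains and the mean chain.\<close>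

lemma dev_chain:
 assumes j: "j < M"
 shows "AE q in pr i. mart_chain S (j * T) (Suc j * T) (%t. dev i j t q)"
 using multi_run.AE_jp[OF MR less_imp_le[OF j] section_chain[OF j], of i]
proof eventually_elim
 case (elim q)
 let ?Z = "{1..j} \<rightarrow>\<^sub>E {1..Suc i}"
 define c where "c kp = jwt S (Suc i) (X (Suc i)) (B (Suc i)) j kp q / real (Suc i) ^ j" for kp
 define g where "g kp t y = gc t (glue (j * T) t (jpath S (X (Suc i)) (B (Suc i)) j kp q, y))" for kp t y
 have "mart_chain S (j * T) (Suc j * T) (%t y. 1 * (\<Sum>kp\<in>?Z. c kp * g kp t y) + (-1) * sm (j * T) t y)"
  using elim unfolding g_def
  by (intro run_seq_seg.mart_chain_lin[OF SG[OF j]] run_seq_seg.mart_chain_sum[OF SG[OF j]] sm_chain j finite_PiE) auto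
 moreover have "(%t. dev i j t q) = (%t y. 1 * (\<Sum>kp\<in>?Z. c kp * g kp t y) + (-1) * sm (j * T) t y)"
  unfolding dev_def jemp_def c_def g_def by (simp add: sum_divide_distrib fun_eq_iff)
 ultimately show ?case by (simp only:)
qed

lemma dev_start:
 assumes j: "j < M" and q: "q \<in> space (pr i)"
 shows "dev i j (j * T) q (%_. undefined) = ji i j (gc (j * T)) q"
proof -
 have jU: "j * T <= U" and jM: "j <= M" using j by (auto intro: mT_le_U)
 have e: "merge {0<..j * T} {j * T<..j * T} (z, %_. undefined) = z" if "z \<in> sp 0 (j * T)" for z
 proof -
  have "merge {0<..j * T} {j * T<..j * T} (z, %_. undefined) = restrict z {0<..j * T}" by (auto simp: merge_def restrict_def)
  then show ?thesis using restrict_PP_id[OF that] by simp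
 qed
 have "ji i j (%z. gc (j * T) (merge {0<..j * T} {j * T<..j * T} (z, %_. undefined))) q = ji i j (gc (j * T)) q"
  unfolding jemp_def
  by (intro arg_cong2[where f="(/)"] sum.cong refl) (simp only: e[OF multi_run.jp_space[OF MR jM _ q]])
 then show ?thesis unfolding dev_def sm_start[OF block_mult jU] by simp
qed

definition vdev :: "nat => nat => nat => nat => 'w => real" where
 "vdev i j s t q = lint (lw (j * T) t) (%y. (dev i j t q y)\<^sup>2 * hr (j * T) s y)"

text \<open>For almost every q the chain property supplies integrability, so the real second moment
  agrees with the nonnegative integral of \<open>dev_square_limit\<close>; the square root then
  costs an arbitrarily small constant.\<close>

lemma vdev_limit:
 assumes j: "j < M" and n: "j * T <= n" "n < Suc j * T" and s: "s = n \<or> s = Suc n"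
 shows "(%i. nint (pr i) (%q. min 1 (ennreal (sqrt (vdev i j s (Suc n) q))))) ---> 0"
  and "vdev i j s (Suc n) \<in> bmf (pr i)"
proof -
 have U: "Suc j * T <= U" using j by (intro mT_le_U) simp
 have nU: "n < U" using n U by simp
 have st: "j * T <= s" "s <= Suc n" "Suc n <= U" using n s nU by auto
 have I: "integrable (lw 0 (Suc n)) (%x. (gc (Suc n) x)\<^sup>2 * hr 0 s x)" using s sq0[OF nU] sq1[OF nU] by auto
 have Sn: "j * T <= Suc n" using n by simp
 interpret L1: prob_space "lw (j * T) (Suc n)" by (intro prob_law block_mult Sn st)
 have law_pair: "sets (pr i >< lw (j * T) (Suc n)) = sets (pr i >< PP {j * T<..Suc n})" for i
  by (intro sets_pair_measure_cong refl) simp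
 have hsnd: "(%p. hr (j * T) s (snd p)) \<in> bmf (pr i >< PP {j * T<..Suc n})" for i
  by (rule mcomp[OF measurable_snd hrel_measurable[OF block_mult st(2,3)]])
 have jm: "(%(q, y). (dev i j (Suc n) q y)\<^sup>2 * hr (j * T) s y) \<in> bmf (pr i >< lw (j * T) (Suc n))" for i
  unfolding measurable_cong_sets[OF law_pair refl] split_beta'
  using dev_meas[OF j Sn st(3), of i] by (intro borel_measurable_times borel_measurable_power hsnd) (simp add: split_beta')
 show vm: "vdev i j s (Suc n) \<in> bmf (pr i)" for i
  unfolding vdev_def[abs_def] by (rule L1.borel_measurable_lebesgue_integral[OF jm])
 define N where "N i q = min 1 (nint (lw (j * T) (Suc n)) (%y. ennreal ((dev i j (Suc n) q y)\<^sup>2 * hr (j * T) s y)))" for i q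
 have Nm: "N i \<in> bmf (pr i)" for i
 proof -
  have "(%(q, y). ennreal ((dev i j (Suc n) q y)\<^sup>2 * hr (j * T) s y)) \<in> bmf (pr i >< lw (j * T) (Suc n))"
   using jm[of i] by (simp add: split_beta')
  from L1.borel_measurable_nn_integral[OF this] show ?thesis unfolding N_def[abs_def] by simp
 qed
 have N0: "(%i. nint (pr i) (%q. N i q)) ---> 0"
  unfolding N_def by (rule dev_square_limit[OF j st I sq1[OF nU]])
 have eqN: "AE q in pr i. 0 <= vdev i j s (Suc n) q \<and> min 1 (ennreal (vdev i j s (Suc n) q)) = N i q" for i
  using dev_chain[OF j, of i]
 proof eventually_elim
  case (elim q)
  have int: "integrable (lw (j * T) (Suc n)) (%y. (dev i j (Suc n) q y)\<^sup>2 * hr (j * T) s y)"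
   using run_seq_seg.mart_chainD(2,3)[OF SG[OF j] elim n] s by auto
  have nn: "AE y in lw (j * T) (Suc n). 0 <= (dev i j (Suc n) q y)\<^sup>2 * hr (j * T) s y"
   using run_seq_seg.hpos[OF SG[OF j] st(1,2)] n by (intro AE_I2) (simp add: less_imp_le)
  show ?case unfolding N_def vdev_def using nn_integral_eq_integral[OF int nn] integral_nonneg_AE[OF nn] by simp
 qed
 show "(%i. nint (pr i) (%q. min 1 (ennreal (sqrt (vdev i j s (Suc n) q))))) ---> 0"
 proof (rule tendsto_0_approx_ennreal)
  fix ep :: real assume ep: "ep > 0"
  have le: "nint (pr i) (%q. min 1 (ennreal (sqrt (vdev i j s (Suc n) q)))) <= ennreal (1 / ep) * nint (pr i) (%q. N i q) + ennreal ep" for i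
  proof -
   interpret Pi: prob_space "pr i" by (rule prob_pr)
   have "AE q in pr i. min 1 (ennreal (sqrt (vdev i j s (Suc n) q))) <= ennreal ep + ennreal (1 / ep) * N i q"
    using eqN[of i]
   proof eventually_elim
    case (elim q)
    then show ?case using min_1_sqrt_le[OF ep, of "vdev i j s (Suc n) q"] by simp
   qed
   then have "nint (pr i) (%q. min 1 (ennreal (sqrt (vdev i j s (Suc n) q)))) <= nint (pr i) (%q. ennreal ep + ennreal (1 / ep) * N i q)"
    by (rule nn_integral_mono_AE)
   also have "... = ennreal ep + ennreal (1 / ep) * nint (pr i) (%q. N i q)"
    using Nm[of i] by (simp add: nn_integral_add nn_integral_cmult Pi.emeasure_space_1)
   finally show ?thesis by (simp add: add.commute)
  qed
  have "(%i. ennreal (1 / ep) * nint (pr i) (%q. N i q)) ---> ennreal (1 / ep) * 0"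
   by (intro ennreal_tendsto_cmult N0) simp
  then have l0: "(%i. ennreal (1 / ep) * nint (pr i) (%q. N i q)) ---> 0" by simp
  show "\<exists>v. (\<forall>i. (nint (pr i) (%q. min 1 (ennreal (sqrt (vdev i j s (Suc n) q))))) <= v i + ennreal ep) \<and> v ---> 0"
   by (intro exI[of _ "%i. ennreal (1 / ep) * nint (pr i) (%q. N i q)"] conjI allI le l0)
 qed
qed

text \<open>The particles of the earlier filters are taken at \<open>q\<close> and those of filter \<open>j + 1\<close> at \<open>q'\<close>, so that
 independence of the filters allows integration over the two arguments separately.\<close>

definition incr :: "nat => nat => 'w => 'w => real" where
 "incr i j q q' = mi i j (dev i j (Suc j * T) q) q' - ji i j (gc (j * T)) q"

lemma incr_eq: "incr i j q q' = ji i j (%z. mi i j (%y. gc (Suc j * T) (glue (j * T) (Suc j * T) (z, y))) q') q - mi i j (sm (j * T) (Suc j * T)) q' - ji i j (gc (j * T)) q"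
 unfolding incr_def dev_def emp_diff jemp_emp_swap ..

lemma incr_diag: "incr i j q q = ji i (Suc j) (gc (Suc j * T)) q - ji i j (gc (j * T)) q - mi i j (sm (j * T) (Suc j * T)) q"
 unfolding incr_eq jemp_Suc by simp

text \<open>After separating the two sample points, the inner expectation is that of the error of
  one filter on the fixed chain \<open>dev\<close> at q, bounded by the L1 estimate for chains. The
  factor sqrt K cancels the rate and leaves a sum of square roots of second moments of
  \<open>dev\<close>, which tends to zero. As these vanish only in probability, everything is capped
  at 1.\<close>

lemma incr_limit:
 assumes j: "j < M"
 shows "(%i. nint (pr i) (%q. min 1 (ennreal \<bar>rt i * incr i j q q\<bar>))) ---> 0"
proof -
 let ?x = "%i q q'. (ennreal \<bar>rt i * incr i j q q'\<bar>)"
 have U: "Suc j * T <= U" using j by (intro mT_le_U) simp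
 have jU: "j * T <= U" and jM: "j <= M" using j by (auto intro: mT_le_U)
 let ?I = "{j * T..<Suc j * T}"
 define V where "V i n q = min 1 (ennreal (sqrt (vdev i j n (Suc n) q))) + min 1 (ennreal (sqrt (vdev i j (Suc n) (Suc n) q)))" for i n q
 have vm: "vdev i j n (Suc n) \<in> bmf (pr i)" "vdev i j (Suc n) (Suc n) \<in> bmf (pr i)" if "n \<in> ?I" for i n
  using vdev_limit(2)[OF j, of n] that by auto
 have "(%i. \<Sum>n\<in>?I. nint (pr i) (%q. V i n q)) ---> (\<Sum>n\<in>?I. 0)"
 proof (rule tendsto_sum)
  fix n assume n: "n \<in> ?I"
  have "(%i. (nint (pr i) (%q. min 1 (ennreal (sqrt (vdev i j n (Suc n) q))))) + nint (pr i) (%q. min 1 (ennreal (sqrt (vdev i j (Suc n) (Suc n) q))))) ---> 0"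
   using n by (intro add_tendsto_0_ennreal vdev_limit(1)[OF j, of n]) auto
  moreover have "nint (pr i) (%q. V i n q) = nint (pr i) (%q. min 1 (ennreal (sqrt (vdev i j n (Suc n) q)))) + nint (pr i) (%q. min 1 (ennreal (sqrt (vdev i j (Suc n) (Suc n) q))))" for i
   unfolding V_def using vm[OF n, of i] by (intro nn_integral_add) auto
  ultimately show "(%i. nint (pr i) (%q. V i n q)) ---> 0" by simp
 qed
 then have lim: "(%i. \<Sum>n\<in>?I. nint (pr i) (%q. V i n q)) ---> 0" by simp
 show ?thesis
 proof (rule tendsto_0_le_ennreal[OF _ lim])
  fix i
  interpret R: multi_run S "Suc i" "pr i" "X (Suc i)" "B (Suc i)" by (rule MR)
  interpret G: run_seq_seg S P X B j by (rule SG[OF j])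
  have A: "{1..j} \<inter> {Suc j} = {}" "{1..j} \<subseteq> {1..M}" "{Suc j} \<subseteq> {1..M}" using j by auto
  have cg: "R.coords (R.Galg {Suc j}) j" using A(3) by (intro R.coords_Galg) auto
  have cs: "R.coords (R.Galg {1..j}) l" if "l < j" for l using A(2) that by (intro R.coords_Galg) auto
  have i1: "(%(q, q'). ji i j (%z. mi i j (%y. gc (Suc j * T) (glue (j * T) (Suc j * T) (z, y))) q') q) \<in> bmf (R.Galg {1..j} >< R.Galg {Suc j})"
   by (intro R.je_param_meas jM cs R.mu_glue_meas j cg gc_meas U)
  have "mi i j (sm (j * T) (Suc j * T)) \<in> bmf (R.Galg {Suc j})"
   using sm_int(2)[OF block_mult mT_le U] by (intro seg_run.emp_measurable[OF R.SR[OF j] mT_le order_refl R.coords_seg[OF j cg]])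
  from mcomp[OF measurable_snd this]
  have i2: "(%(q, q'). mi i j (sm (j * T) (Suc j * T)) q') \<in> bmf (R.Galg {1..j} >< R.Galg {Suc j})"
   by (simp add: split_beta')
  have "(%(y, z). gc (j * T) z) \<in> bmf (R.Galg {Suc j} >< PP {0<..j * T})"
   using mcomp[OF measurable_snd gc_meas[OF jU]] by (simp add: split_beta')
  then have i3: "(%(q, q'). ji i j (gc (j * T)) q) \<in> bmf (R.Galg {1..j} >< R.Galg {Suc j})"
   by (intro R.je_param_meas jM cs)
  have im: "(%(q, q'). incr i j q q') \<in> bmf (R.Galg {1..j} >< R.Galg {Suc j})"
   using i1 i2 i3 unfolding incr_eq split_beta' by (intro borel_measurable_diff)
  then have "(%(q, q'). min 1 (?x i q q')) \<in> bmf (R.Galg {1..j} >< R.Galg {Suc j})"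
   unfolding split_beta' by (intro borel_measurable_min measurable_const mcomp[OF _ measurable_ennreal] borel_measurable_abs borel_measurable_times) auto
  \<comment> \<open>Earlier filters are now governed by q and the current filter by q', integrated
    independently.\<close>
  from R.nn_diagonal[OF A this]
  have "nint (pr i) (%q. min 1 (ennreal \<bar>rt i * incr i j q q\<bar>)) = nint (pr i) (%q. nint (pr i) (%q'. min 1 (?x i q q')))"
   by simp
  also have "... <= nint (pr i) (%q. (\<Sum>n\<in>?I. V i n q))"
  proof (rule nn_integral_mono_AE)
   show "AE q in pr i. (nint (pr i) (%q'. min 1 (?x i q q'))) <= (\<Sum>n\<in>?I. V i n q)"
    using dev_chain[OF j, of i] AE_space
   proof eventually_elim
    case (elim q)
    have mi: "(%q'. \<bar>incr i j q q'\<bar>) \<in> bmf (pr i)"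
     unfolding incr_def using G.em_meas[OF mT_le order_refl G.mart_chain_meas[OF elim(1) mT_le order_refl], of i] by simp
    define s where "s n = sqrt (vdev i j n (Suc n) q) + sqrt (vdev i j (Suc n) (Suc n) q)" for n
    have v0: "0 <= vdev i j n (Suc n) q" "0 <= vdev i j (Suc n) (Suc n) q" if "n \<in> ?I" for n
    proof -
     have n: "j * T <= n" "n < Suc j * T" using that by auto
     show "0 <= vdev i j n (Suc n) q" "0 <= vdev i j (Suc n) (Suc n) q"
      unfolding vdev_def using G.nn_of_int(2)[OF G.mart_chainD(2)[OF elim(1) n]] G.nn_of_int(2)[OF G.mart_chainD(3)[OF elim(1) n]] n by auto
    qed
    have "nint (pr i) (%q'. ennreal \<bar>incr i j q q'\<bar>) <= ennreal ((\<Sum>n\<in>?I. s n) / rt i)"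
     using G.em_chain_L1[OF elim(1) mT_le order_refl, of i] unfolding incr_def dev_start[OF j elim(2)] s_def vdev_def .
    then have "ennreal (rt i) * nint (pr i) (%q'. ennreal \<bar>incr i j q q'\<bar>) <= ennreal (rt i) * ennreal ((\<Sum>n\<in>?I. s n) / rt i)"
     by (rule mult_left_mono) simp
    also have "... = ennreal (\<Sum>n\<in>?I. s n)"
     by (subst ennreal_mult'[symmetric]) simp_all
    also have "... = (\<Sum>n\<in>?I. ennreal (s n))"
     using v0 by (intro sum_ennreal[symmetric]) (simp add: s_def)
    finally have E: "nint (pr i) (%q'. ennreal \<bar>rt i * incr i j q q'\<bar>) <= (\<Sum>n\<in>?I. ennreal (s n))"
     unfolding abs_mult using mi by (simp add: ennreal_mult nn_integral_cmult)
    \<comment> \<open>The minimum with 1 moves outside the inner expectation only; the cap must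
      still be present when q is integrated.\<close>
    have "nint (pr i) (%q'. min 1 (?x i q q')) <= min 1 (nint (pr i) (%q'. ennreal \<bar>rt i * incr i j q q'\<bar>))"
    proof (rule min.boundedI)
     show "nint (pr i) (%q'. min 1 (?x i q q')) <= 1"
      using nn_integral_mono[of "pr i" "%q'. min 1 (?x i q q')" "%_. 1"] R.emeasure_space_1 by simp
    qed (intro nn_integral_mono min.cobounded2)
    also have "... <= min 1 (\<Sum>n\<in>?I. ennreal (s n))" using E by (intro min.mono) simp_all
    also have "... <= (\<Sum>n\<in>?I. min 1 (ennreal (s n)))" by (rule min_1_sum_le) simp
    also have "... <= (\<Sum>n\<in>?I. V i n q)"
    proof (rule sum_mono)
     fix n assume n: "n \<in> ?I"
     show "min 1 (ennreal (s n)) <= V i n q"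
      unfolding s_def V_def using v0[OF n] by (subst ennreal_plus) (auto intro: min_1_add_le_ennreal)
    qed
    finally show ?case .
   qed
  qed
  also have "... = (\<Sum>n\<in>?I. nint (pr i) (%q. V i n q))"
   using vm unfolding V_def by (intro nn_integral_sum) auto
  finally show "nint (pr i) (%q. min 1 (ennreal \<bar>rt i * incr i j q q\<bar>)) <= (\<Sum>n\<in>?I. nint (pr i) (%q. V i n q))" .
 qed
qed

lemma incr_meas:
 assumes j: "j < M"
 shows "(%q. incr i j q q) \<in> bmf (pr i)"
proof -
 have U: "Suc j * T <= U" using j by (intro mT_le_U) simp
 interpret G: run_seq_seg S P X B j by (rule SG[OF j])
 have "ji i (Suc j) (gc (Suc j * T)) \<in> bmf (pr i)" "ji i j (gc (j * T)) \<in> bmf (pr i)"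
  using j U by (auto intro!: ji_meas gc_meas mT_le_U)
 moreover have "mi i j (sm (j * T) (Suc j * T)) \<in> bmf (pr i)"
  by (rule G.em_meas[OF mT_le order_refl sm_int(2)[OF block_mult mT_le U]])
 ultimately show ?thesis unfolding incr_diag by simp
qed

text \<open>The joined means of the backward conditional means telescope from the constant mean 0 of
  \<open>G\<close> up to \<open>G\<close> itself; each difference is a single-filter error on the
  mean chain up to \<open>incr\<close>.\<close>

lemma linearization:
 "conv_prob pr (%i q. rt i * (ji i M G q - (\<Sum>j<M. mi i j (sm (j * T) (Suc j * T)) q))) 0"
proof -
 have "conv_prob pr (%i q. \<Sum>j<M. rt i * incr i j q q) (\<Sum>j<M. 0)"
 proof (rule conv_prob_sum)
  fix j assume "j \<in> {..<M}"
  then have j: "j < M" by simp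
  show m: "(%q. rt i * incr i j q q) \<in> bmf (pr i)" for i
   using incr_meas[OF j, of i] by simp
  show "conv_prob pr (%i q. rt i * incr i j q q) 0"
   by (rule conv_prob_min_L1[OF m incr_limit[OF j]])
 qed simp
 moreover have "(\<Sum>j<M. rt i * incr i j q q) = rt i * (ji i M G q - (\<Sum>j<M. mi i j (sm (j * T) (Suc j * T)) q))" for i q
 proof -
  have "gc 0 (%_. undefined) = lint (lw 0 0) (%z. gc 0 z)"
   unfolding law_refl PiM_empty by (simp add: lebesgue_integral_count_space_finite)
  then have g0: "gc 0 (%_. undefined) = 0" using gc_int[of 0] mean0 by simp
  have "(\<Sum>j<M. ji i (Suc j) (gc (Suc j * T)) q - ji i j (gc (j * T)) q) = ji i M (gc (M * T)) q - ji i 0 (gc (0 * T)) q"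
   by (rule sum_lessThan_telescope)
  also have "... = ji i M G q" using g0 gc_U by (simp add: jemp_0 horizon_def)
  finally show ?thesis unfolding incr_diag sum_distrib_left[symmetric] by (simp add: sum_subtractf)
 qed
 ultimately show ?thesis by simp
qed

end

section \<open>Negligible products and Slutsky's lemma\<close>

context prob_seq
begin

text \<open>Where |A| is at most a threshold the product is small in mean by the L1 bound on W;
  elsewhere the capped product is paid for by the vanishing probability.\<close>

lemma conv_prob_tight_mult:
 assumes A[measurable]: "!!i. A i \<in> bmf (P i)" and W[measurable]: "!!i. W i \<in> bmf (P i)"
  and cA: "conv_prob P A 0" and t: "!!i. (nint (P i) (%q. ennreal \<bar>W i q\<bar>)) <= ennreal c"
 shows "conv_prob P (%i q. A i q * W i q) 0"
proof (rule conv_prob_min_L1)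
 show "(%q. A i q * W i q) \<in> bmf (P i)" for i by simp
 show "(%i. nint (P i) (%q. min 1 (ennreal \<bar>A i q * W i q\<bar>))) ---> 0"
 proof (rule tendsto_0_approx_ennreal)
  fix ep :: real assume ep: "ep > 0"
  \<comment> \<open>Adding 1 makes the threshold well defined even for c = 0, while its product with
    |c| stays below ep.\<close>
  define dl where "dl = ep / (\<bar>c\<bar> + 1)"
  let ?m = "%i q. (min 1 \<bar>1 / dl * A i q\<bar>)"
  have dl: "dl > 0" "dl * \<bar>c\<bar> <= ep"
  proof -
   show "dl > 0" using ep unfolding dl_def by simp
   have "dl * (\<bar>c\<bar> + 1) = ep" unfolding dl_def by simp
   then show "dl * \<bar>c\<bar> <= ep" using \<open>dl > 0\<close> by (simp add: distrib_left)
  qed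
  have cA': "conv_prob P (%i q. 1 / dl * A i q) 0"
   using conv_prob_mult[OF _ A conv_prob_const[of "1 / dl"] cA] by simp
  have le: "nint (P i) (%q. min 1 (ennreal \<bar>A i q * W i q\<bar>)) <= nint (P i) (%q. ennreal (?m i q)) + ennreal ep" for i
  proof -
   have "nint (P i) (%q. min 1 (ennreal \<bar>A i q * W i q\<bar>)) <= nint (P i) (%q. ennreal (?m i q) + ennreal dl * ennreal \<bar>W i q\<bar>)"
   proof (rule nn_integral_mono)
    fix q
    show "min 1 (ennreal \<bar>A i q * W i q\<bar>) <= ennreal (?m i q) + ennreal dl * ennreal \<bar>W i q\<bar>"
    proof (cases "\<bar>A i q\<bar> <= dl")
     case True
     then have "\<bar>A i q * W i q\<bar> <= dl * \<bar>W i q\<bar>" unfolding abs_mult by (intro mult_right_mono) auto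
     then have "ennreal \<bar>A i q * W i q\<bar> <= ennreal (dl * \<bar>W i q\<bar>)" by (rule ennreal_leI)
     also have "... = ennreal dl * ennreal \<bar>W i q\<bar>" using dl by (intro ennreal_mult) auto
     finally show ?thesis by (meson add_increasing min.coboundedI2 zero_le)
    next
     case False
     then have "1 <= \<bar>1 / dl * A i q\<bar>" using dl(1) by (simp add: abs_mult pos_le_divide_eq)
     then have "ennreal (?m i q) = 1" by (simp only: min_absorb1 ennreal_1)
     then show ?thesis by (metis add_increasing2 min.coboundedI1 order_refl zero_le)
    qed
   qed
   also have "... = nint (P i) (%q. ennreal (?m i q)) + ennreal dl * nint (P i) (%q. ennreal \<bar>W i q\<bar>)"
    by (subst nn_integral_add) (auto simp: nn_integral_cmult)
   also have "... <= nint (P i) (%q. ennreal (?m i q)) + ennreal ep"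
   proof (rule add_left_mono)
    have "ennreal dl * nint (P i) (%q. ennreal \<bar>W i q\<bar>) <= ennreal dl * ennreal \<bar>c\<bar>"
     using order_trans[OF t[of i], of "ennreal \<bar>c\<bar>"] by (intro mult_left_mono) (auto intro: ennreal_leI)
    also have "... = ennreal (dl * \<bar>c\<bar>)" using dl by (intro ennreal_mult[symmetric]) auto
    also have "... <= ennreal ep" using dl(2) by (rule ennreal_leI)
    finally show "ennreal dl * nint (P i) (%q. ennreal \<bar>W i q\<bar>) <= ennreal ep" .
   qed
   finally show ?thesis .
  qed
  have l0: "(%i. nint (P i) (%q. ennreal (?m i q))) ---> 0"
   by (rule conv_prob_nn_min[OF _ cA']) auto
  show "\<exists>v. (\<forall>i. (nint (P i) (%q. min 1 (ennreal \<bar>A i q * W i q\<bar>))) <= v i + ennreal ep) \<and> v ---> 0"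
   by (intro exI[of _ "%i. nint (P i) (%q. ennreal (?m i q))"] conjI allI le l0)
 qed
qed

text \<open>The exceptional event D = 0 lies in |D - 1| >= 1, whose probability vanishes; this
  disposes of the arbitrary value of the estimator for a zero denominator.\<close>

lemma conv_prob_off_event:
 assumes [measurable]: "!!i. Z i \<in> bmf (P i)" "!!i. D i \<in> bmf (P i)"
  and cZ: "conv_prob P Z 0" and cD: "conv_prob P D 1"
  and eq: "!!i q. q \<in> space (P i) ==> D i q ~= 0 ==> Z' i q = Z i q"
 shows "conv_prob P Z' 0"
proof (rule conv_probI)
 fix ep :: real assume ep: "ep > 0"
 let ?Y = "%i. {q \<in> space (P i). ep <= \<bar>Z' i q - 0\<bar>}"
 let ?D = "%i. {q \<in> space (P i). 1 <= \<bar>D i q - 1\<bar>}"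
 let ?Z = "%i. {q \<in> space (P i). ep <= \<bar>Z i q - 0\<bar>}"
 have "(%i. measure (P i) (?Z i) + measure (P i) (?D i)) ---> 0 + 0"
  by (intro tendsto_add conv_probD cZ cD ep) simp
 then have lim: "(%i. measure (P i) (?Z i) + measure (P i) (?D i)) ---> 0" by simp
 show "(%i. measure (P i) (?Y i)) ---> 0"
 proof (rule tendsto_0_le_real[OF _ _ lim])
  fix i
  interpret prob_space "P i" by (rule prob)
  have "measure (P i) (?Y i) <= measure (P i) ((?Z i) \<union> (?D i))"
  proof (rule finite_measure_mono)
   show "(?Y i) \<subseteq> (?Z i) \<union> (?D i)"
   proof
    fix q assume "q \<in> (?Y i)"
    then show "q \<in> (?Z i) \<union> (?D i)"
     using eq[of q i] by (cases "D i q = 0") auto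
   qed
  qed measurable
  also have "... <= measure (P i) (?Z i) + measure (P i) (?D i)"
   by (rule measure_Un_le) measurable
  finally show "measure (P i) (?Y i) <= measure (P i) (?Z i) + measure (P i) (?D i)" .
 qed simp
qed

lemma char_distr_eq:
 "Z \<in> bmf (P i) ==> char (distr (P i) borel Z) s = (CLINT q|P i. iexp (s * Z q))"
 unfolding char_def by (rule integral_distr) auto

text \<open>The difference of the exponentials is at most min(2, |s (Y - W)|), whose mean
  vanishes.\<close>

lemma char_slutsky:
 assumes Y[measurable]: "!!i. Y i \<in> bmf (P i)" and W[measurable]: "!!i. W i \<in> bmf (P i)"
  and c: "conv_prob P (%i q. Y i q - W i q) 0"
  and lim: "(%i. char (distr (P i) borel (W i)) s) ---> L"
 shows "(%i. char (distr (P i) borel (Y i)) s) ---> L"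
proof -
 have cs: "conv_prob P (%i q. s * (Y i q - W i q)) 0"
  using conv_prob_mult[OF _ _ conv_prob_const[of s] c] by simp
 have l0: "(%i. lint (P i) (%q. min 2 \<bar>s * (Y i q - W i q)\<bar>)) ---> 0"
  by (rule conv_prob_integral_min[OF _ cs]) auto
 have "(%i. char (distr (P i) borel (Y i)) s - char (distr (P i) borel (W i)) s) ---> 0"
 proof (rule Lim_null_comparison[OF always_eventually l0], rule allI)
  fix i
  interpret prob_space "P i" by (rule prob)
  have int: "integrable (P i) (%q. iexp (s * Z q))" if "Z \<in> bmf (P i)" for Z :: "'w => real"
   using that by (intro integrable_const_bound[where B=1]) auto
  have "char (distr (P i) borel (Y i)) s - char (distr (P i) borel (W i)) s = (CLINT q|P i. iexp (s * Y i q) - iexp (s * W i q))"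
   unfolding char_distr_eq[OF Y] char_distr_eq[OF W] by (rule Bochner_Integration.integral_diff[symmetric]) (intro int Y W)+
  also have "norm \<dots> <= lint (P i) (%q. norm (iexp (s * Y i q) - iexp (s * W i q)))" by (rule integral_norm_bound)
  also have "... <= lint (P i) (%q. min 2 \<bar>s * (Y i q - W i q)\<bar>)"
  proof (rule integral_mono)
   show "integrable (P i) (%q. norm (iexp (s * Y i q) - iexp (s * W i q)))"
    by (intro integrable_norm Bochner_Integration.integrable_diff int Y W)
   show "integrable (P i) (%q. min 2 \<bar>s * (Y i q - W i q)\<bar>)"
    by (intro integrable_const_bound[where B=2]) auto
   fix q
   have e: "iexp (s * Y i q) - iexp (s * W i q) = iexp (s * W i q) * (iexp (s * (Y i q - W i q)) - 1)"
   proof -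
    have "iexp (s * W i q) * iexp (s * (Y i q - W i q)) = iexp (s * W i q + s * (Y i q - W i q))"
     by (simp only: exp_add[symmetric] of_real_add distrib_left)
    also have "s * W i q + s * (Y i q - W i q) = s * Y i q" by (simp add: algebra_simps)
    finally show ?thesis by (simp only: right_diff_distrib mult_1_right)
   qed
   have "norm (iexp (s * Y i q) - iexp (s * W i q)) = norm (iexp (s * (Y i q - W i q)) - 1)"
    unfolding e norm_mult by simp
   moreover have "norm (iexp (s * (Y i q - W i q)) - 1) <= \<bar>s * (Y i q - W i q)\<bar>"
    using iexp_approx1[of "s * (Y i q - W i q)" 0] by simp
   moreover have "norm (iexp (s * (Y i q - W i q)) - 1) <= 2"
    using norm_triangle_ineq4[of "iexp (s * (Y i q - W i q))" 1] by simp
   ultimately show "norm (iexp (s * Y i q) - iexp (s * W i q)) <= min 2 \<bar>s * (Y i q - W i q)\<bar>" by simp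
  qed
  finally show "norm (char (distr (P i) borel (Y i)) s - char (distr (P i) borel (W i)) s) <= lint (P i) (%q. min 2 \<bar>s * (Y i q - W i q)\<bar>)" .
 qed
 from tendsto_add[OF this lim] show ?thesis by simp
qed

end

section \<open>Limit law of the linear part\<close>

context target_run
begin

definition lin :: "nat => 'w => real" where
 "lin i q = (\<Sum>j<M. rt i * mi i j (sm (j * T) (Suc j * T)) q)"

lemma sm_e_meas: "j < M ==> sm (j * T) (Suc j * T) \<in> bp (j * T) (Suc j * T)"
 by (intro sm_int(2) block_mult mT_le mT_le_U) simp

lemma mi_sm_meas: "j < M ==> mi i j (sm (j * T) (Suc j * T)) \<in> bmf (pr i)"
 by (rule run_seq_seg.em_meas[OF SG mT_le order_refl sm_e_meas])

lemma lin_meas: "lin i \<in> bmf (pr i)"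
 unfolding lin_def[abs_def] using mi_sm_meas[of _ i] by (intro borel_measurable_sum borel_measurable_times) auto

text \<open>The mean chain of each filter starts at zero, so its L1 error is of order K^(-1/2) and
  the scaling leaves a constant. Bounded first moments allow division by the denominator later
  on.\<close>

lemma lin_tight: "\<exists>c. \<forall>i. (nint (pr i) (%q. ennreal \<bar>lin i q\<bar>)) <= ennreal c"
proof -
 define b where "b j = (\<Sum>n\<in>{j * T..<Suc j * T}. sqrt (lint (lw (j * T) (Suc n)) (%z. (sm (j * T) (Suc n) z)\<^sup>2 * hr (j * T) n z)) +
  sqrt (lint (lw (j * T) (Suc n)) (%z. (sm (j * T) (Suc n) z)\<^sup>2 * hr (j * T) (Suc n) z)))" for j
 have one: "nint (pr i) (%q. ennreal \<bar>rt i * mi i j (sm (j * T) (Suc j * T)) q\<bar>) <= ennreal (b j)" if j: "j < M" for i j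
 proof -
  interpret G: run_seq_seg S P X B j by (rule SG[OF j])
  have U: "j * T <= U" using j by (auto intro: mT_le_U)
  have "nint (pr i) (%q. ennreal \<bar>mi i j (sm (j * T) (Suc j * T)) q\<bar>) <= ennreal (b j / rt i)"
   using G.em_chain_L1[OF sm_chain[OF j] mT_le order_refl, of i] unfolding sm_start[OF block_mult U] b_def diff_zero .
  then have "ennreal (rt i) * nint (pr i) (%q. ennreal \<bar>mi i j (sm (j * T) (Suc j * T)) q\<bar>) <= ennreal (rt i) * ennreal (b j / rt i)"
   by (rule mult_left_mono) simp
  also have "... = ennreal (b j)" by (subst ennreal_mult'[symmetric]) simp_all
  also have "ennreal (rt i) * nint (pr i) (%q. ennreal \<bar>mi i j (sm (j * T) (Suc j * T)) q\<bar>) = nint (pr i) (%q. ennreal \<bar>rt i * mi i j (sm (j * T) (Suc j * T)) q\<bar>)"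
   unfolding abs_mult using mi_sm_meas[OF j, of i] by (simp add: ennreal_mult nn_integral_cmult)
  finally show ?thesis .
 qed
 have "nint (pr i) (%q. ennreal \<bar>lin i q\<bar>) <= ennreal (\<Sum>j<M. \<bar>b j\<bar>)" for i
 proof -
  have "nint (pr i) (%q. ennreal \<bar>lin i q\<bar>) <= nint (pr i) (%q. (\<Sum>j<M. ennreal \<bar>rt i * mi i j (sm (j * T) (Suc j * T)) q\<bar>))"
   unfolding lin_def by (intro nn_integral_mono) (simp add: sum_ennreal ennreal_leI)
  also have "... = (\<Sum>j<M. nint (pr i) (%q. ennreal \<bar>rt i * mi i j (sm (j * T) (Suc j * T)) q\<bar>))"
   using mi_sm_meas[of _ i] by (intro nn_integral_sum) auto
  also have "... <= (\<Sum>j<M. ennreal \<bar>b j\<bar>)"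
   by (intro sum_mono order_trans[OF one] ennreal_leI) auto
  also have "... = ennreal (\<Sum>j<M. \<bar>b j\<bar>)" by (rule sum_ennreal) simp
  finally show ?thesis .
 qed
 then show ?thesis by blast
qed

definition avar :: real where
 "avar = (\<Sum>j<M. \<Sum>n\<in>{j * T..<Suc j * T}. varS S (j * T) (sm (j * T)) n + varR S (j * T) (sm (j * T)) n)"

text \<open>Each summand is a function of one filter, so the characteristic function factors for
  every K, and each factor has its own Gaussian limit.\<close>

lemma lin_char: "(%i. char (distr (pr i) borel (lin i)) s) ---> of_real (exp (- (s\<^sup>2 * avar / 2)))"
proof -
 define V where "V j = (\<Sum>n\<in>{j * T..<Suc j * T}. varS S (j * T) (sm (j * T)) n + varR S (j * T) (sm (j * T)) n)" for j
 define Y where "Y i j q = rt i * mi i j (sm (j * T) (Suc j * T)) q" for i j q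
 have "(%i. char (distr (pr i) borel (lin i)) s) = (%i. \<Prod>j<M. CLINT q|pr i. iexp (s * Y i j q))"
 proof
  fix i
  interpret R: multi_run S "Suc i" "pr i" "X (Suc i)" "B (Suc i)" by (rule MR)
  have Ym: "Y i j \<in> bmf (pr i)" if "j < M" for j
   unfolding Y_def[abs_def] using mi_sm_meas[OF that, of i] by simp
  \<comment> \<open>Filters are numbered from 1 and segments from 0, hence the shift
    \<open>m - 1\<close>.\<close>
  have "prob_space.indep_vars (pr i) (%_. borel) (%m. Y i (m - 1)) {1..M}"
  proof (rule R.indep_seg_functions)
   fix m assume "m \<in> {1..M}"
   then obtain j where m: "m = Suc j" "j < M" by (cases m) auto
   have "mi i j (sm (j * T) (Suc j * T)) \<in> bmf (R.Falg (Suc j))"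
    using sm_e_meas[OF m(2)] by (intro seg_run.emp_measurable[OF R.SR[OF m(2)] mT_le order_refl R.coords_seg[OF m(2) R.coords_Falg[OF m(2)]]])
   then have "Y i j \<in> bmf (R.Falg (Suc j))" unfolding Y_def[abs_def] by simp
   then show "Y i (m - 1) \<in> bmf (R.Falg m)" unfolding m(1) by simp
  qed
  from R.char_distr_sum[OF this, of s]
  have "char (distr (pr i) borel (%q. \<Sum>m\<in>{1..M}. Y i (m - 1) q)) s = (\<Prod>m\<in>{1..M}. char (distr (pr i) borel (Y i (m - 1))) s)" .
  then have "char (distr (pr i) borel (lin i)) s = (\<Prod>j<M. char (distr (pr i) borel (Y i j)) s)"
   unfolding One_nat_def sum.atLeast1_atMost_eq prod.atLeast1_atMost_eq diff_Suc_Suc diff_zero lin_def[abs_def] Y_def .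
  also have "... = (\<Prod>j<M. CLINT q|pr i. iexp (s * Y i j q))"
   using Ym by (intro prod.cong char_distr_eq refl) auto
  finally show "char (distr (pr i) borel (lin i)) s = (\<Prod>j<M. CLINT q|pr i. iexp (s * Y i j q))" .
 qed
 moreover have "(%i. \<Prod>j<M. CLINT q|pr i. iexp (s * Y i j q)) ---> (\<Prod>j<M. of_real (exp (- (s\<^sup>2 * V j / 2))))"
 proof (rule tendsto_prod)
  fix j assume "j \<in> {..<M}"
  then have j: "j < M" by simp
  have U: "j * T <= U" using j by (auto intro: mT_le_U)
  show "(%i. CLINT q|pr i. iexp (s * Y i j q)) ---> of_real (exp (- (s\<^sup>2 * V j / 2)))"
   unfolding Y_def V_def by (rule run_seq_seg.clt_em[OF SG[OF j] sm_chain[OF j] sm_start[OF block_mult U] mT_le order_refl])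
 qed
 moreover have "(\<Prod>j<M. complex_of_real (exp (- (s\<^sup>2 * V j / 2)))) = of_real (exp (- (s\<^sup>2 * avar / 2)))"
 proof -
  have "(\<Sum>j<M. - (s\<^sup>2 * V j / 2)) = - (s\<^sup>2 * avar / 2)"
   unfolding avar_def V_def[symmetric] by (simp add: sum_negf sum_distrib_left sum_divide_distrib)
  then have "(\<Prod>j<M. exp (- (s\<^sup>2 * V j / 2))) = exp (- (s\<^sup>2 * avar / 2))" by (subst exp_sum[symmetric]) simp_all
  then show ?thesis by (simp only: of_real_prod[symmetric])
 qed
 ultimately show ?thesis by simp
qed

end

section \<open>Importance ratio and normal form of the estimator\<close>

context pf_setting
begin

lemma prop_path_dens_eq: "prop_path_dens S x = (\<Prod>u\<in>{0<..U}. prop_at S u x)"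
 by (simp only: prop_path_dens_def atLeast1)

lemma prop_path_dens_meas: "prop_path_dens S \<in> bp 0 U"
 unfolding prop_path_dens_eq[abs_def] by (rule prod_prop_measurable) auto

lemma prop_path_dens_nonneg: "x \<in> sp 0 U ==> 0 <= prop_path_dens S x"
 unfolding prop_path_dens_eq by (intro prod_nonneg ballI prop_at_nonneg[of 0 _ U]) auto

text \<open>A zero proposal factor at time t forces the step density at t to be zero, by the support
  condition; this condition speaks of paths up to t, hence the restriction. The zero factor
  annihilates the product.\<close>

lemma unnorm_dens_zero:
 assumes x: "x \<in> sp 0 U" and z: "prop_path_dens S x = 0"
 shows "unnorm_dens S x = 0"
proof -
 from z obtain t where t: "t \<in> {1..U}" "prop_at S t x = 0"
  unfolding prop_path_dens_def by auto
 have xt: "restrict x {1..t} \<in> space (PP {1..t})"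
  using measurable_space[OF restrict_measurable[of "{0<..t}" "{0<..U}"] x] t by (simp add: atLeast1 Ioc_subset_iff)
 have p: "prop_at S t (restrict x {1..t}) = prop_at S t x"
 proof -
  have "{seg_start S (filter_of S t)<..<t} \<inter> {1..t} = {seg_start S (filter_of S t)<..<t}" by auto
  then show ?thesis using t by (simp add: prop_at_def restrict_restrict Int_commute)
 qed
 have s: "step_dens S t (restrict x {1..t}) = step_dens S t x"
  using t by (auto simp: step_dens_def)
 have "\<not> step_dens S t x > 0" using prop_pos[OF t(1) xt] t(2) p s by auto
 moreover have "step_dens S t x >= 0"
 proof -
  have c: "x u \<in> space nu" if "u \<in> {1..U}" for u using x that by (auto simp: path_space_def space_PiM)
  show ?thesis
  proof (cases "t = 1")
   case True
   then show ?thesis unfolding step_dens_def using t c[of 1] by (simp add: init_nonneg)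
  next
   case False
   then have "t - 1 \<in> {1..U}" using t(1) unfolding atLeastAtMost_iff by linarith
   then show ?thesis unfolding step_dens_def using False c[OF t(1)] c[of "t - 1"] by (simp add: trans_nonneg)
  qed
 qed
 ultimately have "step_dens S t x = 0" by simp
 then show ?thesis unfolding unnorm_dens_def using t(1) by (intro prod_zero) auto
qed

lemma post_dens_meas: "post_dens S \<in> bp 0 U"
 using likelihood_finite unfolding post_dens_def[abs_def] atLeast1 by (intro borel_measurable_divide) auto

lemma lik_ratio_meas: "lik_ratio S \<in> bp 0 U"
 unfolding lik_ratio_def[abs_def] by (intro borel_measurable_divide post_dens_meas prop_path_dens_meas)

text \<open>Change of measure from the proposal law to the reference measure. On the set where the
  proposal density vanishes the quotient is 0 by convention, and the target density vanishes as
  well.\<close>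

lemma law_lik_ratio:
 assumes f: "f \<in> bp 0 U"
 shows "integrable (lw 0 U) (%x. f x * lik_ratio S x) \<longleftrightarrow> integrable (PP {0<..U}) (%x. f x * post_dens S x)"
  and "lint (lw 0 U) (%x. f x * lik_ratio S x) = lint (PP {0<..U}) (%x. f x * post_dens S x)"
proof -
 have d: "lw 0 U = density (PP {0<..U}) (%x. ennreal (prop_path_dens S x))"
  by (simp only: law_def prop_path_dens_eq)
 have m: "(%x. f x * lik_ratio S x) \<in> bp 0 U" using f lik_ratio_meas by simp
 have nn: "AE x in PP {0<..U}. 0 <= prop_path_dens S x" using prop_path_dens_nonneg by (rule AE_I2)
 have e: "prop_path_dens S x *\<^sub>R (f x * lik_ratio S x) = f x * post_dens S x" if "x \<in> sp 0 U" for x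
  using unnorm_dens_zero[OF that] by (cases "prop_path_dens S x = 0") (auto simp: lik_ratio_def post_dens_def)
 show "integrable (lw 0 U) (%x. f x * lik_ratio S x) \<longleftrightarrow> integrable (PP {0<..U}) (%x. f x * post_dens S x)"
  unfolding d integrable_density[OF m prop_path_dens_meas nn] using e by (rule Bochner_Integration.integrable_cong[OF refl])
 show "lint (lw 0 U) (%x. f x * lik_ratio S x) = lint (PP {0<..U}) (%x. f x * post_dens S x)"
  unfolding d integral_density[OF m prop_path_dens_meas nn] using e by (rule Bochner_Integration.integral_cong[OF refl])
qed

lemma post_dens_int: "integrable (PP {0<..U}) (post_dens S)" "lint (PP {0<..U}) (%x. post_dens S x) = 1"
proof -
 show "integrable (PP {0<..U}) (post_dens S)"
  using likelihood_finite unfolding post_dens_def[abs_def] atLeast1 by simp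
 have "lint (PP {0<..U}) (%x. post_dens S x) = lint (PP {0<..U}) (%x. unnorm_dens S x) / likelihood S"
  unfolding post_dens_def by simp
 also have "... = 1" using likelihood_pos unfolding likelihood_def atLeast1 by simp
 finally show "lint (PP {0<..U}) (%x. post_dens S x) = 1" .
qed

lemma lik_ratio_int: "integrable (lw 0 U) (lik_ratio S)" "lint (lw 0 U) (%x. lik_ratio S x) = 1"
 using law_lik_ratio[of "%_. 1"] post_dens_int by simp_all

lemma centred_lik_ratio_int:
 assumes \<psi>: "\<psi> \<in> bmf (path_space S {1..U})" and i: "integrable (path_space S {1..U}) (%x. \<psi> x * post_dens S x)"
 shows "integrable (lw 0 U) (%x. centred S \<psi> x * lik_ratio S x)" "lint (lw 0 U) (%x. centred S \<psi> x * lik_ratio S x) = 0"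
proof -
 have cm: "centred S \<psi> \<in> bp 0 U" using \<psi> unfolding centred_def[abs_def] atLeast1 by simp
 have e: "centred S \<psi> x * post_dens S x = \<psi> x * post_dens S x - post_mean S \<psi> * post_dens S x" for x
  by (simp add: centred_def left_diff_distrib)
 note L = law_lik_ratio[OF cm]
 show "integrable (lw 0 U) (%x. centred S \<psi> x * lik_ratio S x)"
  unfolding L(1) e using i post_dens_int(1) unfolding atLeast1 by simp
 show "lint (lw 0 U) (%x. centred S \<psi> x * lik_ratio S x) = 0"
  unfolding L(2) e using i post_dens_int unfolding atLeast1 by (simp add: post_mean_def atLeast1)
qed

lemma jpath_eq:
 "jpath S X B m kp q t = (if t \<in> {0<..m * seg_len S} then rpath S X B (filter_of S t) (seg_end S (filter_of S t)) (kp (filter_of S t)) q t else undefined)"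
proof (induction m)
 case 0
 show ?case by simp
next
 case (Suc m)
 show ?case
 proof (cases "t \<in> {m * seg_len S<..Suc m * seg_len S}")
  case True
  then have "filter_of S t = Suc m" by (intro filter_of_eq) auto
  then show ?thesis using True by (simp add: merge_def seg_end_def)
 next
  case False
  show ?thesis
  proof (cases "t \<in> {0<..m * seg_len S}")
   case t: True
   have "m * seg_len S <= Suc m * seg_len S" by simp
   then have "t \<in> {0<..Suc m * seg_len S}" using t unfolding greaterThanAtMost_iff by linarith
   then show ?thesis using t by (simp only: jpath.simps merge_def split_conv if_True Suc.IH)
  next
   case t: False
   then have "t \<notin> {0<..Suc m * seg_len S}" using False unfolding greaterThanAtMost_iff by linarith
   then show ?thesis using t False by (simp only: jpath.simps merge_def split_conv if_False)
  qed
 qed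
qed

lemma joined_path_eq: "joined_path S (%t k. X t k q) (%t k. B t k q) kp = jpath S X B (n_filters S) kp q"
 by (rule ext) (simp add: joined_path_def jpath_eq horizon_def atLeast1 Let_def rpath_def)

lemma joined_weight_eq: "joined_weight S K (%t k. X t k q) (%t k. B t k q) kp = jwt S K X B (n_filters S) kp q"
 by (simp add: joined_weight_def jwt_def hwt_def seg_end_def)

text \<open>The normalization by K^M is common to numerator and denominator and cancels.\<close>

lemma pf_estimator_eq:
 assumes K: "K >= 1"
 shows "pf_estimator S \<psi> c K (%t k. X t k q) (%t k. B t k q) =
  (if jemp S K X B (n_filters S) (lik_ratio S) q = 0 then c
   else jemp S K X B (n_filters S) (%x. \<psi> x * lik_ratio S x) q / jemp S K X B (n_filters S) (lik_ratio S) q)"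
proof -
 have k: "real K ^ n_filters S ~= 0" using K by simp
 have quot: "(if s = 0 then c else r / s) = (if s / k = 0 then c else (r / k) / (s / k))" if "k ~= 0" for r s k :: real
  using that by simp
 have c: "lik_ratio S x * w = w * lik_ratio S x" "lik_ratio S x * \<psi> x * w = w * (\<psi> x * lik_ratio S x)" for x w by simp_all
 show ?thesis
  unfolding pf_estimator_def joined_path_eq joined_weight_eq jemp_def Let_def c(2) unfolding c(1)
  by (rule quot[OF k])
qed

text \<open>Subtracting the posterior mean amounts to centring \<psi> in the numerator, because the
  denominator is the same joined mean with \<psi> replaced by 1.\<close>

lemma pf_estimator_centred:
 assumes K: "K >= 1" and D: "jemp S K X B (n_filters S) (lik_ratio S) q ~= 0"
 shows "pf_estimator S \<psi> c K (%t k. X t k q) (%t k. B t k q) - post_mean S \<psi> =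
  jemp S K X B (n_filters S) (%x. centred S \<psi> x * lik_ratio S x) q / jemp S K X B (n_filters S) (lik_ratio S) q"
proof -
 have "jemp S K X B (n_filters S) (%x. centred S \<psi> x * lik_ratio S x) q =
  jemp S K X B (n_filters S) (%x. \<psi> x * lik_ratio S x) q - post_mean S \<psi> * jemp S K X B (n_filters S) (lik_ratio S) q"
  unfolding centred_def left_diff_distrib jemp_diff by (simp add: jemp_def sum_distrib_left mult_ac)
 then show ?thesis unfolding pf_estimator_eq[OF K] using D by (simp add: diff_divide_distrib)
qed

end

section \<open>Identification of the asymptotic variance\<close>

context target_run
begin

text \<open>At the start of a segment the convention that the function is 0 agrees with
  \<open>sm_start\<close>; at later times it is the conditional mean computed in
  \<open>sm_cond_mean\<close>.\<close>

lemma ffun_cseg_eq: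
 assumes G: "G = (%x. centred S \<psi> x * lik_ratio S x)" and j: "j < M" and t: "j * T <= t" "t <= Suc j * T"
 shows "AE x in lw 0 U. ffun_cseg S \<psi> (Suc j) t x = sm (j * T) t (restrict x {j * T<..t})"
proof -
 have U: "Suc j * T <= U" using j by (intro mT_le_U) simp
 have st: "seg_start S (Suc j) = j * T" by (simp add: seg_start_def)
 show ?thesis
 proof (cases "t = j * T")
  case True
  have "restrict x {j * T<..j * T} = (%_. undefined)" for x :: "nat => 'x" by auto
  then show ?thesis using sm_start[OF block_mult, of j] t U True by (simp add: ffun_cseg_def st)
 next
  case False
  then show ?thesis using sm_cond_mean[OF block_mult t(1)] t U unfolding ffun_cseg_def st G by simp
 qed
qed

lemma seg_square_integral:
 assumes G: "G = (%x. centred S \<psi> x * lik_ratio S x)" and j: "j < M" and t: "j * T <= t" "t <= Suc j * T" and s: "j * T <= s" "s <= t"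
  and I: "integrable (lw (j * T) t) (%y. (sm (j * T) t y)\<^sup>2 * hr (j * T) s y)"
 shows "integrable (prop_law S) (%x. (ffun_cseg S \<psi> (Suc j) t x)\<^sup>2 * hfun_seg S (Suc j) s x)"
  and "lint (prop_law S) (%x. (ffun_cseg S \<psi> (Suc j) t x)\<^sup>2 * hfun_seg S (Suc j) s x) = lint (lw (j * T) t) (%y. (sm (j * T) t y)\<^sup>2 * hr (j * T) s y)"
proof -
 have U: "t <= U" using j t mT_le_U[of "Suc j"] by simp
 have st: "seg_start S (Suc j) = j * T" by (simp add: seg_start_def)
 define f where "f y = (sm (j * T) t y)\<^sup>2 * hr (j * T) s y" for y
 have fm: "f \<in> bp (j * T) t" using I unfolding f_def[abs_def] by (rule integrable_law_meas)
 have rm: "(%x. restrict x {j * T<..t}) \<in> measurable (lw 0 U) (PP {j * T<..t})" using U by (intro measurable_law restrict_measurable) auto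
 have h: "hfun_seg S (Suc j) s x = hr (j * T) s (restrict x {j * T<..t})" for x
  unfolding hfun_seg_eq st using s by (intro hrel_cong block_mult) auto
 have ae: "AE x in lw 0 U. (ffun_cseg S \<psi> (Suc j) t x)\<^sup>2 * hfun_seg S (Suc j) s x = f (restrict x {j * T<..t})"
  using ffun_cseg_eq[OF G j t] by eventually_elim (simp only: f_def h)
 have cm: "ffun_cseg S \<psi> (Suc j) t \<in> bmf (lw 0 U)"
  unfolding ffun_cseg_def cond_mean_def prop_law_eq by (cases "t = seg_start S (Suc j)") simp_all
 have m1: "(%x. (ffun_cseg S \<psi> (Suc j) t x)\<^sup>2 * hfun_seg S (Suc j) s x) \<in> bmf (lw 0 U)"
  unfolding h using cm mcomp[OF rm hrel_measurable[OF block_mult s(2) U]] by simp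
 have m2: "(%x. f (restrict x {j * T<..t})) \<in> bmf (lw 0 U)" by (rule mcomp[OF rm fm])
 note R = int_law_restrict_block[OF block_mult t(1) U order_refl fm]
 show "integrable (prop_law S) (%x. (ffun_cseg S \<psi> (Suc j) t x)\<^sup>2 * hfun_seg S (Suc j) s x)"
  unfolding prop_law_eq integrable_cong_AE[OF m1 m2 ae] R(2) using I unfolding f_def .
 show "lint (prop_law S) (%x. (ffun_cseg S \<psi> (Suc j) t x)\<^sup>2 * hfun_seg S (Suc j) s x) = lint (lw (j * T) t) (%y. (sm (j * T) t y)\<^sup>2 * hr (j * T) s y)"
  unfolding prop_law_eq integral_cong_AE[OF m1 m2 ae] R(1) unfolding f_def ..
qed

text \<open>With t = n + 1 the terms numbered 2 t - 1 and 2 t are the limiting variances of the two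
  increments at time t. The integral of the difference of squares may be split since both parts are
  integrable.\<close>

lemma sigma2_c_eq:
 assumes G: "G = (%x. centred S \<psi> x * lik_ratio S x)" and j: "j < M" and n: "j * T <= n" "n < Suc j * T"
 shows "sigma2_c S \<psi> (2 * n + 1) + sigma2_c S \<psi> (2 * n + 2) = varS S (j * T) (sm (j * T)) n + varR S (j * T) (sm (j * T)) n"
proof -
 have fo: "filter_of S (Suc n) = Suc j" using n by (intro filter_of_eq) auto
 note c = run_seq_seg.mart_chainD[OF SG[OF j] sm_chain[OF j] n]
 have Sn: "j * T <= Suc n" "Suc n <= Suc j * T" using n by auto
 \<comment> \<open>At the start of the segment the function is zero; later this is the resampling
   moment of the preceding stage.\<close>
 have In: "integrable (lw (j * T) n) (%y. (sm (j * T) n y)\<^sup>2 * hr (j * T) n y)"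
 proof (cases "n = j * T")
  case True
  have jU: "j * T <= U" using j by (auto intro: mT_le_U)
  have "(sm (j * T) (j * T) y)\<^sup>2 * hr (j * T) (j * T) y = 0" if "y \<in> space (lw (j * T) (j * T))" for y
  proof -
   have "y = (%_. undefined)" using that by (simp add: path_space_def space_PiM)
   then show ?thesis using sm_start[OF block_mult jU] by simp
  qed
  then have "integrable (lw (j * T) (j * T)) (%y. (sm (j * T) (j * T) y)\<^sup>2 * hr (j * T) (j * T) y) \<longleftrightarrow> integrable (lw (j * T) (j * T)) (%y. 0 :: real)"
   by (rule Bochner_Integration.integrable_cong[OF refl])
  then show ?thesis unfolding True by simp
 next
  case False
  then obtain n' where n': "n = Suc n'" "j * T <= n'" using n by (cases n) auto
  show ?thesis unfolding n'(1) using n n' by (intro run_seq_seg.mart_chainD(3)[OF SG[OF j] sm_chain[OF j]]) auto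
 qed
 note A = seg_square_integral[OF G j Sn n(1) _ c(2)]
 note B = seg_square_integral[OF G j n(1) less_imp_le[OF n(2)] n(1) order_refl In]
 note C = seg_square_integral[OF G j Sn Sn(1) order_refl c(3)]
 have "sigma2_c S \<psi> (2 * n + 1) = lint (prop_law S) (%x. ((ffun_cseg S \<psi> (Suc j) (Suc n) x)\<^sup>2 - (ffun_cseg S \<psi> (Suc j) n x)\<^sup>2) * hfun_seg S (Suc j) n x)"
 proof -
  have "(2 * n + 1 + 1) div 2 = Suc n" "odd (2 * n + 1)" by auto
  then show ?thesis unfolding sigma2_c_def Let_def by (simp only: fo if_True diff_Suc_1 not_False_eq_True)
 qed
 also have "... = varS S (j * T) (sm (j * T)) n"
  unfolding left_diff_distrib varS_def using A B by simp
 finally have 1: "sigma2_c S \<psi> (2 * n + 1) = varS S (j * T) (sm (j * T)) n" .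
 have "sigma2_c S \<psi> (2 * n + 2) = lint (prop_law S) (%x. (ffun_cseg S \<psi> (Suc j) (Suc n) x)\<^sup>2 * hfun_seg S (Suc j) (Suc n) x)"
 proof -
  have "(2 * n + 2 + 1) div 2 = Suc n" "\<not> odd (2 * n + 2)" by auto
  then show ?thesis unfolding sigma2_c_def Let_def by (simp only: fo if_False not_True_eq_False)
 qed
 also have "... = varR S (j * T) (sm (j * T)) n" unfolding varR_def by (rule C(2))
 finally show ?thesis using 1 by simp
qed

lemma sum_pairs: "(\<Sum>u\<in>{1..2 * n}. f u) = (\<Sum>k<n. f (2 * k + 1) + f (2 * k + 2 :: nat) :: real)"
proof (induction n)
 case (Suc n)
 have "{1..2 * Suc n} = insert (2 * n + 2) (insert (2 * n + 1) {1..2 * n})" by auto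
 then show ?case using Suc by simp
qed simp

lemma asym_var_eq:
 assumes G: "G = (%x. centred S \<psi> x * lik_ratio S x)"
 shows "asym_var S \<psi> = avar"
proof -
 have b: "{j * T..<Suc j * T} = {j * T..<j * T + T}" for j by (simp add: mult_Suc add.commute)
 have "asym_var S \<psi> = (\<Sum>n<M * T. sigma2_c S \<psi> (2 * n + 1) + sigma2_c S \<psi> (2 * n + 2))"
  unfolding asym_var_def sum_pairs horizon_def ..
 also have "... = (\<Sum>j<M. \<Sum>n\<in>{j * T..<Suc j * T}. sigma2_c S \<psi> (2 * n + 1) + sigma2_c S \<psi> (2 * n + 2))"
  unfolding b by (rule sum.nat_group[symmetric])
 also have "... = avar"
  unfolding avar_def using sigma2_c_eq[OF G] by (intro sum.cong refl) auto
 finally show ?thesis .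
qed

lemma avar_nonneg: "avar >= 0"
 unfolding avar_def using run_seq_seg.varS_nonneg[OF SG sm_chain] run_seq_seg.varR_nonneg[OF SG sm_chain]
 by (intro sum_nonneg add_nonneg_nonneg) auto

end

subsection \<open>The estimator\<close>

lemma normal_law_distr:
 assumes "v > 0"
 shows "normal_law 0 v = distr std_normal_distribution borel (%x. sqrt v * x)"
proof -
 interpret N: prob_space std_normal_distribution by (rule prob_space_normal_density) simp
 have "distributed std_normal_distribution lborel (%x. x) std_normal_density"
  unfolding distributed_def by (auto simp: distr_id2)
 then have "distributed std_normal_distribution lborel (%x. 0 + sqrt v * x) (normal_density (0 + sqrt v * 0) (\<bar>sqrt v\<bar> * 1))"
  using assms by (intro N.normal_density_affine) auto
 then have "distributed std_normal_distribution lborel (%x. sqrt v * x) (normal_density 0 (sqrt v))"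
  using assms by (simp only: add_0 mult_zero_right mult_1_right abs_of_nonneg real_sqrt_ge_zero less_imp_le)
 then have "distr std_normal_distribution lborel (%x. sqrt v * x) = density lborel (normal_density 0 (sqrt v))"
  by (rule distributed_distr_eq_density)
 moreover have "distr std_normal_distribution borel (%x. sqrt v * x) = distr std_normal_distribution lborel (%x. sqrt v * x)"
  by (rule distr_cong) simp_all
 ultimately show ?thesis using assms by (simp add: normal_law_def)
qed

lemma char_normal_law:
 assumes "v >= 0"
 shows "char (normal_law 0 v) s = of_real (exp (- (s\<^sup>2 * v / 2)))"
proof (cases "v = 0")
 case True
 have "(CLINT x|return borel 0. iexp (s * x)) = iexp (s * 0)" by (rule integral_return) auto
 then show ?thesis using True by (simp add: normal_law_def char_def)
next
 case False
 then have v: "v > 0" using assms by simp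
 have "char (normal_law 0 v) s = char std_normal_distribution (s * sqrt v)"
  unfolding normal_law_distr[OF v] char_def by (subst integral_distr) (simp_all add: mult.assoc)
 also have "... = of_real (exp (- (s\<^sup>2 * v / 2)))"
  using v by (simp add: char_std_normal_distribution power_mult_distrib)
 finally show ?thesis .
qed

lemma real_distribution_normal_law:
 assumes "v >= 0"
 shows "real_distribution (normal_law 0 v)"
proof (cases "v = 0")
 case True
 then show ?thesis unfolding real_distribution_def real_distribution_axioms_def normal_law_def
  by (simp add: prob_space_return)
next
 case False
 then have v: "v > 0" using assms by simp
 interpret N: prob_space std_normal_distribution by (rule prob_space_normal_density) simp
 show ?thesis unfolding normal_law_distr[OF v] by (rule N.real_distribution_distr) simp
qed

text \<open>Nothing is assumed about a run without particles, so the limit is taken along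
  \<open>Suc n\<close> and the first term is dropped.\<close>

lemma weak_conv_m_Suc: "weak_conv_m (%n. \<mu> (Suc n)) nu ==> weak_conv_m \<mu> nu"
 unfolding weak_conv_m_def weak_conv_def
proof (intro allI impI)
 fix x assume a: "\<forall>x. isCont (cdf nu) x \<longrightarrow> (%n. cdf (\<mu> (Suc n)) x) ---> cdf nu x" and "isCont (cdf nu) x"
 then have "(%n. cdf (\<mu> (Suc n)) x) ---> cdf nu x" by blast
 then show "(%n. cdf (\<mu> n) x) ---> cdf nu x" by (rule LIMSEQ_imp_Suc)
qed

context target_run
begin

text \<open>Off the event D = 0 the scaled error is N / D, and N / D - lin = (N - lin) / D + (1 / D
  - 1) lin. The first term vanishes by linearization, the second because D tends to 1 while the
  linear part is bounded in mean.\<close>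

lemma estimator_char:
 fixes \<psi> :: "(nat => 'x) => real" and c :: real and i :: nat
 assumes G: "G = (%x. centred S \<psi> x * lik_ratio S x)" and \<psi>: "\<psi> \<in> bp 0 U"
 defines "Y == %i q. rt i * (pf_estimator S \<psi> c (Suc i) (%t k. X (Suc i) t k q) (%t k. B (Suc i) t k q) - post_mean S \<psi>)"
 shows "Y i \<in> bmf (pr i)"
  and "(%i. char (distr (pr i) borel (Y i)) s) ---> of_real (exp (- (s\<^sup>2 * avar / 2)))"
proof -
 define D where "D i = ji i M (lik_ratio S)" for i
 define N where "N i q = rt i * ji i M G q" for i q
 have MU: "U = M * T" by (simp add: horizon_def)
 have Dm[measurable]: "D i \<in> bmf (pr i)" for i
  unfolding D_def using lik_ratio_meas unfolding MU by (rule ji_meas[OF order_refl])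
 have Gm: "G \<in> bp 0 U" using gc_meas[OF order_refl] unfolding gc_U .
 have Nm[measurable]: "N i \<in> bmf (pr i)" for i
  unfolding N_def[abs_def] using ji_meas[OF order_refl Gm[unfolded MU], of i] by simp
 have lm[measurable]: "lin i \<in> bmf (pr i)" for i by (rule lin_meas)
 have "ji i M (%x. \<psi> x * lik_ratio S x) \<in> bmf (pr i)" for i
  using borel_measurable_times[OF \<psi> lik_ratio_meas] unfolding MU by (rule ji_meas[OF order_refl])
 note [measurable] = this
 have Ym: "Y i \<in> bmf (pr i)" for i
 proof -
  have "(%q. if D i q = 0 then c else ji i M (%x. \<psi> x * lik_ratio S x) q / D i q) \<in> bmf (pr i)"
   by measurable
  moreover have "pf_estimator S \<psi> c (Suc i) (%t k. X (Suc i) t k q) (%t k. B (Suc i) t k q) = (if D i q = 0 then c else ji i M (%x. \<psi> x * lik_ratio S x) q / D i q)" for q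
   unfolding D_def by (rule pf_estimator_eq) simp
  ultimately show ?thesis unfolding Y_def by simp
 qed
 then show "Y i \<in> bmf (pr i)" .
 have cD: "conv_prob pr D 1"
  using lln_je[OF order_refl, of "lik_ratio S"] lik_ratio_int unfolding MU D_def
  by (intro conv_prob_L1 ji_meas[OF order_refl]) (auto intro: integrable_law_meas)
 have cN: "conv_prob pr (%i q. N i q - lin i q) 0"
 proof -
  have "N i q - lin i q = rt i * (ji i M G q - (\<Sum>j<M. mi i j (sm (j * T) (Suc j * T)) q))" for i q
   unfolding N_def lin_def sum_distrib_left[symmetric] right_diff_distrib ..
  then show ?thesis using linearization by simp
 qed
 have cI: "conv_prob pr (%i q. inverse (D i q)) (inverse 1)"
  by (rule conv_prob_cont2[where f="%x _. inverse x", OF Dm Dm cD cD]) (intro continuous_intros, simp)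
 have cI1: "conv_prob pr (%i q. inverse (D i q) - 1) 0"
  using conv_prob_diff[OF _ _ cI conv_prob_const[of 1]] by simp
 obtain b where b: "!!i. (nint (pr i) (%q. ennreal \<bar>lin i q\<bar>)) <= ennreal b" using lin_tight by blast
 have c1: "conv_prob pr (%i q. (inverse (D i q) - 1) * lin i q) 0"
  by (rule conv_prob_tight_mult[OF _ lm cI1 b]) measurable
 have c2: "conv_prob pr (%i q. (N i q - lin i q) * inverse (D i q)) 0"
  using conv_prob_mult[OF _ _ cN cI] by simp
 have c3: "conv_prob pr (%i q. (N i q - lin i q) * inverse (D i q) + (inverse (D i q) - 1) * lin i q) 0"
  using conv_prob_add[OF _ _ c2 c1] by simp
 have c4: "conv_prob pr (%i q. Y i q - lin i q) 0"
 proof (rule conv_prob_off_event[OF _ Dm c3 cD])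
  fix i q assume D: "D i q ~= 0"
  have "pf_estimator S \<psi> c (Suc i) (%t k. X (Suc i) t k q) (%t k. B (Suc i) t k q) - post_mean S \<psi> = ji i M G q / D i q"
   using D unfolding D_def G by (intro pf_estimator_centred) simp_all
  then have "Y i q = N i q * inverse (D i q)" unfolding Y_def N_def by (simp add: divide_inverse mult.assoc)
  then show "Y i q - lin i q = (N i q - lin i q) * inverse (D i q) + (inverse (D i q) - 1) * lin i q"
   by (simp add: algebra_simps)
 qed measurable
 show "(%i. char (distr (pr i) borel (Y i)) s) ---> of_real (exp (- (s\<^sup>2 * avar / 2)))"
  by (rule char_slutsky[OF Ym lm c4 lin_char])
qed

end

text \<open>The conditional mean in the moment condition is almost surely the explicit backward
  integral, and the law of the path up to \<open>Suc n\<close> carries the condition over. Since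
  both h terms are positive, the bound on their sum bounds each of them.\<close>

lemma target_runI:
 fixes S :: "('x, 'y) pf_model"
 assumes setting: "pf_setting S"
  and run: "!!K. K >= 1 ==> parallel_filters S K (P K) (X K) (B K)"
  and psi_measurable: "\<psi> \<in> bmf (path_space S {1..horizon S})"
  and psi_integrable: "integrable (path_space S {1..horizon S}) (%x. \<psi> x * post_dens S x)"
  and moment_centred: "!!t. t \<in> {1..horizon S} ==>
   integrable (prop_law S)
    (%x. (ffun S (centred S \<psi>) t x)\<^sup>2 * (hfun S t x + hfun S (t - 1) x))"
 shows "target_run S P X B (%x. centred S \<psi> x * lik_ratio S x)"
proof -
 interpret pf_setting S by (rule setting)
 define G where "G = (%x. centred S \<psi> x * lik_ratio S x)"
 note CL = centred_lik_ratio_int[OF psi_measurable psi_integrable, folded G_def]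
 interpret target S G by unfold_locales (rule CL(1))
 have sq: "integrable (law S 0 (Suc n)) (%x. (gcond S G (Suc n) x)\<^sup>2 * hrel S 0 s x)"
  if n: "n < U" and s: "s = n \<or> s = Suc n" for n s
 proof -
  have t: "Suc n \<in> {1..U}" "Suc n <= U" "s <= Suc n" using n s by auto
  define f where "f y = (gc (Suc n) y)\<^sup>2 * (hrel S 0 (Suc n) y + hrel S 0 n y)" for y
  have hm: "hrel S 0 u \<in> bmf (PP {0<..Suc n})" if "u <= Suc n" for u
   using that t by (intro hrel_measurable) auto
  have fm: "f \<in> bmf (PP {0<..Suc n})"
   unfolding f_def[abs_def] using gc_meas[OF t(2)] hm[of n] hm[of "Suc n"] by simp
  have rm: "(%x. restrict x {0<..Suc n}) \<in> measurable (law S 0 U) (PP {0<..Suc n})" using t by (intro measurable_law restrict_measurable) auto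
  have h: "hfun S u x = hrel S 0 u (restrict x {0<..Suc n})" if "u <= Suc n" for u x
   unfolding hfun_eq using that by (intro hrel_cong) auto
  have m1: "(%x. (ffun S (centred S \<psi>) (Suc n) x)\<^sup>2 * (hfun S (Suc n) x + hfun S n x)) \<in> bmf (law S 0 U)"
   using moment_centred[OF t(1)] unfolding prop_law_eq diff_Suc_1 by (rule borel_measurable_integrable)
  have m2: "(%x. f (restrict x {0<..Suc n})) \<in> bmf (law S 0 U)" by (rule mcomp[OF rm fm])
  have "AE x in law S 0 U. (ffun S (centred S \<psi>) (Suc n) x)\<^sup>2 * (hfun S (Suc n) x + hfun S n x) = f (restrict x {0<..Suc n})"
   using gc_cond_mean[OF t(2)] by eventually_elim (simp only: f_def ffun_def G_def[symmetric] h[OF order_refl] h[OF le_SucI[OF order_refl]])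
  from integrable_cong_AE[OF m1 m2 this] have "integrable (law S 0 U) (%x. f (restrict x {0<..Suc n}))"
   using moment_centred[OF t(1)] unfolding prop_law_eq diff_Suc_1 by blast
  then have fi: "integrable (law S 0 (Suc n)) f"
   unfolding int_law_restrict_block(2)[OF block_0 le0 t(2) order_refl fm] .
  show ?thesis
  proof (rule int_bound[OF fi])
   show "(%x. (gc (Suc n) x)\<^sup>2 * hrel S 0 s x) \<in> bmf (law S 0 (Suc n))"
    using gc_meas[OF t(2)] hm[OF t(3)] by (intro measurable_law) simp
   show "AE x in law S 0 (Suc n). norm ((gc (Suc n) x)\<^sup>2 * hrel S 0 s x) <= norm (f x)"
   proof (rule AE_I2)
    fix x assume "x \<in> space (law S 0 (Suc n))"
    then have p: "hrel S 0 u x > 0" if "u <= Suc n" for u using that t by (intro hrel_pos[of 0 u "Suc n"]) auto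
    have "(gc (Suc n) x)\<^sup>2 * hrel S 0 s x <= f x"
     unfolding f_def using p[of n] p[of "Suc n"] s by (intro mult_left_mono) auto
    moreover have "0 <= (gc (Suc n) x)\<^sup>2 * hrel S 0 s x" using p[OF t(3)] by simp
    ultimately show "norm ((gc (Suc n) x)\<^sup>2 * hrel S 0 s x) <= norm (f x)" by simp
   qed
  qed
 qed
 have rs: "run_seq S P X B" unfolding run_seq_def run_seq_axioms_def using setting run by blast
 show ?thesis
  unfolding G_def[symmetric] target_run_def target_run_axioms_def
  using rs target_axioms sq CL(2) by simp
qed

theorem corollary1:
  fixes S :: "('x, 'y) pf_model"
    and \<psi> :: "(nat \<Rightarrow> 'x) \<Rightarrow> real"
    and c :: real
    and P :: "nat \<Rightarrow> 'w measure"
    and X :: "nat \<Rightarrow> nat \<Rightarrow> nat \<Rightarrow> 'w \<Rightarrow> 'x"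
    and B :: "nat \<Rightarrow> nat \<Rightarrow> nat \<Rightarrow> 'w \<Rightarrow> nat"
  assumes setting: "pf_setting S"
    and run: "\<And>K. K \<ge> 1 \<Longrightarrow> parallel_filters S K (P K) (X K) (B K)"
    and psi_measurable: "\<psi> \<in> borel_measurable (path_space S {1..horizon S})"
    and psi_integrable: "integrable (path_space S {1..horizon S}) (\<lambda>x. \<psi> x * post_dens S x)"
    and moment: "\<And>t. t \<in> {1..horizon S} \<Longrightarrow>
      integrable (prop_law S) (\<lambda>x. (ffun S \<psi> t x)\<^sup>2 * (hfun S t x + hfun S (t - 1) x))"
    and moment_centred: "\<And>t. t \<in> {1..horizon S} \<Longrightarrow>
      integrable (prop_law S)
        (\<lambda>x. (ffun S (centred S \<psi>) t x)\<^sup>2 * (hfun S t x + hfun S (t - 1) x))"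
  shows "weak_conv_m
    (\<lambda>K. distr (P K) borel
      (\<lambda>\<omega>. sqrt (real K) *
        (pf_estimator S \<psi> c K (\<lambda>t k. X K t k \<omega>) (\<lambda>t k. B K t k \<omega>) - post_mean S \<psi>)))
    (normal_law 0 (asym_var S \<psi>))"
proof (rule weak_conv_m_Suc, rule levy_continuity)
 interpret target_run S P X B "%x. centred S \<psi> x * lik_ratio S x"
  by (rule target_runI[OF setting run psi_measurable psi_integrable moment_centred])
 have \<psi>: "\<psi> \<in> bmf (PP {0<..U})" using psi_measurable unfolding atLeast1 .
 note E = estimator_char[OF refl \<psi>, where c=c]
 have v: "asym_var S \<psi> = avar" "avar >= 0" by (rule asym_var_eq[OF refl]) (rule avar_nonneg)
 show "real_distribution (distr (P (Suc i)) borel (%q. sqrt (real (Suc i)) *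
   (pf_estimator S \<psi> c (Suc i) (%t k. X (Suc i) t k q) (%t k. B (Suc i) t k q) - post_mean S \<psi>)))" for i
  by (rule prob_space.real_distribution_distr[OF prob_pr E(1)])
 show "real_distribution (normal_law 0 (asym_var S \<psi>))" unfolding v(1) by (rule real_distribution_normal_law[OF v(2)])
 show "(%i. char (distr (P (Suc i)) borel (%q. sqrt (real (Suc i)) *
   (pf_estimator S \<psi> c (Suc i) (%t k. X (Suc i) t k q) (%t k. B (Suc i) t k q) - post_mean S \<psi>))) s) ---> char (normal_law 0 (asym_var S \<psi>)) s" for s
  unfolding v(1) char_normal_law[OF v(2)] by (rule E(2))
qed

end
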